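(* Let $d\ge 1$, $\lambda\in\mathbb{R}\setminus\{0\}$, $T>0$ and $s\in(0,1)$. For any $u_0\in H^s(\mathbb{R}^d)$, weak $H^s$ solutions on $[0,T]$ of the Cauchy problem $$i\partial_t u+\Delta u+\lambda u\log(|u|^2)=0,\qquad u|_{t=0}=u_0,$$ are unique; that is, if $u$ and $v$ are two weak $H^s$ solutions of this problem on $[0,T]$ with the same initial datum $u_0$, then $u=v$ on $[0,T]$.
   Context: Functions are complex-valued, and $z\log(|z|^2)$ is understood to be $0$ at $z=0$. Definition. Let $I\subset\mathbb{R}$ be an interval with $0\in I$, let $s\ge 0$ and $u_0\in H^s(\mathbb{R}^d)$. A function $u$ is a weak $H^s$ solution on $I$ if $u\in L^\infty(I,H^s(\mathbb{R}^d))$ and (i) $u$ satisfies $i\partial_t u+\Delta u+\lambda u\log(|u|^2)=0$ in $\mathcal{D}'(I\times\mathbb{R}^d)$, i.e. in the sense of distributions on $I\times\mathbb{R}^d$, and (ii) $u|_{t=0}=u_0$. For $s\in[0,1]$ and $I=[0,T]$, a function $u\in L^\infty([0,T],H^s(\mathbb{R}^d))$ satisfying (i) is (after modification on a null set of times) weakly continuous from $[0,T]$ into $H^s(\mathbb{R}^d)$; condition (ii) is understood for this weakly continuous representative. *)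

theory Defs
  imports "HOL-Analysis.Analysis"
begin

section \<open>Smooth functions and test functions\<close>

definition dir_deriv ::
    "'a::real_normed_vector \<Rightarrow> ('a \<Rightarrow> 'b::real_normed_vector) \<Rightarrow> 'a \<Rightarrow> 'b" where
  "dir_deriv h f = (\<lambda>x. frechet_derivative f (at x) h)"

primrec Ck :: "nat \<Rightarrow> ('a::euclidean_space \<Rightarrow> 'b::real_normed_vector) \<Rightarrow> bool" where
  "Ck 0 f \<longleftrightarrow> continuous_on UNIV f"
| "Ck (Suc k) f \<longleftrightarrow> (\<forall>x. f differentiable (at x)) \<and> (\<forall>b\<in>Basis. Ck k (dir_deriv b f))"

definition smooth :: "('a::euclidean_space \<Rightarrow> 'b::real_normed_vector) \<Rightarrow> bool" where
  "smooth f \<longleftrightarrow> (\<forall>k. Ck k f)"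

definition test_function :: "'a::euclidean_space set \<Rightarrow> ('a \<Rightarrow> complex) \<Rightarrow> bool" where
  "test_function \<Omega> \<phi> \<longleftrightarrow>
     smooth \<phi> \<and> compact (closure {z. \<phi> z \<noteq> 0}) \<and> closure {z. \<phi> z \<noteq> 0} \<subseteq> \<Omega>"

definition time_deriv :: "(real \<times> 'a::euclidean_space \<Rightarrow> complex) \<Rightarrow> real \<times> 'a \<Rightarrow> complex" where
  "time_deriv \<phi> = dir_deriv (1, 0) \<phi>"

definition space_laplacian ::
    "(real \<times> 'a::euclidean_space \<Rightarrow> complex) \<Rightarrow> real \<times> 'a \<Rightarrow> complex" where
  "space_laplacian \<phi> = (\<lambda>z. \<Sum>b\<in>Basis. dir_deriv (0, b) (dir_deriv (0, b) \<phi>) z)"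


section \<open>The Sobolev spaces \<open>H\<^sup>s\<close>\<close>

text \<open>Elements of \<open>L\<^sup>2\<close> and \<open>H\<^sup>s\<close> are represented by Borel functions (every
  Lebesgue class contains one); equality in these spaces is equality almost everywhere.\<close>

definition square_integrable :: "('a::euclidean_space \<Rightarrow> complex) \<Rightarrow> bool" where
  "square_integrable f \<longleftrightarrow>
     f \<in> borel_measurable borel \<and> integrable lborel (\<lambda>x. (cmod (f x))\<^sup>2)"

text \<open>Fourier integral of \<open>f\<close> over the ball of radius \<open>R\<close>, unitary normalisation.\<close>

definition truncated_fourier ::
    "real \<Rightarrow> ('a::euclidean_space \<Rightarrow> complex) \<Rightarrow> 'a \<Rightarrow> complex" where
  "truncated_fourier R f \<xi> =
     complex_of_real ((2 * pi) powr (- real DIM('a) / 2)) *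
     (LINT x:cball 0 R|lborel. f x * exp (- \<i> * complex_of_real (x \<bullet> \<xi>)))"

text \<open>\<open>g\<close> is the Fourier--Plancherel transform of the \<open>L\<^sup>2\<close> function \<open>f\<close>: the limit in
  \<open>L\<^sup>2\<close> of the truncated Fourier integrals. It is unique up to null sets.\<close>

definition is_fourier_transform ::
    "('a::euclidean_space \<Rightarrow> complex) \<Rightarrow> ('a \<Rightarrow> complex) \<Rightarrow> bool" where
  "is_fourier_transform f g \<longleftrightarrow> square_integrable f \<and> square_integrable g \<and>
     (\<lambda>n. \<integral>\<^sup>+ \<xi>. ennreal ((cmod (truncated_fourier (real n) f \<xi> - g \<xi>))\<^sup>2) \<partial>lborel)
       \<longlonglongrightarrow> 0"

definition sobolev_space :: "real \<Rightarrow> ('a::euclidean_space \<Rightarrow> complex) set" where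
  "sobolev_space s = {f. \<exists>g. is_fourier_transform f g \<and>
     integrable lborel (\<lambda>\<xi>. (1 + (norm \<xi>)\<^sup>2) powr s * (cmod (g \<xi>))\<^sup>2)}"

definition sobolev_norm :: "real \<Rightarrow> ('a::euclidean_space \<Rightarrow> complex) \<Rightarrow> real" where
  "sobolev_norm s f =
     sqrt (LINT \<xi>|lborel. (1 + (norm \<xi>)\<^sup>2) powr s *
             (cmod ((SOME g. is_fourier_transform f g) \<xi>))\<^sup>2)"

text \<open>Bounded linear functionals on \<open>H\<^sup>s\<close>. Boundedness forces them to agree on functions
  that are equal almost everywhere.\<close>

definition sobolev_functional ::
    "real \<Rightarrow> (('a::euclidean_space \<Rightarrow> complex) \<Rightarrow> complex) \<Rightarrow> bool" where
  "sobolev_functional s l \<longleftrightarrow>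
     (\<forall>f\<in>sobolev_space s. \<forall>g\<in>sobolev_space s. l (\<lambda>x. f x + g x) = l f + l g) \<and>
     (\<forall>f\<in>sobolev_space s. \<forall>c. l (\<lambda>x. c * f x) = c * l f) \<and>
     (\<exists>C. \<forall>f\<in>sobolev_space s. cmod (l f) \<le> C * sobolev_norm s f)"


section \<open>Functions of time with values in \<open>H\<^sup>s\<close>\<close>

definition sobolev_simple ::
    "real \<Rightarrow> real \<Rightarrow> (real \<Rightarrow> 'a::euclidean_space \<Rightarrow> complex) \<Rightarrow> bool" where
  "sobolev_simple T s w \<longleftrightarrow>
     finite (w ` {0..T}) \<and> w ` {0..T} \<subseteq> sobolev_space s \<and>
     (\<forall>f. {t\<in>{0..T}. w t = f} \<in> sets lebesgue)"

text \<open>Strong (Bochner) measurability: almost everywhere limit of simple functions.\<close>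

definition sobolev_strongly_measurable ::
    "real \<Rightarrow> real \<Rightarrow> (real \<Rightarrow> 'a::euclidean_space \<Rightarrow> complex) \<Rightarrow> bool" where
  "sobolev_strongly_measurable T s u \<longleftrightarrow>
     (\<exists>w. (\<forall>n. sobolev_simple T s (w n)) \<and>
       (AE t in lebesgue. t \<in> {0..T} \<longrightarrow>
          u t \<in> sobolev_space s \<and>
          (\<lambda>n. sobolev_norm s (\<lambda>x. w n t x - u t x)) \<longlonglongrightarrow> 0))"

definition Linf_sobolev ::
    "real \<Rightarrow> real \<Rightarrow> (real \<Rightarrow> 'a::euclidean_space \<Rightarrow> complex) \<Rightarrow> bool" where
  "Linf_sobolev T s u \<longleftrightarrow>
     sobolev_strongly_measurable T s u \<and>
     (\<exists>C. AE t in lebesgue. t \<in> {0..T} \<longrightarrow> sobolev_norm s (u t) \<le> C)"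

definition weakly_continuous ::
    "real \<Rightarrow> real \<Rightarrow> (real \<Rightarrow> 'a::euclidean_space \<Rightarrow> complex) \<Rightarrow> bool" where
  "weakly_continuous T s u \<longleftrightarrow>
     (\<forall>t\<in>{0..T}. u t \<in> sobolev_space s) \<and>
     (\<forall>l. sobolev_functional s l \<longrightarrow> continuous_on {0..T} (\<lambda>t. l (u t)))"

definition weakly_continuous_rep ::
    "real \<Rightarrow> real \<Rightarrow> (real \<Rightarrow> 'a::euclidean_space \<Rightarrow> complex) \<Rightarrow>
     (real \<Rightarrow> 'a \<Rightarrow> complex) \<Rightarrow> bool" where
  "weakly_continuous_rep T s u w \<longleftrightarrow>
     weakly_continuous T s w \<and>
     (AE t in lebesgue. t \<in> {0..T} \<longrightarrow> (AE x in lborel. w t x = u t x))"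


section \<open>Weak solutions of the logarithmic Schroedinger equation\<close>

text \<open>Here \<open>ln 0 = 0\<close> in HOL, and in any case the product vanishes at \<open>z = 0\<close>.\<close>

definition log_nonlinearity :: "complex \<Rightarrow> complex" where
  "log_nonlinearity z = z * complex_of_real (ln ((cmod z)\<^sup>2))"

text \<open>The distribution defined by \<open>w\<close>, evaluated at \<open>\<phi>\<close>. The iterated integral depends only on
  the classes of the functions \<open>w t\<close>, whose representatives may be chosen independently for
  each \<open>t\<close>. The outer measure is the complete one because for strongly measurable \<open>w\<close> the inner
  integral is an almost everywhere limit of measurable functions of \<open>t\<close>.\<close>

definition distribution_pairing ::
    "real \<Rightarrow> (real \<Rightarrow> 'a::euclidean_space \<Rightarrow> complex) \<Rightarrow> (real \<times> 'a \<Rightarrow> complex) \<Rightarrow> complex" where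
  "distribution_pairing T w \<phi> = (LINT t:{0..T}|lebesgue. (LINT x|lborel. w t x * \<phi> (t, x)))"

text \<open>\<open>i \<partial>\<^sub>t u + \<Delta> u + lam u log (|u|\<^sup>2) = 0\<close> in the sense of distributions; the derivatives are
  transposed to the test function, which costs a sign for \<open>\<partial>\<^sub>t\<close>.\<close>

definition logNLS_distributional ::
    "real \<Rightarrow> real \<Rightarrow> (real \<Rightarrow> 'a::euclidean_space \<Rightarrow> complex) \<Rightarrow> bool" where
  "logNLS_distributional lam T u \<longleftrightarrow>
     (\<forall>\<phi>. test_function ({0<..<T} \<times> UNIV) \<phi> \<longrightarrow>
        \<i> * (- distribution_pairing T u (time_deriv \<phi>))
        + distribution_pairing T u (space_laplacian \<phi>)
        + complex_of_real lam * distribution_pairing T (\<lambda>t x. log_nonlinearity (u t x)) \<phi> = 0)"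

definition weak_solution ::
    "real \<Rightarrow> real \<Rightarrow> real \<Rightarrow> ('a::euclidean_space \<Rightarrow> complex) \<Rightarrow>
     (real \<Rightarrow> 'a \<Rightarrow> complex) \<Rightarrow> bool" where
  "weak_solution lam T s u\<^sub>0 u \<longleftrightarrow>
     Linf_sobolev T s u \<and>
     logNLS_distributional lam T u \<and>
     (\<exists>w. weakly_continuous_rep T s u w \<and> (AE x in lborel. w 0 x = u\<^sub>0 x))"

end

theory Submission
  imports Defs "HOL-Probability.Characteristic_Functions" "HOL-Real_Asymp.Real_Asymp"
begin

text \<open>Let \<open>w = u - v\<close> and let \<open>\<rho>\<^sub>\<epsilon>\<close> be a mollifier. The regularised difference
  \<open>W = \<rho>\<^sub>\<epsilon> * w\<close> solves the equation with right-hand side \<open>\<rho>\<^sub>\<epsilon> * (g u - g v)\<close>, where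
  \<open>g z = z log |z|\<^sup>2\<close>, and is absolutely continuous in time, so its \<open>L\<^sup>2\<close> norm, localised by a
  cutoff at scale \<open>R\<close>, can be differentiated. The cutoff flux is \<open>O(1 / (R \<epsilon>))\<close>. In the nonlinear
  term one replaces \<open>W\<close> and \<open>\<rho>\<^sub>\<epsilon> * (g u - g v)\<close> by \<open>w\<close> and \<open>g u - g v\<close> and applies the
  Cazenave--Haraux inequality \<open>|Im ((g a - g b) cnj (a - b))| \<le> 2 |a - b|\<^sup>2\<close>. The commutator error is
  controlled by the \<open>L\<^sup>2\<close> modulus of continuity \<open>\<epsilon>\<^sup>s\<close> of \<open>w\<close> times the \<open>L\<^sup>2\<close> norm of the
  nonlinearity on a ball of radius about \<open>R\<close>, which grows only like \<open>log R\<close>: where \<open>|u|\<close> is small the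
  volume of the ball costs no more than a logarithm, and where it is large the fractional regularity
  gives decay of the distribution function. With \<open>R = \<epsilon>\<close> to the power \<open>-2\<close> all errors vanish as
  \<open>\<epsilon> \<rightarrow> 0\<close>, and Gronwall's inequality yields \<open>w = 0\<close>.\<close>

section \<open>The \<open>L\<^sup>2\<close> norm\<close>

text \<open>For s < 1 the product of \<open>cnj w\<close> with the Laplacian of w has no meaning,
  and the nonlinearity is not Lipschitz at 0 and may fail to be square integrable at infinity; hence
  both a mollifier and a spatial cutoff. The two limits cannot be taken one after the other: for
  fixed \<epsilon> the bound on the nonlinearity diverges as R grows, and for fixed R the flux bound
  1 / (R \<epsilon>) diverges as \<epsilon> -> 0. Coupling them by R = \<epsilon>^(-2) makes the
  flux of order \<epsilon>; any power beyond -1 has the same effect, because the nonlinearity sees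
  only log R. The commutator is arranged so that the mollification error falls on w alone: only the
  convolution of the nonlinear difference is expanded, as an average of its values at x - y, the
  scalar inequality is applied at the point x - y, and what is left over is w(x - y) - W(x). Young's
  inequality with weight q = \<epsilon>^s then yields \<epsilon>^(2s) / q + q (log R)^2 up to
  constants, and both terms tend to 0.\<close>

definition l2sq :: "('a::euclidean_space \<Rightarrow> complex) \<Rightarrow> ennreal" where
  "l2sq f = (\<integral>\<^sup>+x. ennreal ((cmod (f x))\<^sup>2) \<partial>lborel)"

lemma nn_integral_lborel_scale:
  fixes t :: "'a::euclidean_space"
  assumes "c \<noteq> 0" and [measurable]: "f \<in> borel_measurable borel"
  shows "(\<integral>\<^sup>+x. f x \<partial>lborel) = ennreal (\<bar>c\<bar> ^ DIM('a)) * (\<integral>\<^sup>+x. f (t + c *\<^sub>R x) \<partial>lborel)"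
  by (subst lborel_affine[OF assms(1), of t])
     (simp add: nn_integral_density nn_integral_distr nn_integral_cmult)

lemma integral_lborel_scale:
  fixes t :: "'a::euclidean_space" and f :: "'a \<Rightarrow> 'b::{banach, second_countable_topology}"
  assumes "c \<noteq> 0" and [measurable]: "f \<in> borel_measurable borel"
  shows "(LINT x|lborel. f x) = \<bar>c\<bar> ^ DIM('a) *\<^sub>R (LINT x|lborel. f (t + c *\<^sub>R x))"
proof -
  have "(LINT x|lborel. f x) =
      integral\<^sup>L (density (distr lborel borel (\<lambda>x. t + c *\<^sub>R x)) (\<lambda>_. \<bar>c\<bar>^DIM('a))) f"
    using lborel_affine[OF assms(1), of t] by metis
  also have "\<dots> = \<bar>c\<bar> ^ DIM('a) *\<^sub>R (LINT x|lborel. f (t + c *\<^sub>R x))"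
    by (subst integral_density) (auto simp: integral_distr)
  finally show ?thesis .
qed

lemma nn_integral_lborel_shift:
  fixes h :: "'a::euclidean_space"
  assumes [measurable]: "f \<in> borel_measurable borel"
  shows "(\<integral>\<^sup>+x. f (x + h) \<partial>lborel) = (\<integral>\<^sup>+x. f x \<partial>lborel)"
  using nn_integral_lborel_scale[of 1 f h] by (simp add: add.commute)

lemma l2sq_shift:
  assumes "f \<in> borel_measurable borel"
  shows "l2sq (\<lambda>x. f (x + h)) = l2sq f"
  unfolding l2sq_def using assms by (intro nn_integral_lborel_shift) measurable

lemma cmod_add_sq_le: "(cmod (a + b))\<^sup>2 \<le> 2 * (cmod a)\<^sup>2 + 2 * (cmod b)\<^sup>2"
proof -
  have "(cmod (a + b))\<^sup>2 \<le> (cmod a + cmod b)\<^sup>2"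
    by (intro power_mono norm_triangle_ineq) auto
  also have "\<dots> \<le> 2 * (cmod a)\<^sup>2 + 2 * (cmod b)\<^sup>2"
    using sum_squares_bound[of "cmod a" "cmod b"] by (simp add: power2_sum)
  finally show ?thesis .
qed

lemma l2sq_add_le:
  assumes [measurable]: "f \<in> borel_measurable borel" "g \<in> borel_measurable borel"
  shows "l2sq (\<lambda>x. f x + g x) \<le> 2 * l2sq f + 2 * l2sq g"
proof -
  have "l2sq (\<lambda>x. f x + g x) \<le> (\<integral>\<^sup>+x. 2 * ennreal ((cmod (f x))\<^sup>2) + 2 * ennreal ((cmod (g x))\<^sup>2) \<partial>lborel)"
    unfolding l2sq_def
  proof (intro nn_integral_mono)
    fix x
    have "ennreal ((cmod (f x + g x))\<^sup>2) \<le> ennreal (2 * (cmod (f x))\<^sup>2 + 2 * (cmod (g x))\<^sup>2)"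
      by (intro ennreal_leI cmod_add_sq_le)
    then show "ennreal ((cmod (f x + g x))\<^sup>2) \<le> 2 * ennreal ((cmod (f x))\<^sup>2) + 2 * ennreal ((cmod (g x))\<^sup>2)"
      by (simp add: ennreal_mult')
  qed
  also have "\<dots> = 2 * l2sq f + 2 * l2sq g"
    unfolding l2sq_def by (subst nn_integral_add) (auto simp: nn_integral_cmult)
  finally show ?thesis .
qed

lemma l2sq_uminus: "l2sq (\<lambda>x. - f x) = l2sq f"
  by (simp add: l2sq_def)

lemma l2sq_cmult:
  assumes [measurable]: "f \<in> borel_measurable borel"
  shows "l2sq (\<lambda>x. c * f x) = ennreal ((cmod c)\<^sup>2) * l2sq f"
  by (simp add: l2sq_def norm_mult power_mult_distrib ennreal_mult' nn_integral_cmult)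

lemma l2sq_diff_le:
  assumes [measurable]: "f \<in> borel_measurable borel" "g \<in> borel_measurable borel"
  shows "l2sq (\<lambda>x. f x - g x) \<le> 2 * l2sq f + 2 * l2sq g"
  using l2sq_add_le[of f "\<lambda>x. - g x"] by (simp add: l2sq_uminus)

lemma l2sq_mono:
  assumes "\<And>x. cmod (f x) \<le> cmod (g x)"
  shows "l2sq f \<le> l2sq g"
  unfolding l2sq_def by (intro nn_integral_mono ennreal_leI power_mono assms) auto

lemma l2sq_cong_AE:
  assumes "AE x in lborel. f x = g x"
  shows "l2sq f = l2sq g"
  unfolding l2sq_def by (rule nn_integral_cong_AE) (use assms in auto)

lemma l2sq_eq_0_iff:
  assumes [measurable]: "f \<in> borel_measurable borel"
  shows "l2sq f = 0 \<longleftrightarrow> (AE x in lborel. f x = 0)"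
  unfolding l2sq_def by (subst nn_integral_0_iff_AE) auto

lemma square_integrable_iff:
  "square_integrable f \<longleftrightarrow> f \<in> borel_measurable borel \<and> l2sq f < \<infinity>"
  unfolding square_integrable_def l2sq_def integrable_iff_bounded
  by (auto simp: borel_measurable_integrable)

lemma l2sq_eq_integral:
  assumes "square_integrable f"
  shows "l2sq f = ennreal (LINT x|lborel. (cmod (f x))\<^sup>2)"
  using assms unfolding l2sq_def square_integrable_def
  by (intro nn_integral_eq_integral) auto

lemma l2sq_dominated_tendsto:
  fixes f :: "nat \<Rightarrow> 'a::euclidean_space \<Rightarrow> complex"
  assumes [measurable]: "\<And>n. f n \<in> borel_measurable borel" "g \<in> borel_measurable borel"
    "w \<in> borel_measurable borel"
    and w: "(\<integral>\<^sup>+x. w x \<partial>lborel) < \<infinity>"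
    and bound: "\<And>n x. ennreal ((cmod (f n x - g x))\<^sup>2) \<le> w x"
    and lim: "AE x in lborel. (\<lambda>n. f n x) \<longlonglongrightarrow> g x"
  shows "(\<lambda>n. l2sq (\<lambda>x. f n x - g x)) \<longlonglongrightarrow> 0"
proof -
  have "(\<lambda>n. (\<integral>\<^sup>+x. ennreal ((cmod (f n x - g x))\<^sup>2) \<partial>lborel)) \<longlonglongrightarrow> (\<integral>\<^sup>+x. 0 \<partial>(lborel::'a measure))"
  proof (rule nn_integral_dominated_convergence[where w=w])
    show "AE x in lborel. (\<lambda>n. ennreal ((cmod (f n x - g x))\<^sup>2)) \<longlonglongrightarrow> 0"
      using lim
    proof eventually_elim
      fix x assume "(\<lambda>n. f n x) \<longlonglongrightarrow> g x"
      then have "(\<lambda>n. (cmod (f n x - g x))\<^sup>2) \<longlonglongrightarrow> (cmod (g x - g x))\<^sup>2"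
        by (intro tendsto_intros)
      then show "(\<lambda>n. ennreal ((cmod (f n x - g x))\<^sup>2)) \<longlonglongrightarrow> 0"
        by (intro tendsto_ennrealI[where x=0, simplified]) simp
    qed
  qed (use w bound in auto)
  then show ?thesis by (simp add: l2sq_def)
qed

text \<open>Truncation in the domain and in the range leaves a bounded function with bounded
  support; \<open>measurable_on\<close> provides continuous functions converging to it almost
  everywhere, and once these are clamped the convergence is dominated. The same \<open>R\<close>
  bounds the support and the values of the approximant.\<close>

lemma l2_dense_compactly_supported:
  fixes f :: "'a::euclidean_space \<Rightarrow> complex"
  assumes f: "square_integrable f" and e: "e > 0"
  obtains g R where "continuous_on UNIV g" "\<And>x. norm x > R \<Longrightarrow> g x = 0"
    "\<And>x. cmod (g x) \<le> R" "l2sq (\<lambda>x. f x - g x) < e"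
proof -
  have [measurable]: "f \<in> borel_measurable borel" and fin: "l2sq f < \<infinity>"
    using f by (auto simp: square_integrable_iff)
  define F where "F = (\<lambda>k::nat. \<lambda>x. if norm x \<le> real k \<and> cmod (f x) \<le> real k then f x else 0)"
  have [measurable]: "F k \<in> borel_measurable borel" for k
    unfolding F_def by measurable
  have "(\<lambda>k. l2sq (\<lambda>x. F k x - f x)) \<longlonglongrightarrow> 0"
  proof (rule l2sq_dominated_tendsto[where w="\<lambda>x. ennreal ((cmod (f x))\<^sup>2)"])
    show "AE x in lborel. (\<lambda>k. F k x) \<longlonglongrightarrow> f x"
    proof (intro AE_I2 tendsto_eventually)
      fix x
      obtain k0 where k0: "max (norm x) (cmod (f x)) \<le> real k0"
        using real_arch_simple by blast
      show "\<forall>\<^sub>F k in sequentially. F k x = f x"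
        unfolding F_def using eventually_ge_at_top[of k0]
        by eventually_elim (use k0 in force)
    qed
  qed (use fin in \<open>auto simp: F_def l2sq_def\<close>)
  moreover have "e / 4 > 0" using e by (auto simp: ennreal_zero_less_divide)
  ultimately have "\<forall>\<^sub>F k in sequentially. l2sq (\<lambda>x. F k x - f x) < e / 4"
    by (rule order_tendstoD)
  then obtain k where k: "l2sq (\<lambda>x. F k x - f x) < e / 4"
    by (auto simp: eventually_sequentially)
  have "F k measurable_on UNIV"
    by (rule lebesgue_measurable_imp_measurable_on) (auto intro!: measurable_completion)
  then obtain N G where N: "negligible N" and G: "\<And>n. continuous_on UNIV (G n)"
    and lim: "\<And>x. x \<notin> N \<Longrightarrow> (\<lambda>n. G n x) \<longlonglongrightarrow> F k x"
    unfolding measurable_on_def by auto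
  \<comment> \<open>Radial retraction onto the disc of radius k. For k = 0 its denominator may
    vanish, so that case is set apart in \<open>H\<close>.\<close>
  define c where "c = (\<lambda>z. (of_real (real k / max (real k) (cmod z)) :: complex) * z)"
  \<comment> \<open>A continuous cutoff: 1 on the ball of radius k and 0 beyond radius k +
    1.\<close>
  define chi where "chi = (\<lambda>x::'a. (of_real (max 0 (min 1 (real k + 1 - norm x))) :: complex))"
  define kk where "kk = real k + 1"
  define H where "H = (\<lambda>n x. chi x * (if k = 0 then 0 else c (G n x)))"
  have contH: "continuous_on UNIV (H n)" for n
  proof (cases "k = 0")
    case False
    then have "continuous_on UNIV (\<lambda>x. c (G n x))"
      unfolding c_def by (intro continuous_intros G) (auto simp: max_def split: if_splits)
    then show ?thesis
      using False unfolding H_def chi_def by (simp, intro continuous_intros)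
  qed (simp add: H_def)
  have c_le: "cmod (c z) \<le> real k" for z
    by (auto simp: c_def norm_mult norm_divide max_def divide_simps)
  have chi_le: "cmod (chi x) \<le> 1" for x by (auto simp: chi_def)
  have H_le: "cmod (H n x) \<le> real k" for n x
  proof -
    have "cmod (H n x) \<le> 1 * real k"
      unfolding H_def norm_mult by (intro mult_mono chi_le) (auto simp: c_le)
    then show ?thesis by simp
  qed
  have chi_0: "chi x = 0" if "norm x > kk" for x
    using that by (auto simp: chi_def kk_def)
  have H_0: "H n x = 0" if "norm x > kk" for n x
    using chi_0[OF that] by (simp add: H_def)
  have F_le: "cmod (F k x) \<le> real k" for x by (auto simp: F_def)
  have F_0: "F k x = 0" if "norm x > kk" for x using that by (auto simp: F_def kk_def)
  have [measurable]: "H n \<in> borel_measurable borel" for n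
    by (rule borel_measurable_continuous_onI[OF contH])
  have AEN: "AE x in lborel. x \<notin> N"
  proof -
    have "AE x in lebesgue. x \<notin> N"
      using N by (simp add: negligible_iff_null_sets AE_not_in)
    then show ?thesis by (simp add: AE_completion_iff)
  qed
  have "(\<lambda>n. l2sq (\<lambda>x. H n x - F k x)) \<longlonglongrightarrow> 0"
  proof (rule l2sq_dominated_tendsto[where w="\<lambda>x. ennreal ((2 * real k)\<^sup>2) * indicator (cball 0 kk) x"])
    show "(\<integral>\<^sup>+ x. ennreal ((2 * real k)\<^sup>2) * indicator (cball 0 kk) x \<partial>(lborel::'a measure)) < \<infinity>"
      by (subst nn_integral_cmult_indicator)
         (auto simp: ennreal_mult_less_top emeasure_lborel_cball_finite[unfolded infinity_ennreal_def])
    show "ennreal ((cmod (H n x - F k x))\<^sup>2) \<le> ennreal ((2 * real k)\<^sup>2) * indicator (cball 0 kk) x" for n x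
    proof (cases "norm x > kk")
      case False
      have "cmod (H n x - F k x) \<le> 2 * real k"
        using norm_triangle_ineq4[of "H n x" "F k x"] H_le[of n x] F_le[of x] by linarith
      then have "ennreal ((cmod (H n x - F k x))\<^sup>2) \<le> ennreal ((2 * real k)\<^sup>2)"
        by (intro ennreal_leI power_mono) auto
      then show ?thesis using False by (simp add: indicator_def)
    qed (simp add: H_0 F_0)
    show "AE x in lborel. (\<lambda>n. H n x) \<longlonglongrightarrow> F k x"
      using AEN
    proof eventually_elim
      fix x assume "x \<notin> N"
      show "(\<lambda>n. H n x) \<longlonglongrightarrow> F k x"
      proof (cases "k = 0")
        case True
        then show ?thesis using F_le[of x] by (simp add: H_def)
      next
        case False
        have "(\<lambda>n. c (G n x)) \<longlonglongrightarrow> c (F k x)"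
          unfolding c_def using lim[OF \<open>x \<notin> N\<close>] False
          by (intro tendsto_intros) (auto simp: max_def split: if_splits)
        also have "c (F k x) = F k x"
          using False F_le[of x] by (auto simp: c_def max_def)
        finally have *: "(\<lambda>n. chi x * c (G n x)) \<longlonglongrightarrow> chi x * F k x"
          by (intro tendsto_intros)
        have e: "chi x * F k x = F k x"
          by (auto simp: F_def chi_def)
        show ?thesis using *[unfolded e] False by (simp only: H_def if_False)
      qed
    qed
  qed (auto intro!: borel_measurable_times_ennreal borel_measurable_indicator)
  then have "\<forall>\<^sub>F n in sequentially. l2sq (\<lambda>x. H n x - F k x) < e / 4"
    using \<open>e / 4 > 0\<close> by (rule order_tendstoD)
  then obtain n where n: "l2sq (\<lambda>x. H n x - F k x) < e / 4"
    by (auto simp: eventually_sequentially)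
  have "l2sq (\<lambda>x. f x - H n x) \<le> 2 * l2sq (\<lambda>x. f x - F k x) + 2 * l2sq (\<lambda>x. F k x - H n x)"
    using l2sq_add_le[of "\<lambda>x. f x - F k x" "\<lambda>x. F k x - H n x"] by simp
  also have "\<dots> = 2 * l2sq (\<lambda>x. F k x - f x) + 2 * l2sq (\<lambda>x. H n x - F k x)"
    by (simp add: l2sq_def norm_minus_commute)
  also have "\<dots> < 2 * (e / 4) + 2 * (e / 4)"
    using k n by (intro add_strict_mono ennreal_mult_strict_left_mono) auto
  also have "\<dots> = e"
  proof (cases e)
    case (real r)
    then show ?thesis
      by (simp add: ennreal_plus[symmetric] divide_ennreal[symmetric] del: ennreal_plus)
         (simp add: ennreal_numeral[symmetric] divide_ennreal ennreal_mult'[symmetric]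
            ennreal_plus[symmetric] del: ennreal_numeral ennreal_plus)
  next
    case top
    then show ?thesis by (simp add: ennreal_top_divide ennreal_mult_top)
  qed
  finally have "l2sq (\<lambda>x. f x - H n x) < e" .
  then show thesis
    using that[of "H n" kk] contH H_0 H_le[of n] by (force simp: kk_def intro: order_trans[OF H_le])
qed

lemma l2_translation_continuous:
  fixes f :: "'a::euclidean_space \<Rightarrow> complex"
  assumes f: "square_integrable f" and h: "h \<longlonglongrightarrow> 0"
  shows "(\<lambda>n. l2sq (\<lambda>x. f (x + h n) - f x)) \<longlonglongrightarrow> 0"
proof (rule order_tendstoI)
  fix e :: ennreal assume "0 < e"
  have [measurable]: "f \<in> borel_measurable borel"
    using f by (auto simp: square_integrable_iff)
  obtain d :: real where d: "d > 0" "ennreal d < e"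
    using \<open>0 < e\<close> by (metis ennreal_less_zero_iff dense ennreal_cases infinity_ennreal_def order_less_le_trans top_greatest leD less_top)
  \<comment> \<open>The fraction 1/10 pays for using \<open>l2sq_add_le\<close> twice: 2/10 + 2
    (2/10 + 2/10) = 1.\<close>
  obtain g R where g: "continuous_on UNIV g" "\<And>x. norm x > R \<Longrightarrow> g x = 0"
    "\<And>x. cmod (g x) \<le> R" "l2sq (\<lambda>x. f x - g x) < ennreal (d / 10)"
    using l2_dense_compactly_supported[OF f, of "ennreal (d/10)"] d by (auto simp: ennreal_zero_less_divide)
  have [measurable]: "g \<in> borel_measurable borel"
    by (rule borel_measurable_continuous_onI[OF g(1)])
  obtain B where B: "\<And>n. norm (h n) \<le> B"
    using h convergent_imp_Bseq[of h] by (auto simp: convergent_def Bseq_def)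
  have "(\<lambda>n. l2sq (\<lambda>x. g (x + h n) - g x)) \<longlonglongrightarrow> 0"
  proof (rule l2sq_dominated_tendsto[where w="\<lambda>x. ennreal ((2 * R)\<^sup>2) * indicator (cball 0 (R + B)) x"])
    show "(\<integral>\<^sup>+ x. ennreal ((2 * R)\<^sup>2) * indicator (cball 0 (R + B)) x \<partial>(lborel::'a measure)) < \<infinity>"
      by (subst nn_integral_cmult_indicator)
         (auto simp: ennreal_mult_less_top emeasure_lborel_cball_finite[unfolded infinity_ennreal_def])
    show "AE x in lborel. (\<lambda>n. g (x + h n)) \<longlonglongrightarrow> g x"
    proof (rule AE_I2)
      fix x
      have "(\<lambda>n. g (x + h n)) \<longlonglongrightarrow> g (x + 0)"
        using g(1) h by (intro isCont_tendsto_compose[where g=g] tendsto_intros)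
          (auto simp: continuous_on_eq_continuous_at)
      then show "(\<lambda>n. g (x + h n)) \<longlonglongrightarrow> g x" by simp
    qed
    fix n x
    show "ennreal ((cmod (g (x + h n) - g x))\<^sup>2) \<le> ennreal ((2 * R)\<^sup>2) * indicator (cball 0 (R + B)) x"
    proof (cases "norm x > R + B")
      case False
      have "cmod (g (x + h n) - g x) \<le> 2 * R"
        using norm_triangle_ineq4[of "g (x + h n)" "g x"] g(3)[of "x + h n"] g(3)[of x] by linarith
      then have "ennreal ((cmod (g (x + h n) - g x))\<^sup>2) \<le> ennreal ((2 * R)\<^sup>2)"
        by (intro ennreal_leI power_mono) auto
      then show ?thesis using False by (simp add: indicator_def)
    next
      case True
      have "norm x \<le> norm (x + h n) + norm (h n)"
        using norm_triangle_ineq4[of "x + h n" "h n"] by simp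
      then have "norm (x + h n) > R" "norm x > R"
        using True B[of n] norm_ge_zero[of "h n"] by linarith+
      then show ?thesis by (simp add: g(2))
    qed
  qed (auto intro!: borel_measurable_times_ennreal borel_measurable_indicator)
  moreover have "ennreal (d / 10) > 0" using d by simp
  ultimately have "\<forall>\<^sub>F n in sequentially. l2sq (\<lambda>x. g (x + h n) - g x) < ennreal (d / 10)"
    by (rule order_tendstoD)
  then show "\<forall>\<^sub>F n in sequentially. l2sq (\<lambda>x. f (x + h n) - f x) < e"
  proof eventually_elim
    fix n assume n: "l2sq (\<lambda>x. g (x + h n) - g x) < ennreal (d / 10)"
    have sh: "l2sq (\<lambda>x. f (x + h n) - g (x + h n)) = l2sq (\<lambda>x. f x - g x)"
      using l2sq_shift[of "\<lambda>x. f x - g x" "h n"] by simp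
    have gf: "l2sq (\<lambda>x. g x - f x) = l2sq (\<lambda>x. f x - g x)"
      by (simp add: l2sq_def norm_minus_commute)
    have "l2sq (\<lambda>x. f (x + h n) - f x)
      \<le> 2 * l2sq (\<lambda>x. f (x + h n) - g (x + h n)) + 2 * l2sq (\<lambda>x. (g (x + h n) - g x) + (g x - f x))"
      using l2sq_add_le[of "\<lambda>x. f (x + h n) - g (x + h n)" "\<lambda>x. (g (x + h n) - g x) + (g x - f x)"] by simp
    also have "\<dots> \<le> 2 * l2sq (\<lambda>x. f (x + h n) - g (x + h n))
        + 2 * (2 * l2sq (\<lambda>x. g (x + h n) - g x) + 2 * l2sq (\<lambda>x. g x - f x))"
      by (intro add_mono mult_left_mono l2sq_add_le) auto
    also have "\<dots> \<le> 2 * ennreal (d/10) + 2 * (2 * ennreal (d/10) + 2 * ennreal (d/10))"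
      unfolding sh gf using n g(4) by (intro add_mono mult_left_mono) auto
    also have "\<dots> = ennreal d"
      using d by (simp add: ennreal_numeral[symmetric] ennreal_mult'[symmetric]
            ennreal_plus[symmetric] del: ennreal_numeral ennreal_plus)
    finally show "l2sq (\<lambda>x. f (x + h n) - f x) < e" using d by simp
  qed
qed auto

section \<open>A Plancherel inequality\<close>

lemma
  fixes f :: "'a::euclidean_space \<Rightarrow> real \<Rightarrow> complex"
  assumes "\<And>b. b \<in> Basis \<Longrightarrow> integrable lborel (f b)"
  shows integrable_lborel_prod: "integrable (lborel :: 'a measure) (\<lambda>x. \<Prod>b\<in>Basis. f b (x \<bullet> b))"
    and integral_lborel_prod:
      "(LINT x|(lborel :: 'a measure). (\<Prod>b\<in>Basis. f b (x \<bullet> b))) = (\<Prod>b\<in>Basis. (LINT x|lborel. f b x))"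
proof -
  interpret product_sigma_finite "\<lambda>_::'a. lborel :: real measure" ..
  have [measurable]: "b \<in> Basis \<Longrightarrow> f b \<in> borel_measurable borel" for b
    using assms[of b] by auto
  have m: "(\<lambda>f. \<Sum>b\<in>Basis. f b *\<^sub>R b) \<in> measurable (\<Pi>\<^sub>M b\<in>Basis. lborel) (borel :: 'a measure)"
    by measurable
  have "integrable (\<Pi>\<^sub>M b\<in>(Basis :: 'a set). lborel) (\<lambda>x. \<Prod>b\<in>Basis. f b (x b))"
    by (intro product_integrable_prod assms) auto
  then show "integrable (lborel :: 'a measure) (\<lambda>x. \<Prod>b\<in>Basis. f b (x \<bullet> b))"
    by (subst lborel_eq, subst integrable_distr_eq[OF m]) (auto cong: prod.cong_simp)
  show "(LINT x|(lborel :: 'a measure). (\<Prod>b\<in>Basis. f b (x \<bullet> b))) = (\<Prod>b\<in>Basis. (LINT x|lborel. f b x))"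
    by (subst lborel_eq, subst integral_distr[OF m])
       (auto cong: prod.cong_simp intro!: product_integral_prod assms)
qed

section \<open>Gaussians and their Fourier transforms\<close>

lemma norm_sq_eq_sum_Basis: "(norm (x::'a::euclidean_space))\<^sup>2 = (\<Sum>b\<in>Basis. (x \<bullet> b)\<^sup>2)"
  unfolding power2_norm_eq_inner by (subst euclidean_inner) (simp add: power2_eq_square)

text \<open>The parameter is the reciprocal of the width. As \<sigma> -> 0 the Gaussian tends to 1
  on the frequency side, while its transform, a multiple of \<open>gauss (1 / \<sigma>)\<close>,
  concentrates at 0; this is what makes it a summability factor.\<close>

definition gauss :: "real \<Rightarrow> 'a::euclidean_space \<Rightarrow> real" where
  "gauss \<sigma> x = exp (- (\<sigma> * norm x)\<^sup>2 / 2)"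

lemma gauss_measurable [measurable]: "gauss \<sigma> \<in> borel_measurable borel"
  unfolding gauss_def by measurable

lemma gauss_nonneg [simp]: "gauss \<sigma> x \<ge> 0" and gauss_le_1: "gauss \<sigma> x \<le> 1"
  by (auto simp: gauss_def)

lemma gauss_eq_prod: "gauss \<sigma> x = (\<Prod>b\<in>Basis. exp (- (\<sigma> * (x \<bullet> b))\<^sup>2 / 2))"
  unfolding gauss_def
  by (simp add: power_mult_distrib norm_sq_eq_sum_Basis sum_distrib_left exp_sum[symmetric]
      sum_negf sum_divide_distrib)

text \<open>The characteristic function of the standard normal distribution at - z / \<sigma>, after
  the substitution x -> \<sigma> x.\<close>

lemma
  fixes z \<sigma> :: real
  assumes "\<sigma> > 0"
  shows integrable_gaussian_real:
      "integrable lborel (\<lambda>x. exp (- \<i> * of_real (z * x)) * of_real (exp (- (\<sigma> * x)\<^sup>2 / 2)))"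
    and fourier_gaussian_real:
      "(LINT x|lborel. exp (- \<i> * of_real (z * x)) * of_real (exp (- (\<sigma> * x)\<^sup>2 / 2))) =
        of_real (sqrt (2 * pi) / \<sigma> * exp (- (z / \<sigma>)\<^sup>2 / 2))"
proof -
  define g where "g = (\<lambda>x. iexp (- (z / \<sigma>) * x) * of_real (std_normal_density x))"
  have [measurable]: "g \<in> borel_measurable borel" unfolding g_def by measurable
  have gi: "integrable lborel g"
  proof (rule Bochner_Integration.integrable_bound[of _ std_normal_density])
    show "AE x in lborel. cmod (g x) \<le> norm (std_normal_density x)"
      by (intro AE_I2) (simp add: g_def norm_mult)
  qed auto
  have "char std_normal_distribution (- (z / \<sigma>)) = (LINT x|lborel. g x)"
    unfolding char_def g_def
    by (subst integral_density) (auto simp: scaleR_conv_of_real mult.commute)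
  then have gI: "(LINT x|lborel. g x) = of_real (exp (- (z / \<sigma>)\<^sup>2 / 2))"
    by (simp add: char_std_normal_distribution)
  have eq: "exp (- \<i> * of_real (z * x)) * of_real (exp (- (\<sigma> * x)\<^sup>2 / 2)) =
      of_real (sqrt (2 * pi)) * g (0 + \<sigma> * x)" for x
    using assms by (simp add: g_def std_normal_density_def field_simps)
  show "integrable lborel (\<lambda>x. exp (- \<i> * of_real (z * x)) * of_real (exp (- (\<sigma> * x)\<^sup>2 / 2)))"
    unfolding eq using assms gi by (intro integrable_mult_right lborel_integrable_real_affine) auto
  have "(LINT x|lborel. g x) = \<bar>\<sigma>\<bar> *\<^sub>R (LINT x|lborel. g (0 + \<sigma> * x))"
    using assms by (intro lborel_integral_real_affine) auto
  then have "(LINT x|lborel. g (0 + \<sigma> * x)) = of_real (exp (- (z / \<sigma>)\<^sup>2 / 2) / \<sigma>)"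
    using assms gI by (simp add: scaleR_conv_of_real field_simps)
  then show "(LINT x|lborel. exp (- \<i> * of_real (z * x)) * of_real (exp (- (\<sigma> * x)\<^sup>2 / 2))) =
        of_real (sqrt (2 * pi) / \<sigma> * exp (- (z / \<sigma>)\<^sup>2 / 2))"
    unfolding eq by (simp add: field_simps)
qed

lemma
  fixes z :: "'a::euclidean_space"
  assumes \<sigma>: "\<sigma> > 0"
  shows integrable_gauss_cis: "integrable lborel (\<lambda>\<xi>. exp (- \<i> * of_real (z \<bullet> \<xi>)) * of_real (gauss \<sigma> \<xi>))"
    and fourier_gauss: "(LINT \<xi>|lborel. exp (- \<i> * of_real (z \<bullet> \<xi>)) * of_real (gauss \<sigma> \<xi>)) =
      of_real ((sqrt (2 * pi) / \<sigma>) ^ DIM('a) * gauss (1 / \<sigma>) z)"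
proof -
  define f where "f = (\<lambda>b x. exp (- \<i> * of_real ((z \<bullet> b) * x)) * of_real (exp (- (\<sigma> * x)\<^sup>2 / 2)))"
  have eq: "exp (- \<i> * of_real (z \<bullet> \<xi>)) * of_real (gauss \<sigma> \<xi>) = (\<Prod>b\<in>Basis. f b (\<xi> \<bullet> b))" for \<xi> :: 'a
    unfolding f_def prod.distrib gauss_eq_prod of_real_prod
    by (subst euclidean_inner) (simp add: exp_sum[symmetric] sum_distrib_left sum_negf)
  have int: "integrable lborel (f b)" for b
    unfolding f_def by (rule integrable_gaussian_real[OF \<sigma>])
  show "integrable lborel (\<lambda>\<xi>. exp (- \<i> * of_real (z \<bullet> \<xi>)) * of_real (gauss \<sigma> \<xi>))"
    unfolding eq by (rule integrable_lborel_prod[OF int])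
  have "(LINT \<xi>|lborel. exp (- \<i> * of_real (z \<bullet> \<xi>)) * of_real (gauss \<sigma> \<xi>)) =
      (\<Prod>b\<in>Basis. of_real (sqrt (2 * pi) / \<sigma> * exp (- ((z \<bullet> b) / \<sigma>)\<^sup>2 / 2)))"
    unfolding eq integral_lborel_prod[OF int]
    unfolding f_def by (simp only: fourier_gaussian_real[OF \<sigma>])
  also have "\<dots> = of_real ((sqrt (2 * pi) / \<sigma>) ^ DIM('a) * gauss (1 / \<sigma>) z)"
    unfolding of_real_prod[symmetric] prod.distrib by (simp add: gauss_eq_prod)
  finally show "(LINT \<xi>|lborel. exp (- \<i> * of_real (z \<bullet> \<xi>)) * of_real (gauss \<sigma> \<xi>)) =
      of_real ((sqrt (2 * pi) / \<sigma>) ^ DIM('a) * gauss (1 / \<sigma>) z)" .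
qed

lemma
  assumes "\<sigma> > 0"
  shows integrable_gauss: "integrable lborel (gauss \<sigma> :: 'a::euclidean_space \<Rightarrow> real)"
    and integral_gauss: "(LINT x|(lborel :: 'a measure). gauss \<sigma> x) = (sqrt (2 * pi) / \<sigma>) ^ DIM('a)"
proof -
  have "integrable lborel (\<lambda>x::'a. complex_of_real (gauss \<sigma> x))"
    using integrable_gauss_cis[OF assms, of 0] by simp
  then show "integrable lborel (gauss \<sigma> :: 'a \<Rightarrow> real)"
    by (simp add: complex_of_real_integrable_eq)
  have "complex_of_real (LINT x|(lborel :: 'a measure). gauss \<sigma> x) = of_real ((sqrt (2 * pi) / \<sigma>) ^ DIM('a))"
    using fourier_gauss[OF assms, of "0::'a"] by (simp add: gauss_def del: of_real_power)
  then show "(LINT x|(lborel :: 'a measure). gauss \<sigma> x) = (sqrt (2 * pi) / \<sigma>) ^ DIM('a)"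
    by (simp only: of_real_eq_iff)
qed

section \<open>Fourier integrals and autocorrelation\<close>

definition fourier_int :: "('a::euclidean_space \<Rightarrow> complex) \<Rightarrow> 'a \<Rightarrow> complex" where
  "fourier_int f \<xi> = (LINT x|lborel. f x * exp (- \<i> * of_real (x \<bullet> \<xi>)))"

lemma fourier_int_measurable [measurable]:
  assumes [measurable]: "f \<in> borel_measurable borel"
  shows "fourier_int f \<in> borel_measurable borel"
  unfolding fourier_int_def by measurable

lemma integrable_mult_cis:
  fixes f :: "'a::euclidean_space \<Rightarrow> complex"
  assumes "integrable lborel f"
  shows "integrable lborel (\<lambda>x. f x * exp (- \<i> * of_real (x \<bullet> \<xi>)))"
  by (rule Bochner_Integration.integrable_bound[OF assms]) (use assms in \<open>auto simp: norm_mult\<close>)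

lemma integrable_pair_lborelI:
  fixes f :: "'a::euclidean_space \<times> 'b::euclidean_space \<Rightarrow> complex"
  assumes [measurable]: "f \<in> borel_measurable (borel \<Otimes>\<^sub>M borel)"
    and "(\<integral>\<^sup>+x. (\<integral>\<^sup>+y. ennreal (cmod (f (x, y))) \<partial>lborel) \<partial>lborel) < \<infinity>"
  shows "integrable (lborel \<Otimes>\<^sub>M lborel) f"
proof (rule integrableI_bounded)
  have "(\<integral>\<^sup>+ z. ennreal (cmod (f z)) \<partial>(lborel \<Otimes>\<^sub>M lborel)) =
      (\<integral>\<^sup>+x. (\<integral>\<^sup>+y. ennreal (cmod (f (x, y))) \<partial>lborel) \<partial>lborel)"
    by (subst lborel.nn_integral_fst[symmetric]) auto
  then show "(\<integral>\<^sup>+ z. ennreal (cmod (f z)) \<partial>(lborel \<Otimes>\<^sub>M lborel)) < \<infinity>"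
    using assms by simp
qed simp

lemma integral_lborel_shift:
  fixes f :: "'a::euclidean_space \<Rightarrow> 'b::{banach, second_countable_topology}"
  assumes [measurable]: "f \<in> borel_measurable borel"
  shows "(LINT x|lborel. f (x + h)) = (LINT x|lborel. f x)"
  using integral_lborel_scale[of 1 f h] by (simp add: add.commute)

text \<open>The convolution of \<open>f\<close> with its conjugate reflection. Its value at 0 is the
  squared L^2 norm of \<open>f\<close>, and through it the squared modulus of a Fourier integral
  becomes a Fourier integral again.\<close>

definition autocorr :: "('a::euclidean_space \<Rightarrow> complex) \<Rightarrow> 'a \<Rightarrow> complex" where
  "autocorr f h = (LINT y|lborel. cnj (f y) * f (y + h))"

lemma borel_measurable_cnj [measurable (raw)]:
  "f \<in> borel_measurable M \<Longrightarrow> (\<lambda>x. cnj (f x)) \<in> borel_measurable M"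
  by (rule borel_measurable_continuous_on[of cnj]) (auto intro!: continuous_intros)

text \<open>Write the squared modulus as the transform times its conjugate and substitute x = h + y
  in one of the factors: the phases in y cancel, and Fubini lets the integral over y be taken
  first.\<close>

lemma autocorr_fourier:
  fixes f :: "'a::euclidean_space \<Rightarrow> complex"
  assumes f: "integrable lborel f"
  shows "integrable lborel (autocorr f)"
    and "of_real ((cmod (fourier_int f \<xi>))\<^sup>2) = fourier_int (autocorr f) \<xi>"
proof -
  have [measurable]: "f \<in> borel_measurable borel" using f by auto
  have fin: "(\<integral>\<^sup>+x. ennreal (cmod (f x)) \<partial>lborel) < \<infinity>"
    using f by (simp add: integrable_iff_bounded)
  have int: "integrable (lborel \<Otimes>\<^sub>M lborel) (\<lambda>(y, h). cnj (f y) * f (y + h) * exp (- \<i> * of_real (h \<bullet> \<xi>)))" for \<xi>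
  proof (rule integrable_pair_lborelI)
    have "(\<integral>\<^sup>+x. (\<integral>\<^sup>+y. ennreal (cmod (f x)) * ennreal (cmod (f (y + x))) \<partial>lborel) \<partial>lborel)
        = (\<integral>\<^sup>+x. ennreal (cmod (f x)) * (\<integral>\<^sup>+x. ennreal (cmod (f x)) \<partial>lborel) \<partial>lborel)"
      by (simp add: nn_integral_cmult nn_integral_lborel_shift[where f="\<lambda>x. ennreal (cmod (f x))"])
    also have "\<dots> < \<infinity>"
      using fin by (simp add: nn_integral_multc ennreal_mult_less_top)
    finally show "(\<integral>\<^sup>+ x. \<integral>\<^sup>+ y. ennreal (cmod (case (x, y) of (y, h) \<Rightarrow>
        cnj (f y) * f (y + h) * exp (- \<i> * of_real (h \<bullet> \<xi>)))) \<partial>lborel \<partial>lborel) < \<infinity>"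
      by (simp add: norm_mult ennreal_mult' add.commute)
  qed measurable
  show "integrable lborel (autocorr f)"
    using lborel_pair.integrable_snd[OF int[of 0]] by (simp add: autocorr_def[abs_def])
  have "of_real ((cmod (fourier_int f \<xi>))\<^sup>2) = fourier_int f \<xi> * cnj (fourier_int f \<xi>)"
    by (rule complex_norm_square)
  also have "\<dots> = (LINT y|lborel. cnj (f y * exp (- \<i> * of_real (y \<bullet> \<xi>))) * fourier_int f \<xi>)"
    by (subst integral_mult_left_zero) (simp add: fourier_int_def del: complex_cnj_mult)
  also have "\<dots> = (LINT y|lborel. (LINT h|lborel. cnj (f y) * f (y + h) * exp (- \<i> * of_real (h \<bullet> \<xi>))))"
  proof (rule Bochner_Integration.integral_cong[OF refl])
    fix y
    have e: "cnj (exp (- \<i> * of_real (y \<bullet> \<xi>))) * exp (- \<i> * of_real ((h + y) \<bullet> \<xi>))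
        = exp (- \<i> * of_real (h \<bullet> \<xi>))" for h
      unfolding exp_cnj mult_exp_exp by (simp add: inner_add_left algebra_simps)
    have "fourier_int f \<xi> = (LINT h|lborel. f (h + y) * exp (- \<i> * of_real ((h + y) \<bullet> \<xi>)))"
      unfolding fourier_int_def by (rule integral_lborel_shift[symmetric]) simp
    also have "cnj (f y * exp (- \<i> * of_real (y \<bullet> \<xi>))) * \<dots> =
       (LINT h|lborel. cnj (f y * exp (- \<i> * of_real (y \<bullet> \<xi>))) * (f (h + y) * exp (- \<i> * of_real ((h + y) \<bullet> \<xi>))))"
      by (rule integral_mult_right_zero[symmetric])
    also have "\<dots> = (LINT h|lborel. cnj (f y) * f (y + h) * exp (- \<i> * of_real (h \<bullet> \<xi>)))"
    proof (rule Bochner_Integration.integral_cong[OF refl])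
      fix h
      show "cnj (f y * exp (- \<i> * of_real (y \<bullet> \<xi>))) * (f (h + y) * exp (- \<i> * of_real ((h + y) \<bullet> \<xi>))) =
          cnj (f y) * f (y + h) * exp (- \<i> * of_real (h \<bullet> \<xi>))"
        unfolding e[of h, symmetric] by (simp only: complex_cnj_mult mult_ac add.commute[of y])
    qed
    finally show "cnj (f y * exp (- \<i> * of_real (y \<bullet> \<xi>))) * fourier_int f \<xi> =
      (LINT h|lborel. cnj (f y) * f (y + h) * exp (- \<i> * of_real (h \<bullet> \<xi>)))" .
  qed
  also have "\<dots> = (LINT h|lborel. (LINT y|lborel. cnj (f y) * f (y + h) * exp (- \<i> * of_real (h \<bullet> \<xi>))))"
    by (rule lborel_pair.Fubini_integral[symmetric, OF int])
  also have "\<dots> = fourier_int (autocorr f) \<xi>"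
    by (simp add: fourier_int_def autocorr_def)
  finally show "of_real ((cmod (fourier_int f \<xi>))\<^sup>2) = fourier_int (autocorr f) \<xi>" .
qed

text \<open>Polarisation. It turns the continuity of the autocorrelation at 0 into the continuity of
  translations in L^2.\<close>

lemma Re_autocorr:
  assumes f: "square_integrable f"
  shows "Re (autocorr f h) = enn2real (l2sq f) - enn2real (l2sq (\<lambda>x. f (x + h) - f x)) / 2"
proof -
  have [measurable]: "f \<in> borel_measurable borel" and fin: "l2sq f < \<infinity>"
    using f by (auto simp: square_integrable_iff)
  have i1: "integrable lborel (\<lambda>x. (cmod (f x))\<^sup>2)" using f by (simp add: square_integrable_def)
  have s2: "square_integrable (\<lambda>x. f (x + h))"
    using fin l2sq_shift[of f h] by (simp add: square_integrable_iff)
  have s3: "square_integrable (\<lambda>x. f (x + h) - f x)"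
    using l2sq_diff_le[of "\<lambda>x. f (x + h)" f] fin l2sq_shift[of f h]
    by (auto simp: square_integrable_iff ennreal_mult_less_top intro: le_less_trans)
  have i2: "integrable lborel (\<lambda>x. (cmod (f (x + h)))\<^sup>2)" using s2 by (simp add: square_integrable_def)
  have i3: "integrable lborel (\<lambda>x. (cmod (f (x + h) - f x))\<^sup>2)" using s3 by (simp add: square_integrable_def)
  have e: "Re (cnj a * b) = ((cmod a)\<^sup>2 + (cmod b)\<^sup>2 - (cmod (b - a))\<^sup>2) / 2" for a b
    unfolding cmod_power2 by (simp add: power2_eq_square algebra_simps)
  have "integrable lborel (\<lambda>y. cnj (f y) * f (y + h))"
  proof (rule Bochner_Integration.integrable_bound[of _ "\<lambda>x. (cmod (f x))\<^sup>2 + (cmod (f (x + h)))\<^sup>2"])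
    show "AE x in lborel. cmod (cnj (f x) * f (x + h)) \<le> norm ((cmod (f x))\<^sup>2 + (cmod (f (x + h)))\<^sup>2)"
    proof (intro AE_I2)
      fix x
      have "2 * (cmod (f x) * cmod (f (x + h))) \<le> (cmod (f x))\<^sup>2 + (cmod (f (x + h)))\<^sup>2"
        using sum_squares_bound[of "cmod (f x)" "cmod (f (x + h))"] by (simp only: mult.assoc)
      moreover have "0 \<le> cmod (f x) * cmod (f (x + h))" by simp
      ultimately show "cmod (cnj (f x) * f (x + h)) \<le> norm ((cmod (f x))\<^sup>2 + (cmod (f (x + h)))\<^sup>2)"
        unfolding norm_mult complex_mod_cnj real_norm_def by linarith
    qed
  qed (use i1 i2 in auto)
  then have "Re (autocorr f h) = (LINT y|lborel. Re (cnj (f y) * f (y + h)))"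
    unfolding autocorr_def by (simp del: times_complex.sel)
  also have "\<dots> = ((LINT y|lborel. (cmod (f y))\<^sup>2) + (LINT y|lborel. (cmod (f (y + h)))\<^sup>2)
      - (LINT y|lborel. (cmod (f (y + h) - f y))\<^sup>2)) / 2"
    unfolding e using i1 i2 i3 by simp
  also have "(LINT y|lborel. (cmod (f (y + h)))\<^sup>2) = (LINT y|lborel. (cmod (f y))\<^sup>2)"
    by (rule integral_lborel_shift) simp
  also have "(LINT y|lborel. (cmod (f y))\<^sup>2) = enn2real (l2sq f)"
    by (simp add: l2sq_eq_integral[OF f])
  also have "(LINT y|lborel. (cmod (f (y + h) - f y))\<^sup>2) = enn2real (l2sq (\<lambda>x. f (x + h) - f x))"
    by (simp add: l2sq_eq_integral[OF s3])
  finally show ?thesis by simp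
qed

text \<open>With a Gaussian weight on the frequency side Fubini is available, and it turns the
  weighted integral of the squared transform into a Gaussian average of the autocorrelation near 0.
  As \<sigma> -> 0 this average tends to the value at 0, whereas the weight never exceeds 1; so the
  limit is bounded by the full norm of the transform, finite or not.\<close>

theorem plancherel_le:
  fixes f :: "'a::euclidean_space \<Rightarrow> complex"
  assumes f: "square_integrable f" and fi: "integrable lborel f"
  shows "ennreal ((2 * pi) ^ DIM('a)) * l2sq f \<le> l2sq (fourier_int f)"
proof -
  have [measurable]: "f \<in> borel_measurable borel" and fin: "l2sq f < \<infinity>"
    using f by (auto simp: square_integrable_iff)
  define A where "A = autocorr f"
  have Ai: "integrable lborel A" unfolding A_def by (rule autocorr_fourier[OF fi])
  then have [measurable]: "A \<in> borel_measurable borel" by auto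
  define N where "N = enn2real (l2sq f)"
  define D where "D = (\<lambda>h. enn2real (l2sq (\<lambda>x. f (x + h) - f x)))"
  have ReA: "Re (A h) = N - D h / 2" for h
    unfolding A_def N_def D_def by (rule Re_autocorr[OF f])
  have D_le: "D h \<le> 4 * N" for h
  proof -
    have "l2sq (\<lambda>x. f (x + h) - f x) \<le> 2 * l2sq f + 2 * l2sq f"
      using l2sq_diff_le[of "\<lambda>x. f (x + h)" f] l2sq_shift[of f h] by simp
    also have "\<dots> = ennreal (4 * N)"
      using fin by (cases "l2sq f") (auto simp: N_def ennreal_numeral[symmetric] ennreal_mult'[symmetric]
            ennreal_plus[symmetric] simp del: ennreal_numeral ennreal_plus)
    finally show ?thesis unfolding D_def
      by (metis N_def enn2real_leI enn2real_nonneg mult_nonneg_nonneg zero_le_numeral)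
  qed
  have D_nonneg: "D h \<ge> 0" for h by (simp add: D_def)
  have N_nonneg: "N \<ge> 0" by (simp add: N_def)
  \<comment> \<open>One factor \<open>sqrt (2 * pi)\<close> per coordinate from the transform of the
    Gaussian. The integral of \<open>gauss 1\<close> later supplies the same factor once more, which
    makes up (2 \<pi>)^d.\<close>
  define c where "c = sqrt (2 * pi) ^ DIM('a)"
  have J: "ennreal (LINT z|lborel. c * gauss 1 z * Re (A (\<sigma> *\<^sub>R z))) \<le> l2sq (fourier_int f)" if \<sigma>: "\<sigma> > 0" for \<sigma>
  proof -
    have int: "integrable (lborel \<Otimes>\<^sub>M lborel) (\<lambda>(\<xi>, h). A h * exp (- \<i> * of_real (h \<bullet> \<xi>)) * of_real (gauss \<sigma> \<xi>))"
    proof (rule integrable_pair_lborelI)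
      have a: "(\<integral>\<^sup>+x. ennreal (cmod (A x)) \<partial>lborel) < \<infinity>"
        using Ai by (simp add: integrable_iff_bounded)
      have g: "(\<integral>\<^sup>+x. ennreal (gauss \<sigma> x) \<partial>(lborel::'a measure)) < \<infinity>"
        using integrable_gauss[OF \<sigma>] by (simp add: integrable_iff_bounded)
      have "(\<integral>\<^sup>+ x. \<integral>\<^sup>+ y. ennreal (cmod (A y)) * ennreal (gauss \<sigma> x) \<partial>lborel \<partial>(lborel::'a measure)) =
         (\<integral>\<^sup>+x. ennreal (cmod (A x)) \<partial>lborel) * (\<integral>\<^sup>+x. ennreal (gauss \<sigma> x) \<partial>(lborel::'a measure))"
        by (simp add: nn_integral_cmult nn_integral_multc)
      then show "(\<integral>\<^sup>+ x. \<integral>\<^sup>+ y. ennreal (cmod (case (x, y) of (\<xi>, h) \<Rightarrow>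
          A h * exp (- \<i> * of_real (h \<bullet> \<xi>)) * of_real (gauss \<sigma> \<xi>))) \<partial>lborel \<partial>lborel) < \<infinity>"
        using a g by (simp add: norm_mult ennreal_mult' ennreal_mult_less_top)
    qed measurable
    have "(LINT \<xi>|lborel. complex_of_real ((cmod (fourier_int f \<xi>))\<^sup>2 * gauss \<sigma> \<xi>)) =
        (LINT \<xi>|lborel. (LINT h|lborel. A h * exp (- \<i> * of_real (h \<bullet> \<xi>)) * of_real (gauss \<sigma> \<xi>)))"
      using autocorr_fourier(2)[OF fi] by (simp add: fourier_int_def A_def)
    also have "\<dots> = (LINT h|lborel. (LINT \<xi>|lborel. A h * exp (- \<i> * of_real (h \<bullet> \<xi>)) * of_real (gauss \<sigma> \<xi>)))"
      by (rule lborel_pair.Fubini_integral[symmetric, OF int])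
    also have "\<dots> = (LINT h|lborel. A h * of_real ((sqrt (2 * pi) / \<sigma>) ^ DIM('a) * gauss (1 / \<sigma>) h))"
      unfolding mult.assoc integral_mult_right_zero fourier_gauss[OF \<sigma>] ..
    also have "\<dots> = \<bar>\<sigma>\<bar> ^ DIM('a) *\<^sub>R (LINT z|lborel. A (0 + \<sigma> *\<^sub>R z) *
        of_real ((sqrt (2 * pi) / \<sigma>) ^ DIM('a) * gauss (1 / \<sigma>) (0 + \<sigma> *\<^sub>R z)))"
      using \<sigma> by (intro integral_lborel_scale) auto
    also have "\<dots> = (LINT z|lborel. \<sigma> ^ DIM('a) *\<^sub>R (A (\<sigma> *\<^sub>R z) *
        of_real ((sqrt (2 * pi) / \<sigma>) ^ DIM('a) * gauss (1 / \<sigma>) (\<sigma> *\<^sub>R z))))"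
      using \<sigma> by simp
    also have "\<dots> = (LINT z|lborel. of_real (c * gauss 1 z) * A (\<sigma> *\<^sub>R z))"
      using \<sigma> by (intro Bochner_Integration.integral_cong refl)
        (simp add: c_def gauss_def scaleR_conv_of_real power_divide)
    finally have eq: "(LINT \<xi>|lborel. complex_of_real ((cmod (fourier_int f \<xi>))\<^sup>2 * gauss \<sigma> \<xi>)) =
      (LINT z|lborel. of_real (c * gauss 1 z) * A (\<sigma> *\<^sub>R z))" .
    have "integrable lborel (\<lambda>z. of_real (c * gauss 1 z) * A (\<sigma> *\<^sub>R z))"
    proof (rule Bochner_Integration.integrable_bound[of _ "\<lambda>z. c * A (\<sigma> *\<^sub>R z)"])
      have "integrable lborel (\<lambda>z. A (\<sigma> *\<^sub>R z))"
      proof (rule integrableI_bounded)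
        have "(\<integral>\<^sup>+ x. ennreal (cmod (A x)) \<partial>lborel) =
            ennreal (\<bar>\<sigma>\<bar> ^ DIM('a)) * (\<integral>\<^sup>+ x. ennreal (cmod (A (0 + \<sigma> *\<^sub>R x))) \<partial>lborel)"
          using \<sigma> by (intro nn_integral_lborel_scale) auto
        moreover have "(\<integral>\<^sup>+ x. ennreal (cmod (A x)) \<partial>lborel) < \<infinity>"
          using Ai by (simp add: integrable_iff_bounded)
        ultimately show "(\<integral>\<^sup>+ x. ennreal (cmod (A (\<sigma> *\<^sub>R x))) \<partial>lborel) < \<infinity>"
          using \<sigma> by (auto simp: ennreal_mult_less_top)
      qed simp
      then show "integrable lborel (\<lambda>z. c * A (\<sigma> *\<^sub>R z))" by simp
      show "AE z in lborel. cmod (of_real (c * gauss 1 z) * A (\<sigma> *\<^sub>R z)) \<le> norm (c * A (\<sigma> *\<^sub>R z))"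
        by (intro AE_I2) (auto simp: norm_mult abs_mult gauss_le_1 intro!: mult_right_mono mult_left_le)
    qed simp
    then have "Re (LINT z|lborel. of_real (c * gauss 1 z) * A (\<sigma> *\<^sub>R z)) =
        (LINT z|lborel. Re (of_real (c * gauss 1 z) * A (\<sigma> *\<^sub>R z)))"
      by (simp del: times_complex.sel)
    also have "\<dots> = (LINT z|lborel. c * gauss 1 z * Re (A (\<sigma> *\<^sub>R z)))"
      by simp
    finally have eq2: "(LINT z|lborel. c * gauss 1 z * Re (A (\<sigma> *\<^sub>R z))) =
        (LINT \<xi>|lborel. (cmod (fourier_int f \<xi>))\<^sup>2 * gauss \<sigma> \<xi>)"
      unfolding eq[symmetric] integral_complex_of_real by simp
    show ?thesis
    proof (cases "integrable lborel (\<lambda>\<xi>. (cmod (fourier_int f \<xi>))\<^sup>2 * gauss \<sigma> \<xi>)")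
      case True
      then have "ennreal (LINT \<xi>|lborel. (cmod (fourier_int f \<xi>))\<^sup>2 * gauss \<sigma> \<xi>) =
          (\<integral>\<^sup>+\<xi>. ennreal ((cmod (fourier_int f \<xi>))\<^sup>2 * gauss \<sigma> \<xi>) \<partial>lborel)"
        by (subst nn_integral_eq_integral) auto
      also have "\<dots> \<le> l2sq (fourier_int f)"
        unfolding l2sq_def by (intro nn_integral_mono ennreal_leI) (simp add: gauss_le_1 mult_left_le)
      finally show ?thesis unfolding eq2 .
    next
      \<comment> \<open>A function that is not integrable has Bochner integral 0, so the left-hand
        side is 0.\<close>
      case False
      then show ?thesis unfolding eq2 by (simp add: not_integrable_integral_eq)
    qed
  qed
  have "(\<lambda>n. LINT z|lborel. c * gauss 1 z * Re (A ((1 / real (Suc n)) *\<^sub>R z))) \<longlonglongrightarrow>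
      (LINT z|(lborel::'a measure). c * gauss 1 z * N)"
  proof (rule integral_dominated_convergence[where w="\<lambda>z. c * gauss 1 z * (3 * N)"])
    show "integrable lborel (\<lambda>z::'a. c * gauss 1 z * (3 * N))"
      by (intro integrable_mult_left integrable_mult_right integrable_gauss) simp
    show "AE z in lborel. norm (c * gauss 1 z * Re (A ((1 / real (Suc n)) *\<^sub>R z))) \<le> c * gauss 1 z * (3 * N)" for n
    proof (intro AE_I2)
      fix z :: 'a
      have cg: "c * gauss 1 z \<ge> 0" by (simp add: c_def)
      have "\<bar>Re (A ((1 / real (Suc n)) *\<^sub>R z))\<bar> \<le> 3 * N"
        unfolding ReA using D_le[of "(1 / real (Suc n)) *\<^sub>R z"] D_nonneg[of "(1 / real (Suc n)) *\<^sub>R z"] N_nonneg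
        by linarith
      then show "norm (c * gauss 1 z * Re (A ((1 / real (Suc n)) *\<^sub>R z))) \<le> c * gauss 1 z * (3 * N)"
        unfolding real_norm_def abs_mult[of "c * gauss 1 z"] abs_of_nonneg[OF cg] by (rule mult_left_mono[OF _ cg])
    qed
    show "AE z in lborel. (\<lambda>n. c * gauss 1 z * Re (A ((1 / real (Suc n)) *\<^sub>R z))) \<longlonglongrightarrow> c * gauss 1 z * N"
    proof (intro AE_I2)
      fix z :: 'a
      have "(\<lambda>n. (1 / real (Suc n)) *\<^sub>R z) \<longlonglongrightarrow> 0 *\<^sub>R z"
        by (intro tendsto_intros LIMSEQ_Suc[OF lim_1_over_n])
      then have "(\<lambda>n. l2sq (\<lambda>x. f (x + (1 / real (Suc n)) *\<^sub>R z) - f x)) \<longlonglongrightarrow> 0"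
        by (intro l2_translation_continuous[OF f]) simp
      then have "(\<lambda>n. D ((1 / real (Suc n)) *\<^sub>R z)) \<longlonglongrightarrow> enn2real 0"
        unfolding D_def by (intro tendsto_enn2real) (auto simp: ennreal_0[symmetric] simp del: ennreal_0)
      then have "(\<lambda>n. c * gauss 1 z * (N - D ((1 / real (Suc n)) *\<^sub>R z) / 2)) \<longlonglongrightarrow> c * gauss 1 z * (N - 0 / 2)"
        by (intro tendsto_intros) simp_all
      then show "(\<lambda>n. c * gauss 1 z * Re (A ((1 / real (Suc n)) *\<^sub>R z))) \<longlonglongrightarrow> c * gauss 1 z * N"
        by (simp add: ReA)
    qed
  qed measurable
  moreover have "(LINT z|(lborel::'a measure). c * gauss 1 z * N) = (2 * pi) ^ DIM('a) * N"
  proof -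
    have "(LINT z|(lborel::'a measure). c * gauss 1 z * N) = c * (LINT z|(lborel::'a measure). gauss 1 z) * N"
      by simp
    also have "(LINT z|(lborel::'a measure). gauss 1 z) = c"
      using integral_gauss[of 1, where 'a='a] by (simp add: c_def)
    also have "c * c = (2 * pi) ^ DIM('a)"
      unfolding c_def power_mult_distrib[symmetric] by simp
    finally show ?thesis .
  qed
  ultimately have "(\<lambda>n. LINT z|lborel. c * gauss 1 z * Re (A ((1 / real (Suc n)) *\<^sub>R z))) \<longlonglongrightarrow> (2 * pi) ^ DIM('a) * N"
    by (simp only:)
  then have "(\<lambda>n. ennreal (LINT z|lborel. c * gauss 1 z * Re (A ((1 / real (Suc n)) *\<^sub>R z)))) \<longlonglongrightarrow> ennreal ((2 * pi) ^ DIM('a) * N)"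
    by (rule tendsto_ennrealI)
  then have "ennreal ((2 * pi) ^ DIM('a) * N) \<le> l2sq (fourier_int f)"
    by (rule LIMSEQ_le_const2) (auto intro!: J)
  then show ?thesis
    using fin by (simp add: ennreal_mult' N_def)
qed

section \<open>Sobolev functions and moduli of continuity\<close>

definition cutoff :: "real \<Rightarrow> ('a::euclidean_space \<Rightarrow> complex) \<Rightarrow> 'a \<Rightarrow> complex" where
  "cutoff R f x = indicator (cball 0 R) x *\<^sub>R f x"

lemma cutoff_measurable [measurable]:
  fixes f :: "'a::euclidean_space \<Rightarrow> complex"
  assumes [measurable]: "f \<in> borel_measurable borel"
  shows "cutoff R f \<in> borel_measurable borel"
proof -
  have [measurable]: "cball (0::'a) R \<in> sets borel" by simp
  show ?thesis unfolding cutoff_def[abs_def] by measurable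
qed

lemma square_integrable_cutoff:
  assumes "square_integrable f"
  shows "square_integrable (cutoff R f)"
proof -
  have [measurable]: "f \<in> borel_measurable borel" and fin: "l2sq f < \<infinity>"
    using assms by (auto simp: square_integrable_iff)
  have "l2sq (cutoff R f) \<le> l2sq f"
    by (rule l2sq_mono) (auto simp: cutoff_def indicator_def)
  then show ?thesis using fin by (auto simp: square_integrable_iff intro: le_less_trans)
qed

lemma nn_integral_ball_le_l2sq:
  fixes f :: "'a::euclidean_space \<Rightarrow> complex"
  assumes [measurable]: "f \<in> borel_measurable borel"
  shows "(\<integral>\<^sup>+x. ennreal (cmod (f x)) * indicator (cball 0 R) x \<partial>lborel) \<le> l2sq f + emeasure lborel (cball (0::'a) R)"
proof -
  have "(\<integral>\<^sup>+x. ennreal (cmod (f x)) * indicator (cball 0 R) x \<partial>lborel)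
     \<le> (\<integral>\<^sup>+x. ennreal ((cmod (f x))\<^sup>2) + indicator (cball 0 R) x \<partial>lborel)"
  proof (intro nn_integral_mono)
    fix x
    have "cmod (f x) \<le> (cmod (f x))\<^sup>2 + 1"
      using sum_squares_bound[of "cmod (f x)" 1] norm_ge_zero[of "f x"] by (simp, linarith)
    then have "ennreal (cmod (f x)) \<le> ennreal ((cmod (f x))\<^sup>2 + 1)"
      by (rule ennreal_leI)
    then show "ennreal (cmod (f x)) * indicator (cball 0 R) x \<le> ennreal ((cmod (f x))\<^sup>2) + indicator (cball 0 R) x"
      by (auto simp: indicator_def)
  qed
  also have "\<dots> = l2sq f + emeasure lborel (cball (0::'a) R)"
    unfolding l2sq_def by (subst nn_integral_add) (auto intro!: borel_measurable_indicator)
  finally show ?thesis .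
qed

lemma integrable_cutoff:
  fixes f :: "'a::euclidean_space \<Rightarrow> complex"
  assumes "square_integrable f"
  shows "integrable lborel (cutoff R f)"
proof (rule integrableI_bounded)
  have [measurable]: "f \<in> borel_measurable borel" and fin: "l2sq f < \<infinity>"
    using assms by (auto simp: square_integrable_iff)
  show "cutoff R f \<in> borel_measurable lborel" by measurable
  have "(\<integral>\<^sup>+x. ennreal (cmod (cutoff R f x)) \<partial>lborel) =
      (\<integral>\<^sup>+x. ennreal (cmod (f x)) * indicator (cball 0 R) x \<partial>lborel)"
    by (intro nn_integral_cong) (auto simp: cutoff_def indicator_def)
  also have "\<dots> \<le> l2sq f + emeasure lborel (cball (0::'a) R)"
    by (rule nn_integral_ball_le_l2sq) measurable
  also have "\<dots> < \<infinity>"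
    using fin emeasure_lborel_cball_finite[of "0::'a" R] by (simp add: less_top)
  finally show "(\<integral>\<^sup>+x. ennreal (cmod (cutoff R f x)) \<partial>lborel) < \<infinity>" .
qed

abbreviation fourier_const :: "'a::euclidean_space itself \<Rightarrow> real" where
  "fourier_const _ \<equiv> (2 * pi) powr (- real DIM('a) / 2)"

lemma truncated_fourier_eq:
  fixes f :: "'a::euclidean_space \<Rightarrow> complex"
  shows "truncated_fourier R f = (\<lambda>\<xi>. of_real (fourier_const TYPE('a)) * fourier_int (cutoff R f) \<xi>)"
  unfolding truncated_fourier_def fourier_int_def cutoff_def set_lebesgue_integral_def by simp

lemma truncated_fourier_measurable [measurable]:
  assumes [measurable]: "f \<in> borel_measurable borel"
  shows "truncated_fourier R f \<in> borel_measurable borel"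
  unfolding truncated_fourier_eq by measurable

lemma plancherel_unitary_le:
  fixes f :: "'a::euclidean_space \<Rightarrow> complex"
  assumes "square_integrable f" "integrable lborel f"
  shows "l2sq f \<le> l2sq (\<lambda>\<xi>. of_real (fourier_const TYPE('a)) * fourier_int f \<xi>)"
proof -
  have [measurable]: "f \<in> borel_measurable borel" using assms by auto
  have c: "(fourier_const TYPE('a))\<^sup>2 * (2 * pi) ^ DIM('a) = 1"
  proof -
    define p where "p = 2 * pi"
    have "p > 0" by (simp add: p_def)
    have "(p powr (- real DIM('a) / 2))\<^sup>2 = p powr (- real DIM('a))"
      unfolding power2_eq_square powr_add[symmetric] by simp
    moreover have "p powr (- real DIM('a)) * p ^ DIM('a) = 1"
      using \<open>p > 0\<close> by (simp add: powr_minus powr_realpow)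
    ultimately show ?thesis unfolding p_def by (simp only:)
  qed
  have "l2sq f = ennreal ((fourier_const TYPE('a))\<^sup>2 * (2 * pi) ^ DIM('a)) * l2sq f"
    unfolding c by simp
  also have "\<dots> = ennreal ((fourier_const TYPE('a))\<^sup>2) * (ennreal ((2 * pi) ^ DIM('a)) * l2sq f)"
    by (subst ennreal_mult) (auto simp: mult.assoc)
  also have "\<dots> \<le> ennreal ((fourier_const TYPE('a))\<^sup>2) * l2sq (fourier_int f)"
    by (intro mult_left_mono plancherel_le assms) auto
  also have "\<dots> = l2sq (\<lambda>\<xi>. of_real (fourier_const TYPE('a)) * fourier_int f \<xi>)"
    by (subst l2sq_cmult) auto
  finally show ?thesis .
qed

lemma is_fourier_transformD:
  assumes "is_fourier_transform f g"
  shows "square_integrable f" "square_integrable g"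
    and "(\<lambda>n. l2sq (\<lambda>\<xi>. truncated_fourier (real n) f \<xi> - g \<xi>)) \<longlonglongrightarrow> 0"
  using assms unfolding is_fourier_transform_def l2sq_def by auto

lemma fourier_int_shift_diff:
  fixes f :: "'a::euclidean_space \<Rightarrow> complex"
  assumes f: "integrable lborel f"
  shows "fourier_int (\<lambda>x. f (x + h) - a * f x) \<xi> = (exp (\<i> * of_real (h \<bullet> \<xi>)) - a) * fourier_int f \<xi>"
proof -
  have [measurable]: "f \<in> borel_measurable borel" using f by auto
  have e: "f (x + h) * exp (- \<i> * of_real (x \<bullet> \<xi>)) =
      exp (\<i> * of_real (h \<bullet> \<xi>)) * (f (x + h) * exp (- \<i> * of_real ((x + h) \<bullet> \<xi>)))" for x
  proof -
    have "exp (\<i> * of_real (h \<bullet> \<xi>)) * exp (- \<i> * of_real ((x + h) \<bullet> \<xi>)) = exp (- \<i> * of_real (x \<bullet> \<xi>))"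
      unfolding mult_exp_exp by (simp add: inner_add_left algebra_simps)
    then show ?thesis by (simp add: mult.left_commute)
  qed
  have i0: "integrable lborel (\<lambda>x. f x * exp (- \<i> * of_real (x \<bullet> \<xi>)))"
    by (rule integrable_mult_cis[OF f])
  have "integrable lborel (\<lambda>x. f (x + h) * exp (- \<i> * of_real ((x + h) \<bullet> \<xi>)))"
  proof (rule integrableI_bounded)
    have "(\<integral>\<^sup>+ x. ennreal (cmod (f (x + h) * exp (- \<i> * of_real ((x + h) \<bullet> \<xi>)))) \<partial>lborel) =
       (\<integral>\<^sup>+ x. ennreal (cmod (f x * exp (- \<i> * of_real (x \<bullet> \<xi>)))) \<partial>lborel)"
      by (rule nn_integral_lborel_shift[where f="\<lambda>x. ennreal (cmod (f x * exp (- \<i> * of_real (x \<bullet> \<xi>))))"]) measurable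
    then show "(\<integral>\<^sup>+ x. ennreal (cmod (f (x + h) * exp (- \<i> * of_real ((x + h) \<bullet> \<xi>)))) \<partial>lborel) < \<infinity>"
      using i0 by (simp add: integrable_iff_bounded)
  qed measurable
  then have i1: "integrable lborel (\<lambda>x. f (x + h) * exp (- \<i> * of_real (x \<bullet> \<xi>)))"
    unfolding e by (rule integrable_mult_right)
  have "fourier_int (\<lambda>x. f (x + h) - a * f x) \<xi> =
      (LINT x|lborel. f (x + h) * exp (- \<i> * of_real (x \<bullet> \<xi>)) - a * (f x * exp (- \<i> * of_real (x \<bullet> \<xi>))))"
    unfolding fourier_int_def by (simp add: algebra_simps)
  also have "\<dots> = (LINT x|lborel. f (x + h) * exp (- \<i> * of_real (x \<bullet> \<xi>))) - a * fourier_int f \<xi>"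
    unfolding fourier_int_def using i0 i1
    by (subst Bochner_Integration.integral_diff) (auto simp only: integrable_mult_right integral_mult_right_zero)
  also have "(LINT x|lborel. f (x + h) * exp (- \<i> * of_real (x \<bullet> \<xi>))) =
      exp (\<i> * of_real (h \<bullet> \<xi>)) * (LINT x|lborel. f (x + h) * exp (- \<i> * of_real ((x + h) \<bullet> \<xi>)))"
    unfolding e by (rule integral_mult_right_zero)
  also have "(LINT x|lborel. f (x + h) * exp (- \<i> * of_real ((x + h) \<bullet> \<xi>))) = fourier_int f \<xi>"
    unfolding fourier_int_def by (rule integral_lborel_shift[where f="\<lambda>x. f x * exp (- \<i> * of_real (x \<bullet> \<xi>))"]) measurable
  finally show ?thesis by (simp add: algebra_simps)
qed

text \<open>Lower semicontinuity of the norm, for approximants whose norms are bounded only up to an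
  error that vanishes. It serves the passage from truncated to full transforms and again the final
  limit of the uniqueness argument.\<close>

lemma l2sq_Fatou:
  fixes F :: "nat \<Rightarrow> 'a::euclidean_space \<Rightarrow> complex"
  assumes [measurable]: "\<And>n. F n \<in> borel_measurable borel"
    and lim: "\<And>x. (\<lambda>n. F n x) \<longlonglongrightarrow> f x"
    and bound: "\<And>n. l2sq (F n) \<le> B + C * e n" and e: "e \<longlonglongrightarrow> 0" and C: "C < \<infinity>"
  shows "l2sq f \<le> B"
proof -
  have "l2sq f = (\<integral>\<^sup>+x. liminf (\<lambda>n. ennreal ((cmod (F n x))\<^sup>2)) \<partial>lborel)"
    unfolding l2sq_def
  proof (intro nn_integral_cong)
    fix x
    have "(\<lambda>n. ennreal ((cmod (F n x))\<^sup>2)) \<longlonglongrightarrow> ennreal ((cmod (f x))\<^sup>2)"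
      by (intro tendsto_ennrealI tendsto_intros lim)
    then show "ennreal ((cmod (f x))\<^sup>2) = liminf (\<lambda>n. ennreal ((cmod (F n x))\<^sup>2))"
      by (intro lim_imp_Liminf[symmetric]) auto
  qed
  also have "\<dots> \<le> liminf (\<lambda>n. l2sq (F n))"
    unfolding l2sq_def by (rule nn_integral_liminf) measurable
  also have "\<dots> \<le> liminf (\<lambda>n. B + C * e n)"
    by (intro Liminf_mono always_eventually allI bound)
  also have "\<dots> = B + C * 0"
    using C e by (intro lim_imp_Liminf tendsto_add ennreal_tendsto_cmult tendsto_const) (auto simp: less_top)
  finally show ?thesis by simp
qed

text \<open>Translation by \<open>h\<close> becomes multiplication by a phase; the truncations of
  \<open>f\<close> converge pointwise and their transforms in L^2. The parameter \<open>a\<close>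
  lets one argument give two bounds: a = 1 is the translation difference, and a = 0 with h = 0 is
  the norm of \<open>f\<close> itself. The factor 2 arises when the truncation error is split off
  with \<open>l2sq_add_le\<close>.\<close>

lemma l2sq_shift_diff_le_fourier:
  fixes f :: "'a::euclidean_space \<Rightarrow> complex"
  assumes fg: "is_fourier_transform f g" and a: "cmod a \<le> 1"
  shows "l2sq (\<lambda>x. f (x + h) - a * f x) \<le> 2 * l2sq (\<lambda>\<xi>. (exp (\<i> * of_real (h \<bullet> \<xi>)) - a) * g \<xi>)"
proof -
  note D = is_fourier_transformD[OF fg]
  have [measurable]: "f \<in> borel_measurable borel" "g \<in> borel_measurable borel"
    using D by (auto simp: square_integrable_iff)
  define m where "m = (\<lambda>\<xi>. exp (\<i> * of_real (h \<bullet> \<xi>)) - a)"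
  have [measurable]: "m \<in> borel_measurable borel" unfolding m_def by measurable
  have m_le: "cmod (m \<xi>) \<le> 2" for \<xi>
    unfolding m_def using norm_triangle_ineq4[of "exp (\<i> * of_real (h \<bullet> \<xi>))" a] a
    by simp
  define F where "F = (\<lambda>n::nat. \<lambda>x. cutoff (real n) f (x + h) - a * cutoff (real n) f x)"
  have [measurable]: "F n \<in> borel_measurable borel" for n unfolding F_def by measurable
  define e where "e = (\<lambda>n::nat. l2sq (\<lambda>\<xi>. truncated_fourier (real n) f \<xi> - g \<xi>))"
  have "l2sq (\<lambda>x. f (x + h) - a * f x) \<le> 2 * l2sq (\<lambda>\<xi>. m \<xi> * g \<xi>)"
  \<comment> \<open>8 is the factor 2 of \<open>l2sq_add_le\<close> times the square of the bound 2
    for the multiplier.\<close>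
  proof (rule l2sq_Fatou[where F=F and C=8 and e=e])
    show "e \<longlonglongrightarrow> 0" using D(3) by (simp add: e_def)
    show "(\<lambda>n. F n x) \<longlonglongrightarrow> f (x + h) - a * f x" for x
    proof (rule tendsto_eventually)
      obtain n0 where n0: "max (norm x) (norm (x + h)) \<le> real n0"
        using real_arch_simple by blast
      show "\<forall>\<^sub>F n in sequentially. F n x = f (x + h) - a * f x"
        using eventually_ge_at_top[of n0]
      proof eventually_elim
        fix n assume "n0 \<le> n"
        then have "norm x \<le> real n" "norm (x + h) \<le> real n"
          using n0 by (auto intro: order_trans[of _ "real n0"])
        then show "F n x = f (x + h) - a * f x"
          by (simp add: F_def cutoff_def)
      qed
    qed
    fix n
    define c where "c = cutoff (real n) f"
    have [measurable]: "c \<in> borel_measurable borel" unfolding c_def by measurable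
    have ci: "integrable lborel c" and cs: "square_integrable c"
      unfolding c_def by (auto intro: integrable_cutoff square_integrable_cutoff D)
    have "integrable lborel (F n)"
    proof -
      have "integrable lborel (\<lambda>x. c (x + h))"
      proof (rule integrableI_bounded)
        have "(\<integral>\<^sup>+ x. ennreal (cmod (c (x + h))) \<partial>lborel) = (\<integral>\<^sup>+ x. ennreal (cmod (c x)) \<partial>lborel)"
          by (rule nn_integral_lborel_shift[where f="\<lambda>x. ennreal (cmod (c x))"]) measurable
        then show "(\<integral>\<^sup>+ x. ennreal (cmod (c (x + h))) \<partial>lborel) < \<infinity>"
          using ci by (simp add: integrable_iff_bounded)
      qed measurable
      then show ?thesis unfolding F_def c_def[symmetric] using ci by auto
    qed
    moreover have "square_integrable (F n)"
    proof -
      have "l2sq (F n) \<le> 2 * l2sq (\<lambda>x. c (x + h)) + 2 * l2sq (\<lambda>x. a * c x)"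
        unfolding F_def c_def[symmetric] by (rule l2sq_diff_le) measurable
      also have "\<dots> = 2 * l2sq c + 2 * (ennreal ((cmod a)\<^sup>2) * l2sq c)"
        by (simp add: l2sq_cmult l2sq_shift)
      also have "\<dots> < \<infinity>"
        using cs by (simp add: square_integrable_iff ennreal_mult_less_top)
      finally show ?thesis by (simp add: square_integrable_iff)
    qed
    ultimately have "l2sq (F n) \<le> l2sq (\<lambda>\<xi>. of_real (fourier_const TYPE('a)) * fourier_int (F n) \<xi>)"
      by (intro plancherel_unitary_le)
    also have "(\<lambda>\<xi>. of_real (fourier_const TYPE('a)) * fourier_int (F n) \<xi>) =
        (\<lambda>\<xi>. m \<xi> * g \<xi> + m \<xi> * (truncated_fourier (real n) f \<xi> - g \<xi>))"
      unfolding F_def c_def[symmetric] fourier_int_shift_diff[OF ci] truncated_fourier_eq m_def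
      by (simp add: algebra_simps)
    also have "l2sq \<dots> \<le> 2 * l2sq (\<lambda>\<xi>. m \<xi> * g \<xi>) + 2 * l2sq (\<lambda>\<xi>. m \<xi> * (truncated_fourier (real n) f \<xi> - g \<xi>))"
      by (rule l2sq_add_le) measurable
    also have "l2sq (\<lambda>\<xi>. m \<xi> * (truncated_fourier (real n) f \<xi> - g \<xi>))
        \<le> l2sq (\<lambda>\<xi>. 2 * (truncated_fourier (real n) f \<xi> - g \<xi>))"
      by (rule l2sq_mono) (unfold norm_mult, auto intro!: mult_right_mono m_le)
    also have "\<dots> = 4 * e n"
      by (subst l2sq_cmult) (auto simp: e_def)
    finally show "l2sq (F n) \<le> 2 * l2sq (\<lambda>\<xi>. m \<xi> * g \<xi>) + 8 * e n"
      by (simp add: mult_left_mono mult.assoc[symmetric])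
  qed (auto simp: less_top[symmetric])
  then show ?thesis by (simp add: m_def)
qed

lemma l2sq_le_fourier:
  assumes fg: "is_fourier_transform f g"
  shows "l2sq f \<le> 2 * l2sq g"
  using l2sq_shift_diff_le_fourier[OF fg, of 0 0] by simp

text \<open>Both candidates are limits of the same truncated transforms. This matters because
  \<open>sobolev_norm\<close> selects its transform by \<open>SOME\<close>, while membership in
  \<open>sobolev_space\<close> speaks of a transform that may be another representative.\<close>

lemma fourier_transform_unique:
  assumes "is_fourier_transform f g" "is_fourier_transform f g'"
  shows "AE \<xi> in lborel. g \<xi> = g' \<xi>"
proof -
  note D = is_fourier_transformD[OF assms(1)] and D' = is_fourier_transformD[OF assms(2)]
  have [measurable]: "f \<in> borel_measurable borel" "g \<in> borel_measurable borel" "g' \<in> borel_measurable borel"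
    using D D' by (auto simp: square_integrable_iff)
  have "l2sq (\<lambda>\<xi>. g' \<xi> - g \<xi>) \<le> 2 * l2sq (\<lambda>\<xi>. truncated_fourier (real n) f \<xi> - g \<xi>)
      + 2 * l2sq (\<lambda>\<xi>. truncated_fourier (real n) f \<xi> - g' \<xi>)" for n
    using l2sq_diff_le[of "\<lambda>\<xi>. truncated_fourier (real n) f \<xi> - g \<xi>" "\<lambda>\<xi>. truncated_fourier (real n) f \<xi> - g' \<xi>"]
    by simp
  moreover have "(\<lambda>n. 2 * l2sq (\<lambda>\<xi>. truncated_fourier (real n) f \<xi> - g \<xi>)
      + 2 * l2sq (\<lambda>\<xi>. truncated_fourier (real n) f \<xi> - g' \<xi>)) \<longlonglongrightarrow> 2 * 0 + 2 * 0"
    by (intro tendsto_add ennreal_tendsto_cmult D D') auto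
  ultimately have "l2sq (\<lambda>\<xi>. g' \<xi> - g \<xi>) \<le> 0"
    by (intro LIMSEQ_le_const[where a="l2sq (\<lambda>\<xi>. g' \<xi> - g \<xi>)"]) auto
  then have "l2sq (\<lambda>\<xi>. g' \<xi> - g \<xi>) = 0" by simp
  then have "AE \<xi> in lborel. g' \<xi> - g \<xi> = 0"
    by (subst (asm) l2sq_eq_0_iff) auto
  then show ?thesis by auto
qed

lemma fourier_transform_diff:
  fixes f :: "'a::euclidean_space \<Rightarrow> complex"
  assumes "is_fourier_transform f g" "is_fourier_transform f' g'"
  shows "is_fourier_transform (\<lambda>x. f x - f' x) (\<lambda>\<xi>. g \<xi> - g' \<xi>)"
proof -
  note D = is_fourier_transformD[OF assms(1)] and D' = is_fourier_transformD[OF assms(2)]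
  have [measurable]: "f \<in> borel_measurable borel" "g \<in> borel_measurable borel"
     "f' \<in> borel_measurable borel" "g' \<in> borel_measurable borel"
    using D D' by (auto simp: square_integrable_iff)
  have sq: "square_integrable (\<lambda>x. p x - q x)" if "square_integrable p" "square_integrable q"
    for p q :: "'a \<Rightarrow> complex"
    using that l2sq_diff_le[of p q]
    by (auto simp: square_integrable_iff ennreal_mult_less_top intro: le_less_trans)
  have tf: "truncated_fourier R (\<lambda>x. f x - f' x) \<xi> = truncated_fourier R f \<xi> - truncated_fourier R f' \<xi>" for R \<xi>
  proof -
    have "fourier_int (cutoff R (\<lambda>x. f x - f' x)) \<xi> =
        (LINT x|lborel. cutoff R f x * exp (- \<i> * of_real (x \<bullet> \<xi>)) - cutoff R f' x * exp (- \<i> * of_real (x \<bullet> \<xi>)))"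
      unfolding fourier_int_def by (simp add: cutoff_def algebra_simps)
    also have "\<dots> = fourier_int (cutoff R f) \<xi> - fourier_int (cutoff R f') \<xi>"
      unfolding fourier_int_def
      by (rule Bochner_Integration.integral_diff; intro integrable_mult_cis integrable_cutoff D D')
    finally show ?thesis unfolding truncated_fourier_eq by (simp only: right_diff_distrib)
  qed
  have "(\<lambda>n. l2sq (\<lambda>\<xi>. truncated_fourier (real n) (\<lambda>x. f x - f' x) \<xi> - (g \<xi> - g' \<xi>))) \<longlonglongrightarrow> 0"
  proof (rule tendsto_sandwich[OF _ _ tendsto_const])
    show "\<forall>\<^sub>F n in sequentially. l2sq (\<lambda>\<xi>. truncated_fourier (real n) (\<lambda>x. f x - f' x) \<xi> - (g \<xi> - g' \<xi>))
       \<le> 2 * l2sq (\<lambda>\<xi>. truncated_fourier (real n) f \<xi> - g \<xi>)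
         + 2 * l2sq (\<lambda>\<xi>. truncated_fourier (real n) f' \<xi> - g' \<xi>)"
    proof (intro always_eventually allI)
      fix n
      show "l2sq (\<lambda>\<xi>. truncated_fourier (real n) (\<lambda>x. f x - f' x) \<xi> - (g \<xi> - g' \<xi>))
       \<le> 2 * l2sq (\<lambda>\<xi>. truncated_fourier (real n) f \<xi> - g \<xi>)
         + 2 * l2sq (\<lambda>\<xi>. truncated_fourier (real n) f' \<xi> - g' \<xi>)"
        using l2sq_diff_le[of "\<lambda>\<xi>. truncated_fourier (real n) f \<xi> - g \<xi>" "\<lambda>\<xi>. truncated_fourier (real n) f' \<xi> - g' \<xi>"]
        by (simp add: tf algebra_simps)
    qed
    have "(\<lambda>n. 2 * l2sq (\<lambda>\<xi>. truncated_fourier (real n) f \<xi> - g \<xi>)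
         + 2 * l2sq (\<lambda>\<xi>. truncated_fourier (real n) f' \<xi> - g' \<xi>)) \<longlonglongrightarrow> 2 * 0 + 2 * 0"
      by (intro tendsto_add ennreal_tendsto_cmult D D') auto
    then show "(\<lambda>n. 2 * l2sq (\<lambda>\<xi>. truncated_fourier (real n) f \<xi> - g \<xi>)
         + 2 * l2sq (\<lambda>\<xi>. truncated_fourier (real n) f' \<xi> - g' \<xi>)) \<longlonglongrightarrow> 0" by simp
  qed simp
  then show ?thesis
    using sq[OF D(1) D'(1)] sq[OF D(2) D'(2)] unfolding is_fourier_transform_def l2sq_def by auto
qed

section \<open>From weighted transforms to moduli of continuity\<close>

lemma sobolev_space_diff:
  fixes f :: "'a::euclidean_space \<Rightarrow> complex"
  assumes "f \<in> sobolev_space s" "f' \<in> sobolev_space s"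
  shows "(\<lambda>x. f x - f' x) \<in> sobolev_space s"
proof -
  obtain g where g: "is_fourier_transform f g"
    and gi: "integrable lborel (\<lambda>\<xi>. (1 + (norm \<xi>)\<^sup>2) powr s * (cmod (g \<xi>))\<^sup>2)"
    using assms by (auto simp: sobolev_space_def)
  obtain g' where g': "is_fourier_transform f' g'"
    and gi': "integrable lborel (\<lambda>\<xi>. (1 + (norm \<xi>)\<^sup>2) powr s * (cmod (g' \<xi>))\<^sup>2)"
    using assms by (auto simp: sobolev_space_def)
  have [measurable]: "g \<in> borel_measurable borel" "g' \<in> borel_measurable borel"
    using is_fourier_transformD[OF g] is_fourier_transformD[OF g'] by (auto simp: square_integrable_iff)
  have "integrable lborel (\<lambda>\<xi>. (1 + (norm \<xi>)\<^sup>2) powr s * (cmod (g \<xi> - g' \<xi>))\<^sup>2)"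
  proof (rule Bochner_Integration.integrable_bound)
    show "integrable lborel (\<lambda>\<xi>. 2 * ((1 + (norm \<xi>)\<^sup>2) powr s * (cmod (g \<xi>))\<^sup>2)
        + 2 * ((1 + (norm \<xi>)\<^sup>2) powr s * (cmod (g' \<xi>))\<^sup>2))"
      using gi gi' by auto
    show "AE \<xi> in lborel. norm ((1 + (norm \<xi>)\<^sup>2) powr s * (cmod (g \<xi> - g' \<xi>))\<^sup>2) \<le>
      norm (2 * ((1 + (norm \<xi>)\<^sup>2) powr s * (cmod (g \<xi>))\<^sup>2) + 2 * ((1 + (norm \<xi>)\<^sup>2) powr s * (cmod (g' \<xi>))\<^sup>2))"
    proof (intro AE_I2)
      fix \<xi> :: 'a
      have "(cmod (g \<xi> - g' \<xi>))\<^sup>2 \<le> 2 * (cmod (g \<xi>))\<^sup>2 + 2 * (cmod (g' \<xi>))\<^sup>2"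
        using cmod_add_sq_le[of "g \<xi>" "- g' \<xi>"] by simp
      then have "(1 + (norm \<xi>)\<^sup>2) powr s * (cmod (g \<xi> - g' \<xi>))\<^sup>2 \<le>
          (1 + (norm \<xi>)\<^sup>2) powr s * (2 * (cmod (g \<xi>))\<^sup>2 + 2 * (cmod (g' \<xi>))\<^sup>2)"
        by (intro mult_left_mono) auto
      then show "norm ((1 + (norm \<xi>)\<^sup>2) powr s * (cmod (g \<xi> - g' \<xi>))\<^sup>2) \<le>
          norm (2 * ((1 + (norm \<xi>)\<^sup>2) powr s * (cmod (g \<xi>))\<^sup>2) + 2 * ((1 + (norm \<xi>)\<^sup>2) powr s * (cmod (g' \<xi>))\<^sup>2))"
        by (simp add: algebra_simps)
    qed
  qed measurable
  then show ?thesis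
    using fourier_transform_diff[OF g g'] by (auto simp: sobolev_space_def)
qed

text \<open>The only consequence of membership in \<open>H\<^sup>s\<close> that the energy argument uses.\<close>

definition frac_bound :: "real \<Rightarrow> real \<Rightarrow> ('a::euclidean_space \<Rightarrow> complex) \<Rightarrow> bool" where
  "frac_bound s M f \<longleftrightarrow> f \<in> borel_measurable borel \<and> l2sq f \<le> ennreal M \<and>
     (\<forall>h. l2sq (\<lambda>x. f (x + h) - f x) \<le> ennreal (M * norm h powr (2 * s)))"

text \<open>Interpolation between the bound |t|, good for |t| \<le> 1, and the bound 2, good for |t|
  > 1. This is where the fractional exponent enters.\<close>

lemma cmod_exp_minus_1_le:
  fixes t :: real
  assumes "0 \<le> s" "s \<le> 1"
  shows "cmod (exp (\<i> * of_real t) - 1) \<le> 2 * \<bar>t\<bar> powr s"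
proof (cases "\<bar>t\<bar> \<le> 1")
  case True
  show ?thesis
  proof (cases "t = 0")
    case False
    have "cmod (exp (\<i> * of_real t) - 1) \<le> \<bar>t\<bar>"
      using iexp_approx1[of t 0] by simp
    also have "\<dots> = \<bar>t\<bar> powr 1" using False by simp
    also have "\<dots> \<le> \<bar>t\<bar> powr s"
      using True False assms by (intro powr_mono') auto
    finally show ?thesis by (simp add: order_trans)
  qed simp
next
  case False
  have "cmod (exp (\<i> * of_real t) - 1) \<le> 2"
    using norm_triangle_ineq4[of "exp (\<i> * of_real t)" 1] by simp
  also have "\<dots> \<le> 2 * \<bar>t\<bar> powr s"
    using False assms by (simp add: ge_one_powr_ge_zero)
  finally show ?thesis .
qed

text \<open>The phase satisfies |exp(i h \<bullet> \<xi>) - 1|^2 \<le> 4 |h|^(2s) |\<xi>|^(2s), and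
  the power of |\<xi>| is absorbed by the Sobolev weight. The constant 8 is this 4 times the 2 of
  \<open>l2sq_shift_diff_le_fourier\<close>.\<close>

lemma frac_bound_sobolev:
  fixes f :: "'a::euclidean_space \<Rightarrow> complex"
  assumes f: "f \<in> sobolev_space s" and s: "0 < s" "s < 1" and M: "sobolev_norm s f \<le> M"
  shows "frac_bound s (8 * M\<^sup>2) f"
proof -
  define g where "g = (SOME g. is_fourier_transform f g)"
  obtain g0 where g0: "is_fourier_transform f g0"
    and gi0: "integrable lborel (\<lambda>\<xi>. (1 + (norm \<xi>)\<^sup>2) powr s * (cmod (g0 \<xi>))\<^sup>2)"
    using f by (auto simp: sobolev_space_def)
  have g: "is_fourier_transform f g"
    unfolding g_def by (rule someI[of "is_fourier_transform f", OF g0])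
  note D = is_fourier_transformD[OF g] and D0 = is_fourier_transformD[OF g0]
  have [measurable]: "f \<in> borel_measurable borel" "g \<in> borel_measurable borel" "g0 \<in> borel_measurable borel"
    using D D0 by (auto simp: square_integrable_iff)
  have gi: "integrable lborel (\<lambda>\<xi>. (1 + (norm \<xi>)\<^sup>2) powr s * (cmod (g \<xi>))\<^sup>2)"
    by (rule integrable_cong_AE_imp[OF gi0]) (use fourier_transform_unique[OF g0 g] in auto)
  have nonneg: "0 \<le> (LINT \<xi>|lborel. (1 + (norm \<xi>)\<^sup>2) powr s * (cmod (g \<xi>))\<^sup>2)"
    by (intro Bochner_Integration.integral_nonneg) auto
  have N0: "sobolev_norm s f \<ge> 0" by (simp add: sobolev_norm_def)
  have "(\<integral>\<^sup>+\<xi>. ennreal ((1 + (norm \<xi>)\<^sup>2) powr s * (cmod (g \<xi>))\<^sup>2) \<partial>lborel) = ennreal ((sobolev_norm s f)\<^sup>2)"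
    using gi nonneg by (subst nn_integral_eq_integral) (auto simp: sobolev_norm_def g_def)
  also have "\<dots> \<le> ennreal (M\<^sup>2)"
    using M N0 by (intro ennreal_leI power_mono) auto
  finally have W: "(\<integral>\<^sup>+\<xi>. ennreal ((1 + (norm \<xi>)\<^sup>2) powr s * (cmod (g \<xi>))\<^sup>2) \<partial>lborel) \<le> ennreal (M\<^sup>2)" .
  have "l2sq g \<le> (\<integral>\<^sup>+\<xi>. ennreal ((1 + (norm \<xi>)\<^sup>2) powr s * (cmod (g \<xi>))\<^sup>2) \<partial>lborel)"
    unfolding l2sq_def
  proof (intro nn_integral_mono ennreal_leI)
    fix \<xi> :: 'a
    have "1 \<le> (1 + (norm \<xi>)\<^sup>2) powr s" using s by (intro ge_one_powr_ge_zero) auto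
    then show "(cmod (g \<xi>))\<^sup>2 \<le> (1 + (norm \<xi>)\<^sup>2) powr s * (cmod (g \<xi>))\<^sup>2"
      using mult_right_mono[of 1 "(1 + (norm \<xi>)\<^sup>2) powr s" "(cmod (g \<xi>))\<^sup>2"] by simp
  qed
  then have "l2sq g \<le> ennreal (M\<^sup>2)" using W by simp
  then have "2 * l2sq g \<le> 2 * ennreal (M\<^sup>2)" by (rule mult_left_mono) simp
  also have "\<dots> = ennreal (2 * M\<^sup>2)" by (simp add: ennreal_mult')
  also have "\<dots> \<le> ennreal (8 * M\<^sup>2)" by (intro ennreal_leI) simp
  finally have 1: "l2sq f \<le> ennreal (8 * M\<^sup>2)"
    using l2sq_le_fourier[OF g] by simp
  have 2: "l2sq (\<lambda>x. f (x + h) - f x) \<le> ennreal (8 * M\<^sup>2 * norm h powr (2 * s))" for h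
  proof -
    have "l2sq (\<lambda>x. f (x + h) - f x) \<le> 2 * l2sq (\<lambda>\<xi>. (exp (\<i> * of_real (h \<bullet> \<xi>)) - 1) * g \<xi>)"
      using l2sq_shift_diff_le_fourier[OF g, of 1 h] by simp
    also have "l2sq (\<lambda>\<xi>. (exp (\<i> * of_real (h \<bullet> \<xi>)) - 1) * g \<xi>) \<le>
        (\<integral>\<^sup>+\<xi>. ennreal (4 * norm h powr (2 * s)) * ennreal ((1 + (norm \<xi>)\<^sup>2) powr s * (cmod (g \<xi>))\<^sup>2) \<partial>lborel)"
      unfolding l2sq_def
    proof (intro nn_integral_mono)
      fix \<xi> :: 'a
      have "(cmod (exp (\<i> * of_real (h \<bullet> \<xi>)) - 1))\<^sup>2 \<le> (2 * \<bar>h \<bullet> \<xi>\<bar> powr s)\<^sup>2"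
        using s by (intro power_mono cmod_exp_minus_1_le) auto
      also have "\<dots> \<le> (2 * (norm h * norm \<xi>) powr s)\<^sup>2"
        using s Cauchy_Schwarz_ineq2[of h \<xi>] by (intro power_mono mult_left_mono powr_mono2) auto
      also have "\<dots> = 4 * norm h powr (2 * s) * ((norm \<xi>)\<^sup>2) powr s"
      proof -
        have q: "(t powr s)\<^sup>2 = t powr (2 * s)" if "t \<ge> 0" for t :: real
          by (simp add: power2_eq_square powr_add[symmetric])
        have r: "((norm \<xi>)\<^sup>2) powr s = norm \<xi> powr (2 * s)"
        proof (cases "norm \<xi> = 0")
          case False
          then have "(norm \<xi>)\<^sup>2 = norm \<xi> powr 2" using norm_ge_zero[of \<xi>] by simp
          then show ?thesis by (simp only: powr_powr)
        qed simp
        show ?thesis unfolding r power_mult_distrib powr_mult using q[of "norm h"] q[of "norm \<xi>"] by simp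
      qed
      also have "\<dots> \<le> 4 * norm h powr (2 * s) * (1 + (norm \<xi>)\<^sup>2) powr s"
        using s by (intro mult_left_mono powr_mono2) auto
      finally have "(cmod (exp (\<i> * of_real (h \<bullet> \<xi>)) - 1))\<^sup>2 * (cmod (g \<xi>))\<^sup>2 \<le>
          4 * norm h powr (2 * s) * (1 + (norm \<xi>)\<^sup>2) powr s * (cmod (g \<xi>))\<^sup>2"
        by (intro mult_right_mono) auto
      then show "ennreal ((cmod ((exp (\<i> * of_real (h \<bullet> \<xi>)) - 1) * g \<xi>))\<^sup>2) \<le>
        ennreal (4 * norm h powr (2 * s)) * ennreal ((1 + (norm \<xi>)\<^sup>2) powr s * (cmod (g \<xi>))\<^sup>2)"
        by (subst ennreal_mult[symmetric]) (auto simp: norm_mult power_mult_distrib mult.assoc intro!: ennreal_leI)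
    qed
    also have "\<dots> \<le> ennreal (4 * norm h powr (2 * s)) * ennreal (M\<^sup>2)"
      by (subst nn_integral_cmult) (auto intro!: mult_left_mono W)
    finally have "l2sq (\<lambda>x. f (x + h) - f x) \<le> 2 * (ennreal (4 * norm h powr (2 * s)) * ennreal (M\<^sup>2))"
      by (simp add: mult_left_mono)
    also have "\<dots> = ennreal (8 * M\<^sup>2 * norm h powr (2 * s))"
      by (simp add: ennreal_mult'[symmetric] ennreal_numeral[symmetric] mult_ac del: ennreal_numeral)
    finally show ?thesis .
  qed
  show ?thesis using 1 2 by (simp add: frac_bound_def)
qed

lemma l2sq_le_sobolev:
  assumes f: "f \<in> sobolev_space s" and s: "0 < s" "s < 1"
  shows "l2sq f \<le> ennreal (8 * (sobolev_norm s f)\<^sup>2)"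
  using frac_bound_sobolev[OF f s order_refl] by (simp add: frac_bound_def)

lemma sobolev_space_square_integrable:
  assumes "f \<in> sobolev_space s"
  shows "square_integrable f"
  using assms is_fourier_transformD by (auto simp: sobolev_space_def)

lemma frac_bound_cong_AE:
  assumes "frac_bound s M f" and [measurable]: "g \<in> borel_measurable borel"
    and AE: "AE x in lborel. f x = g x"
  shows "frac_bound s M g"
proof -
  have [measurable]: "f \<in> borel_measurable borel" using assms(1) by (simp add: frac_bound_def)
  \<comment> \<open>The exceptional null set is moved along with the translation by means of the
    norm of the difference, which is translation invariant and vanishes.\<close>
  have sh: "AE x in lborel. f (x + h) = g (x + h)" for h
  proof -
    have "l2sq (\<lambda>x. f x - g x) = 0"
      using AE by (subst l2sq_eq_0_iff) auto
    then have "l2sq (\<lambda>x. f (x + h) - g (x + h)) = 0"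
      using l2sq_shift[of "\<lambda>x. f x - g x" h] by simp
    then have "AE x in lborel. f (x + h) - g (x + h) = 0"
      by (subst (asm) l2sq_eq_0_iff) auto
    then show ?thesis by auto
  qed
  have "l2sq (\<lambda>x. g (x + h) - g x) = l2sq (\<lambda>x. f (x + h) - f x)" for h
    using sh[of h] AE by (intro l2sq_cong_AE) auto
  moreover have "l2sq g = l2sq f" using AE by (intro l2sq_cong_AE) auto
  ultimately show ?thesis using assms(1) by (simp add: frac_bound_def)
qed

lemma frac_bound_diff:
  assumes "frac_bound s M f" "frac_bound s M' g" and M: "M \<ge> 0" "M' \<ge> 0"
  shows "frac_bound s (2 * M + 2 * M') (\<lambda>x. f x - g x)"
proof -
  have [measurable]: "f \<in> borel_measurable borel" "g \<in> borel_measurable borel"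
    using assms by (auto simp: frac_bound_def)
  have "l2sq (\<lambda>x. f x - g x) \<le> 2 * l2sq f + 2 * l2sq g"
    by (rule l2sq_diff_le) auto
  also have "\<dots> \<le> 2 * ennreal M + 2 * ennreal M'"
    using assms by (intro add_mono mult_left_mono) (auto simp: frac_bound_def)
  also have "\<dots> = ennreal (2 * M + 2 * M')"
    using M by (simp add: ennreal_mult')
  finally have 1: "l2sq (\<lambda>x. f x - g x) \<le> ennreal (2 * M + 2 * M')" .
  have 2: "l2sq (\<lambda>x. (f (x + h) - g (x + h)) - (f x - g x)) \<le> ennreal ((2 * M + 2 * M') * norm h powr (2 * s))" for h
  proof -
    have "l2sq (\<lambda>x. (f (x + h) - f x) - (g (x + h) - g x)) \<le>
        2 * l2sq (\<lambda>x. f (x + h) - f x) + 2 * l2sq (\<lambda>x. g (x + h) - g x)"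
      by (rule l2sq_diff_le) auto
    also have "\<dots> \<le> 2 * ennreal (M * norm h powr (2 * s)) + 2 * ennreal (M' * norm h powr (2 * s))"
      using assms by (intro add_mono mult_left_mono) (auto simp: frac_bound_def)
    also have "\<dots> = ennreal (2 * (M * norm h powr (2 * s)) + 2 * (M' * norm h powr (2 * s)))"
      using M by (simp add: ennreal_mult')
    finally show ?thesis by (simp add: algebra_simps)
  qed
  show ?thesis using 1 2 by (simp add: frac_bound_def)
qed

section \<open>Smooth functions\<close>

lemma dir_deriv_eq: "(f has_derivative D) (at x) \<Longrightarrow> dir_deriv h f x = D h"
  unfolding dir_deriv_def by (metis frechet_derivative_at)

lemma has_derivative_dir_deriv:
  "f differentiable (at x) \<Longrightarrow> (f has_derivative (\<lambda>h. dir_deriv h f x)) (at x)"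
  unfolding dir_deriv_def using frechet_derivative_works by metis

lemma dir_deriv_expand:
  fixes f :: "'a::euclidean_space \<Rightarrow> 'b::real_normed_vector"
  assumes "f differentiable (at x)"
  shows "dir_deriv h f x = (\<Sum>b\<in>Basis. (h \<bullet> b) *\<^sub>R dir_deriv b f x)"
proof -
  interpret bounded_linear "\<lambda>h. dir_deriv h f x"
    using has_derivative_dir_deriv[OF assms] by (rule has_derivative_bounded_linear)
  have "dir_deriv h f x = dir_deriv (\<Sum>b\<in>Basis. (h \<bullet> b) *\<^sub>R b) f x"
    by (simp add: euclidean_representation)
  also have "\<dots> = (\<Sum>b\<in>Basis. (h \<bullet> b) *\<^sub>R dir_deriv b f x)"
    by (simp only: sum scaleR)
  finally show ?thesis .
qed

lemma Ck_Suc_differentiable: "Ck (Suc k) f \<Longrightarrow> f differentiable (at x)"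
  by simp

lemma Ck_SucD: "Ck (Suc k) f \<Longrightarrow> Ck k f"
proof (induction k arbitrary: f)
  case 0
  then show ?case
    by (auto simp: continuous_on_eq_continuous_at intro: differentiable_imp_continuous_within)
next
  case (Suc k)
  then show ?case by (metis Ck.simps(2))
qed

lemma smooth_imp_continuous: "smooth f \<Longrightarrow> continuous_on UNIV f"
  unfolding smooth_def using Ck.simps(1) by blast

lemma smooth_differentiable: "smooth f \<Longrightarrow> f differentiable (at x)"
  unfolding smooth_def using Ck_Suc_differentiable by blast

lemma smooth_dir_deriv: "smooth f \<Longrightarrow> b \<in> Basis \<Longrightarrow> smooth (dir_deriv b f)"
  unfolding smooth_def using Ck.simps(2) by blast

lemma smooth_borel: "smooth f \<Longrightarrow> f \<in> borel_measurable borel"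
  by (intro borel_measurable_continuous_onI smooth_imp_continuous)

lemma Ck_const: "Ck k (\<lambda>_. c)"
proof (induction k arbitrary: c)
  case (Suc k)
  have "dir_deriv b (\<lambda>_. c) = (\<lambda>_. 0)" for b :: 'a
    by (rule ext, rule dir_deriv_eq) simp
  then show ?case using Suc by simp
qed simp

lemma Ck_add: "Ck k f \<Longrightarrow> Ck k g \<Longrightarrow> Ck k (\<lambda>x. f x + g x)"
proof (induction k arbitrary: f g)
  case (Suc k)
  have "dir_deriv b (\<lambda>x. f x + g x) = (\<lambda>x. dir_deriv b f x + dir_deriv b g x)" for b
    using Suc.prems by (intro ext dir_deriv_eq has_derivative_add has_derivative_dir_deriv) auto
  then show ?case using Suc by auto
qed (auto intro: continuous_intros)

lemma Ck_sum: "finite A \<Longrightarrow> (\<And>i. i \<in> A \<Longrightarrow> Ck k (f i)) \<Longrightarrow> Ck k (\<lambda>x. \<Sum>i\<in>A. f i x)"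
  by (induction rule: finite_induct) (auto intro: Ck_const Ck_add)

lemma Ck_linear_comp:
  assumes m: "bounded_linear m"
  shows "Ck k f \<Longrightarrow> Ck k (\<lambda>x. m (f x))"
proof (induction k arbitrary: f)
  case 0
  then show ?case using bounded_linear.continuous_on[OF m] by auto
next
  case (Suc k)
  have d: "((\<lambda>x. m (f x)) has_derivative (\<lambda>h. m (dir_deriv h f x))) (at x)" for x
    using Suc.prems by (intro bounded_linear.has_derivative[OF m] has_derivative_dir_deriv) auto
  then have "dir_deriv b (\<lambda>x. m (f x)) = (\<lambda>x. m (dir_deriv b f x))" for b
    by (intro ext dir_deriv_eq)
  then show ?case using Suc d by (auto simp: differentiable_def)
qed

lemma has_derivative_affine_comp:
  assumes L: "bounded_linear L" and f: "\<And>x. f differentiable (at x)"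
  shows "((\<lambda>x. f (L x + c)) has_derivative (\<lambda>h. dir_deriv (L h) f (L x + c))) (at x)"
proof -
  have "((\<lambda>x. L x + c) has_derivative L) (at x)"
    using has_derivative_add[OF bounded_linear_imp_has_derivative[OF L] has_derivative_const] by simp
  from has_derivative_compose[OF this has_derivative_dir_deriv[OF f]] show ?thesis .
qed

text \<open>The chain rule produces the derivative in the direction L b, in general not a basis
  vector; expanding it over the basis leads back to the derivatives that \<open>Ck\<close> controls,
  and the induction can proceed.\<close>

lemma Ck_affine:
  fixes f :: "'b::euclidean_space \<Rightarrow> 'c::real_normed_vector" and L :: "'a::euclidean_space \<Rightarrow> 'b"
  assumes L: "bounded_linear L"
  shows "Ck k f \<Longrightarrow> Ck k (\<lambda>x. f (L x + c))"
proof (induction k arbitrary: f)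
  case 0
  have "continuous_on UNIV (\<lambda>x. L x + c)"
    using L by (intro continuous_intros linear_continuous_on)
  then show ?case
    using 0 continuous_on_compose2[of UNIV f UNIV "\<lambda>x. L x + c"] by auto
next
  case (Suc k)
  have df: "f differentiable (at x)" for x using Suc.prems by auto
  note d = has_derivative_affine_comp[OF L df]
  have "dir_deriv b (\<lambda>x. f (L x + c)) = (\<lambda>x. \<Sum>e\<in>Basis. (L b \<bullet> e) *\<^sub>R dir_deriv e f (L x + c))" for b
    by (intro ext trans[OF dir_deriv_eq[OF d] dir_deriv_expand[OF df]])
  moreover have "Ck k (\<lambda>x. \<Sum>e\<in>Basis. (L b \<bullet> e) *\<^sub>R dir_deriv e f (L x + c))" for b
    using Suc by (intro Ck_sum Ck_linear_comp[OF bounded_linear_scaleR_right] Suc.IH) auto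
  moreover have "(\<lambda>x. f (L x + c)) differentiable (at x)" for x
    using d by (rule differentiableI)
  ultimately show ?case by simp
qed

lemma dir_deriv_mult:
  fixes f g :: "'a::real_normed_vector \<Rightarrow> 'b::{real_normed_algebra,comm_ring}"
  assumes "f differentiable (at x)" "g differentiable (at x)"
  shows "dir_deriv h (\<lambda>x. f x * g x) x = f x * dir_deriv h g x + dir_deriv h f x * g x"
  by (rule dir_deriv_eq[OF has_derivative_mult[OF has_derivative_dir_deriv[OF assms(1)] has_derivative_dir_deriv[OF assms(2)]]])

lemma Ck_mult:
  fixes f g :: "'a::euclidean_space \<Rightarrow> 'b::{real_normed_algebra,comm_ring}"
  shows "Ck k f \<Longrightarrow> Ck k g \<Longrightarrow> Ck k (\<lambda>x. f x * g x)"
proof (induction k arbitrary: f g)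
  case (Suc k)
  have "dir_deriv b (\<lambda>x. f x * g x) = (\<lambda>x. f x * dir_deriv b g x + dir_deriv b f x * g x)" for b
    using Suc.prems by (intro ext dir_deriv_mult) auto
  moreover have "Ck k (\<lambda>x. f x * dir_deriv b g x + dir_deriv b f x * g x)" if "b \<in> Basis" for b
    using Suc.prems Suc.prems[THEN Ck_SucD] that by (intro Ck_add Suc.IH) auto
  ultimately show ?case using Suc.prems by (auto intro: differentiable_mult)
qed (auto intro: continuous_intros)

lemma Ck_prod:
  fixes f :: "'i \<Rightarrow> 'a::euclidean_space \<Rightarrow> 'b::{real_normed_algebra_1,comm_ring_1}"
  shows "finite A \<Longrightarrow> (\<And>i. i \<in> A \<Longrightarrow> Ck k (f i)) \<Longrightarrow> Ck k (\<lambda>x. \<Prod>i\<in>A. f i x)"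
  by (induction rule: finite_induct) (auto intro: Ck_const Ck_mult)

section \<open>Mollifiers\<close>

text \<open>The family is closed under differentiation: on the positive half-line the derivative of
  p(1/x) exp(-1/x) is of the same form with the polynomial X^2 (p - p'). Smoothness at 0 thus
  becomes an induction over the order, for all p at once.\<close>

definition expinv :: "real poly \<Rightarrow> real \<Rightarrow> real" where
  "expinv p x = (if x > 0 then poly p (1 / x) * exp (- (1 / x)) else 0)"

text \<open>The power of y in front is there for the induction over the coefficients: it absorbs the
  factor y that \<open>pCons\<close> splits off.\<close>

lemma tendsto_poly_exp_minus: "((\<lambda>y. y ^ k * poly p y * exp (- y)) \<longlongrightarrow> (0::real)) at_top"
proof (induction p arbitrary: k)
  case (pCons a p)
  have "((\<lambda>y. a * (y ^ k / exp y) + y ^ Suc k * poly p y * exp (- y)) \<longlongrightarrow> a * 0 + (0::real)) at_top"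
    by (intro tendsto_intros tendsto_power_div_exp_0 pCons)
  then show ?case
    by (simp add: algebra_simps exp_minus divide_inverse)
qed simp

lemma has_field_derivative_expinv:
  "(expinv p has_real_derivative expinv (pCons 0 (pCons 0 (p - pderiv p))) x) (at x)"
proof -
  consider "x > 0" | "x < 0" | "x = 0" by linarith
  then show ?thesis
  proof cases
    case 1
    have "((\<lambda>x. poly p (1 / x) * exp (- (1 / x))) has_real_derivative
        (poly (pderiv p) (1 / x) * (- 1 / x\<^sup>2)) * exp (- (1 / x)) + exp (- (1 / x)) * (1 / x\<^sup>2) * poly p (1 / x)) (at x)"
    proof (intro DERIV_mult)
      have d: "((\<lambda>x. 1 / x) has_real_derivative - 1 / x\<^sup>2) (at x)"
        using 1 by (auto intro!: derivative_eq_intros simp: power2_eq_square)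
      from DERIV_chain2[OF poly_DERIV d]
      show "((\<lambda>x. poly p (1 / x)) has_real_derivative poly (pderiv p) (1 / x) * (- 1 / x\<^sup>2)) (at x)" .
      show "((\<lambda>x. exp (- (1 / x))) has_real_derivative exp (- (1 / x)) * (1 / x\<^sup>2)) (at x)"
        using 1 by (auto intro!: derivative_eq_intros simp: power2_eq_square)
    qed
    then have "(expinv p has_real_derivative
        (poly (pderiv p) (1 / x) * (- 1 / x\<^sup>2)) * exp (- (1 / x)) + exp (- (1 / x)) * (1 / x\<^sup>2) * poly p (1 / x)) (at x)"
      by (rule has_field_derivative_transform_within_open[of _ _ _ "{0<..}"]) (use 1 in \<open>auto simp: expinv_def\<close>)
    then show ?thesis
      using 1 by (simp add: expinv_def field_simps power2_eq_square)
  next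
    case 2
    have "((\<lambda>_. 0) has_real_derivative 0) (at x)" by simp
    then have "(expinv p has_real_derivative 0) (at x)"
      by (rule has_field_derivative_transform_within_open[of _ _ _ "{..<0}"]) (use 2 in \<open>auto simp: expinv_def\<close>)
    then show ?thesis using 2 by (simp add: expinv_def)
  next
    case 3
    have "((\<lambda>h. expinv p h / h) \<longlongrightarrow> 0) (at_left 0)"
      by (rule tendsto_eventually) (auto simp: eventually_at_filter expinv_def)
    \<comment> \<open>With y = 1 / h the difference quotient is y p(y) exp(-y), and y tends to
      infinity.\<close>
    moreover have "((\<lambda>h. expinv p h / h) \<longlongrightarrow> 0) (at_right 0)"
    proof (rule Lim_transform_eventually)
      show "((\<lambda>h. inverse h ^ 1 * poly p (inverse h) * exp (- inverse h)) \<longlongrightarrow> 0) (at_right 0)"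
        by (rule filterlim_compose[OF tendsto_poly_exp_minus filterlim_inverse_at_top_right])
      show "\<forall>\<^sub>F h in at_right 0. inverse h ^ 1 * poly p (inverse h) * exp (- inverse h) = expinv p h / h"
        by (auto simp: eventually_at_filter expinv_def field_simps)
    qed
    ultimately have "((\<lambda>h. expinv p h / h) \<longlongrightarrow> 0) (at 0)"
      by (rule filterlim_split_at)
    then show ?thesis using 3 by (simp add: has_field_derivative_iff) (simp add: expinv_def)
  qed
qed

lemma dir_deriv_real:
  assumes "(f has_real_derivative d) (at x)"
  shows "dir_deriv 1 f x = d"
  using dir_deriv_eq[OF assms[unfolded has_field_derivative_def], of 1] by simp

lemma Ck_expinv: "Ck k (expinv p)"
proof (induction k arbitrary: p)
  case 0
  show ?case
    using has_field_derivative_expinv[of p] by (auto intro!: continuous_at_imp_continuous_on DERIV_isCont)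
next
  case (Suc k)
  have "dir_deriv 1 (expinv p) = expinv (pCons 0 (pCons 0 (p - pderiv p)))"
    by (intro ext dir_deriv_real has_field_derivative_expinv)
  then show ?case
    using Suc has_field_derivative_expinv[of p]
    by (auto simp: differentiable_def has_field_derivative_def)
qed

section \<open>The bump function and the mollifiers\<close>

definition bump1 :: "real \<Rightarrow> real" where
  "bump1 x = expinv 1 (1 + x) * expinv 1 (1 - x)"

definition bump :: "'a::euclidean_space \<Rightarrow> real" where
  "bump x = (\<Prod>b\<in>Basis. bump1 (x \<bullet> b))"

lemma bump1_nonneg: "bump1 x \<ge> 0" and bump1_pos: "\<bar>x\<bar> < 1 \<Longrightarrow> bump1 x > 0"
  and bump1_eq_0: "\<bar>x\<bar> \<ge> 1 \<Longrightarrow> bump1 x = 0" and bump1_le_1: "bump1 x \<le> 1"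
  by (auto simp: bump1_def expinv_def mult_le_one abs_if split: if_splits)

lemma bump_nonneg: "bump x \<ge> 0"
  unfolding bump_def by (intro prod_nonneg) (simp add: bump1_nonneg)

lemma bump_le_1: "bump x \<le> 1"
  unfolding bump_def by (intro prod_le_1) (simp add: bump1_nonneg bump1_le_1)

text \<open>The function is nonzero only in the cube where every coordinate is below 1 in modulus,
  and there the norm is less than the dimension by comparison with the l^1 norm. This is the origin
  of the factor \<open>DIM('a)\<close> in the later radii.\<close>

lemma bump_eq_0:
  fixes x :: "'a::euclidean_space"
  assumes "norm x \<ge> DIM('a)"
  shows "bump x = 0"
proof (rule ccontr)
  assume "bump x \<noteq> 0"
  then have "\<bar>x \<bullet> b\<bar> < 1" if "b \<in> Basis" for b
    using that bump1_eq_0[of "x \<bullet> b"] unfolding bump_def by (force simp: not_less)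
  then have "(\<Sum>b\<in>Basis. \<bar>x \<bullet> b\<bar>) < (\<Sum>b\<in>(Basis::'a set). 1)"
    by (intro sum_strict_mono) auto
  then show False using assms norm_le_l1[of x] by simp
qed

lemma smooth_bump: "smooth (bump :: 'a::euclidean_space \<Rightarrow> real)"
  unfolding smooth_def
proof
  fix k
  have e: "bump = (\<lambda>x::'a. \<Prod>b\<in>Basis. expinv 1 (x \<bullet> b + 1) * expinv 1 (- (x \<bullet> b) + 1))"
    by (intro ext) (simp add: bump_def bump1_def algebra_simps)
  show "Ck k (bump :: 'a \<Rightarrow> real)"
    unfolding e
    by (intro Ck_prod Ck_mult Ck_affine Ck_expinv bounded_linear_minus bounded_linear_inner_left) auto
qed

lemma integrable_continuous_compact_support:
  fixes f :: "'a::euclidean_space \<Rightarrow> 'b::euclidean_space"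
  assumes f: "continuous_on UNIV f" and R: "\<And>x. norm x > R \<Longrightarrow> f x = 0"
  shows "integrable lborel f"
proof -
  have "integrable lborel (\<lambda>x. indicator (cball 0 R) x *\<^sub>R f x)"
    by (rule borel_integrable_compact) (auto intro: continuous_on_subset[OF f])
  also have "(\<lambda>x. indicator (cball 0 R) x *\<^sub>R f x) = f"
    using R by (intro ext) (auto simp: indicator_def)
  finally show ?thesis .
qed

lemma integrable_bump: "integrable lborel (bump :: 'a::euclidean_space \<Rightarrow> real)"
  by (rule integrable_continuous_compact_support[where R="DIM('a)"])
     (auto intro: bump_eq_0 smooth_imp_continuous smooth_bump)

lemma integral_bump_pos: "(LINT x|lborel. bump (x::'a::euclidean_space)) > 0"
proof -
  have "(LINT x|lborel. bump (x::'a)) \<noteq> 0"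
  proof
    assume "(LINT x|lborel. bump (x::'a)) = 0"
    then have "AE x in lborel. bump (x::'a) = 0"
      using integral_nonneg_eq_0_iff_AE[OF integrable_bump] bump_nonneg by auto
    moreover have "{x::'a. bump x \<noteq> 0} \<in> sets lborel"
      using smooth_imp_continuous[OF smooth_bump] by (auto intro!: borel_open open_Collect_neq)
    ultimately have "{x::'a. bump x \<noteq> 0} \<in> null_sets lborel"
      by (subst (asm) AE_iff_null) auto
    then have "negligible {x::'a. bump x \<noteq> 0}"
      unfolding negligible_iff_null_sets by (rule null_sets_completionI)
    moreover have "open {x::'a. bump x \<noteq> 0}"
      using smooth_imp_continuous[OF smooth_bump] by (intro open_Collect_neq) auto
    ultimately have "{x::'a. bump x \<noteq> 0} = {}"
      using open_not_negligible by blast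
    moreover have "bump (0::'a) \<noteq> 0"
      using bump1_pos[of 0] by (simp add: bump_def)
    ultimately show False by blast
  qed
  moreover have "(LINT x|lborel. bump (x::'a)) \<ge> 0"
    by (intro Bochner_Integration.integral_nonneg bump_nonneg)
  ultimately show ?thesis by simp
qed

definition mollifier :: "real \<Rightarrow> 'a::euclidean_space \<Rightarrow> real" where
  "mollifier \<epsilon> x = bump ((1 / \<epsilon>) *\<^sub>R x) / (\<epsilon> ^ DIM('a) * (LINT y|lborel. bump (y::'a)))"

lemma mollifier_nonneg: "\<epsilon> > 0 \<Longrightarrow> mollifier \<epsilon> x \<ge> 0"
  unfolding mollifier_def by (intro divide_nonneg_pos bump_nonneg mult_pos_pos integral_bump_pos) simp

lemma mollifier_eq_0:
  fixes x :: "'a::euclidean_space" and \<epsilon> :: real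
  assumes "\<epsilon> > 0" "norm x \<ge> DIM('a) * \<epsilon>"
  shows "mollifier \<epsilon> x = 0"
  using assms bump_eq_0[of "(1 / \<epsilon>) *\<^sub>R x"] by (simp add: mollifier_def field_simps)

lemma mollifier_le:
  fixes \<epsilon> :: real
  assumes "\<epsilon> > 0"
  shows "mollifier \<epsilon> (x::'a::euclidean_space) \<le> 1 / (\<epsilon> ^ DIM('a) * (LINT y|lborel. bump (y::'a)))"
  unfolding mollifier_def using assms integral_bump_pos[where 'a='a]
  by (intro divide_right_mono bump_le_1) (simp add: less_imp_le)

lemma smooth_mollifier: "smooth (mollifier \<epsilon> :: 'a::euclidean_space \<Rightarrow> real)"
  unfolding smooth_def
proof
  fix k
  have "Ck k (\<lambda>x::'a. bump ((1 / \<epsilon>) *\<^sub>R x + 0))"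
    using smooth_bump[where 'a='a] by (intro Ck_affine bounded_linear_scaleR_right) (auto simp: smooth_def)
  then show "Ck k (mollifier \<epsilon> :: 'a \<Rightarrow> real)"
    unfolding mollifier_def[abs_def] divide_inverse[of "bump _"] by (intro Ck_mult Ck_const) simp
qed

lemma integrable_mollifier:
  fixes \<epsilon> :: real
  assumes "\<epsilon> > 0"
  shows "integrable lborel (mollifier \<epsilon> :: 'a::euclidean_space \<Rightarrow> real)"
proof (rule integrable_continuous_compact_support[where R="DIM('a) * \<epsilon>"])
  show "mollifier \<epsilon> x = 0" if "norm x > DIM('a) * \<epsilon>" for x :: 'a
    using assms less_imp_le[OF that] by (rule mollifier_eq_0)
qed (rule smooth_imp_continuous[OF smooth_mollifier])

lemma integral_mollifier:
  assumes "\<epsilon> > 0"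
  shows "(LINT x|lborel. mollifier \<epsilon> (x::'a::euclidean_space)) = 1"
proof -
  have [measurable]: "(bump :: 'a \<Rightarrow> real) \<in> borel_measurable borel"
    by (rule smooth_borel[OF smooth_bump])
  have "(LINT x|lborel. bump ((1 / \<epsilon>) *\<^sub>R (x::'a))) =
     \<bar>\<epsilon>\<bar> ^ DIM('a) *\<^sub>R (LINT x|lborel. bump ((1 / \<epsilon>) *\<^sub>R (0 + \<epsilon> *\<^sub>R (x::'a))))"
    using assms by (intro integral_lborel_scale) auto
  also have "\<dots> = \<epsilon> ^ DIM('a) * (LINT y|lborel. bump (y::'a))"
    using assms by simp
  finally show ?thesis
    unfolding mollifier_def using integral_bump_pos[where 'a='a] assms by simp
qed

lemma dir_deriv_eq_0_outside:
  fixes f :: "'a::real_normed_vector \<Rightarrow> 'b::real_normed_vector"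
  assumes "\<And>x. norm x > R \<Longrightarrow> f x = 0" and "norm x > R"
  shows "dir_deriv h f x = 0"
proof -
  have "((\<lambda>_. 0) has_derivative (\<lambda>_. 0)) (at x)" by simp
  then have "(f has_derivative (\<lambda>_. 0)) (at x)"
    by (rule has_derivative_transform_within_open[of _ _ _ _ "{x. norm x > R}"])
       (use assms in \<open>auto intro: open_Collect_less continuous_intros\<close>)
  then show ?thesis by (rule dir_deriv_eq)
qed

lemma dir_deriv_mollifier:
  "dir_deriv h (mollifier \<epsilon>) (x::'a::euclidean_space) =
     dir_deriv h bump ((1 / \<epsilon>) *\<^sub>R x) / (\<epsilon> * \<epsilon> ^ DIM('a) * (LINT y|lborel. bump (y::'a)))"
proof -
  have d: "bump differentiable (at y)" for y :: 'a
    by (rule smooth_differentiable[OF smooth_bump])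
  have "((\<lambda>x. bump ((1 / \<epsilon>) *\<^sub>R x + 0)) has_derivative (\<lambda>h. dir_deriv ((1 / \<epsilon>) *\<^sub>R h) bump ((1 / \<epsilon>) *\<^sub>R x + 0))) (at x)"
    by (rule has_derivative_affine_comp[OF bounded_linear_scaleR_right d])
  then have "((\<lambda>x. bump ((1 / \<epsilon>) *\<^sub>R x) * inverse (\<epsilon> ^ DIM('a) * (LINT y|lborel. bump (y::'a)))) has_derivative
     (\<lambda>h. dir_deriv ((1 / \<epsilon>) *\<^sub>R h) bump ((1 / \<epsilon>) *\<^sub>R x) * inverse (\<epsilon> ^ DIM('a) * (LINT y|lborel. bump (y::'a))))) (at x)"
    by (intro has_derivative_mult_left) simp
  then have "dir_deriv h (mollifier \<epsilon>) x = dir_deriv ((1 / \<epsilon>) *\<^sub>R h) bump ((1 / \<epsilon>) *\<^sub>R x) *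
      inverse (\<epsilon> ^ DIM('a) * (LINT y|lborel. bump (y::'a)))"
    unfolding mollifier_def[abs_def] divide_inverse[of "bump _"] by (rule dir_deriv_eq)
  also have "dir_deriv ((1 / \<epsilon>) *\<^sub>R h) bump ((1 / \<epsilon>) *\<^sub>R x) = (1 / \<epsilon>) *\<^sub>R dir_deriv h bump ((1 / \<epsilon>) *\<^sub>R x)"
    by (rule linear_scale[OF has_derivative_linear[OF has_derivative_dir_deriv[OF d]]])
  finally show ?thesis by (simp add: divide_inverse mult_ac)
qed

text \<open>By scaling, a derivative costs one power of 1 / \<epsilon> in L^1, with a constant that
  depends on the bump alone. It becomes the 1 / \<epsilon> of the flux estimate.\<close>

lemma nn_integral_dir_deriv_mollifier:
  assumes "b \<in> Basis"
  obtains C where "C \<ge> 0" "\<And>\<epsilon>. \<epsilon> > 0 \<Longrightarrow>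
    (\<integral>\<^sup>+x. ennreal \<bar>dir_deriv b (mollifier \<epsilon>) (x::'a::euclidean_space)\<bar> \<partial>lborel) \<le> ennreal (C / \<epsilon>)"
proof -
  define I where "I = (LINT y|lborel. bump (y::'a))"
  have I: "I > 0" unfolding I_def by (rule integral_bump_pos)
  have sm: "smooth (dir_deriv b (bump :: 'a \<Rightarrow> real))"
    by (intro smooth_dir_deriv smooth_bump assms)
  have [measurable]: "dir_deriv b (bump :: 'a \<Rightarrow> real) \<in> borel_measurable borel"
    by (rule smooth_borel[OF sm])
  have int: "integrable lborel (dir_deriv b (bump :: 'a \<Rightarrow> real))"
  proof (rule integrable_continuous_compact_support[where R="DIM('a)"])
    show "dir_deriv b bump x = 0" if "norm x > DIM('a)" for x :: 'a
      using that by (rule dir_deriv_eq_0_outside[rotated]) (auto intro: bump_eq_0)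
  qed (rule smooth_imp_continuous[OF sm])
  define K where "K = (LINT y|lborel. \<bar>dir_deriv b bump (y::'a)\<bar>)"
  have K: "K \<ge> 0" by (simp add: K_def)
  show thesis
  proof (rule that[of "K / I"])
    fix \<epsilon> :: real assume \<epsilon>: "\<epsilon> > 0"
    have "(\<integral>\<^sup>+x. ennreal \<bar>dir_deriv b (mollifier \<epsilon>) (x::'a)\<bar> \<partial>lborel) =
       (\<integral>\<^sup>+x. ennreal (1 / (\<epsilon> * \<epsilon> ^ DIM('a) * I)) * ennreal \<bar>dir_deriv b bump ((1 / \<epsilon>) *\<^sub>R (x::'a))\<bar> \<partial>lborel)"
      using \<epsilon> I unfolding dir_deriv_mollifier I_def[symmetric]
      by (intro nn_integral_cong) (simp add: abs_mult ennreal_mult[symmetric])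
    also have "\<dots> = ennreal (1 / (\<epsilon> * \<epsilon> ^ DIM('a) * I)) * (\<integral>\<^sup>+x. ennreal \<bar>dir_deriv b bump ((1 / \<epsilon>) *\<^sub>R (x::'a))\<bar> \<partial>lborel)"
      by (rule nn_integral_cmult) measurable
    also have "(\<integral>\<^sup>+x. ennreal \<bar>dir_deriv b bump ((1 / \<epsilon>) *\<^sub>R (x::'a))\<bar> \<partial>lborel) =
       ennreal (\<bar>\<epsilon>\<bar> ^ DIM('a)) * (\<integral>\<^sup>+x. ennreal \<bar>dir_deriv b bump ((1 / \<epsilon>) *\<^sub>R (0 + \<epsilon> *\<^sub>R (x::'a)))\<bar> \<partial>lborel)"
      using \<epsilon> by (intro nn_integral_lborel_scale) auto
    also have "\<dots> = ennreal (\<epsilon> ^ DIM('a)) * ennreal K"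
      using \<epsilon> int unfolding K_def by (subst nn_integral_eq_integral[symmetric]) auto
    also have "ennreal (1 / (\<epsilon> * \<epsilon> ^ DIM('a) * I)) * \<dots> = ennreal (K / I / \<epsilon>)"
      using \<epsilon> K I by (simp add: ennreal_mult[symmetric] field_simps)
    finally show "(\<integral>\<^sup>+x. ennreal \<bar>dir_deriv b (mollifier \<epsilon>) (x::'a)\<bar> \<partial>lborel) \<le> ennreal (K / I / \<epsilon>)"
      by simp
  qed (use K I in auto)
qed

section \<open>Convolution\<close>

definition kernel :: "('a::euclidean_space \<Rightarrow> real) \<Rightarrow> bool" where
  "kernel K \<longleftrightarrow> smooth K \<and> (\<exists>r. \<forall>x. norm x > r \<longrightarrow> K x = 0)"

lemma kernelE:
  assumes "kernel (K :: 'a::euclidean_space \<Rightarrow> real)"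
  obtains r B where "r > 0" "\<And>x. norm x > r \<Longrightarrow> K x = 0" "B > 0" "\<And>x. \<bar>K x\<bar> \<le> B"
proof -
  obtain r0 where r0: "\<And>x. norm x > r0 \<Longrightarrow> K x = 0" and sm: "smooth K"
    using assms by (auto simp: kernel_def)
  define r where "r = max r0 1"
  have "compact (K ` cball 0 r)"
    by (intro compact_continuous_image continuous_on_subset[OF smooth_imp_continuous[OF sm]]) auto
  then obtain B where B: "B > 0" "\<And>x. x \<in> cball 0 r \<Longrightarrow> norm (K x) \<le> B"
    using bounded_pos compact_imp_bounded by (metis imageI)
  show thesis
  proof (rule that[of r B])
    show "r > 0" by (simp add: r_def)
    show "K x = 0" if "norm x > r" for x using that r0[of x] by (simp add: r_def)
    then show "\<bar>K x\<bar> \<le> B" for x using B by (cases "norm x > r") auto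
  qed (rule B)
qed

lemma kernel_dir_deriv: "kernel K \<Longrightarrow> b \<in> Basis \<Longrightarrow> kernel (dir_deriv b K)"
  unfolding kernel_def using dir_deriv_eq_0_outside smooth_dir_deriv by metis

lemma kernel_mollifier: "\<epsilon> > 0 \<Longrightarrow> kernel (mollifier \<epsilon> :: 'a::euclidean_space \<Rightarrow> real)"
  unfolding kernel_def using smooth_mollifier mollifier_eq_0 by (metis less_imp_le)

lemma kernel_borel: "kernel K \<Longrightarrow> K \<in> borel_measurable borel"
  by (auto simp: kernel_def intro: smooth_borel)

text \<open>Convolution has to be applied to the nonlinearity of an L^2 function as well, for which
  integrability is available on balls; kernels of compact support make this class
  sufficient.\<close>

definition loc_integrable :: "('a::euclidean_space \<Rightarrow> complex) \<Rightarrow> bool" where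
  "loc_integrable f \<longleftrightarrow> f \<in> borel_measurable borel \<and> (\<forall>R. integrable lborel (cutoff R f))"

lemma square_integrable_imp_loc: "square_integrable f \<Longrightarrow> loc_integrable f"
  by (auto simp: loc_integrable_def integrable_cutoff square_integrable_iff)

definition conv :: "('a::euclidean_space \<Rightarrow> real) \<Rightarrow> ('a \<Rightarrow> complex) \<Rightarrow> 'a \<Rightarrow> complex" where
  "conv K f x = (LINT y|lborel. f y * of_real (K (x - y)))"

lemma loc_integrable_mult_bounded:
  fixes f :: "'a::euclidean_space \<Rightarrow> complex"
  assumes f: "loc_integrable f" and [measurable]: "p \<in> borel_measurable borel"
    and p: "\<And>y. cmod (p y) \<le> B" "\<And>y. norm y > R \<Longrightarrow> p y = 0"
  shows "integrable lborel (\<lambda>y. f y * p y)"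
proof (rule Bochner_Integration.integrable_bound)
  have [measurable]: "f \<in> borel_measurable borel" using f by (simp add: loc_integrable_def)
  show "integrable lborel (\<lambda>y. of_real B * cutoff R f y)"
    using f by (intro integrable_mult_right) (simp add: loc_integrable_def)
  have B: "B \<ge> 0" using p(1)[of 0] norm_ge_zero[of "p 0"] by linarith
  show "AE y in lborel. cmod (f y * p y) \<le> cmod (of_real B * cutoff R f y)"
  proof (intro AE_I2)
    fix y
    show "cmod (f y * p y) \<le> cmod (of_real B * cutoff R f y)"
      using p(2)[of y] mult_right_mono[OF p(1)[of y], of "cmod (f y)"] B
      by (cases "norm y > R") (auto simp: cutoff_def norm_mult mult.commute)
  qed
  show "(\<lambda>y. f y * p y) \<in> borel_measurable lborel" by measurable
qed

lemma integrable_conv: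
  fixes f :: "'a::euclidean_space \<Rightarrow> complex"
  assumes f: "loc_integrable f" and K: "kernel K"
  shows "integrable lborel (\<lambda>y. f y * of_real (K (x - y)))"
proof -
  have [measurable]: "K \<in> borel_measurable borel" by (rule kernel_borel[OF K])
  obtain r B where r: "r > 0" "\<And>x. norm x > r \<Longrightarrow> K x = 0" and B: "B > 0" "\<And>x. \<bar>K x\<bar> \<le> B"
    using kernelE[OF K] by blast
  show ?thesis
  proof (rule loc_integrable_mult_bounded[OF f, where B=B and R="norm x + r"])
    fix y :: 'a assume "norm y > norm x + r"
    then have "norm (x - y) > r" using norm_triangle_ineq2[of y x] by (simp add: norm_minus_commute)
    then show "complex_of_real (K (x - y)) = 0" using r by simp
  qed (use B in auto)
qed

lemma integral_lborel_reflect: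
  fixes f :: "'a::euclidean_space \<Rightarrow> 'b::{banach, second_countable_topology}"
  assumes "f \<in> borel_measurable borel"
  shows "(LINT y|lborel. f (x - y)) = (LINT y|lborel. f y)"
  using integral_lborel_scale[of "-1" f x] assms by simp

lemma nn_integral_lborel_reflect:
  fixes f :: "'a::euclidean_space \<Rightarrow> ennreal"
  assumes "f \<in> borel_measurable borel"
  shows "(\<integral>\<^sup>+y. f (x - y) \<partial>lborel) = (\<integral>\<^sup>+y. f y \<partial>lborel)"
  using nn_integral_lborel_scale[of "-1" f x] assms by simp

lemma conv_alt:
  fixes f :: "'a::euclidean_space \<Rightarrow> complex"
  assumes [measurable]: "f \<in> borel_measurable borel" "K \<in> borel_measurable borel"
  shows "conv K f x = (LINT y|lborel. f (x - y) * of_real (K y))"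
  unfolding conv_def
  by (subst integral_lborel_reflect[of "\<lambda>y. f y * of_real (K (x - y))" x, symmetric]) simp_all

lemma integrable_conv_alt:
  fixes f :: "'a::euclidean_space \<Rightarrow> complex"
  assumes f: "loc_integrable f" and K: "kernel K"
  shows "integrable lborel (\<lambda>y. f (x - y) * of_real (K y))"
proof (rule integrableI_bounded)
  have [measurable]: "K \<in> borel_measurable borel" "f \<in> borel_measurable borel"
    using f kernel_borel[OF K] by (auto simp: loc_integrable_def)
  have "(\<integral>\<^sup>+y. ennreal (cmod (f (x - y) * of_real (K (x - (x - y))))) \<partial>lborel) =
      (\<integral>\<^sup>+y. ennreal (cmod (f y * of_real (K (x - y)))) \<partial>lborel)"
    by (rule nn_integral_lborel_reflect) measurable
  then show "(\<integral>\<^sup>+y. ennreal (cmod (f (x - y) * of_real (K y))) \<partial>lborel) < \<infinity>"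
    using integrable_conv[OF f K, of x] by (simp add: integrable_iff_bounded)
  show "(\<lambda>y. f (x - y) * of_real (K y)) \<in> borel_measurable lborel" by measurable
qed

lemma conv_measurable [measurable (raw)]:
  fixes f :: "'a::euclidean_space \<Rightarrow> complex"
  assumes [measurable]: "f \<in> borel_measurable borel" "K \<in> borel_measurable borel"
  shows "conv K f \<in> borel_measurable borel"
  unfolding conv_def[abs_def] by measurable

section \<open>Norm bounds for convolutions\<close>

lemma norm_integral_le_nn_integral:
  fixes f :: "'a \<Rightarrow> 'b::{banach, second_countable_topology}"
  shows "ennreal (norm (LINT x|M. f x)) \<le> (\<integral>\<^sup>+x. ennreal (norm (f x)) \<partial>M)"
  by (cases "integrable M f") (auto intro: integral_norm_bound_ennreal simp: not_integrable_integral_eq)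

text \<open>Cauchy-Schwarz for the measure |K| dy, after splitting |K| into two square roots. For a
  mollifier the first factor on the right is 1 and the inequality is Jensen's.\<close>

lemma weighted_Cauchy_Schwarz:
  fixes f :: "'a::euclidean_space \<Rightarrow> complex"
  assumes [measurable]: "f \<in> borel_measurable borel" "K \<in> borel_measurable borel"
  shows "ennreal ((cmod (LINT y|lborel. f y * of_real (K y)))\<^sup>2) \<le>
    (\<integral>\<^sup>+y. ennreal \<bar>K y\<bar> \<partial>lborel) * (\<integral>\<^sup>+y. ennreal (\<bar>K y\<bar> * (cmod (f y))\<^sup>2) \<partial>lborel)"
proof -
  have "ennreal ((cmod (LINT y|lborel. f y * of_real (K y)))\<^sup>2) =
      (ennreal (cmod (LINT y|lborel. f y * of_real (K y))))\<^sup>2"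
    by (simp add: ennreal_power)
  also have "\<dots> \<le> (\<integral>\<^sup>+y. ennreal (cmod (f y * of_real (K y))) \<partial>lborel)\<^sup>2"
    by (intro power_mono norm_integral_le_nn_integral) simp
  also have "(\<integral>\<^sup>+y. ennreal (cmod (f y * of_real (K y))) \<partial>lborel) =
      (\<integral>\<^sup>+y. ennreal (sqrt \<bar>K y\<bar>) * ennreal (sqrt \<bar>K y\<bar> * cmod (f y)) \<partial>lborel)"
  proof (intro nn_integral_cong)
    fix y
    have "cmod (f y * of_real (K y)) = sqrt \<bar>K y\<bar> * (sqrt \<bar>K y\<bar> * cmod (f y))"
      unfolding mult.assoc[symmetric] real_sqrt_mult_self by (simp add: norm_mult)
    then show "ennreal (cmod (f y * of_real (K y))) = ennreal (sqrt \<bar>K y\<bar>) * ennreal (sqrt \<bar>K y\<bar> * cmod (f y))"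
      by (simp only: ennreal_mult[symmetric] real_sqrt_ge_zero abs_ge_zero mult_nonneg_nonneg norm_ge_zero)
  qed
  also have "\<dots>\<^sup>2 \<le> (\<integral>\<^sup>+y. (ennreal (sqrt \<bar>K y\<bar>))\<^sup>2 \<partial>lborel) * (\<integral>\<^sup>+y. (ennreal (sqrt \<bar>K y\<bar> * cmod (f y)))\<^sup>2 \<partial>lborel)"
    by (rule Cauchy_Schwarz_nn_integral) measurable
  also have "\<dots> = (\<integral>\<^sup>+y. ennreal \<bar>K y\<bar> \<partial>lborel) * (\<integral>\<^sup>+y. ennreal (\<bar>K y\<bar> * (cmod (f y))\<^sup>2) \<partial>lborel)"
    by (simp add: ennreal_power power_mult_distrib)
  finally show ?thesis .
qed

text \<open>Young's convolution inequality for L^1 times L^2, from the weighted Cauchy-Schwarz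
  inequality and Tonelli.\<close>

lemma l2sq_conv_le:
  fixes f :: "'a::euclidean_space \<Rightarrow> complex"
  assumes [measurable]: "f \<in> borel_measurable borel" "K \<in> borel_measurable borel"
  shows "l2sq (conv K f) \<le> (\<integral>\<^sup>+y. ennreal \<bar>K y\<bar> \<partial>lborel)\<^sup>2 * l2sq f"
proof -
  define A where "A = (\<integral>\<^sup>+y. ennreal \<bar>K y\<bar> \<partial>lborel)"
  have "l2sq (conv K f) \<le> (\<integral>\<^sup>+x. A * (\<integral>\<^sup>+y. ennreal (\<bar>K y\<bar> * (cmod (f (x - y)))\<^sup>2) \<partial>lborel) \<partial>lborel)"
    unfolding l2sq_def A_def
    by (intro nn_integral_mono) (simp add: conv_alt weighted_Cauchy_Schwarz[of "\<lambda>y. f (x - y)" K for x])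
  also have "\<dots> = A * (\<integral>\<^sup>+x. (\<integral>\<^sup>+y. ennreal (\<bar>K y\<bar> * (cmod (f (x - y)))\<^sup>2) \<partial>lborel) \<partial>lborel)"
    by (rule nn_integral_cmult) measurable
  also have "(\<integral>\<^sup>+x. (\<integral>\<^sup>+y. ennreal (\<bar>K y\<bar> * (cmod (f (x - y)))\<^sup>2) \<partial>lborel) \<partial>lborel) =
      (\<integral>\<^sup>+y. (\<integral>\<^sup>+x. ennreal (\<bar>K y\<bar> * (cmod (f (x - y)))\<^sup>2) \<partial>lborel) \<partial>lborel)"
    by (rule lborel_pair.Fubini') measurable
  also have "\<dots> = (\<integral>\<^sup>+y. ennreal \<bar>K y\<bar> * l2sq f \<partial>lborel)"
  proof (intro nn_integral_cong)
    fix y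
    have "(\<integral>\<^sup>+x. ennreal (\<bar>K y\<bar> * (cmod (f (x - y)))\<^sup>2) \<partial>lborel) = ennreal \<bar>K y\<bar> * l2sq (\<lambda>x. f (x + (- y)))"
      unfolding l2sq_def by (simp add: ennreal_mult nn_integral_cmult)
    then show "(\<integral>\<^sup>+x. ennreal (\<bar>K y\<bar> * (cmod (f (x - y)))\<^sup>2) \<partial>lborel) = ennreal \<bar>K y\<bar> * l2sq f"
      using l2sq_shift[of f "- y"] by simp
  qed
  also have "\<dots> = A * l2sq f" unfolding A_def by (rule nn_integral_multc) measurable
  finally show ?thesis by (simp add: A_def power2_eq_square mult.assoc)
qed

lemma nn_integral_mollifier:
  "\<epsilon> > 0 \<Longrightarrow> (\<integral>\<^sup>+y. ennreal (mollifier \<epsilon> (y::'a::euclidean_space)) \<partial>lborel) = 1"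
  by (subst nn_integral_eq_integral) (auto simp: integrable_mollifier integral_mollifier mollifier_nonneg)

lemma frac_boundD:
  assumes "frac_bound s M f"
  shows "f \<in> borel_measurable borel" "square_integrable f" "loc_integrable f" "l2sq f \<le> ennreal M"
    "l2sq (\<lambda>x. f (x + h) - f x) \<le> ennreal (M * norm h powr (2 * s))"
proof -
  show "f \<in> borel_measurable borel" "l2sq f \<le> ennreal M"
    "l2sq (\<lambda>x. f (x + h) - f x) \<le> ennreal (M * norm h powr (2 * s))"
    using assms by (auto simp: frac_bound_def)
  then show "square_integrable f"
    by (auto simp: square_integrable_iff intro: le_less_trans)
  then show "loc_integrable f" by (rule square_integrable_imp_loc)
qed

text \<open>The difference is the average over z of f(x - y) - f(x - z), a translation difference
  whose step y - z has norm at most 2 \<open>DIM('a)\<close> \<epsilon>. With y = 0 it is the plain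
  mollification error; a general y in the support of the mollifier is what the nonlinear term calls
  for.\<close>

lemma mollify_diff_le:
  fixes f :: "'a::euclidean_space \<Rightarrow> complex" and \<epsilon> :: real
  assumes f: "frac_bound s M f" and s: "s > 0" and M: "M \<ge> 0" and \<epsilon>: "\<epsilon> > 0"
    and y: "norm y \<le> DIM('a) * \<epsilon>"
  shows "l2sq (\<lambda>x. f (x - y) - conv (mollifier \<epsilon>) f x) \<le> ennreal (M * (2 * DIM('a) * \<epsilon>) powr (2 * s))"
proof -
  note fD = frac_boundD[OF f]
  define K where "K = (mollifier \<epsilon> :: 'a \<Rightarrow> real)"
  have kK: "kernel K" unfolding K_def by (rule kernel_mollifier[OF \<epsilon>])
  have [measurable]: "f \<in> borel_measurable borel" "K \<in> borel_measurable borel"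
    using fD kernel_borel[OF kK] by auto
  have K0: "K z \<ge> 0" for z unfolding K_def by (rule mollifier_nonneg[OF \<epsilon>])
  have intK: "integrable lborel (\<lambda>z. complex_of_real (K z))"
    unfolding K_def by (simp add: complex_of_real_integrable_eq integrable_mollifier \<epsilon>)
  have one: "(LINT z|lborel. complex_of_real (K z)) = 1"
    unfolding K_def by (simp add: integral_complex_of_real integral_mollifier[OF \<epsilon>])
  have eq: "f (x - y) - conv K f x = (LINT z|lborel. (f (x - y) - f (x - z)) * of_real (K z))" for x
  proof -
    have "(LINT z|lborel. (f (x - y) - f (x - z)) * of_real (K z)) =
       (LINT z|lborel. f (x - y) * of_real (K z) - f (x - z) * of_real (K z))"
      by (simp add: left_diff_distrib)
    also have "\<dots> = f (x - y) * (LINT z|lborel. of_real (K z)) - conv K f x"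
      using integrable_conv_alt[OF fD(3) kK, of x] intK
      by (subst Bochner_Integration.integral_diff) (auto simp: conv_alt)
    finally show ?thesis unfolding one by simp
  qed
  have "l2sq (\<lambda>x. f (x - y) - conv K f x) \<le>
      (\<integral>\<^sup>+x. (\<integral>\<^sup>+z. ennreal (K z * (cmod (f (x - y) - f (x - z)))\<^sup>2) \<partial>lborel) \<partial>lborel)"
    unfolding l2sq_def
  proof (intro nn_integral_mono)
    fix x
    have "(\<integral>\<^sup>+z. ennreal \<bar>K z\<bar> \<partial>lborel) = 1"
      using nn_integral_mollifier[OF \<epsilon>, where 'a='a] K0 by (simp add: K_def)
    then show "ennreal ((cmod (f (x - y) - conv K f x))\<^sup>2) \<le>
        (\<integral>\<^sup>+z. ennreal (K z * (cmod (f (x - y) - f (x - z)))\<^sup>2) \<partial>lborel)"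
      unfolding eq using weighted_Cauchy_Schwarz[of "\<lambda>z. f (x - y) - f (x - z)" K] K0 by simp
  qed
  also have "\<dots> = (\<integral>\<^sup>+z. (\<integral>\<^sup>+x. ennreal (K z * (cmod (f (x - y) - f (x - z)))\<^sup>2) \<partial>lborel) \<partial>lborel)"
    by (rule lborel_pair.Fubini') measurable
  also have "\<dots> = (\<integral>\<^sup>+z. ennreal (K z) * l2sq (\<lambda>x. f (x - y) - f (x - z)) \<partial>lborel)"
    unfolding l2sq_def using K0 by (simp add: ennreal_mult nn_integral_cmult)
  also have "\<dots> \<le> (\<integral>\<^sup>+z. ennreal (K z) * ennreal (M * (2 * DIM('a) * \<epsilon>) powr (2 * s)) \<partial>lborel)"
  proof (intro nn_integral_mono)
    fix z :: 'a
    show "ennreal (K z) * l2sq (\<lambda>x. f (x - y) - f (x - z)) \<le>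
        ennreal (K z) * ennreal (M * (2 * DIM('a) * \<epsilon>) powr (2 * s))"
    proof (cases "norm z \<le> DIM('a) * \<epsilon>")
      case True
      have "l2sq (\<lambda>x. f (x - y) - f (x - z)) = l2sq (\<lambda>x. f (x + (- y)) - f (x + (- y) + (y - z)))"
        by (simp add: algebra_simps)
      also have "\<dots> = l2sq (\<lambda>x. f x - f (x + (y - z)))"
        by (rule l2sq_shift[where f="\<lambda>x. f x - f (x + (y - z))"]) measurable
      also have "\<dots> = l2sq (\<lambda>x. f (x + (y - z)) - f x)"
        by (simp add: l2sq_def norm_minus_commute)
      also have "\<dots> \<le> ennreal (M * norm (y - z) powr (2 * s))" by (rule fD)
      also have "\<dots> \<le> ennreal (M * (2 * DIM('a) * \<epsilon>) powr (2 * s))"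
        using s M y True norm_triangle_ineq4[of y z]
        by (intro ennreal_leI mult_left_mono powr_mono2) auto
      finally show ?thesis by (intro mult_left_mono) auto
    next
      case False
      then show ?thesis using mollifier_eq_0[OF \<epsilon>, of z] by (simp add: K_def)
    qed
  qed
  also have "\<dots> = ennreal (M * (2 * DIM('a) * \<epsilon>) powr (2 * s))"
  proof -
    have "(\<integral>\<^sup>+z. ennreal (K z) \<partial>lborel) = 1"
      unfolding K_def by (rule nn_integral_mollifier[OF \<epsilon>])
    then show ?thesis by (subst nn_integral_multc) simp_all
  qed
  finally show ?thesis by (simp add: K_def)
qed

text \<open>Cauchy-Schwarz against a mollifier whose height is of order \<epsilon>^(-d). Read
  backwards: the mollification can reach the height N only if N^2 \<epsilon>^d is at most of order
  M, which ties levels of f to scales of mollification.\<close>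

lemma mollify_sup_le:
  fixes f :: "'a::euclidean_space \<Rightarrow> complex" and \<epsilon> :: real
  assumes f: "frac_bound s M f" and M: "M \<ge> 0" and \<epsilon>: "\<epsilon> > 0"
  shows "(cmod (conv (mollifier \<epsilon>) f x))\<^sup>2 \<le> M / (\<epsilon> ^ DIM('a) * (LINT y|lborel. bump (y::'a)))"
proof -
  note fD = frac_boundD[OF f]
  define K where "K = (mollifier \<epsilon> :: 'a \<Rightarrow> real)"
  define c where "c = 1 / (\<epsilon> ^ DIM('a) * (LINT y|lborel. bump (y::'a)))"
  have c: "c \<ge> 0" unfolding c_def using \<epsilon> integral_bump_pos[where 'a='a] by simp
  have [measurable]: "f \<in> borel_measurable borel" "K \<in> borel_measurable borel"
    using fD kernel_borel[OF kernel_mollifier[OF \<epsilon>]] by (auto simp: K_def)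
  have K0: "K z \<ge> 0" for z unfolding K_def by (rule mollifier_nonneg[OF \<epsilon>])
  have one: "(\<integral>\<^sup>+z. ennreal \<bar>K z\<bar> \<partial>lborel) = 1"
    using nn_integral_mollifier[OF \<epsilon>, where 'a='a] K0 by (simp add: K_def)
  have "ennreal ((cmod (conv K f x))\<^sup>2) \<le> (\<integral>\<^sup>+z. ennreal (K z * (cmod (f (x - z)))\<^sup>2) \<partial>lborel)"
    using weighted_Cauchy_Schwarz[of "\<lambda>z. f (x - z)" K] K0 one by (simp add: conv_alt)
  also have "\<dots> \<le> (\<integral>\<^sup>+z. ennreal c * ennreal ((cmod (f (x - z)))\<^sup>2) \<partial>lborel)"
  proof (intro nn_integral_mono)
    fix z
    have "K z * (cmod (f (x - z)))\<^sup>2 \<le> c * (cmod (f (x - z)))\<^sup>2"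
      unfolding K_def c_def by (intro mult_right_mono mollifier_le \<epsilon>) auto
    then show "ennreal (K z * (cmod (f (x - z)))\<^sup>2) \<le> ennreal c * ennreal ((cmod (f (x - z)))\<^sup>2)"
      using c by (simp add: ennreal_mult[symmetric] ennreal_leI)
  qed
  also have "\<dots> = ennreal c * (\<integral>\<^sup>+z. ennreal ((cmod (f (x - z)))\<^sup>2) \<partial>lborel)"
    by (rule nn_integral_cmult) measurable
  also have "(\<integral>\<^sup>+z. ennreal ((cmod (f (x - z)))\<^sup>2) \<partial>lborel) = l2sq f"
    unfolding l2sq_def by (rule nn_integral_lborel_reflect) measurable
  also have "ennreal c * l2sq f \<le> ennreal c * ennreal M" by (intro mult_left_mono fD) simp
  finally have "ennreal ((cmod (conv K f x))\<^sup>2) \<le> ennreal (c * M)"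
    using c M by (simp add: ennreal_mult)
  then show ?thesis
    using c M by (simp add: ennreal_le_iff K_def c_def)
qed

section \<open>The logarithmic nonlinearity\<close>

lemma log_nonlinearity_measurable [measurable]: "log_nonlinearity \<in> borel_measurable borel"
  unfolding log_nonlinearity_def by measurable

text \<open>By the choice of \<open>N\<close>, the mollification is at most \<open>N / 2\<close> everywhere; so where \<open>|f| > N\<close>,
  \<open>|f|\<close> is at most twice its distance to the mollification.\<close>

lemma large_values_le:
  fixes f :: "'a::euclidean_space \<Rightarrow> complex" and \<epsilon> :: real
  assumes f: "frac_bound s M f" and s: "s > 0" and M: "M \<ge> 0" and \<epsilon>: "\<epsilon> > 0"
    and N: "4 * M \<le> N\<^sup>2 * (\<epsilon> ^ DIM('a) * (LINT y|lborel. bump (y::'a)))" "N \<ge> 0"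
  shows "(\<integral>\<^sup>+x. ennreal ((cmod (f x))\<^sup>2) * indicator {x. cmod (f x) > N} x \<partial>lborel)
     \<le> ennreal (4 * M * (2 * DIM('a) * \<epsilon>) powr (2 * s))"
proof -
  note fD = frac_boundD[OF f]
  define W where "W = conv (mollifier \<epsilon>) f"
  have [measurable]: "f \<in> borel_measurable borel" "W \<in> borel_measurable borel"
    using fD kernel_borel[OF kernel_mollifier[OF \<epsilon>]] unfolding W_def by (auto intro!: conv_measurable)
  have W: "2 * cmod (W x) \<le> N" for x
  proof -
    have "(cmod (W x))\<^sup>2 \<le> M / (\<epsilon> ^ DIM('a) * (LINT y|lborel. bump (y::'a)))"
      unfolding W_def by (rule mollify_sup_le[OF f M \<epsilon>])
    also have "\<dots> \<le> N\<^sup>2 / 4"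
      using N integral_bump_pos[where 'a='a] \<epsilon> by (simp add: field_simps)
    finally have "(2 * cmod (W x))\<^sup>2 \<le> N\<^sup>2" by (simp add: power_mult_distrib)
    then show ?thesis using N(2) by (rule power2_le_imp_le)
  qed
  have "(\<integral>\<^sup>+x. ennreal ((cmod (f x))\<^sup>2) * indicator {x. cmod (f x) > N} x \<partial>lborel)
     \<le> (\<integral>\<^sup>+x. 4 * ennreal ((cmod (f x - W x))\<^sup>2) \<partial>lborel)"
  proof (intro nn_integral_mono)
    fix x
    show "ennreal ((cmod (f x))\<^sup>2) * indicator {x. cmod (f x) > N} x \<le> 4 * ennreal ((cmod (f x - W x))\<^sup>2)"
    proof (cases "cmod (f x) > N")
      case True
      have "cmod (f x) \<le> 2 * cmod (f x - W x)"
        using W[of x] True norm_triangle_ineq2[of "f x" "W x"] by linarith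
      then have "(cmod (f x))\<^sup>2 \<le> (2 * cmod (f x - W x))\<^sup>2" by (intro power_mono) auto
      then have "ennreal ((cmod (f x))\<^sup>2) \<le> ennreal (4 * (cmod (f x - W x))\<^sup>2)"
        by (intro ennreal_leI) (simp add: power_mult_distrib)
      then show ?thesis using True by (simp add: ennreal_mult')
    qed simp
  qed
  also have "\<dots> = 4 * l2sq (\<lambda>x. f x - W x)" unfolding l2sq_def by (rule nn_integral_cmult) measurable
  also have "\<dots> \<le> 4 * ennreal (M * (2 * DIM('a) * \<epsilon>) powr (2 * s))"
    using mollify_diff_le[OF f s M \<epsilon>, of 0] \<epsilon> by (intro mult_left_mono) (auto simp: W_def)
  also have "\<dots> = ennreal (4 * M * (2 * DIM('a) * \<epsilon>) powr (2 * s))"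
    by (simp add: ennreal_mult' mult.assoc)
  finally show ?thesis .
qed

text \<open>For the level exp k the mollification scale is the smallest one that
  \<open>large_values_le\<close> admits. It decays geometrically in k, and so does the resulting
  bound of order \<epsilon>^(2s). The lemma acts as a weak form of Sobolev embedding, strong enough
  to absorb logarithms.\<close>

lemma large_values_geometric:
  fixes s M :: real
  assumes s: "s > 0" and M: "M > 0"
  obtains B q where "B \<ge> 0" "0 \<le> q" "q < 1" and "\<And>(f::'a::euclidean_space \<Rightarrow> complex) k. frac_bound s M f \<Longrightarrow>
    (\<integral>\<^sup>+x. ennreal ((cmod (f x))\<^sup>2) * indicator {x. cmod (f x) > exp (real k)} x \<partial>lborel) \<le> ennreal (B * q ^ k)"
proof -
  define I where "I = (LINT y|lborel. bump (y::'a))"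
  have I: "I > 0" unfolding I_def by (rule integral_bump_pos)
  define d where "d = real DIM('a)"
  have d: "d > 0" by (simp add: d_def)
  \<comment> \<open>Chosen so that p^d = 4 M / I; then \<epsilon> = p exp(-2k/d) gives equality in
    the condition that \<open>large_values_le\<close> puts on the level N = exp k.\<close>
  define p where "p = (4 * M / I) powr (1 / d)"
  have p: "p > 0" using M I by (simp add: p_def)
  define B where "B = 4 * M * (2 * d * p) powr (2 * s)"
  \<comment> \<open>The k-dependent part of \<epsilon>^(2s) is exp(-2k/d)^(2s), that is,
    q^k.\<close>
  define q where "q = exp (- (4 * s / d))"
  show thesis
  proof (rule that[of B q])
    show "B \<ge> 0" "0 \<le> q" "q < 1" using M s d by (auto simp: B_def q_def)
    fix f :: "'a \<Rightarrow> complex" and k :: nat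
    assume f: "frac_bound s M f"
    define \<epsilon> where "\<epsilon> = p * exp (- (2 * real k / d))"
    have \<epsilon>: "\<epsilon> > 0" using p by (simp add: \<epsilon>_def)
    have "\<epsilon> ^ DIM('a) = p powr d * exp (- (2 * real k))"
    proof -
      have "\<epsilon> ^ DIM('a) = \<epsilon> powr d" using \<epsilon> by (simp add: d_def powr_realpow)
      also have "\<dots> = p powr d * exp (- (2 * real k / d)) powr d"
        using p by (simp add: \<epsilon>_def powr_mult)
      also have "exp (- (2 * real k / d)) powr d = exp (- (2 * real k))"
        using d by (simp add: powr_def)
      finally show ?thesis .
    qed
    also have "p powr d = 4 * M / I"
      using d M I by (simp add: p_def powr_powr)
    finally have "(exp (real k))\<^sup>2 * (\<epsilon> ^ DIM('a) * I) = 4 * M * ((exp (real k))\<^sup>2 * exp (- (2 * real k)))"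
      using I by simp
    also have "(exp (real k))\<^sup>2 * exp (- (2 * real k)) = 1"
      by (simp add: power2_eq_square mult_exp_exp)
    finally have "4 * M \<le> (exp (real k))\<^sup>2 * (\<epsilon> ^ DIM('a) * I)" by simp
    then have "(\<integral>\<^sup>+x. ennreal ((cmod (f x))\<^sup>2) * indicator {x. cmod (f x) > exp (real k)} x \<partial>lborel)
       \<le> ennreal (4 * M * (2 * DIM('a) * \<epsilon>) powr (2 * s))"
      using M unfolding I_def by (intro large_values_le[OF f s _ \<epsilon>]) auto
    also have "4 * M * (2 * DIM('a) * \<epsilon>) powr (2 * s) = B * q ^ k"
    proof -
      have "(2 * DIM('a) * \<epsilon>) powr (2 * s) = (2 * d * p * exp (- (2 * real k / d))) powr (2 * s)"
        by (simp add: \<epsilon>_def d_def mult.assoc)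
      also have "\<dots> = (2 * d * p) powr (2 * s) * exp (- (2 * real k / d)) powr (2 * s)"
        using d p by (simp add: powr_mult)
      also have "exp (- (2 * real k / d)) powr (2 * s) = q ^ k"
        by (simp add: powr_def q_def exp_of_nat_mult[symmetric])
      finally show ?thesis by (simp add: B_def)
    qed
    finally show "(\<integral>\<^sup>+x. ennreal ((cmod (f x))\<^sup>2) * indicator {x. cmod (f x) > exp (real k)} x \<partial>lborel)
       \<le> ennreal (B * q ^ k)" .
  qed
qed

text \<open>Exponential layers: where exp k < |f| \<le> exp(k + 1) the logarithm is at most k + 1,
  and the weight (k + 1)^2 is summable against the geometric decay.\<close>

lemma log_sq_large_values:
  fixes s M :: real
  assumes s: "s > 0" and M: "M > 0"
  obtains C where "C \<ge> 0" and "\<And>f::'a::euclidean_space \<Rightarrow> complex. frac_bound s M f \<Longrightarrow>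
    (\<integral>\<^sup>+x. ennreal ((cmod (f x) * ln (cmod (f x)))\<^sup>2) * indicator {x. cmod (f x) > 1} x \<partial>lborel) \<le> ennreal C"
proof -
  obtain B q where Bq: "B \<ge> 0" "0 \<le> q" "q < 1" and le: "\<And>(f::'a \<Rightarrow> complex) k. frac_bound s M f \<Longrightarrow>
    (\<integral>\<^sup>+x. ennreal ((cmod (f x))\<^sup>2) * indicator {x. cmod (f x) > exp (real k)} x \<partial>lborel) \<le> ennreal (B * q ^ k)"
    using large_values_geometric[OF s M] by blast
  have sm: "summable (\<lambda>k. (real k + 1)\<^sup>2 * (B * q ^ k))"
  proof (cases "q = 0")
    case True
    then show ?thesis by (intro summable_finite[of "{0}"]) auto
  next
    case False
    then have q: "0 < q" using Bq by simp
    show ?thesis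
    proof (rule summable_comparison_test_bigo)
      \<comment> \<open>Of q^k = r^k r^k one factor absorbs the polynomial and the other remains for
        the geometric series.\<close>
      define r where "r = sqrt q"
      have r: "0 < r" "r < 1" using q Bq by (auto simp: r_def)
      show "summable (\<lambda>k. norm (r ^ k))" using r by (simp add: summable_geometric)
      have "(\<lambda>k. (real k + 1)\<^sup>2 * (B * (r * r) ^ k)) \<in> O(\<lambda>k. r ^ k)"
        using r unfolding power_mult_distrib by real_asymp
      then show "(\<lambda>k. (real k + 1)\<^sup>2 * (B * q ^ k)) \<in> O(\<lambda>k. r ^ k)"
        using q by (simp add: r_def)
    qed
  qed
  define C where "C = (\<Sum>k. (real k + 1)\<^sup>2 * (B * q ^ k))"
  show thesis
  proof (rule that[of C])
    show "C \<ge> 0" unfolding C_def using Bq by (intro suminf_nonneg sm) simp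
    fix f :: "'a \<Rightarrow> complex"
    assume f: "frac_bound s M f"
    have [measurable]: "f \<in> borel_measurable borel" by (rule frac_boundD[OF f])
    have "(\<integral>\<^sup>+x. ennreal ((cmod (f x) * ln (cmod (f x)))\<^sup>2) * indicator {x. cmod (f x) > 1} x \<partial>lborel) \<le>
       (\<integral>\<^sup>+x. (\<Sum>k. ennreal ((real k + 1)\<^sup>2) * (ennreal ((cmod (f x))\<^sup>2) * indicator {x. cmod (f x) > exp (real k)} x)) \<partial>lborel)"
    proof (intro nn_integral_mono)
      fix x
      show "ennreal ((cmod (f x) * ln (cmod (f x)))\<^sup>2) * indicator {x. cmod (f x) > 1} x \<le>
        (\<Sum>k. ennreal ((real k + 1)\<^sup>2) * (ennreal ((cmod (f x))\<^sup>2) * indicator {x. cmod (f x) > exp (real k)} x))"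
      proof (cases "cmod (f x) > 1")
        case True
        define L where "L = ln (cmod (f x))"
        have L: "L > 0" unfolding L_def using True by (rule ln_gt_zero)
        \<comment> \<open>Rounding up and subtracting 1 gives k < L \<le> k + 1. The strict
          inequality is the one that the indicator at level exp k asks for; rounding down would lose
          it when L is an integer.\<close>
        define k where "k = nat (\<lceil>L\<rceil> - 1)"
        have ceil: "\<lceil>L\<rceil> \<ge> 1" using L by linarith
        have k: "real k = of_int \<lceil>L\<rceil> - 1" using ceil by (simp add: k_def)
        have "real k < L" unfolding k using ceiling_correct[of L] by linarith
        then have ek: "exp (real k) < cmod (f x)"
          using True by (metis L_def exp_less_mono exp_ln less_trans zero_less_one)
        have "L \<le> real k + 1" unfolding k using ceiling_correct[of L] by linarith
        then have "(cmod (f x) * L)\<^sup>2 \<le> (real k + 1)\<^sup>2 * (cmod (f x))\<^sup>2"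
          unfolding power_mult_distrib mult.commute[of "(cmod (f x))\<^sup>2"]
          using L by (intro mult_right_mono power_mono) auto
        then have "ennreal ((cmod (f x) * L)\<^sup>2) \<le> ennreal ((real k + 1)\<^sup>2) * ennreal ((cmod (f x))\<^sup>2)"
          by (subst ennreal_mult[symmetric]) (auto intro: ennreal_leI)
        also have "\<dots> = (\<Sum>k\<in>{k}. ennreal ((real k + 1)\<^sup>2) * (ennreal ((cmod (f x))\<^sup>2) * indicator {x. cmod (f x) > exp (real k)} x))"
          using ek by simp
        also have "\<dots> \<le> (\<Sum>k. ennreal ((real k + 1)\<^sup>2) * (ennreal ((cmod (f x))\<^sup>2) * indicator {x. cmod (f x) > exp (real k)} x))"
          by (rule sum_le_suminf) auto
        finally show ?thesis using True by (simp add: L_def)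
      qed simp
    qed
    also have "\<dots> = (\<Sum>k. ennreal ((real k + 1)\<^sup>2) *
        (\<integral>\<^sup>+x. ennreal ((cmod (f x))\<^sup>2) * indicator {x. cmod (f x) > exp (real k)} x \<partial>lborel))"
      by (subst nn_integral_suminf) (simp_all add: nn_integral_cmult)
    also have "\<dots> \<le> (\<Sum>k. ennreal ((real k + 1)\<^sup>2) * ennreal (B * q ^ k))"
      by (intro suminf_le mult_left_mono le f) auto
    also have "\<dots> = (\<Sum>k. ennreal ((real k + 1)\<^sup>2 * (B * q ^ k)))"
      using Bq by (simp add: ennreal_mult)
    also have "\<dots> = ennreal C"
      unfolding C_def using Bq by (intro suminf_ennreal_eq summable_sums sm) auto
    finally show "(\<integral>\<^sup>+x. ennreal ((cmod (f x) * ln (cmod (f x)))\<^sup>2) * indicator {x. cmod (f x) > 1} x \<partial>lborel) \<le> ennreal C" .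
  qed
qed

section \<open>The nonlinearity on balls, and the scalar inequality\<close>

lemma cmod_log_nonlinearity: "cmod (log_nonlinearity z) = 2 * \<bar>cmod z * ln (cmod z)\<bar>"
  unfolding log_nonlinearity_def
  by (cases "z = 0") (auto simp: norm_mult ln_realpow abs_mult)

text \<open>A free threshold separates two regimes. Above it the logarithm is at most |ln \<mu>|.
  Below it the bound is 16 |z|, hence 16 \<mu>; this term does not decay where f does, so it has to
  be paid for by the volume of the region of integration.\<close>

lemma log_nonlinearity_small:
  assumes z: "cmod z \<le> 1" and \<mu>: "0 < \<mu>" "\<mu> \<le> 1"
  shows "(cmod (log_nonlinearity z))\<^sup>2 \<le> 16 * \<mu> + 4 * (ln \<mu>)\<^sup>2 * (cmod z)\<^sup>2"
proof (cases "cmod z \<ge> \<mu>")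
  case True
  have "\<bar>ln (cmod z)\<bar> \<le> \<bar>ln \<mu>\<bar>"
  proof -
    have "cmod z > 0" using True \<mu> by linarith
    then have "ln \<mu> \<le> ln (cmod z)" "ln (cmod z) \<le> 0"
      using True \<mu> z by (simp_all del: zero_less_norm_iff)
    then show ?thesis by simp
  qed
  then have "(ln (cmod z))\<^sup>2 \<le> (ln \<mu>)\<^sup>2" by (simp add: abs_le_square_iff)
  then have "4 * (ln (cmod z))\<^sup>2 * (cmod z)\<^sup>2 \<le> 4 * (ln \<mu>)\<^sup>2 * (cmod z)\<^sup>2"
    by (intro mult_right_mono) auto
  moreover have "16 * \<mu> \<ge> 0" using \<mu> by simp
  moreover have "(cmod (log_nonlinearity z))\<^sup>2 = 4 * (ln (cmod z))\<^sup>2 * (cmod z)\<^sup>2"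
    by (simp add: cmod_log_nonlinearity power_mult_distrib mult_ac)
  ultimately show ?thesis by linarith
next
  case False
  define t where "t = cmod z"
  have "(cmod (log_nonlinearity z))\<^sup>2 \<le> 16 * t"
  proof (cases "z = 0")
    case False
    then have t: "t > 0" "t \<le> 1" using z by (auto simp: t_def)
    \<comment> \<open>The inequality ln x \<le> x - 1 at x = 1 / sqrt t. With the square root, the
      squared logarithm costs only 4 / t against the t^2 in front of it.\<close>
    have "- ln t / 2 \<le> 1 / sqrt t"
      using ln_le_minus_one[of "1 / sqrt t"] t by (simp add: ln_div ln_sqrt)
    then have "\<bar>ln t\<bar> \<le> 2 / sqrt t" using t by simp
    then have "(ln t)\<^sup>2 \<le> (2 / sqrt t)\<^sup>2" using t by (simp add: abs_le_square_iff[symmetric])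
    also have "\<dots> = 4 / t" using t by (simp add: power_divide)
    finally have "4 * t\<^sup>2 * (ln t)\<^sup>2 \<le> 4 * t\<^sup>2 * (4 / t)" by (intro mult_left_mono) auto
    also have "\<dots> = 16 * t" using t by (simp add: power2_eq_square)
    finally show ?thesis
      by (simp add: cmod_log_nonlinearity power_mult_distrib t_def)
  qed (simp add: log_nonlinearity_def t_def)
  moreover have "16 * t \<le> 16 * \<mu>" using False by (simp add: t_def)
  moreover have "0 \<le> 4 * (ln \<mu>)\<^sup>2 * (cmod z)\<^sup>2" by simp
  ultimately show ?thesis by linarith
qed

lemma l2_ball_log_nonlinearity:
  fixes s M :: real
  assumes s: "s > 0" and M: "M > 0"
  obtains C where "C \<ge> 0" and "\<And>(f::'a::euclidean_space \<Rightarrow> complex) R. frac_bound s M f \<Longrightarrow> R \<ge> 1 \<Longrightarrow>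
    l2sq (cutoff R (\<lambda>x. log_nonlinearity (f x))) \<le> ennreal (C * (1 + (ln R)\<^sup>2))"
proof -
  obtain C0 where C0: "C0 \<ge> 0" and le: "\<And>f::'a \<Rightarrow> complex. frac_bound s M f \<Longrightarrow>
    (\<integral>\<^sup>+x. ennreal ((cmod (f x) * ln (cmod (f x)))\<^sup>2) * indicator {x. cmod (f x) > 1} x \<partial>lborel) \<le> ennreal C0"
    using log_sq_large_values[OF s M] by blast
  define v where "v = unit_ball_vol (real DIM('a))"
  have v: "v \<ge> 0" by (simp add: v_def)
  define d where "d = real DIM('a)"
  define C where "C = 16 * v + 4 * C0 + 4 * d\<^sup>2 * M"
  show thesis
  proof (rule that[of C])
    show "C \<ge> 0" using v C0 M by (simp add: C_def)
    fix f :: "'a \<Rightarrow> complex" and R :: real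
    assume f: "frac_bound s M f" and R: "R \<ge> 1"
    have [measurable]: "f \<in> borel_measurable borel" by (rule frac_boundD[OF f])
    have [measurable]: "cball (0::'a) R \<in> sets borel" by simp
    \<comment> \<open>The inverse volume of the ball up to a constant: the term 16 \<mu> then
      integrates to 16 \<open>v\<close>, independently of R, while (ln \<mu>)^2 is d^2 (ln
      R)^2.\<close>
    define \<mu> where "\<mu> = 1 / R ^ DIM('a)"
    have \<mu>: "0 < \<mu>" "\<mu> \<le> 1" using R by (auto simp: \<mu>_def)
    have ln\<mu>: "(ln \<mu>)\<^sup>2 = d\<^sup>2 * (ln R)\<^sup>2"
      using R by (simp add: \<mu>_def ln_div ln_realpow d_def power_mult_distrib)
    have "l2sq (cutoff R (\<lambda>x. log_nonlinearity (f x))) \<le>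
      (\<integral>\<^sup>+x. ennreal (16 * \<mu>) * indicator (cball 0 R) x + (ennreal (4 * (ln \<mu>)\<^sup>2) * ennreal ((cmod (f x))\<^sup>2)
        + 4 * (ennreal ((cmod (f x) * ln (cmod (f x)))\<^sup>2) * indicator {x. cmod (f x) > 1} x)) \<partial>lborel)"
      unfolding l2sq_def
    proof (intro nn_integral_mono)
      fix x
      show "ennreal ((cmod (cutoff R (\<lambda>x. log_nonlinearity (f x)) x))\<^sup>2) \<le>
        ennreal (16 * \<mu>) * indicator (cball 0 R) x + (ennreal (4 * (ln \<mu>)\<^sup>2) * ennreal ((cmod (f x))\<^sup>2)
        + 4 * (ennreal ((cmod (f x) * ln (cmod (f x)))\<^sup>2) * indicator {x. cmod (f x) > 1} x))"
      proof (cases "norm x \<le> R")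
        case True
        show ?thesis
        proof (cases "cmod (f x) > 1")
          case big: True
          have "(cmod (log_nonlinearity (f x)))\<^sup>2 = 4 * (cmod (f x) * ln (cmod (f x)))\<^sup>2"
            by (simp add: cmod_log_nonlinearity power_mult_distrib)
          then have "ennreal ((cmod (cutoff R (\<lambda>x. log_nonlinearity (f x)) x))\<^sup>2) =
              4 * (ennreal ((cmod (f x) * ln (cmod (f x)))\<^sup>2) * indicator {x. cmod (f x) > 1} x)"
            using True big by (simp add: cutoff_def ennreal_mult')
          then show ?thesis by (simp add: add_increasing)
        next
          case False
          then have "(cmod (log_nonlinearity (f x)))\<^sup>2 \<le> 16 * \<mu> + 4 * (ln \<mu>)\<^sup>2 * (cmod (f x))\<^sup>2"
            by (intro log_nonlinearity_small \<mu>) auto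
          then have "ennreal ((cmod (log_nonlinearity (f x)))\<^sup>2) \<le> ennreal (16 * \<mu> + 4 * (ln \<mu>)\<^sup>2 * (cmod (f x))\<^sup>2)"
            by (rule ennreal_leI)
          then show ?thesis using True False \<mu> by (simp add: cutoff_def ennreal_mult')
        qed
      qed (simp add: cutoff_def)
    qed
    also have "\<dots> = ennreal (16 * \<mu>) * emeasure lborel (cball (0::'a) R) + (ennreal (4 * (ln \<mu>)\<^sup>2) * l2sq f
       + 4 * (\<integral>\<^sup>+x. ennreal ((cmod (f x) * ln (cmod (f x)))\<^sup>2) * indicator {x. cmod (f x) > 1} x \<partial>lborel))"
      unfolding l2sq_def by (simp add: nn_integral_add nn_integral_cmult nn_integral_cmult_indicator)
    also have "\<dots> \<le> ennreal (16 * \<mu>) * ennreal (v * R ^ DIM('a)) + (ennreal (4 * (ln \<mu>)\<^sup>2) * ennreal M + 4 * ennreal C0)"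
      using R emeasure_cball[of R "0::'a"] by (intro add_mono mult_left_mono le f frac_boundD[OF f]) (auto simp: v_def)
    also have "\<dots> = ennreal (16 * \<mu> * (v * R ^ DIM('a)) + (4 * (ln \<mu>)\<^sup>2 * M + 4 * C0))"
    proof -
      have "ennreal a * ennreal w + (ennreal b * ennreal M + 4 * ennreal C0) = ennreal (a * w + (b * M + 4 * C0))"
        if "a \<ge> 0" "w \<ge> 0" "b \<ge> 0" for a b w :: real
        using that M C0 by (simp add: ennreal_mult)
      then show ?thesis using \<mu> v R by simp
    qed
    also have "16 * \<mu> * (v * R ^ DIM('a)) = 16 * v" using R by (simp add: \<mu>_def)
    also have "ennreal (16 * v + (4 * (ln \<mu>)\<^sup>2 * M + 4 * C0)) \<le> ennreal (C * (1 + (ln R)\<^sup>2))"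
    proof (intro ennreal_leI)
      have "0 \<le> (16 * v + 4 * C0) * (ln R)\<^sup>2" "0 \<le> 4 * d\<^sup>2 * M" using v C0 M by simp_all
      then show "16 * v + (4 * (ln \<mu>)\<^sup>2 * M + 4 * C0) \<le> C * (1 + (ln R)\<^sup>2)"
        unfolding ln\<mu> C_def by (simp add: algebra_simps)
    qed
    finally show "l2sq (cutoff R (\<lambda>x. log_nonlinearity (f x))) \<le> ennreal (C * (1 + (ln R)\<^sup>2))" .
  qed
qed

text \<open>The diagonal terms are real, so only Im (a cnj b) times the difference of the logarithms
  survives. Let x be the argument of smaller modulus and y the other. Since x cnj x is real, the
  first factor is at most |x| |x - y|; the second is at most 2 |x - y| / |x|. The singular 1 / |x|
  cancels.\<close>

lemma Im_log_nonlinearity_le: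
  "\<bar>Im ((log_nonlinearity a - log_nonlinearity b) * cnj (a - b))\<bar> \<le> 2 * (cmod (a - b))\<^sup>2"
proof -
  define la lb where "la = ln ((cmod a)\<^sup>2)" and "lb = ln ((cmod b)\<^sup>2)"
  have eq: "Im ((log_nonlinearity a - log_nonlinearity b) * cnj (a - b)) = Im (a * cnj b) * (lb - la)"
    by (simp add: log_nonlinearity_def la_def[symmetric] lb_def[symmetric] algebra_simps)
  have *: "\<bar>Im (x * cnj y) * (ln ((cmod y)\<^sup>2) - ln ((cmod x)\<^sup>2))\<bar> \<le> 2 * (cmod (x - y))\<^sup>2"
    if le: "cmod x \<le> cmod y" for x y
  proof (cases "x = 0")
    case False
    then have x: "cmod x > 0" and y: "cmod y > 0" using le by (auto intro: less_le_trans)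
    have "\<bar>Im (x * cnj y)\<bar> = \<bar>Im (x * cnj (y - x))\<bar>"
      by (simp add: algebra_simps)
    also have "\<dots> \<le> cmod (x * cnj (y - x))" by (rule abs_Im_le_cmod)
    also have "\<dots> = cmod x * cmod (x - y)" by (simp add: norm_mult norm_minus_commute del: complex_cnj_diff)
    finally have 1: "\<bar>Im (x * cnj y)\<bar> \<le> cmod x * cmod (x - y)" .
    have "ln (cmod y) - ln (cmod x) = ln (cmod y / cmod x)" using x y by (simp add: ln_div)
    also have "\<dots> \<le> cmod y / cmod x - 1" using x y by (intro ln_le_minus_one) simp
    also have "\<dots> = (cmod y - cmod x) / cmod x" using x by (simp add: field_simps)
    also have "\<dots> \<le> cmod (x - y) / cmod x"
      using x norm_triangle_ineq2[of y x] by (intro divide_right_mono) (auto simp: norm_minus_commute)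
    finally have "ln (cmod y) - ln (cmod x) \<le> cmod (x - y) / cmod x" .
    moreover have "ln (cmod y) - ln (cmod x) \<ge> 0" using x y le by simp
    ultimately have 2: "\<bar>ln ((cmod y)\<^sup>2) - ln ((cmod x)\<^sup>2)\<bar> \<le> 2 * (cmod (x - y) / cmod x)"
      using x y by (simp add: ln_realpow)
    have "\<bar>Im (x * cnj y) * (ln ((cmod y)\<^sup>2) - ln ((cmod x)\<^sup>2))\<bar> \<le>
        (cmod x * cmod (x - y)) * (2 * (cmod (x - y) / cmod x))"
      unfolding abs_mult by (intro mult_mono 1 2) auto
    also have "\<dots> = 2 * (cmod (x - y))\<^sup>2" using x by (simp add: power2_eq_square)
    finally show ?thesis .
  qed simp
  show ?thesis
  proof (cases "cmod a \<le> cmod b")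
    case True
    then show ?thesis unfolding eq la_def lb_def by (rule *)
  next
    case False
    have "Im (a * cnj b) * (lb - la) = Im (b * cnj a) * (la - lb)" by (simp add: algebra_simps)
    then show ?thesis
      unfolding eq using False *[of b a] by (simp add: la_def lb_def norm_minus_commute)
  qed
qed

section \<open>Pairings with test functions\<close>

definition pair_with :: "('a::euclidean_space \<Rightarrow> complex) \<Rightarrow> ('a \<Rightarrow> complex) \<Rightarrow> complex" where
  "pair_with f \<psi> = (LINT x|lborel. f x * \<psi> x)"

abbreviation "test \<equiv> test_function UNIV"

lemma testE:
  assumes "test (\<psi> :: 'a::euclidean_space \<Rightarrow> complex)"
  obtains r B where "r > 0" "\<And>x. norm x > r \<Longrightarrow> \<psi> x = 0" "B > 0" "\<And>x. cmod (\<psi> x) \<le> B" "\<psi> \<in> borel_measurable borel"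
proof -
  have sm: "smooth \<psi>" and co: "compact (closure {z. \<psi> z \<noteq> 0})"
    using assms by (auto simp: test_function_def)
  obtain r where r: "r > 0" "\<And>x. x \<in> closure {z. \<psi> z \<noteq> 0} \<Longrightarrow> norm x \<le> r"
    using compact_imp_bounded[OF co] bounded_pos by metis
  have r0: "\<psi> x = 0" if "norm x > r" for x
    using r(2)[of x] that closure_subset[of "{z. \<psi> z \<noteq> 0}"] by force
  have "compact (\<psi> ` cball 0 r)"
    by (intro compact_continuous_image continuous_on_subset[OF smooth_imp_continuous[OF sm]]) auto
  then obtain B where B: "B > 0" "\<And>x. x \<in> cball 0 r \<Longrightarrow> norm (\<psi> x) \<le> B"
    using bounded_pos compact_imp_bounded by (metis imageI)
  have "cmod (\<psi> x) \<le> B" for x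
    using B r0[of x] by (cases "norm x > r") auto
  then show thesis using that r r0 B smooth_borel[OF sm] by blast
qed

lemma testI:
  assumes sm: "smooth \<psi>" and r: "\<And>x. norm x > r \<Longrightarrow> \<psi> x = 0"
  shows "test (\<psi> :: 'a::euclidean_space \<Rightarrow> complex)"
proof -
  have "closure {z. \<psi> z \<noteq> 0} \<subseteq> cball 0 r"
    by (intro closure_minimal) (use r in \<open>auto simp: not_less[symmetric]\<close>)
  then have "compact (closure {z. \<psi> z \<noteq> 0})"
    by (meson bounded_cball bounded_subset closed_closure compact_eq_bounded_closed)
  then show ?thesis using sm by (simp add: test_function_def)
qed

section \<open>Measurability in time of pairings\<close>

text \<open>On the exceptional null set the limit function is arbitrary, and completeness of
  Lebesgue measure absorbs it. With a constant sequence the lemma also transports measurability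
  along equality almost everywhere.\<close>

lemma lebesgue_measurable_AE_limit:
  fixes f :: "'a::euclidean_space \<Rightarrow> 'b::{metric_space, real_normed_vector}"
  assumes g: "\<And>n::nat. g n \<in> borel_measurable lebesgue"
    and lim: "AE x in lebesgue. (\<lambda>n. g n x) \<longlonglongrightarrow> f x"
  shows "f \<in> borel_measurable lebesgue"
proof -
  obtain N where N: "N \<in> null_sets lebesgue" "{x \<in> space lebesgue. \<not> (\<lambda>n. g n x) \<longlonglongrightarrow> f x} \<subseteq> N"
    using lim by (auto simp: eventually_ae_filter)
  define f' where "f' = (\<lambda>x. if x \<in> N then 0 else f x)"
  have Ns: "N \<in> sets lebesgue" using N by (simp add: null_sets_def)
  have "f' \<in> borel_measurable lebesgue"
  proof (rule borel_measurable_LIMSEQ_metric)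
    show "(\<lambda>x. if x \<in> N then 0 else g n x) \<in> borel_measurable lebesgue" for n
      using g[of n] Ns by (intro measurable_If_set) auto
    show "(\<lambda>n. if x \<in> N then 0 else g n x) \<longlonglongrightarrow> f' x" for x
      using N by (auto simp: f'_def)
  qed
  show ?thesis
  proof (rule measurableI)
    fix A :: "'b set" assume A: "A \<in> sets borel"
    have meas: "f' -` A \<inter> space lebesgue \<in> sets lebesgue"
      using \<open>f' \<in> borel_measurable lebesgue\<close> A by (rule measurable_sets)
    have ae: "AE x in lebesgue. x \<in> f' -` A \<inter> space lebesgue \<longleftrightarrow> x \<in> f -` A \<inter> space lebesgue"
      using AE_not_in[OF N(1)] by eventually_elim (simp add: f'_def)
    show "f -` A \<inter> space lebesgue \<in> sets lebesgue"
      by (rule completion.in_sets_AE[OF ae meas]) simp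
  qed simp
qed

text \<open>This makes \<open>f \<mapsto> G \<circ> f\<close> continuous from \<open>L\<^sup>2\<close> to \<open>L\<^sup>1\<close> on bounded sets, for the linear and
  the nonlinear term of the equation alike.\<close>

definition moderate :: "(complex \<Rightarrow> complex) \<Rightarrow> bool" where
  "moderate G \<longleftrightarrow> G \<in> borel_measurable borel \<and>
     (\<forall>\<delta>>0. \<exists>K\<ge>0. \<forall>a b. cmod (G b - G a) \<le> \<delta> * (1 + (cmod a)\<^sup>2) + K * (cmod (b - a))\<^sup>2)"

lemma young_delta:
  fixes t :: real
  assumes "\<delta> > 0"
  shows "t \<le> \<delta> + t\<^sup>2 / \<delta>"
proof -
  have "2 * \<delta> * t \<le> \<delta>\<^sup>2 + t\<^sup>2" by (rule sum_squares_bound)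
  moreover have "0 \<le> \<delta>\<^sup>2 + t\<^sup>2" by simp
  ultimately have "\<delta> * t \<le> \<delta>\<^sup>2 + t\<^sup>2" by linarith
  then show ?thesis using assms by (simp add: field_simps power2_eq_square)
qed

lemma moderate_id: "moderate (\<lambda>z. z)"
  unfolding moderate_def
proof (intro conjI allI impI)
  fix \<delta> :: real assume \<delta>: "\<delta> > 0"
  have "cmod (b - a) \<le> \<delta> * (1 + (cmod a)\<^sup>2) + (1 / \<delta>) * (cmod (b - a))\<^sup>2" for a b
  proof -
    have "0 \<le> \<delta> * (cmod a)\<^sup>2" using \<delta> by simp
    then show ?thesis using young_delta[OF \<delta>, of "cmod (b - a)"] by (simp add: algebra_simps)
  qed
  then show "\<exists>K\<ge>0. \<forall>a b. cmod (b - a) \<le> \<delta> * (1 + (cmod a)\<^sup>2) + K * (cmod (b - a))\<^sup>2"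
    using \<delta> by (intro exI[of _ "1 / \<delta>"]) auto
qed simp

text \<open>For |x| \<le> |y| the difference is (y - x) 2 ln |y| + x 2 (ln |y| - ln |x|). The second
  part is at most 2 |y - x|, because the logarithm of the quotient is at most |y - x| / |x|. In the
  first part the logarithm is bounded by |y| where |y| \<ge> 1; near 0 it is traded for a square
  root of the distance.\<close>

lemma log_nonlinearity_diff_le:
  "cmod (log_nonlinearity b - log_nonlinearity a)
     \<le> 6 * sqrt (cmod (b - a)) + 2 * cmod (b - a) * (cmod a + cmod b + 1)"
proof -
  have *: "cmod (log_nonlinearity y - log_nonlinearity x)
      \<le> 6 * sqrt (cmod (y - x)) + 2 * cmod (y - x) * (cmod x + cmod y + 1)"
    if le: "cmod x \<le> cmod y" for x y
  proof (cases "y = 0")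
    case False
    define d where "d = cmod (y - x)"
    have d0: "d \<ge> 0" by (simp add: d_def)
    define ly where "ly = ln (cmod y)"
    have y: "cmod y > 0" using False by simp
    have gy: "log_nonlinearity y = y * of_real (2 * ly)"
      using y by (simp add: log_nonlinearity_def ly_def ln_realpow)
    have "cmod (log_nonlinearity y - log_nonlinearity x) \<le> 2 * d * \<bar>ly\<bar> + 2 * d"
    proof (cases "x = 0")
      case True
      then show ?thesis using d0 by (simp add: gy norm_mult d_def) (simp add: log_nonlinearity_def norm_mult)
    next
      case False
      then have x: "cmod x > 0" by simp
      define lx where "lx = ln (cmod x)"
      have gx: "log_nonlinearity x = x * of_real (2 * lx)"
        using x by (simp add: log_nonlinearity_def lx_def ln_realpow)
      have "ly - lx \<le> cmod y / cmod x - 1"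
        unfolding ly_def lx_def using x y ln_le_minus_one[of "cmod y / cmod x"] by (simp add: ln_div)
      also have "\<dots> = (cmod y - cmod x) / cmod x" using x by (simp add: field_simps)
      also have "\<dots> \<le> d / cmod x"
        unfolding d_def using norm_triangle_ineq2[of y x] by (intro divide_right_mono) auto
      finally have "cmod x * (ly - lx) \<le> d" using x by (simp add: field_simps)
      moreover have "ly - lx \<ge> 0" unfolding ly_def lx_def using x y le by simp
      ultimately have A: "cmod (x * of_real (2 * (ly - lx))) \<le> 2 * d"
        unfolding norm_mult norm_of_real by (simp add: algebra_simps)
      have "log_nonlinearity y - log_nonlinearity x = (y - x) * of_real (2 * ly) + x * of_real (2 * (ly - lx))"
        by (simp add: gx gy algebra_simps)
      also have "cmod \<dots> \<le> cmod ((y - x) * of_real (2 * ly)) + cmod (x * of_real (2 * (ly - lx)))"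
        by (rule norm_triangle_ineq)
      also have "cmod ((y - x) * of_real (2 * ly)) = 2 * d * \<bar>ly\<bar>" by (simp add: norm_mult d_def)
      finally show ?thesis using A by linarith
    qed
    moreover have "2 * d * \<bar>ly\<bar> \<le> 6 * sqrt d + 2 * d * cmod y"
    proof (cases "cmod y \<ge> 1")
      case True
      have "\<bar>ly\<bar> \<le> cmod y"
        unfolding ly_def using True ln_le_minus_one[OF y] by simp
      then have "2 * d * \<bar>ly\<bar> \<le> 2 * d * cmod y" using d0 by (intro mult_left_mono) auto
      then show ?thesis using d0 by (simp add: add_increasing)
    next
      case False
      define t where "t = cmod y"
      have t: "t > 0" "t < 1" using y False by (auto simp: t_def)
      have "- ln t / 2 \<le> 1 / sqrt t - 1"
        using ln_le_minus_one[of "1 / sqrt t"] t by (simp add: ln_div ln_sqrt)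
      then have L: "\<bar>ly\<bar> \<le> 2 / sqrt t" using t by (simp add: ly_def t_def[symmetric])
      \<comment> \<open>\<open>y\<close> has the larger modulus, so the distance is at most 2 |y|.
        Half a power of it therefore cancels the 1 / sqrt t from the logarithm; replacing sqrt 2 by
        3/2 makes the constant 3, hence the 6 of the statement.\<close>
      have "d \<le> 2 * t"
        unfolding d_def t_def using norm_triangle_ineq4[of y x] le by linarith
      then have "sqrt d \<le> sqrt (2 * t)" by simp
      also have "\<dots> = sqrt 2 * sqrt t" by (simp add: real_sqrt_mult)
      also have "\<dots> \<le> (3 / 2) * sqrt t"
        using t by (intro mult_right_mono real_le_lsqrt) (auto simp: power2_eq_square)
      finally have "sqrt d * (2 / sqrt t) \<le> 3" using t by (simp add: field_simps)
      then have "sqrt d * (sqrt d * (2 / sqrt t)) \<le> sqrt d * 3" using d0 by (intro mult_left_mono) auto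
      then have "d * (2 / sqrt t) \<le> 3 * sqrt d" using d0 by (simp add: mult.assoc[symmetric])
      moreover have "d * \<bar>ly\<bar> \<le> d * (2 / sqrt t)" using L d0 by (rule mult_left_mono)
      moreover have "0 \<le> 2 * d * cmod y" using d0 by simp
      ultimately show ?thesis by linarith
    qed
    moreover have "2 * d * (cmod x + cmod y + 1) = 2 * d * cmod x + 2 * d * cmod y + 2 * d"
      by (simp add: algebra_simps)
    moreover have "0 \<le> 2 * d * cmod x" using d0 by simp
    ultimately show ?thesis unfolding d_def[symmetric] by linarith
  qed (use le in simp)
  show ?thesis
  proof (cases "cmod a \<le> cmod b")
    case True
    then show ?thesis by (rule *)
  next
    case False
    then show ?thesis using *[of b a] by (simp add: norm_minus_commute add.commute)
  qed
qed

lemma moderate_log_nonlinearity: "moderate log_nonlinearity"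
  unfolding moderate_def
proof (intro conjI allI impI)
  fix \<delta>' :: real assume \<delta>': "\<delta>' > 0"
  \<comment> \<open>The constant terms are 6 \<delta> from the square root and 2 \<delta> from the
    linear factor, the quadratic one is 8 \<delta> |a|^2; so 8 \<delta> (1 + |a|^2) in all.
    \<open>K\<close> collects the coefficients of |b - a|^2.\<close>
  define \<delta> where "\<delta> = \<delta>' / 8"
  have \<delta>: "\<delta> > 0" using \<delta>' by (simp add: \<delta>_def)
  define K where "K = 6 / \<delta> ^ 3 + 1 / \<delta> + 2"
  have "cmod (log_nonlinearity b - log_nonlinearity a) \<le> \<delta>' * (1 + (cmod a)\<^sup>2) + K * (cmod (b - a))\<^sup>2" for a b
  proof -
    define d where "d = cmod (b - a)"
    have d: "d \<ge> 0" by (simp add: d_def)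
    \<comment> \<open>If sqrt d exceeds \<delta>, then \<delta>^3 sqrt d \<le> (sqrt d)^4 =
      d^2.\<close>
    have 1: "sqrt d \<le> \<delta> + d\<^sup>2 / \<delta> ^ 3"
    proof (cases "sqrt d \<le> \<delta>")
      case True
      then show ?thesis using \<delta> by (simp add: add_increasing2)
    next
      case False
      then have "\<delta> ^ 3 \<le> sqrt d ^ 3" using \<delta> by (intro power_mono) auto
      then have "sqrt d * \<delta> ^ 3 \<le> sqrt d * sqrt d ^ 3" using d by (intro mult_left_mono) auto
      also have "\<dots> = ((sqrt d)\<^sup>2)\<^sup>2" by (simp only: power_Suc[symmetric] power_mult[symmetric]) simp
      also have "\<dots> = d\<^sup>2" using d by simp
      finally have "sqrt d \<le> d\<^sup>2 / \<delta> ^ 3" using \<delta> by (simp add: field_simps)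
      then show ?thesis using \<delta> by linarith
    qed
    have b: "cmod b \<le> cmod a + d" unfolding d_def using norm_triangle_ineq2[of b a] by linarith
    have "2 * (d * (2 * cmod a + 1)) \<le> \<delta> * (2 * cmod a + 1)\<^sup>2 + d\<^sup>2 / \<delta>"
    proof -
      have "2 * d * (\<delta> * (2 * cmod a + 1)) \<le> d\<^sup>2 + (\<delta> * (2 * cmod a + 1))\<^sup>2" by (rule sum_squares_bound)
      then show ?thesis using \<delta> by (simp add: field_simps power2_eq_square)
    qed
    also have "\<dots> \<le> \<delta> * (8 * (cmod a)\<^sup>2 + 2) + d\<^sup>2 / \<delta>"
    proof -
      have "(2 * cmod a + 1)\<^sup>2 \<le> 8 * (cmod a)\<^sup>2 + 2"
        using zero_le_power2[of "2 * cmod a - 1"] by (simp add: power2_eq_square algebra_simps)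
      then show ?thesis using \<delta> by (intro add_right_mono mult_left_mono) auto
    qed
    finally have 2: "2 * (d * (2 * cmod a + 1)) \<le> \<delta> * (8 * (cmod a)\<^sup>2 + 2) + d\<^sup>2 / \<delta>" .
    have "cmod (log_nonlinearity b - log_nonlinearity a) \<le> 6 * sqrt d + 2 * d * (cmod a + cmod b + 1)"
      unfolding d_def by (rule log_nonlinearity_diff_le)
    also have "\<dots> \<le> 6 * sqrt d + 2 * d * (cmod a + (cmod a + d) + 1)"
      using b d by (intro add_left_mono mult_left_mono) auto
    also have "\<dots> = 6 * sqrt d + 2 * (d * (2 * cmod a + 1)) + 2 * d\<^sup>2"
      by (simp add: power2_eq_square algebra_simps)
    also have "\<dots> \<le> 6 * (\<delta> + d\<^sup>2 / \<delta> ^ 3) + (\<delta> * (8 * (cmod a)\<^sup>2 + 2) + d\<^sup>2 / \<delta>) + 2 * d\<^sup>2"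
      using 1 2 by (intro add_mono mult_left_mono order_refl) auto
    also have "\<dots> = 8 * \<delta> * (1 + (cmod a)\<^sup>2) + K * d\<^sup>2"
      by (simp add: K_def algebra_simps)
    finally show ?thesis by (simp add: \<delta>_def d_def)
  qed
  moreover have "K \<ge> 0" using \<delta> by (simp add: K_def)
  ultimately show "\<exists>K\<ge>0. \<forall>a b. cmod (log_nonlinearity b - log_nonlinearity a) \<le> \<delta>' * (1 + (cmod a)\<^sup>2) + K * (cmod (b - a))\<^sup>2"
    by blast
qed (rule log_nonlinearity_measurable)

lemma integrable_indicator_cball: "integrable lborel (\<lambda>x. indicator (cball (0::'a::euclidean_space) R) x :: real)"
proof -
  have "cball (0::'a) R \<in> sets lborel" by simp
  then show ?thesis
    using emeasure_lborel_cball_finite[of "0::'a" R] by (subst integrable_indicator_iff) (auto simp: less_top)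
qed

text \<open>The inequality that defines \<open>moderate\<close>, integrated against a bounded weight
  of bounded support: the 1 becomes the volume of a ball, the squares become L^2 norms.
  Integrability is the comparison with the value at 0, taken with \<delta> = 1.\<close>

lemma moderate_pairing:
  fixes f :: "'a::euclidean_space \<Rightarrow> complex"
  assumes G: "moderate G" and f: "square_integrable f" and [measurable]: "\<psi> \<in> borel_measurable borel"
    and \<psi>: "\<And>x. cmod (\<psi> x) \<le> B" "\<And>x. norm x > R \<Longrightarrow> \<psi> x = 0"
  shows moderate_integrable: "integrable lborel (\<lambda>x. G (f x) * \<psi> x)"
    and moderate_diff_le: "square_integrable h \<Longrightarrow>
      (\<And>a b. cmod (G b - G a) \<le> \<delta> * (1 + (cmod a)\<^sup>2) + K * (cmod (b - a))\<^sup>2) \<Longrightarrow> K \<ge> 0 \<Longrightarrow> \<delta> \<ge> 0 \<Longrightarrow>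
      cmod (pair_with (\<lambda>x. G (h x)) \<psi> - pair_with (\<lambda>x. G (f x)) \<psi>) \<le>
        B * (\<delta> * (measure lborel (cball (0::'a) R) + enn2real (l2sq f)) + K * enn2real (l2sq (\<lambda>x. h x - f x)))"
proof -
  have B: "B \<ge> 0" using \<psi>(1)[of 0] norm_ge_zero[of "\<psi> 0"] by linarith
  have [measurable]: "G \<in> borel_measurable borel" using G by (simp add: moderate_def)
  have int: "integrable lborel (\<lambda>x. G (f x) * \<psi> x)" if f: "square_integrable f" for f :: "'a \<Rightarrow> complex"
  proof -
    have [measurable]: "f \<in> borel_measurable borel" using f by (simp add: square_integrable_def)
    obtain K where K: "K \<ge> 0" "\<And>a b. cmod (G b - G a) \<le> 1 * (1 + (cmod a)\<^sup>2) + K * (cmod (b - a))\<^sup>2"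
      using G unfolding moderate_def by (metis zero_less_one)
    show ?thesis
    proof (rule Bochner_Integration.integrable_bound)
      show "integrable lborel (\<lambda>x. B * ((cmod (G 0) + 1) * indicator (cball (0::'a) R) x + K * (cmod (f x))\<^sup>2))"
        using f by (intro integrable_mult_right Bochner_Integration.integrable_add integrable_indicator_cball)
          (simp add: square_integrable_def)
      show "AE x in lborel. cmod (G (f x) * \<psi> x) \<le>
          norm (B * ((cmod (G 0) + 1) * indicator (cball (0::'a) R) x + K * (cmod (f x))\<^sup>2))"
      proof (intro AE_I2)
        fix x :: 'a
        have nn: "0 \<le> B * ((cmod (G 0) + 1) * indicator (cball (0::'a) R) x + K * (cmod (f x))\<^sup>2)"
          using B K(1) by simp
        have "cmod (G (f x) * \<psi> x) \<le> B * ((cmod (G 0) + 1) * indicator (cball (0::'a) R) x + K * (cmod (f x))\<^sup>2)"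
        proof (cases "norm x > R")
          case True
          then show ?thesis using \<psi>(2)[of x] nn by simp
        next
          case False
          have "cmod (G (f x)) \<le> cmod (G 0) + cmod (G (f x) - G 0)"
            using norm_triangle_ineq2[of "G (f x)" "G 0"] by linarith
          also have "\<dots> \<le> (cmod (G 0) + 1) + K * (cmod (f x))\<^sup>2" using K(2)[of "f x" 0] by simp
          finally have "cmod (G (f x)) * cmod (\<psi> x) \<le> ((cmod (G 0) + 1) + K * (cmod (f x))\<^sup>2) * B"
            using K by (intro mult_mono \<psi>) auto
          then show ?thesis using False by (simp add: norm_mult mult.commute)
        qed
        then show "cmod (G (f x) * \<psi> x) \<le>
          norm (B * ((cmod (G 0) + 1) * indicator (cball (0::'a) R) x + K * (cmod (f x))\<^sup>2))"
          using nn by simp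
      qed
      show "(\<lambda>x. G (f x) * \<psi> x) \<in> borel_measurable lborel" by measurable
    qed
  qed
  show "integrable lborel (\<lambda>x. G (f x) * \<psi> x)" by (rule int[OF f])
  assume h: "square_integrable h" and K: "\<And>a b. cmod (G b - G a) \<le> \<delta> * (1 + (cmod a)\<^sup>2) + K * (cmod (b - a))\<^sup>2"
    and K0: "K \<ge> 0" and \<delta>: "\<delta> \<ge> 0"
  have [measurable]: "f \<in> borel_measurable borel" "h \<in> borel_measurable borel"
    using f h by (auto simp: square_integrable_def)
  have hf: "square_integrable (\<lambda>x. h x - f x)"
    using f h l2sq_diff_le[of h f]
    by (auto simp: square_integrable_iff ennreal_mult_less_top intro: le_less_trans)
  have intb: "integrable lborel (\<lambda>x. B * (\<delta> * (indicator (cball (0::'a) R) x + (cmod (f x))\<^sup>2) + K * (cmod (h x - f x))\<^sup>2))"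
    using f hf by (intro integrable_mult_right Bochner_Integration.integrable_add integrable_indicator_cball)
      (simp_all add: square_integrable_def)
  have "pair_with (\<lambda>x. G (h x)) \<psi> - pair_with (\<lambda>x. G (f x)) \<psi> = (LINT x|lborel. G (h x) * \<psi> x - G (f x) * \<psi> x)"
    unfolding pair_with_def using int[OF f] int[OF h] by simp
  also have "cmod \<dots> \<le> (LINT x|lborel. B * (\<delta> * (indicator (cball (0::'a) R) x + (cmod (f x))\<^sup>2) + K * (cmod (h x - f x))\<^sup>2))"
  proof (rule order_trans[OF integral_norm_bound integral_mono])
    show "integrable lborel (\<lambda>x. cmod (G (h x) * \<psi> x - G (f x) * \<psi> x))"
      using int[OF f] int[OF h] by simp
    fix x :: 'a
    show "cmod (G (h x) * \<psi> x - G (f x) * \<psi> x) \<le> B * (\<delta> * (indicator (cball (0::'a) R) x + (cmod (f x))\<^sup>2) + K * (cmod (h x - f x))\<^sup>2)"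
    proof (cases "norm x > R")
      case True
      then show ?thesis using \<psi>(2)[of x] B K0 \<delta> by simp
    next
      case False
      have "cmod (G (h x) * \<psi> x - G (f x) * \<psi> x) = cmod (G (h x) - G (f x)) * cmod (\<psi> x)"
        by (simp add: left_diff_distrib[symmetric] norm_mult)
      also have "\<dots> \<le> (\<delta> * (1 + (cmod (f x))\<^sup>2) + K * (cmod (h x - f x))\<^sup>2) * B"
        using K0 \<delta> by (intro mult_mono \<psi> K) auto
      finally show ?thesis using False by (simp add: mult.commute)
    qed
  qed (rule intb)
  also have "\<dots> = B * (\<delta> * (measure lborel (cball (0::'a) R) + (LINT x|lborel. (cmod (f x))\<^sup>2)) + K * (LINT x|lborel. (cmod (h x - f x))\<^sup>2))"
    using f hf integrable_indicator_cball[where 'a='a and R=R] by (simp add: square_integrable_def)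
  finally show "cmod (pair_with (\<lambda>x. G (h x)) \<psi> - pair_with (\<lambda>x. G (f x)) \<psi>) \<le>
        B * (\<delta> * (measure lborel (cball (0::'a) R) + enn2real (l2sq f)) + K * enn2real (l2sq (\<lambda>x. h x - f x)))"
    by (simp add: l2sq_eq_integral[OF f] l2sq_eq_integral[OF hf])
qed

lemma moderate_pairing_tendsto:
  fixes f :: "'a::euclidean_space \<Rightarrow> complex"
  assumes G: "moderate G" and f: "square_integrable f" and h: "\<And>n. square_integrable (h n)"
    and lim: "(\<lambda>n. l2sq (\<lambda>x. h n x - f x)) \<longlonglongrightarrow> 0"
    and [measurable]: "\<psi> \<in> borel_measurable borel"
    and \<psi>: "\<And>x. cmod (\<psi> x) \<le> B" "\<And>x. norm x > R \<Longrightarrow> \<psi> x = 0"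
  shows "(\<lambda>n. pair_with (\<lambda>x. G (h n x)) \<psi>) \<longlonglongrightarrow> pair_with (\<lambda>x. G (f x)) \<psi>"
proof (rule LIMSEQ_I)
  fix e :: real assume e: "e > 0"
  have B: "B \<ge> 0" using \<psi>(1)[of 0] norm_ge_zero[of "\<psi> 0"] by linarith
  define V where "V = measure lborel (cball (0::'a) R) + enn2real (l2sq f)"
  have V: "V \<ge> 0" by (simp add: V_def)
  \<comment> \<open>Makes the part of the bound that does not vanish with n smaller than e / 2; the
    added 1 keeps the denominator positive when B V = 0.\<close>
  define \<delta> where "\<delta> = e / (2 * (B * V + 1))"
  have \<delta>: "\<delta> > 0" using e B V by (simp add: \<delta>_def add_nonneg_pos)
  have BV: "B * V + 1 > 0" using B V by (simp add: add_nonneg_pos)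
  have \<delta>V: "B * (\<delta> * V) < e / 2"
  proof -
    have "B * (\<delta> * V) = (e / 2) * (B * V / (B * V + 1))" using BV by (simp add: \<delta>_def field_simps)
    also have "\<dots> < (e / 2) * 1" using e B V BV by (intro mult_strict_left_mono) auto
    finally show ?thesis by simp
  qed
  obtain K where K: "K \<ge> 0" "\<And>a b. cmod (G b - G a) \<le> \<delta> * (1 + (cmod a)\<^sup>2) + K * (cmod (b - a))\<^sup>2"
    using G \<delta> unfolding moderate_def by metis
  have "(\<lambda>n. enn2real (l2sq (\<lambda>x. h n x - f x))) \<longlonglongrightarrow> enn2real 0"
    using lim by (intro tendsto_enn2real) simp_all
  then have "(\<lambda>n. B * (K * enn2real (l2sq (\<lambda>x. h n x - f x)))) \<longlonglongrightarrow> B * (K * enn2real 0)"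
    by (intro tendsto_mult tendsto_const)
  then have "\<forall>\<^sub>F n in sequentially. B * (K * enn2real (l2sq (\<lambda>x. h n x - f x))) < e / 2"
    using e by (intro order_tendstoD(2)[where y = "B * (K * enn2real 0)"]) auto
  then obtain n0 where n0: "\<And>n. n \<ge> n0 \<Longrightarrow> B * (K * enn2real (l2sq (\<lambda>x. h n x - f x))) < e / 2"
    by (auto simp: eventually_sequentially)
  show "\<exists>no. \<forall>n\<ge>no. norm (pair_with (\<lambda>x. G (h n x)) \<psi> - pair_with (\<lambda>x. G (f x)) \<psi>) < e"
  proof (intro exI[of _ n0] allI impI)
    fix n assume n: "n0 \<le> n"
    have "cmod (pair_with (\<lambda>x. G (h n x)) \<psi> - pair_with (\<lambda>x. G (f x)) \<psi>) \<le>
        B * (\<delta> * V + K * enn2real (l2sq (\<lambda>x. h n x - f x)))"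
      unfolding V_def using \<delta> K(1) by (intro moderate_diff_le[OF G f _ \<psi> h K(2)]) auto
    also have "\<dots> = B * (\<delta> * V) + B * (K * enn2real (l2sq (\<lambda>x. h n x - f x)))" by (simp add: algebra_simps)
    also have "\<dots> < e" using \<delta>V n0[OF n] by linarith
    finally show "norm (pair_with (\<lambda>x. G (h n x)) \<psi> - pair_with (\<lambda>x. G (f x)) \<psi>) < e" .
  qed
qed

text \<open>There are only finitely many values, so the map applied to them may be arbitrary, in
  particular nonlinear.\<close>

lemma sobolev_simple_measurable:
  fixes \<Phi> :: "('a::euclidean_space \<Rightarrow> complex) \<Rightarrow> complex"
  assumes "sobolev_simple T s w"
  shows "(\<lambda>t. if t \<in> {0..T} then \<Phi> (w t) else 0) \<in> borel_measurable lebesgue"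
proof -
  have fin: "finite (w ` {0..T})" and sets: "\<And>f. {t\<in>{0..T}. w t = f} \<in> sets lebesgue"
    using assms by (auto simp: sobolev_simple_def)
  have "(\<lambda>t. if t \<in> {0..T} then \<Phi> (w t) else 0) =
      (\<lambda>t. \<Sum>f\<in>w ` {0..T}. indicator {t\<in>{0..T}. w t = f} t * \<Phi> f)"
  proof
    fix t
    show "(if t \<in> {0..T} then \<Phi> (w t) else 0) = (\<Sum>f\<in>w ` {0..T}. indicator {t\<in>{0..T}. w t = f} t * \<Phi> f)"
    proof (cases "t \<in> {0..T}")
      case True
      have "(\<Sum>f\<in>w ` {0..T}. indicator {t\<in>{0..T}. w t = f} t * \<Phi> f) = (\<Sum>f\<in>w ` {0..T}. if f = w t then \<Phi> f else 0)"
        using True by (intro sum.cong refl) (auto simp: indicator_def)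
      also have "\<dots> = \<Phi> (w t)" using True fin by simp
      finally show ?thesis using True by simp
    next
      case False
      then show ?thesis by (auto intro!: sum.neutral simp: indicator_def)
    qed
  qed
  then show ?thesis using sets by simp
qed

text \<open>Strong measurability supplies simple approximants converging in H^s at almost every
  time, hence in L^2; \<open>moderate\<close> lets the pairing pass to the limit, for the identity
  and for the logarithmic nonlinearity in the same way.\<close>

lemma pairing_measurable:
  fixes u :: "real \<Rightarrow> 'a::euclidean_space \<Rightarrow> complex"
  assumes u: "sobolev_strongly_measurable T s u" and s: "0 < s" "s < 1" and G: "moderate G"
    and [measurable]: "\<psi> \<in> borel_measurable borel"
    and \<psi>: "\<And>x. cmod (\<psi> x) \<le> B" "\<And>x. norm x > R \<Longrightarrow> \<psi> x = 0"
  shows "(\<lambda>t. if t \<in> {0..T} then pair_with (\<lambda>x. G (u t x)) \<psi> else 0) \<in> borel_measurable lebesgue"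
proof -
  obtain w where w: "\<And>n. sobolev_simple T s (w n)"
    and lim: "AE t in lebesgue. t \<in> {0..T} \<longrightarrow> u t \<in> sobolev_space s \<and>
          (\<lambda>n. sobolev_norm s (\<lambda>x. w n t x - u t x)) \<longlonglongrightarrow> 0"
    using u by (auto simp: sobolev_strongly_measurable_def)
  show ?thesis
  proof (rule lebesgue_measurable_AE_limit)
    show "(\<lambda>t. if t \<in> {0..T} then pair_with (\<lambda>x. G (w n t x)) \<psi> else 0) \<in> borel_measurable lebesgue" for n
      by (rule sobolev_simple_measurable[OF w])
    show "AE t in lebesgue. (\<lambda>n. if t \<in> {0..T} then pair_with (\<lambda>x. G (w n t x)) \<psi> else 0)
        \<longlonglongrightarrow> (if t \<in> {0..T} then pair_with (\<lambda>x. G (u t x)) \<psi> else 0)"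
      using lim
    proof eventually_elim
      fix t
      assume t: "t \<in> {0..T} \<longrightarrow> u t \<in> sobolev_space s \<and> (\<lambda>n. sobolev_norm s (\<lambda>x. w n t x - u t x)) \<longlonglongrightarrow> 0"
      show "(\<lambda>n. if t \<in> {0..T} then pair_with (\<lambda>x. G (w n t x)) \<psi> else 0)
        \<longlonglongrightarrow> (if t \<in> {0..T} then pair_with (\<lambda>x. G (u t x)) \<psi> else 0)"
      proof (cases "t \<in> {0..T}")
        case True
        then have ut: "u t \<in> sobolev_space s" and l: "(\<lambda>n. sobolev_norm s (\<lambda>x. w n t x - u t x)) \<longlonglongrightarrow> 0"
          using t by auto
        have wn: "w n t \<in> sobolev_space s" for n using w[of n] True by (auto simp: sobolev_simple_def)
        have "(\<lambda>n. l2sq (\<lambda>x. w n t x - u t x)) \<longlonglongrightarrow> 0"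
        proof (rule tendsto_sandwich[OF _ _ tendsto_const])
          show "\<forall>\<^sub>F n in sequentially. l2sq (\<lambda>x. w n t x - u t x) \<le> ennreal (8 * (sobolev_norm s (\<lambda>x. w n t x - u t x))\<^sup>2)"
            by (intro always_eventually allI l2sq_le_sobolev sobolev_space_diff wn ut s)
          have "(\<lambda>n. ennreal (8 * (sobolev_norm s (\<lambda>x. w n t x - u t x))\<^sup>2)) \<longlonglongrightarrow> ennreal (8 * 0\<^sup>2)"
            by (intro tendsto_ennrealI tendsto_intros l)
          then show "(\<lambda>n. ennreal (8 * (sobolev_norm s (\<lambda>x. w n t x - u t x))\<^sup>2)) \<longlonglongrightarrow> 0" by simp
        qed simp
        then show ?thesis
          using True moderate_pairing_tendsto[OF G _ _ _ _ \<psi>, of "u t" "\<lambda>n. w n t"]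
            sobolev_space_square_integrable[OF ut] sobolev_space_square_integrable[OF wn] by simp
      next
        case False
        then show ?thesis by (simp del: atLeastAtMost_iff)
      qed
    qed
  qed
qed

section \<open>The equation tested in space\<close>

lemma integral_from_has_real_derivative:
  fixes k :: "real \<Rightarrow> real"
  assumes k: "continuous_on UNIV k" and k0: "\<And>t. t \<le> 0 \<Longrightarrow> k t = 0"
  shows "((\<lambda>t. integral {-1..t} k) has_real_derivative k t) (at t)"
proof (cases "t < 0")
  case True
  have "((\<lambda>_. 0) has_real_derivative 0) (at t)" by simp
  then have "((\<lambda>t. integral {-1..t} k) has_real_derivative 0) (at t)"
  proof (rule has_field_derivative_transform_within_open[of _ _ _ "{..<0}"])
    fix x :: real assume "x \<in> {..<0}"
    then have "integral {-1..x} k = integral {-1..x} (\<lambda>_. 0)" by (intro integral_cong k0) auto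
    then show "0 = integral {-1..x} k" by simp
  qed (use True in auto)
  then show ?thesis using True k0[of t] by simp
next
  case False
  have "((\<lambda>t. integral {-1..t} k) has_real_derivative k t) (at t within {-1..t + 1})"
    using False by (intro integral_has_real_derivative continuous_on_subset[OF k]) auto
  moreover have "at t within {-1..t + 1} = at t"
    using False by (intro at_within_interior) auto
  ultimately show ?thesis by simp
qed

text \<open>A smoothed Heaviside function with its jump at \<open>t1\<close>. The lower limit -1 is
  merely a point to the left of the support of the integrand, which the condition \<delta> \<le> t1
  keeps in the nonnegative half-line.\<close>

definition step :: "real \<Rightarrow> real \<Rightarrow> real \<Rightarrow> real" where
  "step \<delta> t1 t = integral {-1..t} (\<lambda>\<tau>. mollifier \<delta> (\<tau> - t1))"

lemma mollifier_real_eq_0: "\<delta> > 0 \<Longrightarrow> \<bar>t\<bar> \<ge> \<delta> \<Longrightarrow> mollifier \<delta> (t::real) = 0"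
  using mollifier_eq_0[of \<delta> t] by simp

lemma integral_mollifier_shift:
  fixes t1 :: real
  assumes "\<delta> > 0"
  shows "integrable lborel (\<lambda>\<tau>. mollifier \<delta> (\<tau> - t1))" "(LINT \<tau>|lborel. mollifier \<delta> (\<tau> - t1)) = 1"
proof -
  have [measurable]: "(mollifier \<delta> :: real \<Rightarrow> real) \<in> borel_measurable borel"
    by (rule smooth_borel[OF smooth_mollifier])
  show "integrable lborel (\<lambda>\<tau>. mollifier \<delta> (\<tau> - t1))"
    using lborel_integrable_real_affine[OF integrable_mollifier[OF assms], of 1 "- t1"]
    by simp
  show "(LINT \<tau>|lborel. mollifier \<delta> (\<tau> - t1)) = 1"
    using integral_lborel_shift[of "mollifier \<delta>" "- t1"] integral_mollifier[OF assms, where 'a=real] by simp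
qed

lemma
  assumes \<delta>: "\<delta> > 0" "\<delta> \<le> t1"
  shows step_derivative: "(step \<delta> t1 has_real_derivative mollifier \<delta> (t - t1)) (at t)"
    and step_eq_0: "t \<le> t1 - \<delta> \<Longrightarrow> step \<delta> t1 t = 0"
    and step_eq_1: "t \<ge> t1 + \<delta> \<Longrightarrow> step \<delta> t1 t = 1"
    and step_bounds: "\<bar>step \<delta> t1 t\<bar> \<le> 1"
proof -
  have cont: "continuous_on UNIV (\<lambda>\<tau>. mollifier \<delta> (\<tau> - t1))"
    by (intro continuous_on_compose2[OF smooth_imp_continuous[OF smooth_mollifier]] continuous_intros) auto
  show "(step \<delta> t1 has_real_derivative mollifier \<delta> (t - t1)) (at t)"
    unfolding step_def
    by (rule integral_from_has_real_derivative[OF cont]) (use \<delta> in \<open>auto intro!: mollifier_real_eq_0\<close>)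
  note int = integral_mollifier_shift[OF \<delta>(1), of t1]
  have seti: "set_integrable lborel {-1..t} (\<lambda>\<tau>. mollifier \<delta> (\<tau> - t1))"
    unfolding set_integrable_def using int(1) by (rule integrable_mult_indicator[rotated]) simp
  have eq: "step \<delta> t1 t = (LINT \<tau>|lborel. indicator {-1..t} \<tau> *\<^sub>R mollifier \<delta> (\<tau> - t1))"
    unfolding step_def using set_borel_integral_eq_integral(2)[OF seti] by (simp add: set_lebesgue_integral_def)
  have nn: "mollifier \<delta> (\<tau> - t1) \<ge> 0" for \<tau> by (rule mollifier_nonneg[OF \<delta>(1)])
  show "step \<delta> t1 t = 0" if "t \<le> t1 - \<delta>"
  proof -
    have "(\<lambda>\<tau>. indicator {-1..t} \<tau> *\<^sub>R mollifier \<delta> (\<tau> - t1)) = (\<lambda>_. 0)"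
      using that \<delta> by (intro ext) (auto simp: indicator_def intro!: mollifier_real_eq_0)
    then show ?thesis unfolding eq by simp
  qed
  show "step \<delta> t1 t = 1" if "t \<ge> t1 + \<delta>"
  proof -
    have "(\<lambda>\<tau>. indicator {-1..t} \<tau> *\<^sub>R mollifier \<delta> (\<tau> - t1)) = (\<lambda>\<tau>. mollifier \<delta> (\<tau> - t1))"
    proof
      fix \<tau>
      show "indicator {-1..t} \<tau> *\<^sub>R mollifier \<delta> (\<tau> - t1) = mollifier \<delta> (\<tau> - t1)"
        using that \<delta> mollifier_real_eq_0[OF \<delta>(1), of "\<tau> - t1"]
        by (cases "\<bar>\<tau> - t1\<bar> \<ge> \<delta>") (auto simp: indicator_def)
    qed
    then show ?thesis unfolding eq using int by simp
  qed
  have "(LINT \<tau>|lborel. indicator {-1..t} \<tau> *\<^sub>R mollifier \<delta> (\<tau> - t1)) \<le> (LINT \<tau>|lborel. mollifier \<delta> (\<tau> - t1))"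
    using seti int(1) nn unfolding set_integrable_def by (intro integral_mono) (auto simp: indicator_def)
  moreover have "0 \<le> (LINT \<tau>|lborel. indicator {-1..t} \<tau> *\<^sub>R mollifier \<delta> (\<tau> - t1))"
    using nn by (intro Bochner_Integration.integral_nonneg) simp
  ultimately show "\<bar>step \<delta> t1 t\<bar> \<le> 1" unfolding eq using int by simp
qed

lemma smooth_real_antiderivative:
  fixes f :: "real \<Rightarrow> real"
  assumes d: "\<And>t. (f has_real_derivative g t) (at t)" and g: "smooth g"
  shows "smooth f" "dir_deriv 1 f = g"
proof -
  show e: "dir_deriv 1 f = g" by (intro ext dir_deriv_real d)
  have diff: "f differentiable (at x)" for x
    using d[of x] by (auto simp: differentiable_def has_field_derivative_def)
  show "smooth f"
    unfolding smooth_def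
  proof
    fix k
    show "Ck k f"
    proof (cases k)
      case 0
      then show ?thesis using d by (auto intro!: continuous_at_imp_continuous_on DERIV_isCont)
    next
      case (Suc j)
      then show ?thesis using diff e g by (auto simp: smooth_def)
    qed
  qed
qed

lemma smooth_mollifier_shift: "smooth (\<lambda>t::real. mollifier \<delta> (t - t1))"
  unfolding smooth_def
proof
  fix k
  have "Ck k (\<lambda>t::real. mollifier \<delta> (t + (- t1)))"
    using smooth_mollifier[of \<delta>, where 'a=real] by (intro Ck_affine bounded_linear_ident) (simp add: smooth_def)
  then show "Ck k (\<lambda>t::real. mollifier \<delta> (t - t1))" by simp
qed

section \<open>Test functions of product form\<close>

lemma test_support:
  assumes "test (\<psi> :: 'a::euclidean_space \<Rightarrow> complex)"
  shows "\<exists>r. \<forall>x. norm x > r \<longrightarrow> \<psi> x = 0"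
  using testE[OF assms] by metis

definition lap :: "('a::euclidean_space \<Rightarrow> complex) \<Rightarrow> 'a \<Rightarrow> complex" where
  "lap \<psi> = (\<lambda>x. \<Sum>b\<in>Basis. dir_deriv b (dir_deriv b \<psi>) x)"

lemma test_lap:
  assumes "test \<psi>"
  shows "test (lap (\<psi> :: 'a::euclidean_space \<Rightarrow> complex))"
proof -
  obtain r where r: "\<And>x. norm x > r \<Longrightarrow> \<psi> x = 0" using test_support[OF assms] by auto
  have sm: "smooth \<psi>" using assms by (simp add: test_function_def)
  have "smooth (lap \<psi>)"
    unfolding smooth_def lap_def
    using smooth_dir_deriv[OF smooth_dir_deriv[OF sm]] by (intro allI Ck_sum) (auto simp: smooth_def)
  moreover have "lap \<psi> x = 0" if "norm x > r" for x
    unfolding lap_def using that r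
    by (intro sum.neutral ballI dir_deriv_eq_0_outside[where R=r and f="dir_deriv b \<psi>" for b])
       (auto intro: dir_deriv_eq_0_outside[where R=r])
  ultimately show ?thesis by (rule testI)
qed

text \<open>Testing with \<theta>(t) \<psi>(x) separates the variables: for every \<psi> the
  distributional equation becomes a weak differential equation for a scalar function of
  time.\<close>

lemma product_test_function:
  fixes \<theta> :: "real \<Rightarrow> real" and \<psi> :: "'a::euclidean_space \<Rightarrow> complex"
  assumes \<theta>: "smooth \<theta>" "\<And>t. t \<notin> {c..d} \<Longrightarrow> \<theta> t = 0" and cd: "0 < c" "d < T" and \<psi>: "test \<psi>"
  defines "\<phi> \<equiv> \<lambda>z::real \<times> 'a. of_real (\<theta> (fst z)) * \<psi> (snd z)"
  shows "test_function ({0<..<T} \<times> UNIV) \<phi>"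
    and "time_deriv \<phi> (t, x) = of_real (dir_deriv 1 \<theta> t) * \<psi> x"
    and "space_laplacian \<phi> (t, x) = of_real (\<theta> t) * lap \<psi> x"
proof -
  have sm: "smooth \<psi>" using \<psi> by (simp add: test_function_def)
  obtain r where r: "\<And>x. norm x > r \<Longrightarrow> \<psi> x = 0" using test_support[OF \<psi>] by auto
  have CkT: "Ck k (\<lambda>z::real \<times> 'a. complex_of_real (\<theta> (fst z)))" for k
  proof -
    have "Ck k (\<lambda>t. complex_of_real (\<theta> t))"
      using \<theta>(1) unfolding smooth_def by (intro Ck_linear_comp[OF bounded_linear_of_real]) simp
    from Ck_affine[OF bounded_linear_fst this, of 0] show ?thesis by simp
  qed
  have CkX: "smooth q \<Longrightarrow> Ck k (\<lambda>z::real \<times> 'a. q (snd z))" for k and q :: "'a \<Rightarrow> complex"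
    using Ck_affine[OF bounded_linear_snd, where f="q" and k=k and c=0] by (simp add: smooth_def)
  have "smooth \<phi>" unfolding smooth_def \<phi>_def using CkT CkX[OF sm] by (intro allI Ck_mult)
  moreover have sub: "closure {z. \<phi> z \<noteq> 0} \<subseteq> {c..d} \<times> cball 0 r"
  proof (rule closure_minimal)
    show "{z. \<phi> z \<noteq> 0} \<subseteq> {c..d} \<times> cball 0 r"
      using \<theta>(2) r by (force simp: \<phi>_def not_less[symmetric])
  qed (intro closed_Times closed_cball closed_real_atLeastAtMost)
  moreover have "compact (closure {z. \<phi> z \<noteq> 0})"
    using bounded_subset[OF compact_imp_bounded[OF compact_Times[OF compact_Icc compact_cball]] sub]
    by (simp add: compact_eq_bounded_closed)
  ultimately show "test_function ({0<..<T} \<times> UNIV) \<phi>"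
    using cd unfolding test_function_def by force
  have dT: "(\<lambda>z::real \<times> 'a. complex_of_real (\<theta> (fst z))) differentiable (at z)" for z
    using CkT[of "Suc 0"] by (rule Ck_Suc_differentiable)
  have dX: "smooth q \<Longrightarrow> (\<lambda>z::real \<times> 'a. q (snd z)) differentiable (at z)" for z and q :: "'a \<Rightarrow> complex"
    using CkX[of q "Suc 0"] by (intro Ck_Suc_differentiable)
  have gT: "dir_deriv h (\<lambda>z::real \<times> 'a. complex_of_real (\<theta> (fst z))) z = of_real (fst h * dir_deriv 1 \<theta> (fst z))" for h z
  proof -
    have "((\<lambda>z::real \<times> 'a. \<theta> (fst z + 0)) has_derivative (\<lambda>h. dir_deriv (fst h) \<theta> (fst z + 0))) (at z)"
      by (rule has_derivative_affine_comp[OF bounded_linear_fst smooth_differentiable[OF \<theta>(1)]])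
    from has_derivative_of_real[OF this]
    have "((\<lambda>z::real \<times> 'a. complex_of_real (\<theta> (fst z))) has_derivative (\<lambda>h. of_real (dir_deriv (fst h) \<theta> (fst z)))) (at z)"
      by simp
    then show ?thesis
      using dir_deriv_expand[OF smooth_differentiable[OF \<theta>(1)], of "fst h" "fst z"] by (simp add: dir_deriv_eq)
  qed
  have gX: "dir_deriv h (\<lambda>z::real \<times> 'a. q (snd z)) z = dir_deriv (snd h) q (snd z)"
    if "smooth q" for h z and q :: "'a \<Rightarrow> complex"
    using dir_deriv_eq[OF has_derivative_affine_comp[OF bounded_linear_snd smooth_differentiable[OF that], of 0 z], of h] by simp
  have d0: "dir_deriv 0 f y = 0" if "f differentiable (at y)" for f :: "'a \<Rightarrow> complex" and y
    using dir_deriv_expand[OF that, of 0] by simp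
  show "time_deriv \<phi> (t, x) = of_real (dir_deriv 1 \<theta> t) * \<psi> x"
    unfolding time_deriv_def \<phi>_def dir_deriv_mult[OF dT dX[OF sm]] gT gX[OF sm]
    by (simp add: d0[OF smooth_differentiable[OF sm]])
  have s1: "dir_deriv (0, b) (\<lambda>z::real \<times> 'a. of_real (\<theta> (fst z)) * q (snd z)) =
      (\<lambda>z. of_real (\<theta> (fst z)) * dir_deriv b q (snd z))" if "smooth q" for b and q :: "'a \<Rightarrow> complex"
    by (intro ext) (simp add: dir_deriv_mult[OF dT dX[OF that]] gT gX[OF that])
  show "space_laplacian \<phi> (t, x) = of_real (\<theta> t) * lap \<psi> x"
    unfolding space_laplacian_def \<phi>_def lap_def
    by (simp add: s1[OF sm] s1[OF smooth_dir_deriv[OF sm]] sum_distrib_left)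
qed

section \<open>From a weak time derivative to an integral equation\<close>

lemma mollifier_approx_identity:
  fixes a :: "real \<Rightarrow> complex"
  assumes a: "continuous_on {0..T} a" and t1: "0 < t1" "t1 < T"
  shows "(\<lambda>n. LINT t:{0..T}|lebesgue. of_real (mollifier (1 / real (Suc n)) (t - t1)) * a t) \<longlonglongrightarrow> a t1"
proof (rule LIMSEQ_I)
  fix e :: real assume e: "e > 0"
  have "isCont a t1" using a t1 by (intro continuous_on_interior[OF a]) auto
  then obtain \<eta> where \<eta>: "\<eta> > 0" "\<And>t. dist t t1 < \<eta> \<Longrightarrow> dist (a t) (a t1) < e / 2"
    using e unfolding continuous_at_eps_delta dist_norm by (metis half_gt_zero)
  \<comment> \<open>Small enough both for the continuity of \<open>a\<close> at \<open>t1\<close>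
    and for the support of the mollifier to stay inside [0, T].\<close>
  obtain n0 where n0: "1 / real (Suc n0) < min \<eta> (min t1 (T - t1))"
    using \<eta> t1 nat_approx_posE[of "min \<eta> (min t1 (T - t1))"] by auto
  define A where "A = (\<lambda>t. indicator {0..T} t *\<^sub>R a t)"
  have [measurable]: "A \<in> borel_measurable borel"
    unfolding A_def by (rule borel_measurable_continuous_on_indicator[OF _ a]) simp
  obtain C where C: "\<And>t. t \<in> {0..T} \<Longrightarrow> cmod (a t) \<le> C"
    using compact_imp_bounded[OF compact_continuous_image[OF a compact_Icc]] unfolding bounded_iff by blast
  have AC: "cmod (A t) \<le> max C 0" for t using C[of t] by (auto simp: A_def indicator_def)
  show "\<exists>no. \<forall>n\<ge>no. norm ((LINT t:{0..T}|lebesgue. of_real (mollifier (1 / real (Suc n)) (t - t1)) * a t) - a t1) < e"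
  proof (intro exI[of _ n0] allI impI)
    fix n assume "n0 \<le> n"
    define \<delta> where "\<delta> = 1 / real (Suc n)"
    have \<delta>: "\<delta> > 0" by (simp add: \<delta>_def)
    have "\<delta> \<le> 1 / real (Suc n0)" unfolding \<delta>_def using \<open>n0 \<le> n\<close> by (intro divide_left_mono) auto
    then have \<delta>': "\<delta> < \<eta>" "\<delta> < t1" "\<delta> < T - t1" using n0 by auto
    define K where "K = (\<lambda>t. mollifier \<delta> (t - t1))"
    have K: "integrable lborel K" "(LINT t|lborel. K t) = 1" unfolding K_def using integral_mollifier_shift[OF \<delta>] by auto
    have K0: "K t \<ge> 0" for t unfolding K_def by (rule mollifier_nonneg[OF \<delta>])
    have [measurable]: "K \<in> borel_measurable borel" using K(1) by auto
    have KA: "integrable lborel (\<lambda>t. of_real (K t) * A t)"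
    proof (rule Bochner_Integration.integrable_bound[of _ "\<lambda>t. max C 0 * K t"])
      show "AE t in lborel. cmod (of_real (K t) * A t) \<le> norm (max C 0 * K t)"
        using K0 by (intro AE_I2) (simp add: norm_mult mult.commute[of _ "K _"] mult_left_mono AC)
      show "(\<lambda>t. of_real (K t) * A t) \<in> borel_measurable lborel" by measurable
    qed (use K in simp)
    have Ka: "integrable lborel (\<lambda>t. of_real (K t) * a t1)"
      using K(1) by (intro integrable_mult_left) (simp add: complex_of_real_integrable_eq)
    have "(LINT t:{0..T}|lebesgue. of_real (K t) * a t) = (LINT t|lebesgue. of_real (K t) * A t)"
      unfolding set_lebesgue_integral_def A_def by (intro Bochner_Integration.integral_cong) auto
    also have "\<dots> = (LINT t|lborel. of_real (K t) * A t)"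
      by (rule integral_completion) measurable
    finally have "(LINT t:{0..T}|lebesgue. of_real (K t) * a t) - a t1 = (LINT t|lborel. of_real (K t) * A t) - (LINT t|lborel. of_real (K t) * a t1)"
      using K(2) by (simp add: integral_complex_of_real)
    also have "\<dots> = (LINT t|lborel. of_real (K t) * A t - of_real (K t) * a t1)"
      using KA Ka by (rule Bochner_Integration.integral_diff[symmetric])
    finally have "cmod ((LINT t:{0..T}|lebesgue. of_real (K t) * a t) - a t1) =
        cmod (LINT t|lborel. of_real (K t) * A t - of_real (K t) * a t1)" by simp
    also have "\<dots> \<le> (LINT t|lborel. K t * (e / 2))"
    proof (rule order_trans[OF integral_norm_bound integral_mono])
      show "integrable lborel (\<lambda>t. cmod (of_real (K t) * A t - of_real (K t) * a t1))" using KA Ka by simp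
      show "integrable lborel (\<lambda>t. K t * (e / 2))" using K by simp
      fix t
      show "cmod (of_real (K t) * A t - of_real (K t) * a t1) \<le> K t * (e / 2)"
      proof (cases "\<bar>t - t1\<bar> \<ge> \<delta>")
        case True
        then show ?thesis using mollifier_real_eq_0[OF \<delta>] by (simp add: K_def)
      next
        case False
        then have "t \<in> {0..T}" using \<delta>' by (auto simp: abs_le_iff abs_less_iff not_le)
        then have "A t = a t" by (simp add: A_def)
        then have "cmod (of_real (K t) * A t - of_real (K t) * a t1) = K t * dist (a t) (a t1)"
          using K0[of t] by (simp add: right_diff_distrib[symmetric] norm_mult dist_norm)
        also have "\<dots> \<le> K t * (e / 2)"
          using \<eta>(2)[of t] False \<delta>' K0[of t] by (intro mult_left_mono) (auto simp: dist_real_def intro: less_imp_le)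
        finally show ?thesis .
      qed
    qed
    also have "\<dots> = e / 2" using K by simp
    also have "\<dots> < e" using e by simp
    finally show "norm ((LINT t:{0..T}|lebesgue. of_real (mollifier (1 / real (Suc n)) (t - t1)) * a t) - a t1) < e"
      by (simp add: K_def \<delta>_def)
  qed
qed

text \<open>Dominated convergence for smoothed or shrunken indicators. The bound 2 is the one that
  the triangle inequality gives for a difference of two functions \<open>step\<close>.\<close>

lemma integral_limit_intervals:
  fixes p :: "real \<Rightarrow> complex" and \<theta> :: "nat \<Rightarrow> real \<Rightarrow> real"
  assumes p: "(\<lambda>t. if t \<in> {0..T} then p t else 0) \<in> borel_measurable lebesgue"
    and C: "AE t in lebesgue. t \<in> {0..T} \<longrightarrow> cmod (p t) \<le> C"
    and \<theta>: "\<And>n. \<theta> n \<in> borel_measurable lebesgue" "\<And>n t. \<bar>\<theta> n t\<bar> \<le> 2"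
    and I: "S \<in> sets lebesgue" "S \<subseteq> {0..T}"
    and lim: "AE t in lebesgue. (\<lambda>n. \<theta> n t) \<longlonglongrightarrow> indicator S t"
  shows "(\<lambda>n. LINT t:{0..T}|lebesgue. of_real (\<theta> n t) * p t) \<longlonglongrightarrow> (LINT t:S|lebesgue. p t)"
proof -
  define P where "P = (\<lambda>t. if t \<in> {0..T} then p t else 0)"
  have [measurable]: "P \<in> borel_measurable lebesgue" unfolding P_def by (rule p)
  note [measurable] = \<theta>(1) I(1)
  have "(\<lambda>n. LINT t|lebesgue. of_real (\<theta> n t) * P t) \<longlonglongrightarrow> (LINT t|lebesgue. of_real (indicator S t) * P t)"
  proof (rule integral_dominated_convergence[where w="\<lambda>t. 2 * \<bar>C\<bar> * indicator {0..T} t"])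
    show "integrable lebesgue (\<lambda>t. 2 * \<bar>C\<bar> * indicator {0..T} t)"
      by (intro integrable_mult_right) (simp add: integrable_indicator_iff emeasure_lborel_Icc_eq)
    show "AE t in lebesgue. (\<lambda>n. of_real (\<theta> n t) * P t) \<longlonglongrightarrow> of_real (indicator S t) * P t"
      using lim by eventually_elim (intro tendsto_intros)
    show "AE t in lebesgue. norm (of_real (\<theta> n t) * P t) \<le> 2 * \<bar>C\<bar> * indicator {0..T} t" for n
      using C
    proof eventually_elim
      fix t assume t: "t \<in> {0..T} \<longrightarrow> cmod (p t) \<le> C"
      show "norm (of_real (\<theta> n t) * P t) \<le> 2 * \<bar>C\<bar> * indicator {0..T} t"
      proof (cases "t \<in> {0..T}")
        case True
        then have "\<bar>\<theta> n t\<bar> * cmod (p t) \<le> 2 * \<bar>C\<bar>"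
          using t by (intro mult_mono \<theta>) auto
        then show ?thesis using True by (simp add: P_def norm_mult)
      next
        case False
        then show ?thesis by (simp add: P_def del: atLeastAtMost_iff)
      qed
    qed
  qed (measurable)
  moreover have "(LINT t|lebesgue. of_real (\<theta> n t) * P t) = (LINT t:{0..T}|lebesgue. of_real (\<theta> n t) * p t)" for n
    unfolding set_lebesgue_integral_def P_def by (intro Bochner_Integration.integral_cong) (auto simp: indicator_def)
  moreover have "(LINT t|lebesgue. of_real (indicator S t) * P t) = (LINT t:S|lebesgue. p t)"
    unfolding set_lebesgue_integral_def P_def using I(2)
    by (intro Bochner_Integration.integral_cong) (auto simp: indicator_def)
  ultimately show ?thesis by simp
qed

text \<open>The test functions approximate the indicator of [t1, t2]; their derivatives are
  differences of approximate identities at t1 and t2 and recover the values of \<open>a\<close>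
  there by continuity. As test functions vanish near 0 and T, the endpoints are reached by a second
  limit, from the interior.\<close>

lemma weak_derivative_imp_integral:
  fixes a p :: "real \<Rightarrow> complex"
  assumes T: "T > 0" and a: "continuous_on {0..T} a"
    and p: "(\<lambda>t. if t \<in> {0..T} then p t else 0) \<in> borel_measurable lebesgue"
    and C: "AE t in lebesgue. t \<in> {0..T} \<longrightarrow> cmod (p t) \<le> C"
    and weak: "\<And>\<theta> c d. smooth \<theta> \<Longrightarrow> (\<And>t. t \<notin> {c..d} \<Longrightarrow> \<theta> t = 0) \<Longrightarrow> 0 < c \<Longrightarrow> d < T \<Longrightarrow>
      (LINT t:{0..T}|lebesgue. of_real (dir_deriv 1 \<theta> t) * a t) = - (LINT t:{0..T}|lebesgue. of_real (\<theta> t) * p t)"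
    and t: "t \<in> {0..T}"
  shows "a t - a 0 = (LINT \<tau>:{0..t}|lebesgue. p \<tau>)"
proof -
  have interior: "a t2 - a t1 = (LINT t:{t1..t2}|lebesgue. p t)" if t12: "0 < t1" "t1 < t2" "t2 < T" for t1 t2
  proof -
    \<comment> \<open>Smoothing at scales below \<open>m0\<close> keeps the support of the test
      function between t1 / 2 and (t2 + T) / 2, strictly inside (0, T).\<close>
    define m0 where "m0 = min (t1 / 2) ((T - t2) / 2)"
    have m0: "m0 > 0" using t12 by (simp add: m0_def)
    obtain n0 where n0: "1 / real (Suc n0) < m0" using nat_approx_posE[OF m0] by blast
    define \<delta> where "\<delta> = (\<lambda>n. 1 / real (Suc n))"
    have \<delta>: "\<delta> n > 0" for n by (simp add: \<delta>_def)
    have \<delta>le: "\<delta> n < m0" if "n \<ge> n0" for n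
    proof -
      have "\<delta> n \<le> 1 / real (Suc n0)" unfolding \<delta>_def using that by (intro divide_left_mono) auto
      then show ?thesis using n0 by simp
    qed
    have m0t: "m0 < t1" "m0 < t2" using t12 by (auto simp: m0_def)
    \<comment> \<open>Smoothed indicator of [t1, t2]. The index is shifted by \<open>n0\<close> so
      that every member of the sequence is admissible, not only the tail.\<close>
    define \<theta> where "\<theta> = (\<lambda>n t. step (\<delta> (n + n0)) t1 t - step (\<delta> (n + n0)) t2 t)"
    define k where "k = (\<lambda>n t. mollifier (\<delta> (n + n0)) (t - t1) - mollifier (\<delta> (n + n0)) (t - t2))"
    have \<delta>t: "\<delta> (n + n0) \<le> t1" "\<delta> (n + n0) \<le> t2" "\<delta> (n + n0) < m0" for n using \<delta>le[of "n + n0"] m0t by auto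
    have der: "(\<theta> n has_real_derivative k n t) (at t)" for n t
      unfolding \<theta>_def k_def by (intro DERIV_diff step_derivative \<delta> \<delta>t)
    have smk: "smooth (k n)" for n
      unfolding k_def smooth_def diff_conv_add_uminus
      using smooth_mollifier_shift[of "\<delta> (n + n0)" t1] smooth_mollifier_shift[of "\<delta> (n + n0)" t2]
      by (intro allI Ck_add Ck_linear_comp[OF bounded_linear_minus[OF bounded_linear_ident]]) (auto simp: smooth_def)
    note sm = smooth_real_antiderivative[OF der smk]
    have supp: "\<theta> n t = 0" if "t \<notin> {t1 / 2..(t2 + T) / 2}" for n t
    proof (cases "t < t1 / 2")
      case True
      then have "t \<le> t1 - \<delta> (n + n0)" "t \<le> t2 - \<delta> (n + n0)" using \<delta>t(3)[of n] t12 by (auto simp: m0_def)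
      then show ?thesis unfolding \<theta>_def using step_eq_0[OF \<delta>] \<delta>t by simp
    next
      case False
      then have "t > (t2 + T) / 2" using that by simp
      then have "t \<ge> t1 + \<delta> (n + n0)" "t \<ge> t2 + \<delta> (n + n0)" using \<delta>t(3)[of n] t12 by (auto simp: m0_def field_simps)
      then show ?thesis unfolding \<theta>_def using step_eq_1[OF \<delta>] \<delta>t by simp
    qed
    have eq: "(LINT t:{0..T}|lebesgue. of_real (k n t) * a t) = - (LINT t:{0..T}|lebesgue. of_real (\<theta> n t) * p t)" for n
      using weak[of "\<theta> n" "t1 / 2" "(t2 + T) / 2", OF sm(1) supp] t12 unfolding sm(2) by simp
    have aint: "set_integrable lebesgue {0..T} (\<lambda>t. of_real (mollifier (\<delta> m) (t - q)) * a t)" for m q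
    proof -
      have "continuous_on {0..T} (\<lambda>t. of_real (mollifier (\<delta> m) (t - q)) * a t)"
        by (intro continuous_intros a continuous_on_compose2[OF smooth_imp_continuous[OF smooth_mollifier]]) auto
      then have "set_integrable lborel {0..T} (\<lambda>t. of_real (mollifier (\<delta> m) (t - q)) * a t)"
        unfolding set_integrable_def by (intro borel_integrable_compact) auto
      then show ?thesis
        unfolding set_integrable_def by (subst integrable_completion) auto
    qed
    have "(\<lambda>n. LINT t:{0..T}|lebesgue. of_real (k n t) * a t) \<longlonglongrightarrow> a t1 - a t2"
    proof -
      have "(\<lambda>n. (LINT t:{0..T}|lebesgue. of_real (mollifier (\<delta> (n + n0)) (t - t1)) * a t)
          - (LINT t:{0..T}|lebesgue. of_real (mollifier (\<delta> (n + n0)) (t - t2)) * a t)) \<longlonglongrightarrow> a t1 - a t2"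
        unfolding \<delta>_def using t12
        by (intro tendsto_diff LIMSEQ_ignore_initial_segment[OF mollifier_approx_identity] a) auto
      moreover have "(LINT t:{0..T}|lebesgue. of_real (mollifier (\<delta> (n + n0)) (t - t1)) * a t)
          - (LINT t:{0..T}|lebesgue. of_real (mollifier (\<delta> (n + n0)) (t - t2)) * a t)
          = (LINT t:{0..T}|lebesgue. of_real (k n t) * a t)" for n
        unfolding k_def by (subst set_integral_diff(2)[symmetric, OF aint aint]) (simp add: left_diff_distrib)
      ultimately show ?thesis by simp
    qed
    moreover have "(\<lambda>n. LINT t:{0..T}|lebesgue. of_real (\<theta> n t) * p t) \<longlonglongrightarrow> (LINT t:{t1..t2}|lebesgue. p t)"
    proof (rule integral_limit_intervals[OF p C])
      show "\<theta> n \<in> borel_measurable lebesgue" for n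
        using smooth_borel[OF sm(1)] by (intro measurable_completion) simp
      show "\<bar>\<theta> n t\<bar> \<le> 2" for n t
        unfolding \<theta>_def using step_bounds[OF \<delta> \<delta>t(1), of n t] step_bounds[OF \<delta> \<delta>t(2), of n t] by linarith
      have "AE t in lebesgue. t \<noteq> t1 \<and> t \<noteq> t2"
        using AE_completion[OF AE_lborel_singleton[of t1]] AE_completion[OF AE_lborel_singleton[of t2]] by auto
      then show "AE t in lebesgue. (\<lambda>n. \<theta> n t) \<longlonglongrightarrow> indicator {t1..t2} t"
      proof eventually_elim
        fix t assume t: "t \<noteq> t1 \<and> t \<noteq> t2"
        define \<eta> where "\<eta> = min \<bar>t - t1\<bar> \<bar>t - t2\<bar>"
        have "\<eta> > 0" using t by (simp add: \<eta>_def)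
        then obtain n1 where n1: "1 / real (Suc n1) < \<eta>" using nat_approx_posE by blast
        show "(\<lambda>n. \<theta> n t) \<longlonglongrightarrow> indicator {t1..t2} t"
        proof (rule tendsto_eventually)
          show "\<forall>\<^sub>F n in sequentially. \<theta> n t = indicator {t1..t2} t"
            using eventually_ge_at_top[of n1]
          proof eventually_elim
            fix n assume "n1 \<le> n"
            have "\<delta> (n + n0) \<le> 1 / real (Suc n1)" unfolding \<delta>_def using \<open>n1 \<le> n\<close> by (intro divide_left_mono) auto
            then have d: "\<delta> (n + n0) < \<bar>t - t1\<bar>" "\<delta> (n + n0) < \<bar>t - t2\<bar>" using n1 by (auto simp: \<eta>_def)
            consider "t < t1" | "t1 < t" "t < t2" | "t2 < t" using t by linarith
            then show "\<theta> n t = indicator {t1..t2} t"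
            proof cases
              case 1
              then have "t \<le> t1 - \<delta> (n + n0)" "t \<le> t2 - \<delta> (n + n0)" using d t12 by auto
              then show ?thesis unfolding \<theta>_def using step_eq_0[OF \<delta>] \<delta>t 1 by simp
            next
              case 2
              then have "t \<ge> t1 + \<delta> (n + n0)" "t \<le> t2 - \<delta> (n + n0)" using d by auto
              then show ?thesis unfolding \<theta>_def using step_eq_0[OF \<delta> \<delta>t(2)] step_eq_1[OF \<delta> \<delta>t(1)] 2 by simp
            next
              case 3
              then have "t \<ge> t1 + \<delta> (n + n0)" "t \<ge> t2 + \<delta> (n + n0)" using d t12 by auto
              then show ?thesis unfolding \<theta>_def using step_eq_1[OF \<delta>] \<delta>t 3 by simp
            qed
          qed
        qed
      qed
    qed (use t12 in auto)
    ultimately have "a t1 - a t2 = - (LINT t:{t1..t2}|lebesgue. p t)"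
      unfolding eq by (intro LIMSEQ_unique[OF _ tendsto_minus])
    then show ?thesis by (simp add: algebra_simps)
  qed
  show ?thesis
  proof (cases "t = 0")
    case True
    have ae: "AE \<tau> in lebesgue. \<tau> \<noteq> (0::real)" using AE_completion[OF AE_lborel_singleton[of "0::real"]] by simp
    \<comment> \<open>\<open>p\<close> is known to be measurable only after being cut off to [0, T];
      on the single point 0 its cutoff is a multiple of an indicator.\<close>
    have meas: "(\<lambda>\<tau>. indicator {0..0} \<tau> *\<^sub>R p \<tau>) \<in> borel_measurable lebesgue"
    proof -
      have "(\<lambda>\<tau>. indicator {0..0} \<tau> *\<^sub>R p \<tau>) = (\<lambda>\<tau>. indicator {0} \<tau> *\<^sub>R p 0)"
        by (auto simp: indicator_def)
      moreover have "(\<lambda>\<tau>. indicator {0} \<tau> *\<^sub>R p 0) \<in> borel_measurable lebesgue"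
        by (rule measurable_completion) simp
      ultimately show ?thesis by (simp only:)
    qed
    have "AE \<tau> in lebesgue. indicator {0..0} \<tau> *\<^sub>R p \<tau> = 0"
      using ae by eventually_elim simp
    then have "(LINT \<tau>:{0..0}|lebesgue. p \<tau>) = (LINT \<tau>|(lebesgue :: real measure). 0)"
      unfolding set_lebesgue_integral_def by (intro Bochner_Integration.integral_cong_AE meas) auto
    then show ?thesis using True by simp
  next
    case False
    then have t0: "t > 0" "t \<le> T" using t by auto
    \<comment> \<open>The offset 3 ensures that l is at most t / 3 and r at least 2 t / 3, so the
      intervals are nondegenerate for all n.\<close>
    define l r where "l = (\<lambda>n. t / real (n + 3))" and "r = (\<lambda>n. t - t / real (n + 3))"
    have lr: "0 < l n" "l n < r n" "r n < T" "r n < t" "r n > 0" for n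
    proof -
      show "0 < l n" using t0 by (simp add: l_def)
      have "l n \<le> t / 3" unfolding l_def using t0 by (intro divide_left_mono) auto
      moreover have "r n = t - l n" by (simp add: l_def r_def)
      ultimately show "l n < r n" "r n > 0" using t0 by linarith+
      show "r n < t" using t0 by (simp add: r_def)
      then show "r n < T" using t0 by simp
    qed
    have l0: "l \<longlonglongrightarrow> 0" unfolding l_def by real_asymp
    then have rt: "r \<longlonglongrightarrow> t" unfolding r_def using tendsto_diff[OF tendsto_const[of t] l0] by (simp add: l_def)
    have "(\<lambda>n. a (r n) - a (l n)) \<longlonglongrightarrow> a t - a 0"
    proof (intro tendsto_diff)
      show "(\<lambda>n. a (r n)) \<longlonglongrightarrow> a t"
        using lr by (intro continuous_on_tendsto_compose[OF a rt t]) (auto intro!: always_eventually less_imp_le)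
      have "l n \<in> {0..T}" for n using lr[of n] by auto
      then show "(\<lambda>n. a (l n)) \<longlonglongrightarrow> a 0"
        using t by (intro continuous_on_tendsto_compose[OF a l0]) auto
    qed
    moreover have "(\<lambda>n. LINT t:{0..T}|lebesgue. of_real (indicator {l n..r n} t) * p t) \<longlonglongrightarrow> (LINT \<tau>:{0..t}|lebesgue. p \<tau>)"
    proof (rule integral_limit_intervals[OF p C])
      show "\<bar>indicator {l n..r n} \<tau> :: real\<bar> \<le> 2" for n \<tau> by (simp add: indicator_def)
      have "AE \<tau> in lebesgue. \<tau> \<noteq> 0 \<and> \<tau> \<noteq> t"
        using AE_completion[OF AE_lborel_singleton[of "0::real"]] AE_completion[OF AE_lborel_singleton[of t]] by auto
      then show "AE \<tau> in lebesgue. (\<lambda>n. indicator {l n..r n} \<tau> :: real) \<longlonglongrightarrow> indicator {0..t} \<tau>"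
      proof eventually_elim
        fix \<tau> assume \<tau>: "\<tau> \<noteq> 0 \<and> \<tau> \<noteq> t"
        show "(\<lambda>n. indicator {l n..r n} \<tau> :: real) \<longlonglongrightarrow> indicator {0..t} \<tau>"
        proof (cases "\<tau> \<in> {0..t}")
          case True
          then have "0 < \<tau>" "\<tau> < t" using \<tau> by auto
          then have "\<forall>\<^sub>F n in sequentially. l n < \<tau>" "\<forall>\<^sub>F n in sequentially. \<tau> < r n"
            using order_tendstoD(2)[OF l0] order_tendstoD(1)[OF rt] by auto
          then have "\<forall>\<^sub>F n in sequentially. (indicator {l n..r n} \<tau> :: real) = indicator {0..t} \<tau>"
            by eventually_elim (use True in auto)
          then show ?thesis by (rule tendsto_eventually)
        next
          case False
          then have "\<tau> \<notin> {l n..r n}" for n using lr[of n] by auto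
          then show ?thesis using False by (simp del: atLeastAtMost_iff)
        qed
      qed
    qed (use t0 in \<open>auto intro!: borel_measurable_indicator\<close>)
    moreover have "(LINT t:{0..T}|lebesgue. of_real (indicator {l n..r n} t) * p t) = a (r n) - a (l n)" for n
    proof -
      have "(LINT t:{0..T}|lebesgue. of_real (indicator {l n..r n} t) * p t) = (LINT t:{l n..r n}|lebesgue. p t)"
        unfolding set_lebesgue_integral_def using lr[of n]
        by (intro Bochner_Integration.integral_cong) (auto simp: indicator_def)
      then show ?thesis using interior[of "l n" "r n"] lr[of n] by simp
    qed
    ultimately show ?thesis by (simp add: LIMSEQ_unique)
  qed
qed

section \<open>Weakly continuous representatives\<close>

text \<open>Comparison with f = 0, where the pairing vanishes. The bound is uniform on balls of L^2,
  so pairings along a solution are essentially bounded in time.\<close>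

lemma moderate_pairing_bounded:
  fixes \<psi> :: "'a::euclidean_space \<Rightarrow> complex"
  assumes G: "moderate G" "G 0 = 0" and \<psi>: "test \<psi>"
  obtains C where "C \<ge> 0" "\<And>f. square_integrable f \<Longrightarrow> l2sq f \<le> ennreal M \<Longrightarrow> cmod (pair_with (\<lambda>x. G (f x)) \<psi>) \<le> C"
proof -
  obtain r B where rB: "r > 0" "\<And>x. norm x > r \<Longrightarrow> \<psi> x = 0" "B > 0" "\<And>x. cmod (\<psi> x) \<le> B" "\<psi> \<in> borel_measurable borel"
    using testE[OF \<psi>] by metis
  obtain K where K: "K \<ge> 0" "\<And>a b. cmod (G b - G a) \<le> 1 * (1 + (cmod a)\<^sup>2) + K * (cmod (b - a))\<^sup>2"
    using G(1) unfolding moderate_def by (metis zero_less_one)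
  define V where "V = measure lborel (cball (0::'a) r)"
  show thesis
  proof (rule that[of "B * (V + K * max M 0)"])
    show "B * (V + K * max M 0) \<ge> 0" using rB K by (simp add: V_def)
    fix f :: "'a \<Rightarrow> complex"
    assume f: "square_integrable f" and M: "l2sq f \<le> ennreal M"
    have z: "square_integrable (\<lambda>_::'a. 0)" by (simp add: square_integrable_def)
    have "cmod (pair_with (\<lambda>x. G (f x)) \<psi> - pair_with (\<lambda>x. G ((\<lambda>_. 0) x)) \<psi>) \<le>
        B * (1 * (measure lborel (cball (0::'a) r) + enn2real (l2sq (\<lambda>_::'a. 0))) + K * enn2real (l2sq (\<lambda>x. f x - (\<lambda>_. 0) x)))"
      using K(1) by (intro moderate_diff_le[OF G(1) z rB(5,4,2) f K(2)]) auto
    also have "pair_with (\<lambda>x::'a. G ((\<lambda>_. 0) x)) \<psi> = 0" by (simp add: G pair_with_def)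
    also have "enn2real (l2sq (\<lambda>_::'a. 0)) = 0" by (simp add: l2sq_def)
    finally have "cmod (pair_with (\<lambda>x. G (f x)) \<psi>) \<le> B * (V + K * enn2real (l2sq f))" by (simp add: V_def)
    also have "\<dots> \<le> B * (V + K * max M 0)"
    proof -
      have "l2sq f \<le> ennreal (max M 0)"
        using M by (rule order_trans) (intro ennreal_leI, simp)
      then have "enn2real (l2sq f) \<le> max M 0" by (intro enn2real_leI) auto
      then show ?thesis using rB K by (intro mult_left_mono add_left_mono) auto
    qed
    finally show "cmod (pair_with (\<lambda>x. G (f x)) \<psi>) \<le> B * (V + K * max M 0)" .
  qed
qed

lemma pair_with_cong_AE:
  fixes f g :: "'a::euclidean_space \<Rightarrow> complex"
  assumes "AE x in lborel. f x = g x" and [measurable]: "f \<in> borel_measurable borel" "g \<in> borel_measurable borel"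
    "G \<in> borel_measurable borel" "\<psi> \<in> borel_measurable borel"
  shows "pair_with (\<lambda>x. G (f x)) \<psi> = pair_with (\<lambda>x. G (g x)) \<psi>"
  unfolding pair_with_def
proof (rule Bochner_Integration.integral_cong_AE)
  show "AE x in lborel. G (f x) * \<psi> x = G (g x) * \<psi> x" using assms(1) by eventually_elim simp
qed measurable

text \<open>The uniform bound is known for u at almost every time and reaches the weakly continuous
  representative through equality almost everywhere in space, which \<open>frac_bound\<close>
  respects. Taking the maximum with 1 makes the constant positive.\<close>

lemma Linf_sobolev_rep:
  assumes s: "0 < s" "s < 1" and u: "Linf_sobolev T s u" and u': "weakly_continuous_rep T s u u'"
  obtains M where "M > 0" "AE t in lebesgue. t \<in> {0..T} \<longrightarrow>
     frac_bound s M (u t) \<and> frac_bound s M (u' t) \<and> (AE x in lborel. u t x = u' t x)"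
proof -
  obtain C where C: "AE t in lebesgue. t \<in> {0..T} \<longrightarrow> sobolev_norm s (u t) \<le> C"
    using u by (auto simp: Linf_sobolev_def)
  have sp: "AE t in lebesgue. t \<in> {0..T} \<longrightarrow> u t \<in> sobolev_space s"
    using u unfolding Linf_sobolev_def sobolev_strongly_measurable_def by (auto elim: AE_mp)
  have rep: "AE t in lebesgue. t \<in> {0..T} \<longrightarrow> (AE x in lborel. u' t x = u t x)"
    and sp': "\<And>t. t \<in> {0..T} \<Longrightarrow> u' t \<in> sobolev_space s"
    using u' by (auto simp: weakly_continuous_rep_def weakly_continuous_def)
  show thesis
  proof (rule that[of "8 * (max C 1)\<^sup>2"])
    show "AE t in lebesgue. t \<in> {0..T} \<longrightarrow> frac_bound s (8 * (max C 1)\<^sup>2) (u t) \<and>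
        frac_bound s (8 * (max C 1)\<^sup>2) (u' t) \<and> (AE x in lborel. u t x = u' t x)"
      using C sp rep
    proof eventually_elim
      fix t
      assume a: "t \<in> {0..T} \<longrightarrow> sobolev_norm s (u t) \<le> C" "t \<in> {0..T} \<longrightarrow> u t \<in> sobolev_space s"
        "t \<in> {0..T} \<longrightarrow> (AE x in lborel. u' t x = u t x)"
      show "t \<in> {0..T} \<longrightarrow> frac_bound s (8 * (max C 1)\<^sup>2) (u t) \<and>
        frac_bound s (8 * (max C 1)\<^sup>2) (u' t) \<and> (AE x in lborel. u t x = u' t x)"
      proof
        assume t: "t \<in> {0..T}"
        have 1: "frac_bound s (8 * (max C 1)\<^sup>2) (u t)"
          using a t by (intro frac_bound_sobolev s) auto
        have e: "AE x in lborel. u t x = u' t x" using a(3) t by (auto elim: AE_mp)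
        have "u' t \<in> borel_measurable borel"
          using sobolev_space_square_integrable[OF sp'[OF t]] by (simp add: square_integrable_def)
        from frac_bound_cong_AE[OF 1 this e] 1 e
        show "frac_bound s (8 * (max C 1)\<^sup>2) (u t) \<and>
          frac_bound s (8 * (max C 1)\<^sup>2) (u' t) \<and> (AE x in lborel. u t x = u' t x)" by blast
      qed
    qed
  qed (simp add: max_def)
qed

lemma pair_with_Cauchy_Schwarz:
  fixes f \<psi> :: "'a::euclidean_space \<Rightarrow> complex"
  assumes [measurable]: "f \<in> borel_measurable borel" "\<psi> \<in> borel_measurable borel"
  shows "ennreal ((cmod (pair_with f \<psi>))\<^sup>2) \<le> l2sq f * l2sq \<psi>"
proof -
  have "ennreal ((cmod (pair_with f \<psi>))\<^sup>2) = (ennreal (cmod (pair_with f \<psi>)))\<^sup>2"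
    by (simp add: ennreal_power)
  also have "\<dots> \<le> (\<integral>\<^sup>+x. ennreal (cmod (f x * \<psi> x)) \<partial>lborel)\<^sup>2"
    unfolding pair_with_def by (intro power_mono norm_integral_le_nn_integral) simp
  also have "\<dots> = (\<integral>\<^sup>+x. ennreal (cmod (f x)) * ennreal (cmod (\<psi> x)) \<partial>lborel)\<^sup>2"
    by (simp add: norm_mult ennreal_mult)
  also have "\<dots> \<le> (\<integral>\<^sup>+x. (ennreal (cmod (f x)))\<^sup>2 \<partial>lborel) * (\<integral>\<^sup>+x. (ennreal (cmod (\<psi> x)))\<^sup>2 \<partial>lborel)"
    by (rule Cauchy_Schwarz_nn_integral) measurable
  finally show ?thesis by (simp add: l2sq_def ennreal_power)
qed

lemma test_square_integrable:
  assumes "test (\<psi> :: 'a::euclidean_space \<Rightarrow> complex)"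
  shows "square_integrable \<psi>"
proof -
  obtain r where r: "\<And>x. norm x > r \<Longrightarrow> \<psi> x = 0" using test_support[OF assms] by auto
  have "continuous_on UNIV \<psi>"
    using assms by (intro smooth_imp_continuous) (simp add: test_function_def)
  then have "integrable lborel (\<lambda>x. (cmod (\<psi> x))\<^sup>2)"
    using r by (intro integrable_continuous_compact_support[where R=r] continuous_intros) auto
  then show ?thesis
    using smooth_borel[of \<psi>] assms by (auto simp: square_integrable_def test_function_def)
qed

text \<open>Weak continuity quantifies over bounded functionals on H^s. Pairing with a test function
  is one of them, because the H^s norm controls the L^2 norm and Cauchy-Schwarz does the rest; this
  is the form in which weak continuity is exploited.\<close>

lemma sobolev_functional_pair_with:
  fixes \<psi> :: "'a::euclidean_space \<Rightarrow> complex"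
  assumes s: "0 < s" "s < 1" and \<psi>: "test \<psi>"
  shows "sobolev_functional s (\<lambda>f. pair_with f \<psi>)"
proof -
  obtain r B where rB: "r > 0" "\<And>x. norm x > r \<Longrightarrow> \<psi> x = 0" "B > 0" "\<And>x. cmod (\<psi> x) \<le> B" "\<psi> \<in> borel_measurable borel"
    using testE[OF \<psi>] by metis
  have int: "integrable lborel (\<lambda>x. f x * \<psi> x)" if "f \<in> sobolev_space s" for f
    using moderate_integrable[OF moderate_id sobolev_space_square_integrable[OF that] rB(5,4,2)] by simp
  define Q where "Q = enn2real (l2sq \<psi>)"
  have Q: "l2sq \<psi> = ennreal Q" "Q \<ge> 0"
    using test_square_integrable[OF \<psi>] by (auto simp: Q_def square_integrable_iff)
  have bound: "cmod (pair_with f \<psi>) \<le> sqrt (8 * Q) * sobolev_norm s f" if f: "f \<in> sobolev_space s" for f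
  proof -
    have N: "sobolev_norm s f \<ge> 0" by (simp add: sobolev_norm_def)
    have [measurable]: "f \<in> borel_measurable borel"
      using sobolev_space_square_integrable[OF f] by (simp add: square_integrable_def)
    have "ennreal ((cmod (pair_with f \<psi>))\<^sup>2) \<le> l2sq f * l2sq \<psi>"
      by (rule pair_with_Cauchy_Schwarz) (use rB in auto)
    also have "\<dots> \<le> ennreal (8 * (sobolev_norm s f)\<^sup>2) * ennreal Q"
      unfolding Q by (intro mult_right_mono l2sq_le_sobolev f s) auto
    also have "\<dots> = ennreal (8 * (sobolev_norm s f)\<^sup>2 * Q)" using Q by (simp add: ennreal_mult)
    finally have "(cmod (pair_with f \<psi>))\<^sup>2 \<le> 8 * (sobolev_norm s f)\<^sup>2 * Q"
      using Q by (simp add: ennreal_le_iff)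
    also have "\<dots> = (sqrt (8 * Q) * sobolev_norm s f)\<^sup>2"
      using Q by (simp add: power_mult_distrib)
    finally show ?thesis using Q N by (intro power2_le_imp_le[of "cmod (pair_with f \<psi>)"]) auto
  qed
  show ?thesis
    unfolding sobolev_functional_def
  proof (intro conjI ballI allI exI[of _ "sqrt (8 * Q)"] bound)
    fix f g :: "'a \<Rightarrow> complex" assume fg: "f \<in> sobolev_space s" "g \<in> sobolev_space s"
    show "pair_with (\<lambda>x. f x + g x) \<psi> = pair_with f \<psi> + pair_with g \<psi>"
      unfolding pair_with_def using int[OF fg(1)] int[OF fg(2)] by (simp add: distrib_right)
  next
    fix f :: "'a \<Rightarrow> complex" and c
    show "pair_with (\<lambda>x. c * f x) \<psi> = c * pair_with f \<psi>"
      unfolding pair_with_def by (simp add: mult.assoc)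
  qed
qed

lemma weakly_continuous_pairing:
  assumes s: "0 < s" "s < 1" and u': "weakly_continuous_rep T s u u'" and \<psi>: "test \<psi>"
  shows "continuous_on {0..T} (\<lambda>t. pair_with (u' t) \<psi>)"
  using u' sobolev_functional_pair_with[OF s \<psi>] unfolding weakly_continuous_rep_def weakly_continuous_def by blast

text \<open>The strongly measurable function and the weakly continuous one are different objects
  that agree almost everywhere in time. Measurability of the pairings comes from the former,
  continuity from the latter; here the two are brought together, with G for the identity or for the
  nonlinearity.\<close>

lemma pairing_rep:
  fixes u u' :: "real \<Rightarrow> 'a::euclidean_space \<Rightarrow> complex"
  assumes s: "0 < s" "s < 1" and u: "Linf_sobolev T s u" and u': "weakly_continuous_rep T s u u'"
    and G: "moderate G" "G 0 = 0" and \<psi>: "test \<psi>"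
  shows pairing_rep_measurable: "(\<lambda>t. if t \<in> {0..T} then pair_with (\<lambda>x. G (u' t x)) \<psi> else 0) \<in> borel_measurable lebesgue" (is ?A)
    and pairing_rep_bounded: "\<exists>C. AE t in lebesgue. t \<in> {0..T} \<longrightarrow> cmod (pair_with (\<lambda>x. G (u' t x)) \<psi>) \<le> C" (is ?B)
    and pairing_rep_integral: "smooth \<theta> \<Longrightarrow> (LINT t:{0..T}|lebesgue. of_real (\<theta> t) * pair_with (\<lambda>x. G (u t x)) \<psi>) =
      (LINT t:{0..T}|lebesgue. of_real (\<theta> t) * pair_with (\<lambda>x. G (u' t x)) \<psi>)"
    and pairing_rep_integrable: "smooth \<theta> \<Longrightarrow>
      set_integrable lebesgue {0..T} (\<lambda>t. of_real (\<theta> t) * pair_with (\<lambda>x. G (u' t x)) \<psi>)"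
proof -
  obtain M where M: "M > 0" "AE t in lebesgue. t \<in> {0..T} \<longrightarrow>
     frac_bound s M (u t) \<and> frac_bound s M (u' t) \<and> (AE x in lborel. u t x = u' t x)"
    using Linf_sobolev_rep[OF s u u'] by blast
  obtain r B where rB: "r > 0" "\<And>x. norm x > r \<Longrightarrow> \<psi> x = 0" "B > 0" "\<And>x. cmod (\<psi> x) \<le> B" "\<psi> \<in> borel_measurable borel"
    using testE[OF \<psi>] by metis
  have Gm: "G \<in> borel_measurable borel" using G by (simp add: moderate_def)
  define P where "P = (\<lambda>t. if t \<in> {0..T} then pair_with (\<lambda>x. G (u t x)) \<psi> else 0)"
  define P' where "P' = (\<lambda>t. if t \<in> {0..T} then pair_with (\<lambda>x. G (u' t x)) \<psi> else 0)"
  have mP: "P \<in> borel_measurable lebesgue"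
    unfolding P_def using u by (intro pairing_measurable[OF _ s G(1) rB(5,4,2)]) (simp add: Linf_sobolev_def)
  have ae: "AE t in lebesgue. P t = P' t"
    using M(2)
  proof eventually_elim
    fix t assume t: "t \<in> {0..T} \<longrightarrow> frac_bound s M (u t) \<and> frac_bound s M (u' t) \<and> (AE x in lborel. u t x = u' t x)"
    show "P t = P' t"
    proof (cases "t \<in> {0..T}")
      case True
      then have "pair_with (\<lambda>x. G (u t x)) \<psi> = pair_with (\<lambda>x. G (u' t x)) \<psi>"
        using t by (intro pair_with_cong_AE Gm rB(5)) (auto simp: frac_bound_def)
      then show ?thesis by (simp add: P_def P'_def)
    next
      case False
      then show ?thesis by (simp add: P_def P'_def del: atLeastAtMost_iff)
    qed
  qed
  have mP': "P' \<in> borel_measurable lebesgue"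
    by (rule lebesgue_measurable_AE_limit[OF mP]) (use ae in eventually_elim, simp)
  then show ?A by (simp only: P'_def)
  obtain C where C: "C \<ge> 0" "\<And>f. square_integrable f \<Longrightarrow> l2sq f \<le> ennreal M \<Longrightarrow> cmod (pair_with (\<lambda>x. G (f x)) \<psi>) \<le> C"
    using moderate_pairing_bounded[OF G \<psi>] by metis
  have bd: "AE t in lebesgue. t \<in> {0..T} \<longrightarrow> cmod (pair_with (\<lambda>x. G (u' t x)) \<psi>) \<le> C"
    using M(2) by eventually_elim (use C(2) frac_boundD in blast)
  then show ?B by blast
  assume \<theta>: "smooth \<theta>"
  have m\<theta>: "\<theta> \<in> borel_measurable lebesgue"
    using smooth_borel[OF \<theta>] by (intro measurable_completion) simp
  have eqi: "indicator {0..T} t *\<^sub>R (of_real (\<theta> t) * pair_with (\<lambda>x. G (u t x)) \<psi>) = of_real (\<theta> t) * P t"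
    "indicator {0..T} t *\<^sub>R (of_real (\<theta> t) * pair_with (\<lambda>x. G (u' t x)) \<psi>) = of_real (\<theta> t) * P' t" for t
    by (auto simp: P_def P'_def)
  show "(LINT t:{0..T}|lebesgue. of_real (\<theta> t) * pair_with (\<lambda>x. G (u t x)) \<psi>) =
      (LINT t:{0..T}|lebesgue. of_real (\<theta> t) * pair_with (\<lambda>x. G (u' t x)) \<psi>)"
    unfolding set_lebesgue_integral_def eqi
  proof (rule Bochner_Integration.integral_cong_AE)
    show "AE t in lebesgue. of_real (\<theta> t) * P t = of_real (\<theta> t) * P' t"
      using ae by eventually_elim simp
  qed (use mP mP' m\<theta> in measurable)
  have "compact (\<theta> ` {0..T})"
    by (intro compact_continuous_image continuous_on_subset[OF smooth_imp_continuous[OF \<theta>]]) auto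
  then obtain D where D: "D > 0" "\<And>t. t \<in> {0..T} \<Longrightarrow> \<bar>\<theta> t\<bar> \<le> D"
    using compact_imp_bounded bounded_pos by (metis imageI real_norm_def)
  show "set_integrable lebesgue {0..T} (\<lambda>t. of_real (\<theta> t) * pair_with (\<lambda>x. G (u' t x)) \<psi>)"
    unfolding set_integrable_def eqi
  proof (rule Bochner_Integration.integrable_bound)
    show "integrable lebesgue (\<lambda>t. D * C * indicator {0..T} t)"
      by (intro integrable_mult_right) (simp add: integrable_indicator_iff emeasure_lborel_Icc_eq)
    show "AE t in lebesgue. cmod (of_real (\<theta> t) * P' t) \<le> norm (D * C * indicator {0..T} t)"
      using bd
    proof eventually_elim
      fix t assume t: "t \<in> {0..T} \<longrightarrow> cmod (pair_with (\<lambda>x. G (u' t x)) \<psi>) \<le> C"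
      show "cmod (of_real (\<theta> t) * P' t) \<le> norm (D * C * indicator {0..T} t)"
      proof (cases "t \<in> {0..T}")
        case True
        then have "\<bar>\<theta> t\<bar> * cmod (pair_with (\<lambda>x. G (u' t x)) \<psi>) \<le> D * C"
          using t D by (intro mult_mono) auto
        then show ?thesis using True C D by (simp add: P'_def norm_mult abs_mult)
      next
        case False
        then show ?thesis by (simp add: P'_def del: atLeastAtMost_iff)
      qed
    qed
  qed (use mP' m\<theta> in measurable)
qed

section \<open>Solutions in integrated form\<close>

lemma continuous_eq_of_AE_eq:
  fixes f g :: "real \<Rightarrow> complex"
  assumes T: "T > 0" and f: "continuous_on {0..T} f" and g: "continuous_on {0..T} g"
    and ae: "AE t in lebesgue. t \<in> {0..T} \<longrightarrow> f t = g t" and t: "t \<in> {0..T}"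
  shows "f t = g t"
proof (rule ccontr)
  assume ne: "f t \<noteq> g t"
  define d where "d = (\<lambda>t. f t - g t)"
  have d: "continuous_on {0..T} d" unfolding d_def by (intro continuous_intros f g)
  have "d t \<noteq> 0" using ne by (simp add: d_def)
  then obtain e where e: "e > 0" "\<And>x. x \<in> {0..T} \<Longrightarrow> dist x t < e \<Longrightarrow> dist (d x) (d t) < cmod (d t)"
    using d t unfolding continuous_on_iff by (metis zero_less_norm_iff)
  define l where "l = max 0 (t - e)"
  define r where "r = min T (t + e)"
  have lr: "l < r" using T t e by (auto simp: l_def r_def)
  have "AE x in lebesgue. x \<notin> {l<..<r}"
    using ae
  proof eventually_elim
    fix x assume x: "x \<in> {0..T} \<longrightarrow> f x = g x"
    show "x \<notin> {l<..<r}"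
    proof
      assume "x \<in> {l<..<r}"
      then have "x \<in> {0..T}" "dist x t < e" by (auto simp: l_def r_def dist_real_def)
      then show False using e(2)[of x] x by (auto simp: d_def)
    qed
  qed
  then have "emeasure lebesgue {l<..<r} = 0"
    by (subst (asm) AE_iff_null_sets[symmetric]) auto
  then show False using lr by simp
qed

text \<open>The interface between the weak formulation and the energy argument. The bound
  \<open>M\<close> is uniform but holds at almost every time; the second clause gives at each single
  time a bound that may depend on the time, and is what makes the final conclusion meaningful for
  every t. The last clause is the equation integrated in time.\<close>

definition tested_solution ::
    "real \<Rightarrow> real \<Rightarrow> real \<Rightarrow> real \<Rightarrow> (real \<Rightarrow> 'a::euclidean_space \<Rightarrow> complex) \<Rightarrow> bool" where
  "tested_solution lam T s M u \<longleftrightarrow>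
     (AE t in lebesgue. t \<in> {0..T} \<longrightarrow> frac_bound s M (u t)) \<and>
     (\<forall>t\<in>{0..T}. \<exists>N\<ge>0. frac_bound s N (u t)) \<and>
     (\<forall>\<psi>. test \<psi> \<longrightarrow> continuous_on {0..T} (\<lambda>t. pair_with (u t) \<psi>)) \<and>
     (\<forall>\<psi>. test \<psi> \<longrightarrow>
        (\<lambda>t. if t \<in> {0..T} then pair_with (\<lambda>x. log_nonlinearity (u t x)) \<psi> else 0) \<in> borel_measurable lebesgue) \<and>
     (\<forall>\<psi>. \<forall>t\<in>{0..T}. test \<psi> \<longrightarrow> pair_with (u t) \<psi> - pair_with (u 0) \<psi> =
        (LINT \<tau>:{0..t}|lebesgue. \<i> * (pair_with (u \<tau>) (lap \<psi>)
           + of_real lam * pair_with (\<lambda>x. log_nonlinearity (u \<tau> x)) \<psi>)))"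

lemma tested_solution_rep:
  fixes u u' :: "real \<Rightarrow> 'a::euclidean_space \<Rightarrow> complex"
  assumes T: "T > 0" and s: "0 < s" "s < 1" and u: "Linf_sobolev T s u"
    and eq: "logNLS_distributional lam T u" and u': "weakly_continuous_rep T s u u'"
  obtains M where "M > 0" "tested_solution lam T s M u'"
proof -
  obtain M where M: "M > 0" "AE t in lebesgue. t \<in> {0..T} \<longrightarrow>
     frac_bound s M (u t) \<and> frac_bound s M (u' t) \<and> (AE x in lborel. u t x = u' t x)"
    using Linf_sobolev_rep[OF s u u'] by blast
  have g0: "log_nonlinearity 0 = 0" by (simp add: log_nonlinearity_def)
  note rep_id = pairing_rep[OF s u u' moderate_id refl]
  note rep_log = pairing_rep[OF s u u' moderate_log_nonlinearity g0]
  have duhamel: "pair_with (u' t) \<psi> - pair_with (u' 0) \<psi> =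
        (LINT \<tau>:{0..t}|lebesgue. \<i> * (pair_with (u' \<tau>) (lap \<psi>)
           + of_real lam * pair_with (\<lambda>x. log_nonlinearity (u' \<tau> x)) \<psi>))"
    if \<psi>: "test \<psi>" and t: "t \<in> {0..T}" for \<psi> t
  proof -
    obtain C1 where C1: "AE t in lebesgue. t \<in> {0..T} \<longrightarrow> cmod (pair_with (\<lambda>x. u' t x) (lap \<psi>)) \<le> C1"
      using rep_id(2)[OF test_lap[OF \<psi>]] by blast
    obtain C2 where C2: "AE t in lebesgue. t \<in> {0..T} \<longrightarrow> cmod (pair_with (\<lambda>x. log_nonlinearity (u' t x)) \<psi>) \<le> C2"
      using rep_log(2)[OF \<psi>] by blast
    show ?thesis
  proof (rule weak_derivative_imp_integral[OF T weakly_continuous_pairing[OF s u' \<psi>] _ _ _ t])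
    let ?L = "\<lambda>t. if t \<in> {0..T} then pair_with (\<lambda>x. u' t x) (lap \<psi>) else 0"
    let ?N = "\<lambda>t. if t \<in> {0..T} then pair_with (\<lambda>x. log_nonlinearity (u' t x)) \<psi> else 0"
    have "(\<lambda>t. \<i> * (?L t + of_real lam * ?N t)) \<in> borel_measurable lebesgue"
      using rep_id(1)[OF test_lap[OF \<psi>]] rep_log(1)[OF \<psi>] by (intro borel_measurable_times borel_measurable_add) auto
    also have "(\<lambda>t. \<i> * (?L t + of_real lam * ?N t)) =
      (\<lambda>t. if t \<in> {0..T} then \<i> * (pair_with (u' t) (lap \<psi>)
           + of_real lam * pair_with (\<lambda>x. log_nonlinearity (u' t x)) \<psi>) else 0)" by auto
    finally show "\<dots> \<in> borel_measurable lebesgue" .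
    show "AE t in lebesgue. t \<in> {0..T} \<longrightarrow> cmod (\<i> * (pair_with (u' t) (lap \<psi>)
           + of_real lam * pair_with (\<lambda>x. log_nonlinearity (u' t x)) \<psi>)) \<le> C1 + \<bar>lam\<bar> * C2"
      using C1 C2
    proof (eventually_elim, intro impI)
      fix t assume a: "t \<in> {0..T} \<longrightarrow> cmod (pair_with (\<lambda>x. u' t x) (lap \<psi>)) \<le> C1"
        "t \<in> {0..T} \<longrightarrow> cmod (pair_with (\<lambda>x. log_nonlinearity (u' t x)) \<psi>) \<le> C2" and t: "t \<in> {0..T}"
      have "cmod (of_real lam * pair_with (\<lambda>x. log_nonlinearity (u' t x)) \<psi>) \<le> \<bar>lam\<bar> * C2"
        using a(2) t by (simp add: norm_mult mult_left_mono)
      then show "cmod (\<i> * (pair_with (u' t) (lap \<psi>)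
           + of_real lam * pair_with (\<lambda>x. log_nonlinearity (u' t x)) \<psi>)) \<le> C1 + \<bar>lam\<bar> * C2"
        using a(1) t by (simp add: norm_mult norm_triangle_mono)
    qed
    fix \<theta> :: "real \<Rightarrow> real" and c d
    assume \<theta>: "smooth \<theta>" "\<And>t. t \<notin> {c..d} \<Longrightarrow> \<theta> t = 0" and cd: "0 < c" "d < T"
    define \<phi> where "\<phi> = (\<lambda>z::real \<times> 'a. of_real (\<theta> (fst z)) * \<psi> (snd z))"
    have ptf1: "test_function ({0<..<T} \<times> UNIV) \<phi>"
      unfolding \<phi>_def using \<theta> cd \<psi> by (rule product_test_function)
    have ptf2: "time_deriv \<phi> (t, x) = of_real (dir_deriv 1 \<theta> t) * \<psi> x" for t x
      unfolding \<phi>_def using \<theta> cd \<psi> by (rule product_test_function)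
    have ptf3: "space_laplacian \<phi> (t, x) = of_real (\<theta> t) * lap \<psi> x" for t x
      unfolding \<phi>_def using \<theta> cd \<psi> by (rule product_test_function)
    have d\<theta>: "smooth (dir_deriv 1 \<theta>)" by (rule smooth_dir_deriv[OF \<theta>(1)]) simp
    define X where "X = (LINT t:{0..T}|lebesgue. of_real (dir_deriv 1 \<theta> t) * pair_with (\<lambda>x. u' t x) \<psi>)"
    define Y where "Y = (LINT t:{0..T}|lebesgue. of_real (\<theta> t) * pair_with (\<lambda>x. u' t x) (lap \<psi>))"
    define Z where "Z = (LINT t:{0..T}|lebesgue. of_real (\<theta> t) * pair_with (\<lambda>x. log_nonlinearity (u' t x)) \<psi>)"
    have pull: "(LINT x|lborel. f x * (of_real q * \<eta> x)) = of_real q * pair_with f \<eta>" for f \<eta> :: "'a \<Rightarrow> complex" and q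
    proof -
      have "(LINT x|lborel. f x * (of_real q * \<eta> x)) = (LINT x|lborel. of_real q * (f x * \<eta> x))"
        by (simp add: mult.left_commute)
      then show ?thesis by (simp add: pair_with_def)
    qed
    have 1: "distribution_pairing T u (time_deriv \<phi>) = X"
      unfolding distribution_pairing_def ptf2 pull X_def by (rule rep_id(3)[OF \<psi> d\<theta>])
    have 2: "distribution_pairing T u (space_laplacian \<phi>) = Y"
      unfolding distribution_pairing_def ptf3 pull Y_def by (rule rep_id(3)[OF test_lap[OF \<psi>] \<theta>(1)])
    have 3: "distribution_pairing T (\<lambda>t x. log_nonlinearity (u t x)) \<phi> = Z"
      unfolding distribution_pairing_def \<phi>_def fst_conv snd_conv pull Z_def by (rule rep_log(3)[OF \<psi> \<theta>(1)])
    have "\<i> * (- X) + Y + of_real lam * Z = 0"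
      using eq ptf1 unfolding logNLS_distributional_def 1[symmetric] 2[symmetric] 3[symmetric] by blast
    \<comment> \<open>Multiplication by \<i> isolates the term with the time derivative, because
      \<i> (\<i> (- X)) = X.\<close>
    then have "\<i> * (\<i> * (- X) + Y + of_real lam * Z) = 0" by simp
    then have "X = - (\<i> * (Y + of_real lam * Z))"
    proof -
      assume z: "\<i> * (\<i> * (- X) + Y + of_real lam * Z) = 0"
      have "\<i> * (\<i> * (- X)) = X" by (simp flip: mult.assoc)
      then have "\<i> * (\<i> * (- X) + Y + of_real lam * Z) = X + \<i> * (Y + of_real lam * Z)"
        by (simp only: distrib_left add.assoc)
      then show ?thesis using z by (simp add: eq_neg_iff_add_eq_0)
    qed
    also have "\<i> * (Y + of_real lam * Z) = (LINT t:{0..T}|lebesgue. \<i> * (of_real (\<theta> t) * pair_with (\<lambda>x. u' t x) (lap \<psi>)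
        + of_real lam * (of_real (\<theta> t) * pair_with (\<lambda>x. log_nonlinearity (u' t x)) \<psi>)))"
      unfolding Y_def Z_def
      using rep_id(4)[OF test_lap[OF \<psi>] \<theta>(1)] rep_log(4)[OF \<psi> \<theta>(1)] by simp
    also have "\<dots> = (LINT t:{0..T}|lebesgue. of_real (\<theta> t) * (\<i> * (pair_with (u' t) (lap \<psi>)
           + of_real lam * pair_with (\<lambda>x. log_nonlinearity (u' t x)) \<psi>)))"
      by (simp add: algebra_simps)
    finally show "(LINT t:{0..T}|lebesgue. of_real (dir_deriv 1 \<theta> t) * pair_with (u' t) \<psi>) =
        - (LINT t:{0..T}|lebesgue. of_real (\<theta> t) * (\<i> * (pair_with (u' t) (lap \<psi>)
           + of_real lam * pair_with (\<lambda>x. log_nonlinearity (u' t x)) \<psi>)))"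
      by (simp add: X_def)
  qed
  qed
  have "tested_solution lam T s M u'"
    unfolding tested_solution_def
  proof (intro conjI allI impI ballI duhamel)
    show "AE t in lebesgue. t \<in> {0..T} \<longrightarrow> frac_bound s M (u' t)"
      using M(2) by eventually_elim blast
    show "\<exists>N\<ge>0. frac_bound s N (u' t)" if "t \<in> {0..T}" for t
    proof -
      have "u' t \<in> sobolev_space s"
        using u' that by (simp add: weakly_continuous_rep_def weakly_continuous_def)
      then show ?thesis using frac_bound_sobolev[OF _ s order_refl, of "u' t"] by (intro exI conjI) auto
    qed
    show "continuous_on {0..T} (\<lambda>t. pair_with (u' t) \<psi>)" if "test \<psi>" for \<psi>
      by (rule weakly_continuous_pairing[OF s u' that])
    show "(\<lambda>t. if t \<in> {0..T} then pair_with (\<lambda>x. log_nonlinearity (u' t x)) \<psi> else 0) \<in> borel_measurable lebesgue"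
      if "test \<psi>" for \<psi>
      by (rule rep_log(1)[OF that])
  qed
  then show thesis using that M(1) by blast
qed

text \<open>The initial condition is known for one particular representative w. Any other one agrees
  with it at almost every time, and since their pairings are continuous, also at time 0.\<close>

lemma rep_initial:
  fixes u u' w :: "real \<Rightarrow> 'a::euclidean_space \<Rightarrow> complex"
  assumes T: "T > 0" and s: "0 < s" "s < 1"
    and u': "weakly_continuous_rep T s u u'" and w: "weakly_continuous_rep T s u w"
    and u0: "u\<^sub>0 \<in> borel_measurable borel" and w0: "AE x in lborel. w 0 x = u\<^sub>0 x" and \<psi>: "test \<psi>"
  shows "pair_with (u' 0) \<psi> = pair_with u\<^sub>0 \<psi>"
proof -
  have m: "v t \<in> borel_measurable borel" if "weakly_continuous_rep T s u v" "t \<in> {0..T}" for v t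
    using that sobolev_space_square_integrable[of "v t" s]
    by (auto simp: weakly_continuous_rep_def weakly_continuous_def square_integrable_def)
  have \<psi>m: "\<psi> \<in> borel_measurable borel" using \<psi> by (simp add: test_function_def smooth_borel)
  have "AE t in lebesgue. t \<in> {0..T} \<longrightarrow> (AE x in lborel. u' t x = u t x)"
    "AE t in lebesgue. t \<in> {0..T} \<longrightarrow> (AE x in lborel. w t x = u t x)"
    using u' w by (auto simp: weakly_continuous_rep_def)
  then have "AE t in lebesgue. t \<in> {0..T} \<longrightarrow> pair_with (u' t) \<psi> = pair_with (w t) \<psi>"
  proof (eventually_elim, intro impI)
    fix t assume a: "t \<in> {0..T} \<longrightarrow> (AE x in lborel. u' t x = u t x)"
      "t \<in> {0..T} \<longrightarrow> (AE x in lborel. w t x = u t x)" and t: "t \<in> {0..T}"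
    have "AE x in lborel. u' t x = w t x" using a[rule_format, OF t] by eventually_elim simp
    then show "pair_with (u' t) \<psi> = pair_with (w t) \<psi>"
      using pair_with_cong_AE[of "u' t" "w t" "\<lambda>z. z" \<psi>] m[OF u' t] m[OF w t] \<psi>m by simp
  qed
  then have "pair_with (u' 0) \<psi> = pair_with (w 0) \<psi>"
    using T by (intro continuous_eq_of_AE_eq[OF T weakly_continuous_pairing[OF s u' \<psi>] weakly_continuous_pairing[OF s w \<psi>]]) auto
  also have "\<dots> = pair_with u\<^sub>0 \<psi>"
    using pair_with_cong_AE[of "w 0" u\<^sub>0 "\<lambda>z. z" \<psi>] m[OF w, of 0] T w0 u0 \<psi>m by simp
  finally show ?thesis .
qed

section \<open>Convolution as a pairing\<close>

definition lapR :: "('a::euclidean_space \<Rightarrow> real) \<Rightarrow> 'a \<Rightarrow> real" where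
  "lapR K = (\<lambda>x. \<Sum>b\<in>Basis. dir_deriv b (dir_deriv b K) x)"

lemma kernel_lapR:
  assumes "kernel (K :: 'a::euclidean_space \<Rightarrow> real)"
  shows "kernel (lapR K)"
proof -
  have k: "kernel (dir_deriv b (dir_deriv b K))" if "b \<in> Basis" for b
    using assms that by (intro kernel_dir_deriv)
  have "smooth (lapR K)"
    using k unfolding smooth_def lapR_def kernel_def by (intro allI Ck_sum) auto
  moreover obtain r where r: "\<And>x. norm x > r \<Longrightarrow> K x = 0" using assms by (auto simp: kernel_def)
  have "lapR K x = 0" if "norm x > r" for x
    unfolding lapR_def using that r
    by (intro sum.neutral ballI dir_deriv_eq_0_outside[where R=r and f="dir_deriv b K" for b])
       (auto intro: dir_deriv_eq_0_outside[where R=r])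
  ultimately show ?thesis by (auto simp: kernel_def)
qed

lemma smooth_reflect:
  fixes K :: "'a::euclidean_space \<Rightarrow> real"
  assumes "smooth K"
  shows "smooth (\<lambda>y. complex_of_real (K (x - y)))"
    and "dir_deriv b (\<lambda>y. complex_of_real (K (x - y))) = (\<lambda>y. complex_of_real (- dir_deriv b K (x - y)))"
proof -
  have lin: "bounded_linear (\<lambda>y::'a. - y)" by (intro bounded_linear_minus bounded_linear_ident)
  have e: "(\<lambda>y. K (x - y)) = (\<lambda>y. K (- y + x))" by simp
  show "smooth (\<lambda>y. complex_of_real (K (x - y)))"
    unfolding smooth_def
  proof
    fix k
    have "Ck k (\<lambda>y. K (- y + x))" using assms by (intro Ck_affine lin) (simp add: smooth_def)
    then show "Ck k (\<lambda>y. complex_of_real (K (x - y)))"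
      unfolding e[symmetric] by (rule Ck_linear_comp[OF bounded_linear_of_real])
  qed
  show "dir_deriv b (\<lambda>y. complex_of_real (K (x - y))) = (\<lambda>y. complex_of_real (- dir_deriv b K (x - y)))"
  proof
    fix y
    have "((\<lambda>y. K (- y + x)) has_derivative (\<lambda>h. dir_deriv (- h) K (- y + x))) (at y)"
      by (rule has_derivative_affine_comp[OF lin smooth_differentiable[OF assms]])
    from has_derivative_of_real[OF this]
    have "dir_deriv b (\<lambda>y. complex_of_real (K (x - y))) y = complex_of_real (dir_deriv (- b) K (x - y))"
      by (intro dir_deriv_eq) simp
    also have "dir_deriv (- b) K (x - y) = - dir_deriv b K (x - y)"
      by (rule linear_neg[OF has_derivative_linear[OF has_derivative_dir_deriv[OF smooth_differentiable[OF assms]]]])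
    finally show "dir_deriv b (\<lambda>y. complex_of_real (K (x - y))) y = complex_of_real (- dir_deriv b K (x - y))" .
  qed
qed

text \<open>The value of a convolution at x is the pairing with the reflected kernel, so the
  integrated equation can be evaluated at x. Each derivative of the reflected kernel changes sign,
  hence second derivatives do not.\<close>

lemma test_reflect:
  fixes K :: "'a::euclidean_space \<Rightarrow> real"
  assumes "kernel K"
  shows "test (\<lambda>y. complex_of_real (K (x - y)))"
    and "lap (\<lambda>y. complex_of_real (K (x - y))) = (\<lambda>y. complex_of_real (lapR K (x - y)))"
proof -
  obtain r where r: "\<And>x. norm x > r \<Longrightarrow> K x = 0" and sm: "smooth K" using assms by (auto simp: kernel_def)
  show "test (\<lambda>y. complex_of_real (K (x - y)))"
  proof (rule testI[OF smooth_reflect(1)[OF sm]])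
    fix y :: 'a assume "norm y > norm x + r"
    then have "norm (x - y) > r" using norm_triangle_ineq2[of y x] by (simp add: norm_minus_commute)
    then show "complex_of_real (K (x - y)) = 0" using r by simp
  qed
  have "dir_deriv b (dir_deriv b (\<lambda>y. complex_of_real (K (x - y)))) = (\<lambda>y. complex_of_real (dir_deriv b (dir_deriv b K) (x - y)))"
    if b: "b \<in> Basis" for b
  proof -
    define D where "D = (\<lambda>y. - dir_deriv b K y)"
    have smD: "smooth D"
      unfolding smooth_def D_def using smooth_dir_deriv[OF sm b]
      by (intro allI Ck_linear_comp[OF bounded_linear_minus[OF bounded_linear_ident]]) (simp add: smooth_def)
    have "dir_deriv b D y = - dir_deriv b (dir_deriv b K) y" for y
      unfolding D_def
      by (intro dir_deriv_eq has_derivative_minus has_derivative_dir_deriv smooth_differentiable smooth_dir_deriv sm b)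
    then show ?thesis
      unfolding smooth_reflect(2)[OF sm] using smooth_reflect(2)[OF smD, of b x] by (simp add: D_def)
  qed
  then show "lap (\<lambda>y. complex_of_real (K (x - y))) = (\<lambda>y. complex_of_real (lapR K (x - y)))"
    unfolding lap_def lapR_def by (simp add: of_real_sum)
qed

lemma pair_with_reflect: "pair_with f (\<lambda>y. of_real (K (x - y))) = conv K f x"
  by (simp add: pair_with_def conv_def)

lemma conv_lapR:
  fixes f :: "'a::euclidean_space \<Rightarrow> complex"
  assumes f: "loc_integrable f" and K: "kernel K"
  shows "conv (lapR K) f x = (\<Sum>b\<in>Basis. conv (dir_deriv b (dir_deriv b K)) f x)"
  unfolding conv_def lapR_def
  by (simp add: of_real_sum sum_distrib_left)
     (intro Bochner_Integration.integral_sum integrable_conv f kernel_dir_deriv K)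

section \<open>Difference quotients\<close>

definition quot :: "'a::real_normed_vector \<Rightarrow> ('a \<Rightarrow> 'b::real_normed_vector) \<Rightarrow> nat \<Rightarrow> 'a \<Rightarrow> 'b" where
  "quot b F n x = real (Suc n) *\<^sub>R (F (x + (1 / real (Suc n)) *\<^sub>R b) - F x)"

text \<open>Differentiability along the steps 1 / (n + 1) only, together with locally uniform bounds
  on the quotients. It is made for the operations applied to mollified functions: products, bounded
  linear maps, and limits under the integral by dominated convergence.\<close>

definition qdiff :: "'a::euclidean_space \<Rightarrow> ('a \<Rightarrow> 'b::real_normed_vector) \<Rightarrow> ('a \<Rightarrow> 'b) \<Rightarrow> bool" where
  "qdiff b F F' \<longleftrightarrow> continuous_on UNIV F \<and> (\<forall>x. (\<lambda>n. quot b F n x) \<longlonglongrightarrow> F' x) \<and>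
     (\<forall>R. \<exists>L. \<forall>n x. norm x \<le> R \<longrightarrow> norm (quot b F n x) \<le> L)"

lemma norm_shift_step:
  fixes b :: "'a::real_normed_vector"
  assumes "norm b \<le> 1"
  shows "norm (x + (1 / real (Suc n)) *\<^sub>R b) \<le> norm x + 1" "norm x \<le> norm (x + (1 / real (Suc n)) *\<^sub>R b) + 1"
proof -
  define s where "s = (1 / real (Suc n)) *\<^sub>R b"
  have "norm s \<le> 1 * 1"
    unfolding norm_scaleR s_def using assms by (intro mult_mono) auto
  then show "norm (x + s) \<le> norm x + 1" "norm x \<le> norm (x + s) + 1"
    using norm_triangle_ineq[of x s] norm_triangle_ineq4[of "x + s" s] by auto
qed

lemma tendsto_shift_Basis:
  fixes F :: "'a::euclidean_space \<Rightarrow> 'b::real_normed_vector"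
  assumes "continuous_on UNIV F"
  shows "(\<lambda>n. F (x + (1 / real (Suc n)) *\<^sub>R b)) \<longlonglongrightarrow> F x"
proof -
  have "(\<lambda>n. x + (1 / real (Suc n)) *\<^sub>R b) \<longlonglongrightarrow> x + 0 *\<^sub>R b"
    by (intro tendsto_intros LIMSEQ_Suc[OF lim_1_over_n])
  then show ?thesis
    using assms by (intro isCont_tendsto_compose[where g=F]) (auto simp: continuous_on_eq_continuous_at)
qed

lemma bounded_on_cball:
  fixes F :: "'a::euclidean_space \<Rightarrow> 'b::real_normed_vector"
  assumes "continuous_on UNIV F"
  obtains B where "B \<ge> 0" "\<And>x. norm x \<le> R \<Longrightarrow> norm (F x) \<le> B"
proof -
  have "compact (F ` cball 0 R)"
    by (intro compact_continuous_image continuous_on_subset[OF assms]) auto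
  then obtain B where "B > 0" "\<And>x. x \<in> cball 0 R \<Longrightarrow> norm (F x) \<le> B"
    using compact_imp_bounded bounded_pos by (metis imageI)
  then show thesis using that[of B] by auto
qed

lemma qdiff_bilinear:
  fixes F :: "'a::euclidean_space \<Rightarrow> 'b::real_normed_vector" and G :: "'a \<Rightarrow> 'c::real_normed_vector"
  assumes bil: "bounded_bilinear p" and F: "qdiff b F F'" and G: "qdiff b G G'" and b: "norm b \<le> 1"
  shows "qdiff b (\<lambda>x. p (F x) (G x)) (\<lambda>x. p (F' x) (G x) + p (F x) (G' x))"
proof -
  interpret bounded_bilinear p by (rule bil)
  have cF: "continuous_on UNIV F" and cG: "continuous_on UNIV G" using F G by (auto simp: qdiff_def)
  have eq: "quot b (\<lambda>x. p (F x) (G x)) n x =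
      p (quot b F n x) (G (x + (1 / real (Suc n)) *\<^sub>R b)) + p (F x) (quot b G n x)" for n x
    unfolding quot_def by (simp add: diff_left diff_right scaleR_left scaleR_right scaleR_diff_right)
  show ?thesis
    unfolding qdiff_def
  proof (intro conjI allI)
    show "continuous_on UNIV (\<lambda>x. p (F x) (G x))" by (rule continuous_on[OF cF cG])
    fix x
    show "(\<lambda>n. quot b (\<lambda>x. p (F x) (G x)) n x) \<longlonglongrightarrow> p (F' x) (G x) + p (F x) (G' x)"
      unfolding eq using F G
      by (intro tendsto_add tendsto tendsto_shift_Basis cG tendsto_const) (auto simp: qdiff_def)
  next
    fix R
    obtain LF where LF: "\<And>n x. norm x \<le> R \<Longrightarrow> norm (quot b F n x) \<le> LF" using F unfolding qdiff_def by metis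
    obtain LG where LG: "\<And>n x. norm x \<le> R \<Longrightarrow> norm (quot b G n x) \<le> LG" using G unfolding qdiff_def by metis
    obtain BF where BF: "BF \<ge> 0" "\<And>x. norm x \<le> R \<Longrightarrow> norm (F x) \<le> BF" using bounded_on_cball[OF cF] by metis
    obtain BG where BG: "BG \<ge> 0" "\<And>x. norm x \<le> R + 1 \<Longrightarrow> norm (G x) \<le> BG" using bounded_on_cball[OF cG] by metis
    obtain Kp where Kp: "Kp \<ge> 0" "\<And>a c. norm (p a c) \<le> norm a * norm c * Kp" using nonneg_bounded by metis
    show "\<exists>L. \<forall>n x. norm x \<le> R \<longrightarrow> norm (quot b (\<lambda>x. p (F x) (G x)) n x) \<le> L"
    proof (intro exI[of _ "max LF 0 * BG * Kp + BF * max LG 0 * Kp"] allI impI)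
      fix n and x :: 'a assume x: "norm x \<le> R"
      have "norm (x + (1 / real (Suc n)) *\<^sub>R b) \<le> R + 1"
        using x norm_shift_step(1)[OF b, of x n] by linarith
      then have g: "norm (G (x + (1 / real (Suc n)) *\<^sub>R b)) \<le> BG" by (rule BG)
      have "norm (p (quot b F n x) (G (x + (1 / real (Suc n)) *\<^sub>R b))) \<le> max LF 0 * BG * Kp"
        by (rule order_trans[OF Kp(2)]) (intro mult_mono Kp(1) g order_refl, use LF[OF x, of n] BG Kp in \<open>auto intro: order_trans\<close>)
      moreover have "norm (p (F x) (quot b G n x)) \<le> BF * max LG 0 * Kp"
        by (rule order_trans[OF Kp(2)]) (intro mult_mono Kp(1) BF x order_refl, use LG[OF x, of n] BF Kp in \<open>auto intro: order_trans\<close>)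
      ultimately show "norm (quot b (\<lambda>x. p (F x) (G x)) n x) \<le> max LF 0 * BG * Kp + BF * max LG 0 * Kp"
        unfolding eq by (intro norm_triangle_mono)
    qed
  qed
qed

lemma qdiff_linear:
  fixes F :: "'a::euclidean_space \<Rightarrow> 'b::real_normed_vector"
  assumes m: "bounded_linear m" and F: "qdiff b F F'"
  shows "qdiff b (\<lambda>x. m (F x)) (\<lambda>x. m (F' x))"
proof -
  interpret bounded_linear m by (rule m)
  have eq: "quot b (\<lambda>x. m (F x)) n x = m (quot b F n x)" for n x
    unfolding quot_def by (simp add: scaleR diff)
  show ?thesis
    unfolding qdiff_def
  proof (intro conjI allI)
    show "continuous_on UNIV (\<lambda>x. m (F x))" using F by (intro continuous_on) (simp add: qdiff_def)
    show "(\<lambda>n. quot b (\<lambda>x. m (F x)) n x) \<longlonglongrightarrow> m (F' x)" for x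
      unfolding eq using F by (intro tendsto) (simp add: qdiff_def)
    fix R
    obtain LF where LF: "\<And>n x. norm x \<le> R \<Longrightarrow> norm (quot b F n x) \<le> LF" using F unfolding qdiff_def by metis
    obtain Km where Km: "Km \<ge> 0" "\<And>a. norm (m a) \<le> norm a * Km" using nonneg_bounded by metis
    show "\<exists>L. \<forall>n x. norm x \<le> R \<longrightarrow> norm (quot b (\<lambda>x. m (F x)) n x) \<le> L"
      unfolding eq using LF Km by (intro exI[of _ "LF * Km"] allI impI) (meson mult_right_mono order_trans)
  qed
qed

text \<open>Integration by parts without boundary term: every difference quotient has integral 0 by
  translation invariance, and dominated convergence carries this to the limit.\<close>

lemma integral_qdiff_0:
  fixes G :: "'a::euclidean_space \<Rightarrow> real"
  assumes G: "qdiff b G G'" and b: "norm b \<le> 1" and R: "\<And>x. norm x > R \<Longrightarrow> G x = 0"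
  shows "(LINT x|lborel. G' x) = 0"
proof -
  have cG: "continuous_on UNIV G" using G by (simp add: qdiff_def)
  have [measurable]: "G \<in> borel_measurable borel" by (rule borel_measurable_continuous_onI[OF cG])
  have [measurable]: "quot b G n \<in> borel_measurable borel" for n unfolding quot_def[abs_def] by measurable
  have lim: "(\<lambda>n. quot b G n x) \<longlonglongrightarrow> G' x" for x using G by (simp add: qdiff_def)
  have [measurable]: "G' \<in> borel_measurable borel"
    by (rule borel_measurable_LIMSEQ_real[OF lim]) measurable
  obtain L where L: "\<And>n x. norm x \<le> R + 1 \<Longrightarrow> norm (quot b G n x) \<le> L" using G unfolding qdiff_def by metis
  have int: "integrable lborel G" by (rule integrable_continuous_compact_support[OF cG R])
  have zero: "(LINT x|lborel. quot b G n x) = 0" for n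
  proof -
    have "integrable lborel (\<lambda>x. G (x + (1 / real (Suc n)) *\<^sub>R b))"
    proof (rule integrable_continuous_compact_support[where R="R + 1"])
      show "continuous_on UNIV (\<lambda>x. G (x + (1 / real (Suc n)) *\<^sub>R b))"
        by (intro continuous_on_compose2[OF cG] continuous_intros) auto
      fix x :: 'a assume x: "norm x > R + 1"
      have "norm (x + (1 / real (Suc n)) *\<^sub>R b) > R"
        using x norm_shift_step(2)[OF b, of x n] by linarith
      then show "G (x + (1 / real (Suc n)) *\<^sub>R b) = 0" by (rule R)
    qed
    then have "(LINT x|lborel. quot b G n x) =
        real (Suc n) *\<^sub>R ((LINT x|lborel. G (x + (1 / real (Suc n)) *\<^sub>R b)) - (LINT x|lborel. G x))"
      unfolding quot_def using int by simp
    also have "(LINT x|lborel. G (x + (1 / real (Suc n)) *\<^sub>R b)) = (LINT x|lborel. G x)"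
      by (rule integral_lborel_shift) simp
    finally show ?thesis by simp
  qed
  have "(\<lambda>n. LINT x|lborel. quot b G n x) \<longlonglongrightarrow> (LINT x|lborel. G' x)"
  proof (rule integral_dominated_convergence[where w="\<lambda>x. L * indicator (cball (0::'a) (R + 1)) x"])
    show "integrable lborel (\<lambda>x. L * indicator (cball (0::'a) (R + 1)) x)"
      by (intro integrable_mult_right integrable_indicator_cball)
    show "AE x in lborel. (\<lambda>n. quot b G n x) \<longlonglongrightarrow> G' x" using lim by simp
    show "AE x in lborel. norm (quot b G n x) \<le> L * indicator (cball (0::'a) (R + 1)) x" for n
    proof (intro AE_I2)
      fix x :: 'a
      show "norm (quot b G n x) \<le> L * indicator (cball (0::'a) (R + 1)) x"
      proof (cases "norm x \<le> R + 1")
        case True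
        then show ?thesis using L[of x n] by simp
      next
        case False
        have "norm (x + (1 / real (Suc n)) *\<^sub>R b) > R" "norm x > R"
          using False norm_shift_step(2)[OF b, of x n] by linarith+
        then show ?thesis using R False by (simp add: quot_def)
      qed
    qed
  qed measurable
  then show ?thesis unfolding zero by (simp add: LIMSEQ_const_iff)
qed

lemma quot_kernel:
  fixes K :: "'a::euclidean_space \<Rightarrow> real"
  assumes K: "kernel K" and b: "b \<in> Basis"
  shows "(\<lambda>n. quot b K n x) \<longlonglongrightarrow> dir_deriv b K x"
    and "\<exists>L. \<forall>n x. norm (quot b K n x) \<le> L"
proof -
  have sm: "smooth K" using K by (simp add: kernel_def)
  have d: "((\<lambda>t. K (z + t *\<^sub>R b)) has_real_derivative dir_deriv b K (z + t *\<^sub>R b)) (at t)" for z t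
  proof -
    have "((\<lambda>t. K (t *\<^sub>R b + z)) has_derivative (\<lambda>h. dir_deriv (h *\<^sub>R b) K (t *\<^sub>R b + z))) (at t)"
      by (rule has_derivative_affine_comp[OF bounded_linear_scaleR_left smooth_differentiable[OF sm]])
    moreover have "dir_deriv (h *\<^sub>R b) K y = dir_deriv b K y * h" for h y
      using linear_scale[OF has_derivative_linear[OF has_derivative_dir_deriv[OF smooth_differentiable[OF sm]]], of h b y]
      by simp
    ultimately show ?thesis by (simp add: has_field_derivative_def add.commute)
  qed
  show "(\<lambda>n. quot b K n x) \<longlonglongrightarrow> dir_deriv b K x"
  proof -
    have "((\<lambda>h. (K (x + h *\<^sub>R b) - K x) / h) \<longlongrightarrow> dir_deriv b K x) (at 0)"
      using d[of x 0] by (simp add: has_field_derivative_iff)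
    moreover have "filterlim (\<lambda>n. 1 / real (Suc n)) (at 0) sequentially"
      unfolding filterlim_at using LIMSEQ_Suc[OF lim_1_over_n] by (auto intro!: always_eventually)
    ultimately have "(\<lambda>n. (K (x + (1 / real (Suc n)) *\<^sub>R b) - K x) / (1 / real (Suc n))) \<longlonglongrightarrow> dir_deriv b K x"
      by (rule filterlim_compose)
    then show ?thesis by (simp add: quot_def mult.commute)
  qed
  obtain L where L: "L > 0" "\<And>x. \<bar>dir_deriv b K x\<bar> \<le> L"
    using kernelE[OF kernel_dir_deriv[OF K b]] by metis
  show "\<exists>L. \<forall>n x. norm (quot b K n x) \<le> L"
  proof (intro exI[of _ L] allI)
    fix n x
    define h where "h = 1 / real (Suc n)"
    have h: "h > 0" by (simp add: h_def)
    obtain z where "K (x + h *\<^sub>R b) - K (x + 0 *\<^sub>R b) = (h - 0) * dir_deriv b K (x + z *\<^sub>R b)"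
      using MVT2[OF h, of "\<lambda>t. K (x + t *\<^sub>R b)" "\<lambda>t. dir_deriv b K (x + t *\<^sub>R b)"] d by auto
    then have "quot b K n x = dir_deriv b K (x + z *\<^sub>R b)"
      by (simp add: quot_def h_def)
    then show "norm (quot b K n x) \<le> L" using L by simp
  qed
qed

lemma qdiff_kernel:
  assumes "kernel (K :: 'a::euclidean_space \<Rightarrow> real)" "b \<in> Basis"
  shows "qdiff b K (dir_deriv b K)"
proof -
  obtain L where "\<And>n x. norm (quot b K n x) \<le> L" using quot_kernel(2)[OF assms] by blast
  then have "\<forall>R. \<exists>L. \<forall>n x. norm x \<le> R \<longrightarrow> norm (quot b K n x) \<le> L" by blast
  then show ?thesis
    unfolding qdiff_def using quot_kernel(1)[OF assms] smooth_imp_continuous assms(1) by (auto simp: kernel_def)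
qed

section \<open>Regularity of convolutions\<close>

lemma conv_tendsto:
  fixes f :: "'a::euclidean_space \<Rightarrow> complex" and K :: "nat \<Rightarrow> 'a \<Rightarrow> real"
  assumes f: "loc_integrable f" and [measurable]: "\<And>n. K n \<in> borel_measurable borel"
    and K: "\<And>n y. \<bar>K n y\<bar> \<le> B" "\<And>n y. norm y > R \<Longrightarrow> K n y = 0" and lim: "\<And>y. (\<lambda>n. K n y) \<longlonglongrightarrow> K' y"
  shows "(\<lambda>n. LINT y|lborel. f y * of_real (K n y)) \<longlonglongrightarrow> (LINT y|lborel. f y * of_real (K' y))"
proof (rule integral_dominated_convergence[where w="\<lambda>y. B * cmod (cutoff R f y)"])
  have [measurable]: "f \<in> borel_measurable borel" using f by (simp add: loc_integrable_def)
  have B: "B \<ge> 0" using K(1)[of 0 0] by linarith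
  have [measurable]: "K' \<in> borel_measurable borel"
    by (rule borel_measurable_LIMSEQ_real[OF lim]) measurable
  show "(\<lambda>y. f y * of_real (K' y)) \<in> borel_measurable lborel" "(\<lambda>y. f y * of_real (K n y)) \<in> borel_measurable lborel" for n
    by measurable
  show "integrable lborel (\<lambda>y. B * cmod (cutoff R f y))"
    using f by (intro integrable_mult_right integrable_norm) (simp add: loc_integrable_def)
  show "AE y in lborel. (\<lambda>n. f y * of_real (K n y)) \<longlonglongrightarrow> f y * of_real (K' y)"
    by (intro AE_I2 tendsto_intros lim)
  show "AE y in lborel. cmod (f y * of_real (K n y)) \<le> B * cmod (cutoff R f y)" for n
  proof (intro AE_I2)
    fix y
    show "cmod (f y * of_real (K n y)) \<le> B * cmod (cutoff R f y)"
      using K(2)[of y n] mult_right_mono[OF K(1)[of n y], of "cmod (f y)"] B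
      by (cases "norm y > R") (auto simp: cutoff_def norm_mult mult.commute)
  qed
qed

lemma continuous_conv:
  fixes f :: "'a::euclidean_space \<Rightarrow> complex"
  assumes f: "loc_integrable f" and K: "kernel K"
  shows "continuous_on UNIV (conv K f)"
proof (rule continuous_on_sequentiallyI)
  fix x :: "nat \<Rightarrow> 'a" and a
  assume lim: "x \<longlonglongrightarrow> a"
  obtain r B where r: "r > 0" "\<And>x. norm x > r \<Longrightarrow> K x = 0" and B: "B > 0" "\<And>x. \<bar>K x\<bar> \<le> B"
    using kernelE[OF K] by metis
  have [measurable]: "K \<in> borel_measurable borel" by (rule kernel_borel[OF K])
  have cK: "isCont K z" for z
    using K smooth_imp_continuous by (auto simp: kernel_def continuous_on_eq_continuous_at)
  obtain D where D: "\<And>n. norm (x n) \<le> D"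
    using lim convergent_imp_Bseq[of x] by (auto simp: convergent_def Bseq_def)
  show "(\<lambda>n. conv K f (x n)) \<longlonglongrightarrow> conv K f a"
    unfolding conv_def
  proof (rule conv_tendsto[OF f, where B=B and R="D + r"])
    fix n and y :: 'a assume "norm y > D + r"
    then have "norm (x n - y) > r" using norm_triangle_ineq2[of y "x n"] D[of n] by (simp add: norm_minus_commute)
    then show "K (x n - y) = 0" by (rule r)
  next
    show "(\<lambda>n. K (x n - y)) \<longlonglongrightarrow> K (a - y)" for y
      by (intro isCont_tendsto_compose[OF cK] tendsto_intros lim)
  qed (use B in auto)
qed

text \<open>The difference quotient can be moved onto the kernel, whose quotients are uniformly
  bounded and supported in a fixed ball.\<close>

lemma qdiff_conv:
  fixes f :: "'a::euclidean_space \<Rightarrow> complex"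
  assumes f: "loc_integrable f" and K: "kernel K" and b: "b \<in> Basis"
  shows "qdiff b (conv K f) (conv (dir_deriv b K) f)"
proof -
  obtain r where r: "r > 0" "\<And>x. norm x > r \<Longrightarrow> K x = 0" using kernelE[OF K] by metis
  have [measurable]: "K \<in> borel_measurable borel" by (rule kernel_borel[OF K])
  have [measurable]: "f \<in> borel_measurable borel" using f by (simp add: loc_integrable_def)
  have [measurable]: "quot b K n \<in> borel_measurable borel" for n unfolding quot_def[abs_def] by measurable
  obtain L where L: "\<And>n x. \<bar>quot b K n x\<bar> \<le> L" using quot_kernel(2)[OF K b] by auto
  have q0: "quot b K n x = 0" if "norm x > r + 1" for n x
  proof -
    have "norm (x + (1 / real (Suc n)) *\<^sub>R b) > r" "norm x > r"
      using that b norm_shift_step(2)[of b x n] by auto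
    then show ?thesis using r by (simp add: quot_def)
  qed
  have q0': "quot b K n (x - y) = 0" if "norm y > norm x + (r + 1)" for n x y
  proof -
    have "norm (x - y) > r + 1" using that norm_triangle_ineq2[of y x] by (simp add: norm_minus_commute)
    then show ?thesis by (rule q0)
  qed
  have eq: "quot b (conv K f) n x = (LINT y|lborel. f y * of_real (quot b K n (x - y)))" for n x
  proof -
    have "quot b (conv K f) n x = real (Suc n) *\<^sub>R (LINT y|lborel. f y * of_real (K (x + (1 / real (Suc n)) *\<^sub>R b - y)) - f y * of_real (K (x - y)))"
      unfolding quot_def conv_def using integrable_conv[OF f K] by (subst Bochner_Integration.integral_diff) auto
    also have "\<dots> = (LINT y|lborel. real (Suc n) *\<^sub>R (f y * of_real (K (x + (1 / real (Suc n)) *\<^sub>R b - y)) - f y * of_real (K (x - y))))"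
      by simp
    also have "\<dots> = (LINT y|lborel. f y * of_real (quot b K n (x - y)))"
      unfolding quot_def by (intro Bochner_Integration.integral_cong refl) (simp add: scaleR_conv_of_real algebra_simps)
    finally show ?thesis .
  qed
  show ?thesis
    unfolding qdiff_def
  proof (intro conjI allI)
    show "continuous_on UNIV (conv K f)" by (rule continuous_conv[OF f K])
    show "(\<lambda>n. quot b (conv K f) n x) \<longlonglongrightarrow> conv (dir_deriv b K) f x" for x
      unfolding eq conv_def
      by (rule conv_tendsto[OF f, where B=L and R="norm x + (r + 1)"])
         (auto intro: L q0' quot_kernel(1)[OF K b])
    fix R
    define D where "D = (LINT y|lborel. L * cmod (cutoff (R + (r + 1)) f y))"
    show "\<exists>L. \<forall>n x. norm x \<le> R \<longrightarrow> norm (quot b (conv K f) n x) \<le> L"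
    proof (intro exI[of _ D] allI impI)
      fix n and x :: 'a assume x: "norm x \<le> R"
      show "norm (quot b (conv K f) n x) \<le> D"
        unfolding eq D_def
      proof (rule order_trans[OF integral_norm_bound integral_mono])
        show "integrable lborel (\<lambda>y. cmod (f y * of_real (quot b K n (x - y))))"
          by (intro integrable_norm loc_integrable_mult_bounded[OF f, where B=L and R="norm x + (r + 1)"])
             (auto simp: L q0')
        show "integrable lborel (\<lambda>y. L * cmod (cutoff (R + (r + 1)) f y))"
          using f by (intro integrable_mult_right integrable_norm) (simp add: loc_integrable_def)
        fix y
        have Lp: "L \<ge> 0" using L[of 0 0] by linarith
        show "cmod (f y * of_real (quot b K n (x - y))) \<le> L * cmod (cutoff (R + (r + 1)) f y)"
          using q0'[of x y n] mult_right_mono[OF L[of n "x - y"], of "cmod (f y)"] Lp x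
          by (cases "norm y > R + (r + 1)") (auto simp: cutoff_def norm_mult mult.commute)
      qed
    qed
  qed
qed

section \<open>Localised estimates for the regularised difference\<close>

text \<open>The bump stretched to width R. It does not take the value 1 anywhere; as R grows it
  tends pointwise to the constant \<open>bump 0\<close>, which is positive, and this is the property
  used at the end.\<close>

definition plateau :: "real \<Rightarrow> 'a::euclidean_space \<Rightarrow> real" where
  "plateau R x = bump ((1 / R) *\<^sub>R x)"

lemma plateau_nonneg: "plateau R x \<ge> 0" and plateau_le_1: "plateau R x \<le> 1"
  by (auto simp: plateau_def bump_nonneg bump_le_1)

lemma plateau_eq_0:
  fixes x :: "'a::euclidean_space" and R :: real
  assumes "R > 0" "norm x \<ge> DIM('a) * R"
  shows "plateau R x = 0"
  using assms bump_eq_0[of "(1 / R) *\<^sub>R x"] by (simp add: plateau_def field_simps)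

lemma kernel_plateau:
  assumes "R > 0"
  shows "kernel (plateau R :: 'a::euclidean_space \<Rightarrow> real)"
proof -
  have "smooth (plateau R :: 'a \<Rightarrow> real)"
    unfolding smooth_def
  proof
    fix k
    have "Ck k (\<lambda>x::'a. bump ((1 / R) *\<^sub>R x + 0))"
      using smooth_bump[where 'a='a] by (intro Ck_affine bounded_linear_scaleR_right) (auto simp: smooth_def)
    then show "Ck k (plateau R :: 'a \<Rightarrow> real)" unfolding plateau_def[abs_def] by simp
  qed
  moreover have "plateau R x = 0" if "norm x > DIM('a) * R" for x :: 'a
    using assms less_imp_le[OF that] by (rule plateau_eq_0)
  ultimately show ?thesis by (auto simp: kernel_def)
qed

lemma plateau_measurable [measurable]: "(plateau R :: 'a::euclidean_space \<Rightarrow> real) \<in> borel_measurable borel"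
proof -
  have [measurable]: "(bump :: 'a \<Rightarrow> real) \<in> borel_measurable borel"
    by (rule smooth_borel[OF smooth_bump])
  show ?thesis unfolding plateau_def[abs_def] by measurable
qed

lemma kernel_bump: "kernel (bump :: 'a::euclidean_space \<Rightarrow> real)"
  using kernel_plateau[of 1, where 'a='a] by (simp add: plateau_def[abs_def])

lemma kernel_imp_continuous: "kernel K \<Longrightarrow> continuous_on UNIV K"
  by (auto simp: kernel_def intro: smooth_imp_continuous)

lemma dir_deriv_plateau_bound:
  assumes "b \<in> Basis"
  obtains C where "C \<ge> 0" "\<And>R (x::'a::euclidean_space). R > 0 \<Longrightarrow> \<bar>dir_deriv b (plateau R) x\<bar> \<le> C / R"
proof -
  obtain C where C: "C > 0" "\<And>x::'a. \<bar>dir_deriv b bump x\<bar> \<le> C"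
    using kernelE[OF kernel_dir_deriv[OF kernel_bump assms]] by metis
  show thesis
  proof (rule that[of C])
    fix R :: real and x :: 'a assume R: "R > 0"
    have d: "bump differentiable (at y)" for y :: 'a by (rule smooth_differentiable[OF smooth_bump])
    have "((\<lambda>x. bump ((1 / R) *\<^sub>R x + 0)) has_derivative (\<lambda>h. dir_deriv ((1 / R) *\<^sub>R h) bump ((1 / R) *\<^sub>R x + 0))) (at x)"
      by (rule has_derivative_affine_comp[OF bounded_linear_scaleR_right d])
    then have "dir_deriv b (plateau R) x = dir_deriv ((1 / R) *\<^sub>R b) bump ((1 / R) *\<^sub>R x)"
      unfolding plateau_def[abs_def] by (intro dir_deriv_eq) simp
    also have "\<dots> = (1 / R) *\<^sub>R dir_deriv b bump ((1 / R) *\<^sub>R x)"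
      by (rule linear_scale[OF has_derivative_linear[OF has_derivative_dir_deriv[OF d]]])
    finally show "\<bar>dir_deriv b (plateau R) x\<bar> \<le> C / R"
      using C(2)[of "(1 / R) *\<^sub>R x"] R by (simp add: abs_mult divide_right_mono)
  qed (use C in simp)
qed

lemma l2sq_conv_mollifier_le:
  fixes f :: "'a::euclidean_space \<Rightarrow> complex" and \<epsilon> :: real
  assumes "f \<in> borel_measurable borel" "\<epsilon> > 0"
  shows "l2sq (conv (mollifier \<epsilon>) f) \<le> l2sq f"
proof -
  have "(\<integral>\<^sup>+y. ennreal \<bar>mollifier \<epsilon> (y::'a)\<bar> \<partial>lborel) = 1"
    using nn_integral_mollifier[OF assms(2), where 'a='a] mollifier_nonneg[OF assms(2), where 'a='a] by simp
  then show ?thesis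
    using l2sq_conv_le[OF assms(1) kernel_borel[OF kernel_mollifier[OF assms(2)]]] by simp
qed

lemma integrable_sq_le:
  assumes "f \<in> borel_measurable borel" "l2sq f \<le> ennreal m" "m \<ge> 0"
  shows "integrable lborel (\<lambda>x. (cmod (f x))\<^sup>2)" "(LINT x|lborel. (cmod (f x))\<^sup>2) \<le> m"
proof -
  have s: "square_integrable f" using assms by (auto simp: square_integrable_iff intro: le_less_trans)
  then show "integrable lborel (\<lambda>x. (cmod (f x))\<^sup>2)" by (simp add: square_integrable_def)
  show "(LINT x|lborel. (cmod (f x))\<^sup>2) \<le> m"
    using assms(2,3) unfolding l2sq_eq_integral[OF s] by (simp add: ennreal_le_iff)
qed

text \<open>Integrating by parts in the direction b leaves only the term in which the derivative
  hits the cutoff, which is of size 1 / R. The remaining factors are W, bounded in L^2 by f, and its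
  first derivative, which costs 1 / \<epsilon>. So of the two derivatives in the Laplacian one has
  been moved to the cutoff.\<close>

lemma flux_bound_Basis:
  assumes b: "b \<in> (Basis :: 'a::euclidean_space set)"
  shows "\<exists>C\<ge>0. \<forall>\<epsilon> R (f :: 'a \<Rightarrow> complex) m. 0 < \<epsilon> \<longrightarrow> \<epsilon> \<le> 1 \<longrightarrow> 0 < R \<longrightarrow> f \<in> borel_measurable borel \<longrightarrow>
    l2sq f \<le> ennreal m \<longrightarrow> 0 \<le> m \<longrightarrow>
    \<bar>LINT x|lborel. plateau R x * Im (cnj (conv (mollifier \<epsilon>) f x) * conv (dir_deriv b (dir_deriv b (mollifier \<epsilon>))) f x)\<bar>
      \<le> C * m / (R * \<epsilon>)"
proof -
  obtain C1 where C1: "C1 \<ge> 0" "\<And>R (x::'a). R > 0 \<Longrightarrow> \<bar>dir_deriv b (plateau R) x\<bar> \<le> C1 / R"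
    using dir_deriv_plateau_bound[OF b] by metis
  obtain C2 where C2: "C2 \<ge> 0" "\<And>\<epsilon>. \<epsilon> > 0 \<Longrightarrow>
    (\<integral>\<^sup>+x. ennreal \<bar>dir_deriv b (mollifier \<epsilon>) (x::'a)\<bar> \<partial>lborel) \<le> ennreal (C2 / \<epsilon>)"
    using nn_integral_dir_deriv_mollifier[OF b] by metis
  define C where "C = C1 * (1 + C2\<^sup>2)"
  show ?thesis
  proof (intro exI[of _ C] conjI allI impI)
    show "C \<ge> 0" using C1 C2 by (simp add: C_def)
    fix \<epsilon> R m :: real and f :: "'a \<Rightarrow> complex"
    assume \<epsilon>: "0 < \<epsilon>" "\<epsilon> \<le> 1" and R: "0 < R" and fm[measurable]: "f \<in> borel_measurable borel"
      and f: "l2sq f \<le> ennreal m" and m: "0 \<le> m"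
    have "square_integrable f" using f by (auto simp: square_integrable_iff intro: le_less_trans)
    then have lf: "loc_integrable f" by (rule square_integrable_imp_loc)
    define \<rho> where "\<rho> = (mollifier \<epsilon> :: 'a \<Rightarrow> real)"
    have k: "kernel \<rho>" unfolding \<rho>_def by (rule kernel_mollifier[OF \<epsilon>(1)])
    note k1 = kernel_dir_deriv[OF k b] and k2 = kernel_dir_deriv[OF kernel_dir_deriv[OF k b] b]
    define W where "W = conv \<rho> f"
    define Wb where "Wb = conv (dir_deriv b \<rho>) f"
    define Wbb where "Wbb = conv (dir_deriv b (dir_deriv b \<rho>)) f"
    define p where "p = (plateau R :: 'a \<Rightarrow> real)"
    define pb where "pb = dir_deriv b p"
    have cont: "continuous_on UNIV W" "continuous_on UNIV Wb" "continuous_on UNIV Wbb" "continuous_on UNIV p" "continuous_on UNIV pb"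
      unfolding W_def Wb_def Wbb_def p_def pb_def
      using kernel_plateau[OF R, where 'a='a] kernel_dir_deriv[OF kernel_plateau[OF R, where 'a='a] b]
      by (auto intro!: continuous_conv lf k k1 k2 intro: kernel_imp_continuous)
    have Wm[measurable]: "W \<in> borel_measurable borel" "Wb \<in> borel_measurable borel"
      by (auto intro: borel_measurable_continuous_onI cont)
    have nb: "norm b \<le> 1" using b by simp
    have "qdiff b (\<lambda>x. cnj (W x)) (\<lambda>x. cnj (Wb x))"
      unfolding W_def Wb_def by (intro qdiff_linear[OF bounded_linear_cnj] qdiff_conv lf k b)
    moreover have "qdiff b Wb Wbb"
      unfolding Wb_def Wbb_def by (intro qdiff_conv lf k1 b)
    ultimately have "qdiff b (\<lambda>x. cnj (W x) * Wb x) (\<lambda>x. cnj (Wb x) * Wb x + cnj (W x) * Wbb x)"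
      by (rule qdiff_bilinear[OF bounded_bilinear_mult _ _ nb])
    then have qi: "qdiff b (\<lambda>x. Im (cnj (W x) * Wb x)) (\<lambda>x. Im (cnj (Wb x) * Wb x + cnj (W x) * Wbb x))"
      by (rule qdiff_linear[OF bounded_linear_Im])
    have qd: "qdiff b (\<lambda>x. p x * Im (cnj (W x) * Wb x))
        (\<lambda>x. pb x * Im (cnj (W x) * Wb x) + p x * Im (cnj (Wb x) * Wb x + cnj (W x) * Wbb x))"
      unfolding pb_def by (rule qdiff_bilinear[OF bounded_bilinear_mult qdiff_kernel[OF _ b] qi nb])
        (simp add: p_def kernel_plateau[OF R])
    have p0: "p x = 0" if "norm x > DIM('a) * R" for x
      unfolding p_def using R less_imp_le[OF that] by (rule plateau_eq_0)
    have pb0: "pb x = 0" if "norm x > DIM('a) * R" for x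
      unfolding pb_def by (rule dir_deriv_eq_0_outside[OF p0 that])
    have "(LINT x|lborel. pb x * Im (cnj (W x) * Wb x) + p x * Im (cnj (Wb x) * Wb x + cnj (W x) * Wbb x)) = 0"
      by (rule integral_qdiff_0[OF qd nb, where R="DIM('a) * R"]) (simp add: p0)
    \<comment> \<open>The product of the first derivative with its own conjugate is real; this
      removes the only term that would be as large as \<epsilon>^(-2).\<close>
    moreover have "Im (cnj z * z + v) = Im v" for z v :: complex by simp
    ultimately have z: "(LINT x|lborel. pb x * Im (cnj (W x) * Wb x) + p x * Im (cnj (W x) * Wbb x)) = 0"
      by (simp del: times_complex.sel plus_complex.sel)
    have i1: "integrable lborel (\<lambda>x. pb x * Im (cnj (W x) * Wb x))"
      by (rule integrable_continuous_compact_support[where R="DIM('a) * R"])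
         (auto intro!: continuous_intros cont simp: pb0)
    have i2: "integrable lborel (\<lambda>x. p x * Im (cnj (W x) * Wbb x))"
      by (rule integrable_continuous_compact_support[where R="DIM('a) * R"])
         (auto intro!: continuous_intros cont simp: p0)
    have "\<bar>LINT x|lborel. p x * Im (cnj (W x) * Wbb x)\<bar> = \<bar>LINT x|lborel. pb x * Im (cnj (W x) * Wb x)\<bar>"
      using z unfolding Bochner_Integration.integral_add[OF i1 i2] by linarith
    \<comment> \<open>Young's inequality with weight \<epsilon> balances the two norms: m /
      \<epsilon> for W, and \<epsilon> (C2 / \<epsilon>)^2 m for its derivative. Hence the constant
      C1 (1 + C2^2).\<close>
    also have "\<dots> \<le> (LINT x|lborel. C1 / R * ((cmod (W x))\<^sup>2 / \<epsilon> + \<epsilon> * (cmod (Wb x))\<^sup>2))"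
    proof -
      have "l2sq W \<le> ennreal m"
        unfolding W_def \<rho>_def using l2sq_conv_mollifier_le[OF fm \<epsilon>(1)] f by (rule order_trans)
      note W1 = integrable_sq_le[OF Wm(1) this m]
      have W2b: "l2sq Wb \<le> ennreal ((C2 / \<epsilon>)\<^sup>2 * m)"
      proof -
        have "l2sq Wb \<le> (\<integral>\<^sup>+x. ennreal \<bar>dir_deriv b \<rho> x\<bar> \<partial>lborel)\<^sup>2 * l2sq f"
          unfolding Wb_def by (rule l2sq_conv_le[OF fm kernel_borel[OF k1]])
        also have "\<dots> \<le> (ennreal (C2 / \<epsilon>))\<^sup>2 * ennreal m"
          unfolding \<rho>_def by (intro mult_mono power_mono C2 \<epsilon> f) auto
        also have "\<dots> = ennreal ((C2 / \<epsilon>)\<^sup>2 * m)"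
          using C2 \<epsilon> m by (simp add: ennreal_power ennreal_mult)
        finally show ?thesis .
      qed
      have "0 \<le> (C2 / \<epsilon>)\<^sup>2 * m" using m by simp
      note W2 = integrable_sq_le[OF Wm(2) W2b this]
      have ib: "integrable lborel (\<lambda>x. C1 / R * ((cmod (W x))\<^sup>2 / \<epsilon> + \<epsilon> * (cmod (Wb x))\<^sup>2))"
        using W1 W2 by simp
      show ?thesis
        unfolding real_norm_def[symmetric]
      proof (rule order_trans[OF integral_norm_bound integral_mono])
        fix x
        have "\<bar>pb x\<bar> \<le> C1 / R" unfolding pb_def p_def by (rule C1(2)[OF R])
        moreover have "\<bar>Im (cnj (W x) * Wb x)\<bar> \<le> (cmod (W x))\<^sup>2 / \<epsilon> + \<epsilon> * (cmod (Wb x))\<^sup>2"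
        proof -
          have "\<bar>Im (cnj (W x) * Wb x)\<bar> \<le> cmod (W x) * cmod (Wb x)"
            using abs_Im_le_cmod[of "cnj (W x) * Wb x"] by (simp add: norm_mult del: times_complex.sel)
          also have "\<dots> \<le> (cmod (W x))\<^sup>2 / \<epsilon> + \<epsilon> * (cmod (Wb x))\<^sup>2"
          proof -
            have "2 * cmod (W x) * (\<epsilon> * cmod (Wb x)) \<le> (cmod (W x))\<^sup>2 + (\<epsilon> * cmod (Wb x))\<^sup>2" by (rule sum_squares_bound)
            moreover have "0 \<le> cmod (W x) * (\<epsilon> * cmod (Wb x))" using \<epsilon> by simp
            ultimately have "\<epsilon> * (cmod (W x) * cmod (Wb x)) \<le> (cmod (W x))\<^sup>2 + (\<epsilon> * cmod (Wb x))\<^sup>2"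
              by (simp add: mult_ac)
            then have "cmod (W x) * cmod (Wb x) \<le> ((cmod (W x))\<^sup>2 + (\<epsilon> * cmod (Wb x))\<^sup>2) / \<epsilon>"
              using \<epsilon> by (simp add: field_simps)
            also have "\<dots> = (cmod (W x))\<^sup>2 / \<epsilon> + \<epsilon> * (cmod (Wb x))\<^sup>2"
              using \<epsilon> by (simp add: field_simps power2_eq_square)
            finally show ?thesis .
          qed
          finally show ?thesis .
        qed
        ultimately show "norm (pb x * Im (cnj (W x) * Wb x)) \<le> C1 / R * ((cmod (W x))\<^sup>2 / \<epsilon> + \<epsilon> * (cmod (Wb x))\<^sup>2)"
          unfolding real_norm_def abs_mult using C1 R by (intro mult_mono) auto
      qed (use i1 ib in auto)
    qed
    also have "\<dots> \<le> C * m / (R * \<epsilon>)"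
    proof -
      have "l2sq W \<le> ennreal m"
        unfolding W_def \<rho>_def using l2sq_conv_mollifier_le[OF fm \<epsilon>(1)] f by (rule order_trans)
      note W1 = integrable_sq_le[OF Wm(1) this m]
      have W2b: "l2sq Wb \<le> ennreal ((C2 / \<epsilon>)\<^sup>2 * m)"
      proof -
        have "l2sq Wb \<le> (\<integral>\<^sup>+x. ennreal \<bar>dir_deriv b \<rho> x\<bar> \<partial>lborel)\<^sup>2 * l2sq f"
          unfolding Wb_def by (rule l2sq_conv_le[OF fm kernel_borel[OF k1]])
        also have "\<dots> \<le> (ennreal (C2 / \<epsilon>))\<^sup>2 * ennreal m"
          unfolding \<rho>_def by (intro mult_mono power_mono C2 \<epsilon> f) auto
        also have "\<dots> = ennreal ((C2 / \<epsilon>)\<^sup>2 * m)"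
          using C2 \<epsilon> m by (simp add: ennreal_power ennreal_mult)
        finally show ?thesis .
      qed
      have "0 \<le> (C2 / \<epsilon>)\<^sup>2 * m" using m by simp
      note W2 = integrable_sq_le[OF Wm(2) W2b this]
      have "(LINT x|lborel. C1 / R * ((cmod (W x))\<^sup>2 / \<epsilon> + \<epsilon> * (cmod (Wb x))\<^sup>2)) =
          C1 / R * ((LINT x|lborel. (cmod (W x))\<^sup>2) / \<epsilon> + \<epsilon> * (LINT x|lborel. (cmod (Wb x))\<^sup>2))"
        using W1(1) W2(1) by simp
      also have "\<dots> \<le> C1 / R * (m / \<epsilon> + \<epsilon> * ((C2 / \<epsilon>)\<^sup>2 * m))"
        using W1(2) W2(2) C1 R \<epsilon> by (intro mult_left_mono add_mono divide_right_mono) auto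
      also have "\<dots> = C * m / (R * \<epsilon>)"
        using \<epsilon> R by (simp add: C_def field_simps power2_eq_square)
      finally show ?thesis .
    qed
    finally show "\<bar>LINT x|lborel. plateau R x * Im (cnj (conv (mollifier \<epsilon>) f x) * conv (dir_deriv b (dir_deriv b (mollifier \<epsilon>))) f x)\<bar>
      \<le> C * m / (R * \<epsilon>)"
      by (simp only: p_def W_def Wbb_def \<rho>_def)
  qed
qed

lemma flux_bound:
  "\<exists>C\<ge>0. \<forall>\<epsilon> R (f :: 'a::euclidean_space \<Rightarrow> complex) m. 0 < \<epsilon> \<longrightarrow> \<epsilon> \<le> 1 \<longrightarrow> 0 < R \<longrightarrow> f \<in> borel_measurable borel \<longrightarrow>
    l2sq f \<le> ennreal m \<longrightarrow> 0 \<le> m \<longrightarrow>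
    \<bar>LINT x|lborel. plateau R x * Im (cnj (conv (mollifier \<epsilon>) f x) * conv (lapR (mollifier \<epsilon>)) f x)\<bar> \<le> C * m / (R * \<epsilon>)"
proof -
  have "\<forall>b\<in>Basis. \<exists>C. 0 \<le> C \<and> (\<forall>\<epsilon> R (f :: 'a \<Rightarrow> complex) m. 0 < \<epsilon> \<longrightarrow> \<epsilon> \<le> 1 \<longrightarrow> 0 < R \<longrightarrow> f \<in> borel_measurable borel \<longrightarrow>
    l2sq f \<le> ennreal m \<longrightarrow> 0 \<le> m \<longrightarrow>
    \<bar>LINT x|lborel. plateau R x * Im (cnj (conv (mollifier \<epsilon>) f x) * conv (dir_deriv b (dir_deriv b (mollifier \<epsilon>))) f x)\<bar>
      \<le> C * m / (R * \<epsilon>))"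
    using flux_bound_Basis by blast
  then obtain C where CC: "\<forall>b\<in>Basis. 0 \<le> C b \<and> (\<forall>\<epsilon> R (f :: 'a \<Rightarrow> complex) m. 0 < \<epsilon> \<longrightarrow> \<epsilon> \<le> 1 \<longrightarrow> 0 < R \<longrightarrow> f \<in> borel_measurable borel \<longrightarrow>
    l2sq f \<le> ennreal m \<longrightarrow> 0 \<le> m \<longrightarrow>
    \<bar>LINT x|lborel. plateau R x * Im (cnj (conv (mollifier \<epsilon>) f x) * conv (dir_deriv b (dir_deriv b (mollifier \<epsilon>))) f x)\<bar>
      \<le> C b * m / (R * \<epsilon>))"
    by (rule bchoice[THEN exE])
  then have C: "\<And>b. b \<in> Basis \<Longrightarrow> C b \<ge> 0"
    and le: "\<And>b \<epsilon> R (f :: 'a \<Rightarrow> complex) m. b \<in> Basis \<Longrightarrow> 0 < \<epsilon> \<Longrightarrow> \<epsilon> \<le> 1 \<Longrightarrow> 0 < R \<Longrightarrow> f \<in> borel_measurable borel \<Longrightarrow>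
    l2sq f \<le> ennreal m \<Longrightarrow> 0 \<le> m \<Longrightarrow>
    \<bar>LINT x|lborel. plateau R x * Im (cnj (conv (mollifier \<epsilon>) f x) * conv (dir_deriv b (dir_deriv b (mollifier \<epsilon>))) f x)\<bar>
      \<le> C b * m / (R * \<epsilon>)" by auto
  show ?thesis
  proof (intro exI[of _ "\<Sum>b\<in>Basis. C b"] conjI allI impI)
    show "(\<Sum>b\<in>Basis. C b) \<ge> 0" using C by (rule sum_nonneg)
    fix \<epsilon> R m :: real and f :: "'a \<Rightarrow> complex"
    assume \<epsilon>: "0 < \<epsilon>" "\<epsilon> \<le> 1" and R: "0 < R" and fm: "f \<in> borel_measurable borel"
      and f: "l2sq f \<le> ennreal m" and m: "0 \<le> m"
    have "square_integrable f" using f fm by (auto simp: square_integrable_iff intro: le_less_trans)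
    then have lf: "loc_integrable f" by (rule square_integrable_imp_loc)
    have k: "kernel (mollifier \<epsilon> :: 'a \<Rightarrow> real)" by (rule kernel_mollifier[OF \<epsilon>(1)])
    define g where "g = (\<lambda>b x. plateau R x * Im (cnj (conv (mollifier \<epsilon>) f x) * conv (dir_deriv b (dir_deriv b (mollifier \<epsilon>))) f x))"
    have gi: "integrable lborel (g b)" if b: "b \<in> Basis" for b
    proof (rule integrable_continuous_compact_support[where R="DIM('a) * R"])
      show "continuous_on UNIV (g b)"
        unfolding g_def
        by (intro continuous_intros continuous_conv lf k kernel_dir_deriv b kernel_imp_continuous[OF kernel_plateau[OF R]])
      show "g b x = 0" if "norm x > DIM('a) * R" for x
        unfolding g_def using plateau_eq_0[OF R less_imp_le[OF that]] by simp
    qed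
    have "(LINT x|lborel. plateau R x * Im (cnj (conv (mollifier \<epsilon>) f x) * conv (lapR (mollifier \<epsilon>)) f x)) =
        (LINT x|lborel. (\<Sum>b\<in>Basis. g b x))"
      unfolding conv_lapR[OF lf k] g_def by (simp add: sum_distrib_left del: times_complex.sel)
    also have "\<dots> = (\<Sum>b\<in>Basis. (LINT x|lborel. g b x))" using gi by (rule Bochner_Integration.integral_sum)
    also have "\<bar>\<dots>\<bar> \<le> (\<Sum>b\<in>Basis. \<bar>LINT x|lborel. g b x\<bar>)" by (rule sum_abs)
    also have "\<dots> \<le> (\<Sum>b\<in>Basis. C b * m / (R * \<epsilon>))"
      unfolding g_def by (intro sum_mono le \<epsilon> R fm f m)
    also have "\<dots> = (\<Sum>b\<in>Basis. C b) * m / (R * \<epsilon>)"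
      by (simp add: sum_distrib_right sum_divide_distrib)
    finally show "\<bar>LINT x|lborel. plateau R x * Im (cnj (conv (mollifier \<epsilon>) f x) * conv (lapR (mollifier \<epsilon>)) f x)\<bar>
      \<le> (\<Sum>b\<in>Basis. C b) * m / (R * \<epsilon>)" .
  qed
qed

text \<open>A crude bound for a fixed kernel, uniform in f, in terms of the norm of f on a larger
  ball. Working with the cutoff makes it applicable to the nonlinearity, for which bounds in L^2 are
  available on balls.\<close>

lemma conv_bound_cball:
  fixes K :: "'a::euclidean_space \<Rightarrow> real"
  assumes K: "kernel K"
  obtains C r where "C \<ge> 0" "r \<ge> 1" "\<And>(f :: 'a \<Rightarrow> complex) m x. f \<in> borel_measurable borel \<Longrightarrow> 0 \<le> m \<Longrightarrow>
    l2sq (cutoff r f) \<le> ennreal m \<Longrightarrow> norm x \<le> R \<Longrightarrow> cmod (conv K f x) \<le> C * (m + 1)"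
proof -
  obtain r0 B where r0: "r0 > 0" "\<And>x. norm x > r0 \<Longrightarrow> K x = 0" and B: "B > 0" "\<And>x. \<bar>K x\<bar> \<le> B"
    using kernelE[OF K] by metis
  have [measurable]: "K \<in> borel_measurable borel" by (rule kernel_borel[OF K])
  define r where "r = max 1 (R + r0)"
  have [measurable]: "cball (0::'a) r \<in> sets borel" by simp
  define V where "V = enn2real (emeasure lborel (cball (0::'a) r))"
  have V: "emeasure lborel (cball (0::'a) r) = ennreal V" "V \<ge> 0"
    using emeasure_lborel_cball_finite[of "0::'a" r] by (auto simp: V_def)
  show thesis
  proof (rule that[of "B * (1 + V)" r])
    show "B * (1 + V) \<ge> 0" "r \<ge> 1" using B V by (auto simp: r_def)
    fix f :: "'a \<Rightarrow> complex" and m and x :: 'a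
    assume [measurable]: "f \<in> borel_measurable borel" and m: "0 \<le> m" "l2sq (cutoff r f) \<le> ennreal m" and x: "norm x \<le> R"
    have "ennreal (cmod (conv K f x)) \<le> (\<integral>\<^sup>+y. ennreal (cmod (f y * of_real (K (x - y)))) \<partial>lborel)"
      unfolding conv_def by (rule norm_integral_le_nn_integral)
    also have "\<dots> \<le> (\<integral>\<^sup>+y. ennreal B * (ennreal (cmod (cutoff r f y)) * indicator (cball 0 r) y) \<partial>lborel)"
    proof (intro nn_integral_mono)
      fix y
      show "ennreal (cmod (f y * of_real (K (x - y)))) \<le> ennreal B * (ennreal (cmod (cutoff r f y)) * indicator (cball 0 r) y)"
      proof (cases "norm y \<le> r")
        case True
        have "cmod (f y) * \<bar>K (x - y)\<bar> \<le> cmod (f y) * B" by (intro mult_left_mono B) simp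
        then show ?thesis
          using True B by (simp add: cutoff_def norm_mult ennreal_mult'[symmetric] ennreal_leI mult.commute)
      next
        case False
        then have "norm (x - y) > r0"
          using norm_triangle_ineq2[of y x] x by (auto simp: norm_minus_commute r_def)
        then show ?thesis using r0 by simp
      qed
    qed
    also have "\<dots> = ennreal B * (\<integral>\<^sup>+y. ennreal (cmod (cutoff r f y)) * indicator (cball 0 r) y \<partial>lborel)"
      by (rule nn_integral_cmult) measurable
    also have "\<dots> \<le> ennreal B * (ennreal m + ennreal V)"
      using nn_integral_ball_le_l2sq[of "cutoff r f" r] m(2) V
      by (intro mult_left_mono) (auto intro: order_trans add_right_mono)
    also have "\<dots> = ennreal (B * (m + V))" using B m V by (simp add: ennreal_mult')
    finally have "cmod (conv K f x) \<le> B * (m + V)" using B m V by (simp add: ennreal_le_iff)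
    also have "\<dots> \<le> B * ((1 + V) * (m + 1))"
    proof -
      have "0 \<le> V * m" using V m by simp
      then show ?thesis using B by (intro mult_left_mono) (auto simp: algebra_simps)
    qed
    finally show "cmod (conv K f x) \<le> B * (1 + V) * (m + 1)" by (simp add: mult.assoc)
  qed
qed

section \<open>The nonlinear term\<close>

lemma l2sq_cutoff_diff_log_le:
  assumes [measurable]: "u \<in> borel_measurable borel" "v \<in> borel_measurable borel"
    and u: "l2sq (cutoff R (\<lambda>x. log_nonlinearity (u x))) \<le> ennreal c"
    and v: "l2sq (cutoff R (\<lambda>x. log_nonlinearity (v x))) \<le> ennreal c" and c: "c \<ge> 0"
  shows "l2sq (cutoff R (\<lambda>x. log_nonlinearity (u x) - log_nonlinearity (v x))) \<le> ennreal (4 * c)"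
proof -
  have "l2sq (cutoff R (\<lambda>x. log_nonlinearity (u x) - log_nonlinearity (v x))) =
      l2sq (\<lambda>x. cutoff R (\<lambda>x. log_nonlinearity (u x)) x - cutoff R (\<lambda>x. log_nonlinearity (v x)) x)"
    by (simp add: cutoff_def[abs_def] scaleR_diff_right)
  also have "\<dots> \<le> 2 * l2sq (cutoff R (\<lambda>x. log_nonlinearity (u x))) + 2 * l2sq (cutoff R (\<lambda>x. log_nonlinearity (v x)))"
    by (rule l2sq_diff_le) measurable
  also have "\<dots> \<le> 2 * ennreal c + 2 * ennreal c" by (intro add_mono mult_left_mono u v) auto
  also have "\<dots> = ennreal (4 * c)" using c by (simp add: ennreal_mult' flip: distrib_right)
  finally show ?thesis .
qed

text \<open>Replace W by a - b. The main part is bounded by twice |a - b|^2, hence by 4 |W|^2 + 4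
  D^2 with D the modulus of the error; the product of the error with the nonlinear difference is
  split by Young's inequality with weight q. As q \<le> 1, the two multiples of D^2 combine to 5 /
  q.\<close>

lemma log_difference_pointwise:
  fixes a b W :: complex
  assumes q: "0 < q" "q \<le> 1"
  shows "\<bar>Im (cnj W * (log_nonlinearity a - log_nonlinearity b))\<bar> \<le>
     4 * (cmod W)\<^sup>2 + (5 / q) * (cmod ((a - b) - W))\<^sup>2 + q * (cmod (log_nonlinearity a - log_nonlinearity b))\<^sup>2"
proof -
  define F where "F = log_nonlinearity a - log_nonlinearity b"
  define D where "D = cmod ((a - b) - W)"
  have "Im (cnj W * F) = Im (F * cnj (a - b)) - Im (cnj ((a - b) - W) * F)"
    by (simp add: algebra_simps)
  then have "\<bar>Im (cnj W * F)\<bar> \<le> \<bar>Im (F * cnj (a - b))\<bar> + \<bar>Im (cnj ((a - b) - W) * F)\<bar>" by linarith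
  also have "\<bar>Im (F * cnj (a - b))\<bar> \<le> 2 * (cmod (a - b))\<^sup>2" unfolding F_def by (rule Im_log_nonlinearity_le)
  also have "(cmod (a - b))\<^sup>2 \<le> 2 * (cmod W)\<^sup>2 + 2 * D\<^sup>2"
    unfolding D_def using cmod_add_sq_le[of W "(a - b) - W"] by simp
  also have "\<bar>Im (cnj ((a - b) - W) * F)\<bar> \<le> D\<^sup>2 / q + q * (cmod F)\<^sup>2"
  proof -
    have "\<bar>Im (cnj ((a - b) - W) * F)\<bar> \<le> D * cmod F"
      using abs_Im_le_cmod[of "cnj ((a - b) - W) * F"] unfolding norm_mult complex_mod_cnj D_def .
    also have "\<dots> \<le> D\<^sup>2 / q + q * (cmod F)\<^sup>2"
    proof -
      have "2 * D * (q * cmod F) \<le> D\<^sup>2 + (q * cmod F)\<^sup>2" by (rule sum_squares_bound)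
      moreover have "0 \<le> D * (q * cmod F)" using q by (simp add: D_def)
      ultimately have "q * (D * cmod F) \<le> D\<^sup>2 + (q * cmod F)\<^sup>2" by (simp add: mult_ac)
      then have "D * cmod F \<le> (D\<^sup>2 + (q * cmod F)\<^sup>2) / q" using q by (simp add: field_simps)
      also have "\<dots> = D\<^sup>2 / q + q * (cmod F)\<^sup>2" using q by (simp add: field_simps power2_eq_square)
      finally show ?thesis .
    qed
    finally show ?thesis .
  qed
  finally have f1: "\<bar>Im (cnj W * F)\<bar> \<le> 2 * (2 * (cmod W)\<^sup>2 + 2 * D\<^sup>2) + (D\<^sup>2 / q + q * (cmod F)\<^sup>2)"
    by simp
  have f2: "4 * D\<^sup>2 \<le> 4 * (D\<^sup>2 / q)"
    using q by (simp add: field_simps mult_left_le_one_le)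
  have f3: "(5 / q) * D\<^sup>2 = 4 * (D\<^sup>2 / q) + D\<^sup>2 / q" by (simp add: field_simps)
  have "(X::real) \<le> 4 * x1 + z + x4"
    if "X \<le> 2 * (2 * x1 + 2 * x2) + (x3 + x4)" "4 * x2 \<le> 4 * x3" "z = 4 * x3 + x3" for X x1 x2 x3 x4 z :: real
    using that by (simp add: algebra_simps)
  from this[OF f1 f2 f3] show ?thesis by (simp only: F_def D_def)
qed

text \<open>The weight \<open>q\<close> comes from Young's inequality; it balances the mollification error \<open>m\<close> against the
  growth \<open>L\<close> of the nonlinearity.\<close>

lemma nonlinear_bound:
  fixes u v :: "'a::euclidean_space \<Rightarrow> complex" and \<epsilon> R q m L :: real
  defines "w \<equiv> \<lambda>x. u x - v x" and "F \<equiv> \<lambda>x. log_nonlinearity (u x) - log_nonlinearity (v x)"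
  assumes um[measurable]: "u \<in> borel_measurable borel" "v \<in> borel_measurable borel" and \<epsilon>: "\<epsilon> > 0" and R: "R > 0"
    and q: "0 < q" "q \<le> 1" and w: "square_integrable w"
    and D: "\<And>y. norm y \<le> DIM('a) * \<epsilon> \<Longrightarrow> l2sq (\<lambda>x. w (x - y) - conv (mollifier \<epsilon>) w x) \<le> ennreal m" and m: "m \<ge> 0"
    and L: "l2sq (cutoff (DIM('a) * (R + \<epsilon>)) F) \<le> ennreal L" "L \<ge> 0"
    and F: "loc_integrable F"
  shows "\<bar>LINT x|lborel. plateau R x * Im (cnj (conv (mollifier \<epsilon>) w x) * conv (mollifier \<epsilon>) F x)\<bar> \<le>
    4 * (LINT x|lborel. plateau R x * (cmod (conv (mollifier \<epsilon>) w x))\<^sup>2) + (5 * m / q + q * L)"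
proof -
  define \<rho> where "\<rho> = (mollifier \<epsilon> :: 'a \<Rightarrow> real)"
  define p where "p = (plateau R :: 'a \<Rightarrow> real)"
  define W where "W = conv \<rho> w"
  have k: "kernel \<rho>" unfolding \<rho>_def by (rule kernel_mollifier[OF \<epsilon>])
  have [measurable]: "\<rho> \<in> borel_measurable borel" by (rule kernel_borel[OF k])
  have [measurable]: "w \<in> borel_measurable borel" "F \<in> borel_measurable borel" unfolding w_def F_def by measurable
  have [measurable]: "W \<in> borel_measurable borel" unfolding W_def by measurable
  have [measurable]: "p \<in> borel_measurable borel" unfolding p_def by measurable
  have \<rho>0: "\<rho> y \<ge> 0" for y unfolding \<rho>_def by (rule mollifier_nonneg[OF \<epsilon>])
  have \<rho>1: "(\<integral>\<^sup>+y. ennreal (\<rho> y) \<partial>lborel) = 1" unfolding \<rho>_def by (rule nn_integral_mollifier[OF \<epsilon>])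
  have p01: "0 \<le> p x" "p x \<le> 1" for x by (auto simp: p_def plateau_nonneg plateau_le_1)
  define A where "A = (\<lambda>x y. 4 * (cmod (W x))\<^sup>2 + (5 / q) * (cmod (w (x - y) - W x))\<^sup>2 + q * (cmod (F (x - y)))\<^sup>2)"
  have A0: "A x y \<ge> 0" for x y using q by (simp add: A_def)
  \<comment> \<open>The convolution of F is an average of F(x - y), and for each y the scalar
    inequality is applied to the values of u and v at x - y, against W at x. So the error to be
    controlled is w(x - y) - W(x), which is the quantity in assumption \<open>D\<close>.\<close>
  have pt: "ennreal \<bar>Im (cnj (W x) * conv \<rho> F x)\<bar> \<le> (\<integral>\<^sup>+y. ennreal (\<rho> y * A x y) \<partial>lborel)" for x
  proof -
    have i: "integrable lborel (\<lambda>y. cnj (W x) * (F (x - y) * of_real (\<rho> y)))"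
      by (intro integrable_mult_right integrable_conv_alt F k)
    have e1: "cnj (W x) * conv \<rho> F x = (LINT y|lborel. cnj (W x) * (F (x - y) * of_real (\<rho> y)))"
      by (simp add: conv_alt)
    have "Im (cnj (W x) * conv \<rho> F x) = (LINT y|lborel. Im (cnj (W x) * (F (x - y) * of_real (\<rho> y))))"
      unfolding e1 by (rule integral_Im[OF i, symmetric])
    then have "ennreal \<bar>Im (cnj (W x) * conv \<rho> F x)\<bar> \<le> (\<integral>\<^sup>+y. ennreal \<bar>Im (cnj (W x) * (F (x - y) * of_real (\<rho> y)))\<bar> \<partial>lborel)"
      using norm_integral_le_nn_integral[of lborel "\<lambda>y. Im (cnj (W x) * (F (x - y) * of_real (\<rho> y)))"] by simp
    also have "\<dots> \<le> (\<integral>\<^sup>+y. ennreal (\<rho> y * A x y) \<partial>lborel)"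
    proof (intro nn_integral_mono ennreal_leI)
      fix y
      have "Im (cnj (W x) * (F (x - y) * of_real (\<rho> y))) = \<rho> y * Im (cnj (W x) * F (x - y))"
        by (simp add: algebra_simps)
      moreover have "\<bar>Im (cnj (W x) * F (x - y))\<bar> \<le> A x y"
        unfolding A_def F_def w_def by (rule log_difference_pointwise[OF q])
      ultimately show "\<bar>Im (cnj (W x) * (F (x - y) * of_real (\<rho> y)))\<bar> \<le> \<rho> y * A x y"
        using \<rho>0[of y] by (simp add: abs_mult mult_left_mono)
    qed
    finally show ?thesis .
  qed
  have Wi: "integrable lborel (\<lambda>x. (cmod (W x))\<^sup>2)"
  proof -
    have "l2sq W < \<infinity>"
      unfolding W_def \<rho>_def using w l2sq_conv_mollifier_le[of w \<epsilon>] \<epsilon> by (auto simp: square_integrable_iff intro: le_less_trans)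
    then have "square_integrable W" by (simp add: square_integrable_iff)
    then show ?thesis by (simp add: square_integrable_def)
  qed
  have pWi: "integrable lborel (\<lambda>x. p x * (cmod (W x))\<^sup>2)"
    by (rule Bochner_Integration.integrable_bound[OF Wi]) (use p01 in \<open>auto simp: abs_mult mult_left_le_one_le\<close>)
  define E where "E = (LINT x|lborel. p x * (cmod (W x))\<^sup>2)"
  have E0: "E \<ge> 0" unfolding E_def using p01 by (intro Bochner_Integration.integral_nonneg) simp
  have E: "(\<integral>\<^sup>+x. ennreal (p x * (cmod (W x))\<^sup>2) \<partial>lborel) = ennreal E"
    unfolding E_def using p01 by (intro nn_integral_eq_integral pWi) simp
  \<comment> \<open>For x in the support of the plateau and y in that of the mollifier, x - y lies
    in the ball of radius \<open>DIM('a)\<close> (R + \<epsilon>); this is why \<open>L\<close>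
    bounds the nonlinearity on that ball.\<close>
  have inner: "(\<integral>\<^sup>+x. ennreal (p x * A x y) \<partial>lborel) \<le> ennreal (4 * E + (5 * m / q + q * L))" if y: "norm y \<le> DIM('a) * \<epsilon>" for y
  proof -
    have "(\<integral>\<^sup>+x. ennreal (p x * A x y) \<partial>lborel) \<le> (\<integral>\<^sup>+x. 4 * ennreal (p x * (cmod (W x))\<^sup>2) +
        (ennreal (5 / q) * ennreal ((cmod (w (x - y) - W x))\<^sup>2) + ennreal q * ennreal ((cmod (cutoff (DIM('a) * (R + \<epsilon>)) F (x + (- y))))\<^sup>2)) \<partial>lborel)"
    proof (intro nn_integral_mono)
      fix x
      have "p x * A x y \<le> 4 * (p x * (cmod (W x))\<^sup>2) + ((5 / q) * (cmod (w (x - y) - W x))\<^sup>2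
          + q * (cmod (cutoff (DIM('a) * (R + \<epsilon>)) F (x + (- y))))\<^sup>2)"
      proof (cases "norm x \<ge> DIM('a) * R")
        case True
        then show ?thesis using plateau_eq_0[OF R, of x] q by (simp add: p_def)
      next
        case False
        then have "norm (x - y) \<le> DIM('a) * (R + \<epsilon>)"
          using y norm_triangle_ineq4[of x y] by (simp add: distrib_left)
        then have c: "cutoff (DIM('a) * (R + \<epsilon>)) F (x + (- y)) = F (x - y)" by (simp add: cutoff_def)
        have "p x * ((5 / q) * (cmod (w (x - y) - W x))\<^sup>2 + q * (cmod (F (x - y)))\<^sup>2) \<le>
            1 * ((5 / q) * (cmod (w (x - y) - W x))\<^sup>2 + q * (cmod (F (x - y)))\<^sup>2)"
          using p01[of x] q by (intro mult_right_mono) auto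
        then show ?thesis unfolding c A_def by (simp add: algebra_simps)
      qed
      then have "ennreal (p x * A x y) \<le> ennreal (4 * (p x * (cmod (W x))\<^sup>2) + ((5 / q) * (cmod (w (x - y) - W x))\<^sup>2
          + q * (cmod (cutoff (DIM('a) * (R + \<epsilon>)) F (x + (- y))))\<^sup>2))" by (rule ennreal_leI)
      also have "\<dots> = 4 * ennreal (p x * (cmod (W x))\<^sup>2) +
        (ennreal (5 / q) * ennreal ((cmod (w (x - y) - W x))\<^sup>2) + ennreal q * ennreal ((cmod (cutoff (DIM('a) * (R + \<epsilon>)) F (x + (- y))))\<^sup>2))"
      proof -
        have g: "ennreal (4 * a + (b * c + d * e)) = 4 * ennreal a + (ennreal b * ennreal c + ennreal d * ennreal e)"
          if "a \<ge> 0" "b \<ge> 0" "c \<ge> 0" "d \<ge> 0" "e \<ge> 0" for a b c d e :: real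
          using that by (simp add: ennreal_mult)
        show ?thesis by (rule g) (use p01[of x] q in auto)
      qed
      finally show "ennreal (p x * A x y) \<le> 4 * ennreal (p x * (cmod (W x))\<^sup>2) +
        (ennreal (5 / q) * ennreal ((cmod (w (x - y) - W x))\<^sup>2) + ennreal q * ennreal ((cmod (cutoff (DIM('a) * (R + \<epsilon>)) F (x + (- y))))\<^sup>2))" .
    qed
    also have "\<dots> = 4 * ennreal E + (ennreal (5 / q) * l2sq (\<lambda>x. w (x - y) - W x)
        + ennreal q * l2sq (\<lambda>x. cutoff (DIM('a) * (R + \<epsilon>)) F (x + (- y))))"
      unfolding l2sq_def E[symmetric] by (simp add: nn_integral_add nn_integral_cmult)
    also have "l2sq (\<lambda>x. cutoff (DIM('a) * (R + \<epsilon>)) F (x + (- y))) = l2sq (cutoff (DIM('a) * (R + \<epsilon>)) F)"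
      by (rule l2sq_shift) measurable
    also have "4 * ennreal E + (ennreal (5 / q) * l2sq (\<lambda>x. w (x - y) - W x) + ennreal q * l2sq (cutoff (DIM('a) * (R + \<epsilon>)) F)) \<le>
        4 * ennreal E + (ennreal (5 / q) * ennreal m + ennreal q * ennreal L)"
      unfolding W_def \<rho>_def using y by (intro add_mono mult_left_mono D L order_refl) auto
    also have "\<dots> = ennreal (4 * E + (5 / q * m + q * L))"
    proof -
      have g: "ennreal (4 * a + (b * c + d * e)) = 4 * ennreal a + (ennreal b * ennreal c + ennreal d * ennreal e)"
        if "a \<ge> 0" "b \<ge> 0" "c \<ge> 0" "d \<ge> 0" "e \<ge> 0" for a b c d e :: real
        using that by (simp add: ennreal_mult)
      show ?thesis by (rule g[symmetric]) (use E0 q m L in auto)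
    qed
    finally show ?thesis by simp
  qed
  have "ennreal \<bar>LINT x|lborel. p x * Im (cnj (W x) * conv \<rho> F x)\<bar> \<le> (\<integral>\<^sup>+x. ennreal \<bar>p x * Im (cnj (W x) * conv \<rho> F x)\<bar> \<partial>lborel)"
    using norm_integral_le_nn_integral[of lborel "\<lambda>x. p x * Im (cnj (W x) * conv \<rho> F x)"] by simp
  also have "\<dots> \<le> (\<integral>\<^sup>+x. (\<integral>\<^sup>+y. ennreal (p x * (\<rho> y * A x y)) \<partial>lborel) \<partial>lborel)"
  proof (intro nn_integral_mono)
    fix x
    have "ennreal \<bar>p x * Im (cnj (W x) * conv \<rho> F x)\<bar> = ennreal (p x) * ennreal \<bar>Im (cnj (W x) * conv \<rho> F x)\<bar>"
      using p01[of x] by (simp add: abs_mult ennreal_mult del: times_complex.sel)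
    also have "\<dots> \<le> ennreal (p x) * (\<integral>\<^sup>+y. ennreal (\<rho> y * A x y) \<partial>lborel)" by (intro mult_left_mono pt) simp
    also have "\<dots> = (\<integral>\<^sup>+y. ennreal (p x) * ennreal (\<rho> y * A x y) \<partial>lborel)"
      unfolding A_def by (rule nn_integral_cmult[symmetric]) measurable
    also have "\<dots> = (\<integral>\<^sup>+y. ennreal (p x * (\<rho> y * A x y)) \<partial>lborel)"
      using p01[of x] A0 \<rho>0 by (intro nn_integral_cong) (simp add: ennreal_mult)
    finally show "ennreal \<bar>p x * Im (cnj (W x) * conv \<rho> F x)\<bar> \<le> (\<integral>\<^sup>+y. ennreal (p x * (\<rho> y * A x y)) \<partial>lborel)" .
  qed
  also have "\<dots> = (\<integral>\<^sup>+y. (\<integral>\<^sup>+x. ennreal (p x * (\<rho> y * A x y)) \<partial>lborel) \<partial>lborel)"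
    unfolding A_def by (rule lborel_pair.Fubini') measurable
  also have "\<dots> \<le> (\<integral>\<^sup>+y. ennreal (\<rho> y) * ennreal (4 * E + (5 * m / q + q * L)) \<partial>lborel)"
  proof (intro nn_integral_mono)
    fix y :: 'a
    show "(\<integral>\<^sup>+x. ennreal (p x * (\<rho> y * A x y)) \<partial>lborel) \<le> ennreal (\<rho> y) * ennreal (4 * E + (5 * m / q + q * L))"
    proof (cases "norm y \<le> DIM('a) * \<epsilon>")
      case True
      have "(\<integral>\<^sup>+x. ennreal (p x * (\<rho> y * A x y)) \<partial>lborel) = (\<integral>\<^sup>+x. ennreal (\<rho> y) * ennreal (p x * A x y) \<partial>lborel)"
        using p01 A0 \<rho>0 by (intro nn_integral_cong) (simp add: ennreal_mult[symmetric] mult.left_commute)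
      also have "\<dots> = ennreal (\<rho> y) * (\<integral>\<^sup>+x. ennreal (p x * A x y) \<partial>lborel)"
        unfolding A_def by (rule nn_integral_cmult) measurable
      also have "\<dots> \<le> ennreal (\<rho> y) * ennreal (4 * E + (5 * m / q + q * L))" by (intro mult_left_mono inner True) simp
      finally show ?thesis .
    next
      case False
      then have "\<rho> y = 0" unfolding \<rho>_def by (intro mollifier_eq_0 \<epsilon>) simp
      then show ?thesis by simp
    qed
  qed
  also have "\<dots> = ennreal (4 * E + (5 * m / q + q * L))"
    using \<rho>1 by (subst nn_integral_multc) simp_all
  finally have "ennreal \<bar>LINT x|lborel. p x * Im (cnj (W x) * conv \<rho> F x)\<bar> \<le> ennreal (4 * E + (5 * m / q + q * L))" .
  moreover have "0 \<le> 4 * E + (5 * m / q + q * L)" using E0 m q L by simp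
  ultimately have "\<bar>LINT x|lborel. p x * Im (cnj (W x) * conv \<rho> F x)\<bar> \<le> 4 * E + (5 * m / q + q * L)"
    by (simp only: ennreal_le_iff)
  then show ?thesis by (simp only: p_def W_def \<rho>_def E_def)
qed

section \<open>Integration in time\<close>

text \<open>Fubini is applied to the product of the complete measure in time with the Borel measure
  in space: pairings along a solution are only Lebesgue measurable in t.\<close>

lemma sigma_finite_lebesgue: "sigma_finite_measure (lebesgue :: real measure)"
proof (rule sigma_finite_measure.intro)
  obtain A :: "real set set" where A: "countable A" "A \<subseteq> sets lborel" "\<Union>A = space lborel" "\<forall>a\<in>A. emeasure lborel a \<noteq> \<infinity>"
    using lborel.sigma_finite_countable by blast
  have a1: "A \<subseteq> sets (lebesgue :: real measure)" using A(2) by auto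
  have a2: "\<forall>a\<in>A. emeasure (lebesgue :: real measure) a \<noteq> \<infinity>"
    using A(2,4) by (auto simp: emeasure_completion main_part_sets)
  have a3: "\<Union>A = space (lebesgue :: real measure)" using A(3) by simp
  show "\<exists>A. countable A \<and> A \<subseteq> sets (lebesgue :: real measure) \<and> \<Union>A = space (lebesgue :: real measure) \<and>
      (\<forall>a\<in>A. emeasure (lebesgue :: real measure) a \<noteq> \<infinity>)"
    using A(1) a1 a2 a3 by blast
qed

text \<open>Joint measurability of a Caratheodory function: x is approximated by functions with
  finitely many values, for which measurability in t suffices, and continuity in x gives the
  limit.\<close>

lemma caratheodory_measurable:
  fixes f :: "real \<Rightarrow> 'a::euclidean_space \<Rightarrow> complex"
  assumes f: "\<And>x. (\<lambda>t. f t x) \<in> borel_measurable lebesgue" and c: "\<And>t. continuous_on UNIV (f t)"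
  shows "(\<lambda>(t, x). f t x) \<in> borel_measurable (lebesgue \<Otimes>\<^sub>M lborel)"
proof -
  obtain F :: "nat \<Rightarrow> 'a \<Rightarrow> 'a" where F: "\<And>i. simple_function lborel (F i)" and lim: "\<And>x. (\<lambda>i. F i x) \<longlonglongrightarrow> x"
    using borel_measurable_implies_sequence_metric[of "\<lambda>x::'a. x" lborel 0] by auto
  show ?thesis
  proof (rule borel_measurable_LIMSEQ_metric)
    fix i
    have fin: "finite (range (F i))" using F[of i] by (simp add: simple_function_def)
    have "F i \<in> measurable lborel (count_space (range (F i)))"
      using simple_function_measurable2[of lborel] F[of i]
      by (auto simp: measurable_count_space_eq2 fin simple_function_def)
    then have g: "(\<lambda>z. F i (snd z)) \<in> measurable (lebesgue \<Otimes>\<^sub>M lborel) (count_space (range (F i)))"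
      by (rule measurable_compose[OF measurable_snd])
    have fy: "(\<lambda>z. f (fst z) y) \<in> borel_measurable (lebesgue \<Otimes>\<^sub>M lborel)" for y
      by (rule measurable_compose[OF measurable_fst f])
    show "(\<lambda>z. f (fst z) (F i (snd z))) \<in> borel_measurable (lebesgue \<Otimes>\<^sub>M lborel)"
      by (rule measurable_compose_countable'[OF fy g countable_finite[OF fin]])
  next
    fix z :: "real \<times> 'a"
    have "isCont (f (fst z)) (snd z)" using c by (simp add: continuous_on_eq_continuous_at)
    then have "(\<lambda>i. f (fst z) (F i (snd z))) \<longlonglongrightarrow> f (fst z) (snd z)"
      by (rule isCont_tendsto_compose[OF _ lim])
    then show "(\<lambda>i. f (fst z) (F i (snd z))) \<longlonglongrightarrow> (case z of (t, x) \<Rightarrow> f t x)"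
      by (simp add: case_prod_unfold)
  qed
qed

lemma set_integrable_bounded:
  fixes h :: "real \<Rightarrow> 'b::{banach, second_countable_topology}"
  assumes h: "h \<in> borel_measurable lebesgue" "\<And>t. norm (h t) \<le> C"
  shows "set_integrable lebesgue {a..b} h"
  unfolding set_integrable_def
proof (rule Bochner_Integration.integrable_bound)
  show "integrable lebesgue (\<lambda>t. C * indicator {a..b} t)"
    by (intro integrable_mult_right) (simp add: integrable_indicator_iff emeasure_lborel_Icc_eq)
  have "C \<ge> 0" using h(2)[of 0] norm_ge_zero[of "h 0"] by linarith
  then show "AE t in lebesgue. norm (indicator {a..b} t *\<^sub>R h t) \<le> norm (C * indicator {a..b} t)"
    using h(2) by (intro AE_I2) (auto simp: indicator_def)
  show "(\<lambda>t. indicator {a..b} t *\<^sub>R h t) \<in> borel_measurable lebesgue"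
    using h by (intro borel_measurable_scaleR borel_measurable_indicator) auto
qed

lemma set_integral_increment:
  fixes h :: "real \<Rightarrow> 'b::{banach, second_countable_topology}"
  assumes h: "h \<in> borel_measurable lebesgue" "\<And>t. norm (h t) \<le> C" and st: "0 \<le> s" "s \<le> t"
  shows "(LINT \<tau>:{0..t}|lebesgue. h \<tau>) - (LINT \<tau>:{0..s}|lebesgue. h \<tau>) = (LINT \<tau>:{s..t}|lebesgue. h \<tau>)"
    and "norm (LINT \<tau>:{s..t}|lebesgue. h \<tau>) \<le> C * (t - s)"
proof -
  note si = set_integrable_bounded[OF h]
  have ae: "AE \<tau> in lebesgue. \<tau> \<noteq> s" using AE_completion[OF AE_lborel_singleton[of s]] by simp
  have "(LINT \<tau>:{0..t}|lebesgue. h \<tau>) - (LINT \<tau>:{0..s}|lebesgue. h \<tau>) =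
      (LINT \<tau>|lebesgue. indicator {0..t} \<tau> *\<^sub>R h \<tau> - indicator {0..s} \<tau> *\<^sub>R h \<tau>)"
    unfolding set_lebesgue_integral_def using si[unfolded set_integrable_def]
    by (intro Bochner_Integration.integral_diff[symmetric]) auto
  also have "\<dots> = (LINT \<tau>:{s..t}|lebesgue. h \<tau>)"
    unfolding set_lebesgue_integral_def
  proof (rule Bochner_Integration.integral_cong_AE)
    show "(\<lambda>\<tau>. indicator {0..t} \<tau> *\<^sub>R h \<tau> - indicator {0..s} \<tau> *\<^sub>R h \<tau>) \<in> borel_measurable lebesgue"
      "(\<lambda>\<tau>. indicator {s..t} \<tau> *\<^sub>R h \<tau>) \<in> borel_measurable lebesgue"
      using si[unfolded set_integrable_def] by auto
    show "AE \<tau> in lebesgue. indicator {0..t} \<tau> *\<^sub>R h \<tau> - indicator {0..s} \<tau> *\<^sub>R h \<tau> = indicator {s..t} \<tau> *\<^sub>R h \<tau>"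
      using ae by eventually_elim (use st in \<open>auto simp: indicator_def\<close>)
  qed
  finally show "(LINT \<tau>:{0..t}|lebesgue. h \<tau>) - (LINT \<tau>:{0..s}|lebesgue. h \<tau>) = (LINT \<tau>:{s..t}|lebesgue. h \<tau>)" .
  have C: "C \<ge> 0" using h(2)[of 0] norm_ge_zero[of "h 0"] by linarith
  have "norm (LINT \<tau>:{s..t}|lebesgue. h \<tau>) \<le> (LINT \<tau>|lebesgue. C * indicator {s..t} \<tau>)"
    unfolding set_lebesgue_integral_def
  proof (rule order_trans[OF integral_norm_bound integral_mono])
    show "integrable lebesgue (\<lambda>\<tau>. norm (indicator {s..t} \<tau> *\<^sub>R h \<tau>))"
      using si[unfolded set_integrable_def] by (intro integrable_norm)
    show "integrable lebesgue (\<lambda>\<tau>. C * indicator {s..t} \<tau>)"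
      by (intro integrable_mult_right) (simp add: integrable_indicator_iff emeasure_lborel_Icc_eq)
    show "norm (indicator {s..t} \<tau> *\<^sub>R h \<tau>) \<le> C * indicator {s..t} \<tau>" for \<tau>
      using h(2)[of \<tau>] by (simp add: indicator_def)
  qed
  also have "\<dots> = C * (t - s)" using st by simp
  finally show "norm (LINT \<tau>:{s..t}|lebesgue. h \<tau>) \<le> C * (t - s)" .
qed

text \<open>The increments are of second order, so the derivative exists and vanishes everywhere on
  the half-line.\<close>

lemma quadratic_increment_imp_constant:
  fixes f :: "real \<Rightarrow> real"
  assumes "\<And>s t. 0 \<le> s \<Longrightarrow> s \<le> t \<Longrightarrow> \<bar>f t - f s\<bar> \<le> K * (t - s)\<^sup>2" and t: "0 \<le> t"
  shows "f t = f 0"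
proof -
  have inc: "\<bar>f y - f x\<bar> \<le> \<bar>K\<bar> * (y - x)\<^sup>2" if "x \<in> {0..}" "y \<in> {0..}" for x y
  proof -
    have "\<bar>f y - f x\<bar> \<le> K * (y - x)\<^sup>2"
    proof (cases "x \<le> y")
      case True
      then show ?thesis using assms(1)[of x y] that by simp
    next
      case False
      then show ?thesis using assms(1)[of y x] that by (simp add: abs_minus_commute power2_commute)
    qed
    also have "\<dots> \<le> \<bar>K\<bar> * (y - x)\<^sup>2" by (intro mult_right_mono) auto
    finally show ?thesis .
  qed
  have "(f has_field_derivative 0) (at x within {0..})" if x: "x \<in> {0..}" for x
    unfolding has_field_derivative_iff
  proof (rule Lim_null_comparison)
    show "\<forall>\<^sub>F y in at x within {0..}. norm ((f y - f x) / (y - x)) \<le> \<bar>K\<bar> * \<bar>y - x\<bar>"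
      unfolding eventually_at_filter
    proof (intro always_eventually allI impI)
      fix y assume y: "y \<noteq> x" "y \<in> {0..}"
      have "\<bar>f y - f x\<bar> \<le> \<bar>K\<bar> * \<bar>y - x\<bar> * \<bar>y - x\<bar>"
        using inc[OF x y(2)] by (simp add: power2_eq_square mult.assoc)
      then show "norm ((f y - f x) / (y - x)) \<le> \<bar>K\<bar> * \<bar>y - x\<bar>"
        using y by (simp add: abs_divide field_simps)
    qed
    have "((\<lambda>y. \<bar>K\<bar> * \<bar>y - x\<bar>) \<longlongrightarrow> \<bar>K\<bar> * \<bar>x - x\<bar>) (at x within {0..})" by (intro tendsto_intros)
    then show "((\<lambda>y. \<bar>K\<bar> * \<bar>y - x\<bar>) \<longlongrightarrow> 0) (at x within {0..})" by simp
  qed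
  then obtain c where "\<And>x. x \<in> {0..} \<Longrightarrow> f x = c"
    using has_field_derivative_zero_constant[of "{0::real..}" f] by auto
  then show ?thesis using t by simp
qed

text \<open>The product rule for an absolutely continuous primitive, obtained from increments of second order
  rather than from differentiability almost everywhere.\<close>

lemma cmod_sq_primitive:
  fixes p :: "real \<Rightarrow> complex"
  assumes p: "p \<in> borel_measurable lebesgue" "\<And>t. cmod (p t) \<le> C" and T: "T \<ge> 0" "\<And>t. t > T \<Longrightarrow> p t = 0"
    and t: "t \<ge> 0"
  defines "A \<equiv> \<lambda>t. LINT \<tau>:{0..t}|lebesgue. p \<tau>"
  shows "(cmod (A t))\<^sup>2 = (LINT \<tau>:{0..t}|lebesgue. 2 * Re (cnj (A \<tau>) * p \<tau>))"
proof -
  have C: "C \<ge> 0" using p(2)[of 0] norm_ge_zero[of "p 0"] by linarith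
  have inc: "A t - A s = (LINT \<tau>:{s..t}|lebesgue. p \<tau>)" "cmod (A t - A s) \<le> C * (t - s)"
    if "0 \<le> s" "s \<le> t" for s t
    using set_integral_increment[OF p that] by (auto simp: A_def)
  have A0: "A 0 = 0"
    using inc(1)[of 0 0] by (simp add: A_def)
  \<comment> \<open>For negative t the interval from 0 to t is empty; A is thereby Lipschitz on the
    whole line, and measurability follows from continuity.\<close>
  have Aneg: "A t = 0" if "t < 0" for t using that by (simp add: A_def set_lebesgue_integral_def)
  have lip: "cmod (A x - A y) \<le> C * \<bar>x - y\<bar>" for x y
  proof -
    have *: "cmod (A y - A x) \<le> C * (y - x)" if "x \<le> y" for x y
    proof (cases "x \<ge> 0")
      case True
      then show ?thesis using inc(2)[of x y] that by simp
    next
      case x: False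
      show ?thesis
      proof (cases "y \<ge> 0")
        case True
        then have "cmod (A y - A 0) \<le> C * y" using inc(2)[of 0 y] by simp
        also have "\<dots> \<le> C * (y - x)" using x C by (intro mult_left_mono) auto
        finally show ?thesis using A0 Aneg[of x] x by simp
      next
        case False
        then show ?thesis using x Aneg[of x] Aneg[of y] that C by simp
      qed
    qed
    show ?thesis using *[of x y] *[of y x] by (cases "x \<le> y") (auto simp: norm_minus_commute)
  qed
  have "C-lipschitz_on UNIV A"
    using lip C by (intro lipschitz_onI) (auto simp: dist_norm dist_real_def)
  then have contA: "continuous_on UNIV A" by (rule lipschitz_on_continuous_on)
  have mA: "A \<in> borel_measurable lebesgue"
    by (rule measurable_completion) (simp add: borel_measurable_continuous_onI[OF contA])
  \<comment> \<open>As \<open>p\<close> vanishes after T, the primitive is bounded for all times,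
    and so is the integrand \<open>h\<close>.\<close>
  have Ab: "cmod (A t) \<le> C * T" for t
  proof -
    have "cmod (A t) \<le> (LINT \<tau>|lebesgue. C * indicator {0..T} \<tau>)"
      unfolding A_def set_lebesgue_integral_def
    proof (rule order_trans[OF integral_norm_bound integral_mono])
      show "integrable lebesgue (\<lambda>\<tau>. norm (indicator {0..t} \<tau> *\<^sub>R p \<tau>))"
        using set_integrable_bounded[OF p, of 0 t] unfolding set_integrable_def by (intro integrable_norm)
      show "integrable lebesgue (\<lambda>\<tau>. C * indicator {0..T} \<tau>)"
        by (intro integrable_mult_right) (simp add: integrable_indicator_iff emeasure_lborel_Icc_eq)
      show "norm (indicator {0..t} \<tau> *\<^sub>R p \<tau>) \<le> C * indicator {0..T} \<tau>" for \<tau>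
        using p(2)[of \<tau>] T(2)[of \<tau>] C by (auto simp: indicator_def)
    qed
    also have "\<dots> = C * T" using T by simp
    finally show ?thesis .
  qed
  define h where "h = (\<lambda>\<tau>. 2 * Re (cnj (A \<tau>) * p \<tau>))"
  have Re_le: "\<bar>Re (cnj z * w)\<bar> \<le> cmod z * cmod w" for z w
    using abs_Re_le_cmod[of "cnj z * w"] unfolding norm_mult complex_mod_cnj .
  have mh: "h \<in> borel_measurable lebesgue" unfolding h_def using mA p(1) by (simp del: times_complex.sel)
  have hb: "norm (h \<tau>) \<le> 2 * (C * T * C)" for \<tau>
  proof -
    have "\<bar>Re (cnj (A \<tau>) * p \<tau>)\<bar> \<le> (C * T) * C"
      using C T by (intro order_trans[OF Re_le] mult_mono Ab p) auto
    then show ?thesis by (simp add: h_def del: times_complex.sel)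
  qed
  define \<phi> where "\<phi> = (\<lambda>t. (cmod (A t))\<^sup>2 - (LINT \<tau>:{0..t}|lebesgue. h \<tau>))"
  have "\<phi> t = \<phi> 0"
  proof (rule quadratic_increment_imp_constant[OF _ t])
    fix s t :: real assume st: "0 \<le> s" "s \<le> t"
    have sp: "set_integrable lebesgue {s..t} (\<lambda>\<tau>. cnj (A s) * p \<tau>)"
      using set_integrable_bounded[OF p, of s t] by simp
    have "(LINT \<tau>:{s..t}|lebesgue. 2 * Re (cnj (A s) * p \<tau>)) = 2 * Re (cnj (A s) * (A t - A s))"
    proof -
      have "Re (LINT \<tau>:{s..t}|lebesgue. cnj (A s) * p \<tau>) = (LINT \<tau>:{s..t}|lebesgue. Re (cnj (A s) * p \<tau>))"
        using integral_Re[OF sp[unfolded set_integrable_def]] unfolding set_lebesgue_integral_def by (simp del: times_complex.sel)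
      then show ?thesis unfolding inc(1)[OF st] by (simp del: times_complex.sel)
    qed
    moreover have "(cmod (A t))\<^sup>2 - (cmod (A s))\<^sup>2 = (cmod (A t - A s))\<^sup>2 + 2 * Re (cnj (A s) * (A t - A s))"
      unfolding cmod_power2 by (simp add: power2_eq_square algebra_simps)
    moreover have "(LINT \<tau>:{0..t}|lebesgue. h \<tau>) - (LINT \<tau>:{0..s}|lebesgue. h \<tau>) = (LINT \<tau>:{s..t}|lebesgue. h \<tau>)"
      by (rule set_integral_increment[OF mh hb st])
    ultimately have eq: "\<phi> t - \<phi> s = (cmod (A t - A s))\<^sup>2 -
        ((LINT \<tau>:{s..t}|lebesgue. h \<tau>) - (LINT \<tau>:{s..t}|lebesgue. 2 * Re (cnj (A s) * p \<tau>)))"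
      unfolding \<phi>_def by linarith
    \<comment> \<open>The error of freezing A at the left endpoint s. It is bounded by 2 C^2 (t - s)
      on an interval of length t - s, hence of second order; together with the square of the
      increment of A, at most C^2 (t - s)^2, this gives the constant 3 C^2.\<close>
    define g where "g = (\<lambda>\<tau>. if \<tau> \<in> {s..t} then 2 * Re (cnj (A \<tau> - A s) * p \<tau>) else 0)"
    have mg: "g \<in> borel_measurable lebesgue"
      unfolding g_def using mA p(1) by (intro measurable_If_set) (auto simp del: times_complex.sel)
    have gb: "norm (g \<tau>) \<le> 2 * (C * (t - s) * C)" for \<tau>
    proof (cases "\<tau> \<in> {s..t}")
      case True
      have "\<bar>Re (cnj (A \<tau> - A s) * p \<tau>)\<bar> \<le> (C * (\<tau> - s)) * C"
        using C True st by (intro order_trans[OF Re_le] mult_mono inc p) auto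
      also have "\<dots> \<le> (C * (t - s)) * C" using C True by (intro mult_right_mono mult_left_mono) auto
      finally show ?thesis using True by (simp add: g_def del: times_complex.sel)
    next
      case False
      then show ?thesis using C st by (simp add: g_def del: atLeastAtMost_iff)
    qed
    have "(LINT \<tau>:{s..t}|lebesgue. h \<tau>) - (LINT \<tau>:{s..t}|lebesgue. 2 * Re (cnj (A s) * p \<tau>)) = (LINT \<tau>:{s..t}|lebesgue. g \<tau>)"
    proof -
      have i2: "set_integrable lebesgue {s..t} (\<lambda>\<tau>. 2 * Re (cnj (A s) * p \<tau>))"
        unfolding set_integrable_def using integrable_Re[OF sp[unfolded set_integrable_def]]
        by (simp del: times_complex.sel add: mult.left_commute)
      have "(LINT \<tau>:{s..t}|lebesgue. h \<tau>) - (LINT \<tau>:{s..t}|lebesgue. 2 * Re (cnj (A s) * p \<tau>)) =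
         (LINT \<tau>:{s..t}|lebesgue. h \<tau> - 2 * Re (cnj (A s) * p \<tau>))"
        by (rule set_integral_diff(2)[symmetric, OF set_integrable_bounded[OF mh hb] i2])
      also have "\<dots> = (LINT \<tau>:{s..t}|lebesgue. g \<tau>)"
        unfolding set_lebesgue_integral_def h_def g_def
        by (intro Bochner_Integration.integral_cong refl) (simp add: indicator_def algebra_simps)
      finally show ?thesis .
    qed
    moreover have "\<bar>LINT \<tau>:{s..t}|lebesgue. g \<tau>\<bar> \<le> 2 * (C * (t - s) * C) * (t - s)"
      using set_integral_increment(2)[OF mg gb st] by simp
    moreover have "(cmod (A t - A s))\<^sup>2 \<le> (C * (t - s))\<^sup>2" by (intro power_mono inc st) simp
    ultimately have "\<bar>\<phi> t - \<phi> s\<bar> \<le> (C * (t - s))\<^sup>2 + 2 * (C * (t - s) * C) * (t - s)"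
      unfolding eq using zero_le_power2[of "cmod (A t - A s)"] by linarith
    also have "\<dots> = 3 * C\<^sup>2 * (t - s)\<^sup>2" by (simp add: power2_eq_square algebra_simps)
    finally show "\<bar>\<phi> t - \<phi> s\<bar> \<le> 3 * C\<^sup>2 * (t - s)\<^sup>2" .
  qed
  moreover have "(LINT \<tau>:{0..0}|lebesgue. h \<tau>) = 0"
    using set_integral_increment(1)[OF mh hb, of 0 0] by simp
  ultimately show ?thesis using A0 by (simp add: \<phi>_def h_def del: times_complex.sel)
qed

lemma set_integral_exp:
  fixes L t :: real
  assumes "L > 0" "t \<ge> 0"
  shows "(LINT \<tau>:{0..t}|lebesgue. exp (L * \<tau>)) = (exp (L * t) - 1) / L"
    and "set_integrable lebesgue {0..t} (\<lambda>\<tau>. exp (L * \<tau>))"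
proof -
  have "set_integrable lborel {0..t} (\<lambda>\<tau>. exp (L * \<tau>))"
    unfolding set_integrable_def by (intro borel_integrable_compact compact_Icc continuous_intros)
  then show i: "set_integrable lebesgue {0..t} (\<lambda>\<tau>. exp (L * \<tau>))"
    unfolding set_integrable_def by (subst integrable_completion) auto
  have "((\<lambda>\<tau>. exp (L * \<tau>)) has_integral exp (L * t) / L - exp (L * 0) / L) {0..t}"
    using assms
    by (intro fundamental_theorem_of_calculus) (auto intro!: derivative_eq_intros simp: has_real_derivative_iff_has_vector_derivative[symmetric])
  then have "integral {0..t} (\<lambda>\<tau>. exp (L * \<tau>)) = (exp (L * t) - 1) / L"
    by (simp add: integral_unique diff_divide_distrib)
  then show "(LINT \<tau>:{0..t}|lebesgue. exp (L * \<tau>)) = (exp (L * t) - 1) / L"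
    using set_lebesgue_integral_eq_integral(2)[OF i] by simp
qed

text \<open>A weighted supremum in place of iteration: let S be the supremum of exp(-2Lt) E(t).
  Inserting E \<le> S exp(2Lt) into the integral inequality returns S \<le> \<kappa> T + S / 2, the
  rate 2 L being chosen to make the factor 1/2. S is finite because E is bounded, so S / 2 can be
  absorbed. Measurability and boundedness of E are thus enough.\<close>

lemma gronwall_integral:
  fixes E :: "real \<Rightarrow> real"
  assumes T: "T > 0" and L: "L > 0" and \<kappa>: "\<kappa> \<ge> 0"
    and E: "\<And>t. t \<in> {0..T} \<Longrightarrow> 0 \<le> E t" "\<And>t. t \<in> {0..T} \<Longrightarrow> E t \<le> B"
    and m: "(\<lambda>t. if t \<in> {0..T} then E t else 0) \<in> borel_measurable lebesgue"
    and ineq: "\<And>t. t \<in> {0..T} \<Longrightarrow> E t \<le> (LINT \<tau>:{0..t}|lebesgue. \<kappa> + L * E \<tau>)"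
    and t: "t \<in> {0..T}"
  shows "E t \<le> 2 * \<kappa> * T * exp (2 * L * t)"
proof -
  define S where "S = (SUP t\<in>{0..T}. exp (- (2 * L * t)) * E t)"
  have bdd: "bdd_above ((\<lambda>t. exp (- (2 * L * t)) * E t) ` {0..T})"
  proof (rule bdd_aboveI2)
    fix t assume t: "t \<in> {0..T}"
    have "exp (- (2 * L * t)) * E t \<le> 1 * B"
      using E[OF t] L t by (intro mult_mono) auto
    then show "exp (- (2 * L * t)) * E t \<le> B" by simp
  qed
  have ES: "exp (- (2 * L * t)) * E t \<le> S" if "t \<in> {0..T}" for t
    unfolding S_def using bdd that by (rule cSUP_upper[rotated])
  have ES': "E t \<le> S * exp (2 * L * t)" if "t \<in> {0..T}" for t
    using ES[OF that] by (simp add: exp_minus field_simps)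
  have S0: "S \<ge> 0" using ES[of 0] E(1)[of 0] T by simp
  define E' where "E' = (\<lambda>t. if t \<in> {0..T} then E t else 0)"
  have E'b: "norm (E' t) \<le> max B 0" for t using E[of t] by (auto simp: E'_def)
  have "exp (- (2 * L * t)) * E t \<le> \<kappa> * T + S / 2" if t: "t \<in> {0..T}" for t
  proof -
    have t0: "0 \<le> t" "t \<le> T" using t by auto
    have iE: "set_integrable lebesgue {0..t} E'"
      by (rule set_integrable_bounded[OF _ E'b]) (simp only: E'_def m)
    have ic: "set_integrable lebesgue {0..t} (\<lambda>_. \<kappa>)"
      by (rule set_integrable_bounded[of _ "\<kappa>"]) (use \<kappa> in auto)
    have e: "indicator {0..t} \<tau> *\<^sub>R (\<kappa> + L * E \<tau>) = indicator {0..t} \<tau> *\<^sub>R (\<kappa> + L * E' \<tau>)" for \<tau>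
      using t0 by (auto simp: indicator_def E'_def)
    have "E t \<le> (LINT \<tau>:{0..t}|lebesgue. \<kappa> + L * E' \<tau>)"
      using ineq[OF t] unfolding set_lebesgue_integral_def e .
    also have "\<dots> \<le> (LINT \<tau>:{0..t}|lebesgue. \<kappa> + L * (S * exp (2 * L * \<tau>)))"
    proof (rule set_integral_mono)
      show "set_integrable lebesgue {0..t} (\<lambda>\<tau>. \<kappa> + L * E' \<tau>)" using iE ic by (intro set_integral_add) auto
      show "set_integrable lebesgue {0..t} (\<lambda>\<tau>. \<kappa> + L * (S * exp (2 * L * \<tau>)))"
        using set_integral_exp(2)[of "2 * L" t] L t0 ic by (intro set_integral_add) auto
      show "\<kappa> + L * E' \<tau> \<le> \<kappa> + L * (S * exp (2 * L * \<tau>))" if "\<tau> \<in> {0..t}" for \<tau>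
        using ES'[of \<tau>] that t0 L by (auto simp: E'_def)
    qed
    also have "\<dots> = (LINT \<tau>:{0..t}|lebesgue. \<kappa>) + (LINT \<tau>:{0..t}|lebesgue. L * (S * exp (2 * L * \<tau>)))"
      using set_integral_exp(2)[of "2 * L" t] L t0 ic by (intro set_integral_add) auto
    also have "(LINT \<tau>:{0..t}|lebesgue. \<kappa>) = \<kappa> * t"
      unfolding set_lebesgue_integral_def using t0 by simp
    also have "(LINT \<tau>:{0..t}|lebesgue. L * (S * exp (2 * L * \<tau>))) = S / 2 * (exp (2 * L * t) - 1)"
      using set_integral_exp(1)[of "2 * L" t] L t0 by (simp add: mult.assoc[symmetric])
    finally have "E t \<le> \<kappa> * t + S / 2 * (exp (2 * L * t) - 1)" .
    also have "\<dots> \<le> \<kappa> * T * exp (2 * L * t) + S / 2 * exp (2 * L * t)"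
    proof (intro add_mono)
      have "\<kappa> * t \<le> \<kappa> * T * 1" using \<kappa> t0 by (simp add: mult_left_mono)
      also have "\<dots> \<le> \<kappa> * T * exp (2 * L * t)" using \<kappa> T L t0 by (intro mult_left_mono) auto
      finally show "\<kappa> * t \<le> \<kappa> * T * exp (2 * L * t)" .
      show "S / 2 * (exp (2 * L * t) - 1) \<le> S / 2 * exp (2 * L * t)" using S0 by (intro mult_left_mono) auto
    qed
    finally have "exp (- (2 * L * t)) * E t \<le> exp (- (2 * L * t)) * ((\<kappa> * T + S / 2) * exp (2 * L * t))"
      by (intro mult_left_mono) (auto simp: distrib_right)
    also have "\<dots> = \<kappa> * T + S / 2" by (simp add: exp_minus field_simps)
    finally show ?thesis .
  qed
  then have "S \<le> \<kappa> * T + S / 2"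
    unfolding S_def[of] using T by (intro cSUP_least) (auto simp: S_def[symmetric])
  then have "S \<le> 2 * \<kappa> * T" by simp
  then have "S * exp (2 * L * t) \<le> 2 * \<kappa> * T * exp (2 * L * t)" by (intro mult_right_mono) auto
  then show ?thesis using ES'[OF t] by linarith
qed

section \<open>The energy inequality\<close>

lemma frac_bound_mono:
  assumes "frac_bound s M f" "M \<le> M'"
  shows "frac_bound s M' f"
proof -
  have "l2sq (\<lambda>x. f (x + h) - f x) \<le> ennreal (M' * norm h powr (2 * s))" for h
  proof -
    have "M * norm h powr (2 * s) \<le> M' * norm h powr (2 * s)" using assms(2) by (intro mult_right_mono) auto
    then show ?thesis using assms(1) unfolding frac_bound_def by (meson ennreal_leI order_trans)
  qed
  moreover have "l2sq f \<le> ennreal M'"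
    using assms unfolding frac_bound_def by (meson ennreal_leI order_trans)
  ultimately show ?thesis using assms(1) by (simp add: frac_bound_def)
qed

lemma tested_solution_mono:
  assumes "tested_solution lam T s M u" "M \<le> M'"
  shows "tested_solution lam T s M' u"
proof -
  have "AE t in lebesgue. t \<in> {0..T} \<longrightarrow> frac_bound s M (u t)" using assms(1) by (simp add: tested_solution_def)
  then have "AE t in lebesgue. t \<in> {0..T} \<longrightarrow> frac_bound s M' (u t)"
    by eventually_elim (use frac_bound_mono[OF _ assms(2)] in blast)
  then show ?thesis using assms(1) unfolding tested_solution_def by blast
qed

lemma loc_integrable_log_nonlinearity:
  fixes f :: "'a::euclidean_space \<Rightarrow> complex"
  assumes f: "square_integrable f"
  shows "loc_integrable (\<lambda>x. log_nonlinearity (f x))"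
  unfolding loc_integrable_def
proof (intro conjI allI)
  have [measurable]: "f \<in> borel_measurable borel" using f by (simp add: square_integrable_def)
  show "(\<lambda>x. log_nonlinearity (f x)) \<in> borel_measurable borel" by measurable
  fix R
  have m: "(\<lambda>x::'a. indicator (cball 0 R) x :: complex) \<in> borel_measurable borel"
    by (intro borel_measurable_indicator) simp
  have "integrable lborel (\<lambda>x. log_nonlinearity (f x) * indicator (cball 0 R) x)"
    by (rule moderate_integrable[OF moderate_log_nonlinearity f m, where B=1 and R=R]) (auto simp: indicator_def)
  also have "(\<lambda>x. log_nonlinearity (f x) * indicator (cball 0 R) x) = cutoff R (\<lambda>x. log_nonlinearity (f x))"
    by (intro ext) (simp add: cutoff_def indicator_def)
  finally show "integrable lborel (cutoff R (\<lambda>x. log_nonlinearity (f x)))" .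
qed

lemma loc_integrable_diff:
  assumes "loc_integrable f" "loc_integrable g"
  shows "loc_integrable (\<lambda>x. f x - g x)"
proof -
  have "cutoff R (\<lambda>x. f x - g x) = (\<lambda>x. cutoff R f x - cutoff R g x)" for R
    by (intro ext) (simp add: cutoff_def scaleR_diff_right)
  then show ?thesis using assms by (auto simp: loc_integrable_def)
qed

lemma conv_diff:
  fixes f g :: "'a::euclidean_space \<Rightarrow> complex"
  assumes "loc_integrable f" "loc_integrable g" "kernel K"
  shows "conv K (\<lambda>x. f x - g x) x = conv K f x - conv K g x"
  unfolding conv_def left_diff_distrib
  by (rule Bochner_Integration.integral_diff; intro integrable_conv assms)

lemma l2sq_cutoff_le: "l2sq (cutoff R f) \<le> l2sq f"
  by (rule l2sq_mono) (auto simp: cutoff_def indicator_def)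

text \<open>The integrated equation tested with the reflected kernel at x, that is, the equation
  satisfied by the mollified solution. Its right-hand side is set to 0 outside the full set of times
  \<open>good\<close>, so that continuity in x and the bounds hold at every t. Leaving
  \<open>good\<close> as a parameter lets two solutions share one set of times.\<close>

lemma tested_conv:
  fixes u :: "real \<Rightarrow> 'a::euclidean_space \<Rightarrow> complex" and T s M lam R0 :: real
  assumes ts: "tested_solution lam T s M u" and k: "kernel K" and s: "0 < s" and M: "0 < M"
    and good: "AE t in lebesgue. t \<in> {0..T} \<longrightarrow> good t" "\<And>t. good t \<Longrightarrow> t \<in> {0..T} \<and> frac_bound s M (u t)"
  defines "P \<equiv> \<lambda>t x. if good t then \<i> * (conv (lapR K) (u t) x + of_real lam * conv K (\<lambda>x. log_nonlinearity (u t x)) x) else 0"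
  shows tested_conv_measurable: "(\<lambda>t. P t x) \<in> borel_measurable lebesgue"
    and tested_conv_continuous: "continuous_on UNIV (P t)"
    and tested_conv_bounded: "\<exists>C\<ge>0. \<forall>t x. norm x \<le> R0 \<longrightarrow> cmod (P t x) \<le> C"
    and tested_conv_duhamel: "t \<in> {0..T} \<Longrightarrow> conv K (u t) x - conv K (u 0) x = (LINT \<tau>:{0..t}|lebesgue. P \<tau> x)"
    and tested_conv_time_measurable: "(\<lambda>t. if t \<in> {0..T} then conv K (u t) x else 0) \<in> borel_measurable lebesgue"
proof -
  note k2 = kernel_lapR[OF k]
  have meas_id: "(\<lambda>t. if t \<in> {0..T} then conv K' (u t) x else 0) \<in> borel_measurable lebesgue" if "kernel K'" for K' x
  proof -
    have "continuous_on {0..T} (\<lambda>t. pair_with (u t) (\<lambda>y. of_real (K' (x - y))))"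
      using ts test_reflect(1)[OF that, of x] by (auto simp: tested_solution_def)
    then have c: "continuous_on {0..T} (\<lambda>t. conv K' (u t) x)" by (simp add: pair_with_reflect)
    have "(\<lambda>t. indicator {0..T} t *\<^sub>R conv K' (u t) x) \<in> borel_measurable borel"
      by (rule borel_measurable_continuous_on_indicator[OF _ c]) simp
    then have "(\<lambda>t. indicator {0..T} t *\<^sub>R conv K' (u t) x) \<in> borel_measurable lebesgue"
      by (intro measurable_completion) simp
    also have "(\<lambda>t. indicator {0..T} t *\<^sub>R conv K' (u t) x) = (\<lambda>t. if t \<in> {0..T} then conv K' (u t) x else 0)"
      by (auto simp: indicator_def)
    finally show ?thesis .
  qed
  show "(\<lambda>t. if t \<in> {0..T} then conv K (u t) x else 0) \<in> borel_measurable lebesgue" by (rule meas_id[OF k])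
  define Q where "Q = (\<lambda>t x. \<i> * (conv (lapR K) (u t) x + of_real lam * conv K (\<lambda>x. log_nonlinearity (u t x)) x))"
  have mQ: "(\<lambda>t. if t \<in> {0..T} then Q t x else 0) \<in> borel_measurable lebesgue" for x
  proof -
    have "(\<lambda>t. if t \<in> {0..T} then pair_with (\<lambda>x. log_nonlinearity (u t x)) (\<lambda>y. of_real (K (x - y))) else 0) \<in> borel_measurable lebesgue"
      using ts test_reflect(1)[OF k, of x] by (auto simp: tested_solution_def)
    then have mg: "(\<lambda>t. if t \<in> {0..T} then conv K (\<lambda>x. log_nonlinearity (u t x)) x else 0) \<in> borel_measurable lebesgue"
      by (simp only: pair_with_reflect)
    have "(\<lambda>t. \<i> * ((if t \<in> {0..T} then conv (lapR K) (u t) x else 0)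
        + of_real lam * (if t \<in> {0..T} then conv K (\<lambda>x. log_nonlinearity (u t x)) x else 0))) \<in> borel_measurable lebesgue"
      using meas_id[OF k2, of x] mg by (intro borel_measurable_times borel_measurable_add borel_measurable_const)
    also have "(\<lambda>t. \<i> * ((if t \<in> {0..T} then conv (lapR K) (u t) x else 0)
        + of_real lam * (if t \<in> {0..T} then conv K (\<lambda>x. log_nonlinearity (u t x)) x else 0))) =
      (\<lambda>t. if t \<in> {0..T} then Q t x else 0)" by (auto simp: Q_def)
    finally show ?thesis .
  qed
  have ae: "AE t in lebesgue. (if t \<in> {0..T} then Q t x else 0) = P t x" for x
    using good(1)
  proof eventually_elim
    fix t assume "t \<in> {0..T} \<longrightarrow> good t"
    then show "(if t \<in> {0..T} then Q t x else 0) = P t x"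
      using good(2)[of t] unfolding P_def Q_def by metis
  qed
  have mP: "(\<lambda>t. P t x) \<in> borel_measurable lebesgue" for x

  proof (rule lebesgue_measurable_AE_limit[OF mQ])
    show "AE t in lebesgue. (\<lambda>n::nat. if t \<in> {0..T} then Q t x else 0) \<longlonglongrightarrow> P t x"
      using ae[of x] by eventually_elim simp
  qed
  then show "(\<lambda>t. P t x) \<in> borel_measurable lebesgue" .
  have sq: "square_integrable (u t)" if "good t" for t using good(2)[OF that] frac_boundD by blast
  show "continuous_on UNIV (P t)"
  proof (cases "good t")
    case True
    then show ?thesis
      unfolding P_def using sq[OF True]
      by (auto intro!: continuous_intros continuous_conv square_integrable_imp_loc loc_integrable_log_nonlinearity k k2)
  qed (simp add: P_def)
  have bound: "\<exists>C\<ge>0. \<forall>t x. norm x \<le> R0 \<longrightarrow> cmod (P t x) \<le> C" for R0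
  proof -
    obtain C1 r1 where C1: "C1 \<ge> 0" "\<And>(f :: 'a \<Rightarrow> complex) m x. f \<in> borel_measurable borel \<Longrightarrow> 0 \<le> m \<Longrightarrow>
        l2sq (cutoff r1 f) \<le> ennreal m \<Longrightarrow> norm x \<le> R0 \<Longrightarrow> cmod (conv (lapR K) f x) \<le> C1 * (m + 1)"
      using conv_bound_cball[OF k2, of R0] by metis
    obtain C2 r2 where C2: "C2 \<ge> 0" "r2 \<ge> 1" "\<And>(f :: 'a \<Rightarrow> complex) m x. f \<in> borel_measurable borel \<Longrightarrow> 0 \<le> m \<Longrightarrow>
        l2sq (cutoff r2 f) \<le> ennreal m \<Longrightarrow> norm x \<le> R0 \<Longrightarrow> cmod (conv K f x) \<le> C2 * (m + 1)"
      using conv_bound_cball[OF k, of R0] by metis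
    obtain C3 where C3: "C3 \<ge> 0" "\<And>(f :: 'a \<Rightarrow> complex) R. frac_bound s M f \<Longrightarrow> R \<ge> 1 \<Longrightarrow>
        l2sq (cutoff R (\<lambda>x. log_nonlinearity (f x))) \<le> ennreal (C3 * (1 + (ln R)\<^sup>2))"
      using l2_ball_log_nonlinearity[OF s M, where 'a='a] by metis
    define c where "c = C3 * (1 + (ln r2)\<^sup>2)"
    have c: "c \<ge> 0" using C3 by (simp add: c_def)
    define C where "C = C1 * (M + 1) + \<bar>lam\<bar> * (C2 * (c + 1))"
    have C: "C \<ge> 0" using C1 C2 c M by (simp add: C_def)
    show ?thesis
    proof (intro exI[of _ C] conjI C allI impI)
      fix t and x :: 'a assume x: "norm x \<le> R0"
      show "cmod (P t x) \<le> C"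
      proof (cases "good t")
        case True
        note fb = conjunct2[OF good(2)[OF True]]
        have um[measurable]: "u t \<in> borel_measurable borel" by (rule frac_boundD[OF fb])
        have "l2sq (cutoff r1 (u t)) \<le> ennreal M"
          using l2sq_cutoff_le frac_boundD(4)[OF fb] by (rule order_trans)
        then have 1: "cmod (conv (lapR K) (u t) x) \<le> C1 * (M + 1)" using M x by (intro C1 um) auto
        have 2: "cmod (conv K (\<lambda>x. log_nonlinearity (u t x)) x) \<le> C2 * (c + 1)"
          unfolding c_def using C3 C2(2) fb x c by (intro C2) (auto simp: c_def)
        have "cmod (P t x) \<le> cmod (conv (lapR K) (u t) x) + cmod (of_real lam * conv K (\<lambda>x. log_nonlinearity (u t x)) x)"
          using True norm_triangle_ineq unfolding P_def if_P[OF True] norm_mult[of \<i>] norm_ii mult_1_left by blast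
        also have "\<dots> \<le> C"
          unfolding C_def norm_mult norm_of_real by (intro add_mono 1 mult_left_mono 2) simp
        finally show ?thesis .
      qed (use C in \<open>simp add: P_def\<close>)
    qed
  qed
  then show "\<exists>C\<ge>0. \<forall>t x. norm x \<le> R0 \<longrightarrow> cmod (P t x) \<le> C" .
  assume t: "t \<in> {0..T}"
  have "conv K (u t) x - conv K (u 0) x = (LINT \<tau>:{0..t}|lebesgue. Q \<tau> x)"
  proof -
    let ?\<psi> = "\<lambda>y. complex_of_real (K (x - y))"
    have "pair_with (u t) ?\<psi> - pair_with (u 0) ?\<psi> =
        (LINT \<tau>:{0..t}|lebesgue. \<i> * (pair_with (u \<tau>) (lap ?\<psi>)
           + of_real lam * pair_with (\<lambda>x. log_nonlinearity (u \<tau> x)) ?\<psi>))"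
      using ts t test_reflect(1)[OF k, of x] unfolding tested_solution_def by blast
    then show ?thesis unfolding test_reflect(2)[OF k] pair_with_reflect Q_def .
  qed
  also have "\<dots> = (LINT \<tau>:{0..t}|lebesgue. P \<tau> x)"
    unfolding set_lebesgue_integral_def
  proof (rule Bochner_Integration.integral_cong_AE)
    have "(\<lambda>\<tau>. indicator {0..t} \<tau> *\<^sub>R (if \<tau> \<in> {0..T} then Q \<tau> x else 0)) \<in> borel_measurable lebesgue"
      by (intro borel_measurable_scaleR borel_measurable_indicator mQ) simp
    also have "(\<lambda>\<tau>. indicator {0..t} \<tau> *\<^sub>R (if \<tau> \<in> {0..T} then Q \<tau> x else 0)) = (\<lambda>\<tau>. indicator {0..t} \<tau> *\<^sub>R Q \<tau> x)"
      using t by (auto simp: indicator_def)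
    finally show "(\<lambda>\<tau>. indicator {0..t} \<tau> *\<^sub>R Q \<tau> x) \<in> borel_measurable lebesgue" .
    show "(\<lambda>\<tau>. indicator {0..t} \<tau> *\<^sub>R P \<tau> x) \<in> borel_measurable lebesgue"
      by (intro borel_measurable_scaleR borel_measurable_indicator mP) simp
    show "AE \<tau> in lebesgue. indicator {0..t} \<tau> *\<^sub>R Q \<tau> x = indicator {0..t} \<tau> *\<^sub>R P \<tau> x"
      using ae[of x] by eventually_elim (use t in \<open>auto simp: indicator_def\<close>)
  qed
  finally show "conv K (u t) x - conv K (u 0) x = (LINT \<tau>:{0..t}|lebesgue. P \<tau> x)" .
qed

text \<open>For each x the mollified difference is a primitive in time that vanishes initially, so
  its squared modulus is the integral of a product; multiplying by the cutoff, integrating in x and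
  exchanging the integrals gives the energy identity. The estimates in space enter as the
  assumptions with \<kappa>1 and \<kappa>2, which keeps the argument in time free of the choice of
  \<epsilon> and R. The 4 M is the bound for a difference of two functions bounded by M.\<close>

lemma energy_inequality:
  fixes u v :: "real \<Rightarrow> 'a::euclidean_space \<Rightarrow> complex" and T s M lam \<epsilon> R \<kappa>1 \<kappa>2 :: real
  assumes T: "T > 0" and s: "0 < s" and M: "0 < M" and \<epsilon>: "\<epsilon> > 0" and R: "R > 0"
    and u: "tested_solution lam T s M u" and v: "tested_solution lam T s M v"
    and init: "\<And>\<psi>. test \<psi> \<Longrightarrow> pair_with (u 0) \<psi> = pair_with (v 0) \<psi>"
    and flux: "\<And>f :: 'a \<Rightarrow> complex. f \<in> borel_measurable borel \<Longrightarrow> l2sq f \<le> ennreal (4 * M) \<Longrightarrow>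
      \<bar>LINT x|lborel. plateau R x * Im (cnj (conv (mollifier \<epsilon>) f x) * conv (lapR (mollifier \<epsilon>)) f x)\<bar> \<le> \<kappa>1"
    and nonlin: "\<And>a b :: 'a \<Rightarrow> complex. frac_bound s M a \<Longrightarrow> frac_bound s M b \<Longrightarrow>
      \<bar>LINT x|lborel. plateau R x * Im (cnj (conv (mollifier \<epsilon>) (\<lambda>x. a x - b x) x) *
         conv (mollifier \<epsilon>) (\<lambda>x. log_nonlinearity (a x) - log_nonlinearity (b x)) x)\<bar> \<le>
      4 * (LINT x|lborel. plateau R x * (cmod (conv (mollifier \<epsilon>) (\<lambda>x. a x - b x) x))\<^sup>2) + \<kappa>2"
  defines "E \<equiv> \<lambda>t. LINT x|lborel. plateau R x * (cmod (conv (mollifier \<epsilon>) (\<lambda>x. u t x - v t x) x))\<^sup>2"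
  shows energy_measurable: "(\<lambda>t. if t \<in> {0..T} then E t else 0) \<in> borel_measurable lebesgue"
    and energy_bounded: "\<exists>B. \<forall>t\<in>{0..T}. E t \<le> B"
    and energy_le_integral: "t \<in> {0..T} \<Longrightarrow>
      E t \<le> (LINT \<tau>:{0..t}|lebesgue. (2 * \<kappa>1 + 2 * \<bar>lam\<bar> * \<kappa>2) + 8 * \<bar>lam\<bar> * E \<tau>)"
proof -
  interpret L: sigma_finite_measure "lebesgue :: real measure" by (rule sigma_finite_lebesgue)
  interpret LL: pair_sigma_finite "lebesgue :: real measure" "lborel :: 'a measure" ..
  define \<rho> where "\<rho> = (mollifier \<epsilon> :: 'a \<Rightarrow> real)"
  have k: "kernel \<rho>" unfolding \<rho>_def by (rule kernel_mollifier[OF \<epsilon>])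
  note k2 = kernel_lapR[OF k]
  define p where "p = (plateau R :: 'a \<Rightarrow> real)"
  have p01: "0 \<le> p x" "p x \<le> 1" for x by (auto simp: p_def plateau_nonneg plateau_le_1)
  have cp: "continuous_on UNIV p" unfolding p_def by (rule kernel_imp_continuous[OF kernel_plateau[OF R]])
  have [measurable]: "p \<in> borel_measurable borel" unfolding p_def by measurable
  define R0 where "R0 = DIM('a) * R"
  have p0: "p x = 0" if "norm x > R0" for x
    unfolding p_def using R less_imp_le[OF that[unfolded R0_def]] by (rule plateau_eq_0)
  \<comment> \<open>Common to u and v, so that the difference of the two right-hand sides has a
    single formula on it and is 0 elsewhere.\<close>
  define good where "good t \<longleftrightarrow> t \<in> {0..T} \<and> frac_bound s M (u t) \<and> frac_bound s M (v t)" for t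
  have gT: "good t \<Longrightarrow> t \<in> {0..T}" for t by (simp add: good_def)
  have aeg: "AE t in lebesgue. t \<in> {0..T} \<longrightarrow> good t"
  proof -
    have "AE t in lebesgue. t \<in> {0..T} \<longrightarrow> frac_bound s M (u t)" "AE t in lebesgue. t \<in> {0..T} \<longrightarrow> frac_bound s M (v t)"
      using u v by (auto simp: tested_solution_def)
    then show ?thesis by eventually_elim (simp add: good_def)
  qed
  have good_u: "good t \<Longrightarrow> t \<in> {0..T} \<and> frac_bound s M (u t)"
    and good_v: "good t \<Longrightarrow> t \<in> {0..T} \<and> frac_bound s M (v t)" for t by (auto simp: good_def)
  define Pu where "Pu = (\<lambda>t x. if good t then \<i> * (conv (lapR \<rho>) (u t) x + of_real lam * conv \<rho> (\<lambda>x. log_nonlinearity (u t x)) x) else 0)"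
  define Pv where "Pv = (\<lambda>t x. if good t then \<i> * (conv (lapR \<rho>) (v t) x + of_real lam * conv \<rho> (\<lambda>x. log_nonlinearity (v t x)) x) else 0)"
  have cu: "(\<lambda>t. Pu t x) \<in> borel_measurable lebesgue" "continuous_on UNIV (Pu t)"
    "\<exists>C\<ge>0. \<forall>t x. norm x \<le> R0 \<longrightarrow> cmod (Pu t x) \<le> C"
    "t \<in> {0..T} \<Longrightarrow> conv \<rho> (u t) x - conv \<rho> (u 0) x = (LINT \<tau>:{0..t}|lebesgue. Pu \<tau> x)"
    "(\<lambda>t. if t \<in> {0..T} then conv \<rho> (u t) x else 0) \<in> borel_measurable lebesgue" for t x
    unfolding Pu_def
    by (rule tested_conv_measurable[OF u k s M aeg good_u], assumption)
       (rule tested_conv_continuous[OF u k s M aeg good_u], assumption,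
        rule tested_conv_bounded[OF u k s M aeg good_u], assumption,
        rule tested_conv_duhamel[OF u k s M aeg good_u], assumption, assumption,
        rule tested_conv_time_measurable[OF u k s M aeg good_u], assumption)
  have cv: "(\<lambda>t. Pv t x) \<in> borel_measurable lebesgue" "continuous_on UNIV (Pv t)"
    "\<exists>C\<ge>0. \<forall>t x. norm x \<le> R0 \<longrightarrow> cmod (Pv t x) \<le> C"
    "t \<in> {0..T} \<Longrightarrow> conv \<rho> (v t) x - conv \<rho> (v 0) x = (LINT \<tau>:{0..t}|lebesgue. Pv \<tau> x)"
    "(\<lambda>t. if t \<in> {0..T} then conv \<rho> (v t) x else 0) \<in> borel_measurable lebesgue" for t x
    unfolding Pv_def
    by (rule tested_conv_measurable[OF v k s M aeg good_v], assumption)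
       (rule tested_conv_continuous[OF v k s M aeg good_v], assumption,
        rule tested_conv_bounded[OF v k s M aeg good_v], assumption,
        rule tested_conv_duhamel[OF v k s M aeg good_v], assumption, assumption,
        rule tested_conv_time_measurable[OF v k s M aeg good_v], assumption)
  define P where "P = (\<lambda>t x. Pu t x - Pv t x)"
  define w where "w = (\<lambda>t x. u t x - v t x)"
  define F where "F = (\<lambda>t x. log_nonlinearity (u t x) - log_nonlinearity (v t x))"
  have sq: "square_integrable (u t)" "square_integrable (v t)" if "t \<in> {0..T}" for t
    using u v that frac_boundD(2) unfolding tested_solution_def by blast+
  have li: "loc_integrable (u t)" "loc_integrable (v t)"
    "loc_integrable (\<lambda>x. log_nonlinearity (u t x))" "loc_integrable (\<lambda>x. log_nonlinearity (v t x))" if "t \<in> {0..T}" for t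
    using sq[OF that] by (auto intro: square_integrable_imp_loc loc_integrable_log_nonlinearity)
  have lw: "loc_integrable (w t)" "loc_integrable (F t)" if "t \<in> {0..T}" for t
    unfolding w_def F_def using li[OF that] by (auto intro: loc_integrable_diff)
  \<comment> \<open>Set to 0 outside [0, T] to be measurable and bounded for all times.\<close>
  define W where "W = (\<lambda>t x. if t \<in> {0..T} then conv \<rho> (w t) x else 0)"
  have Wuv: "conv \<rho> (w t) x = conv \<rho> (u t) x - conv \<rho> (v t) x" if "t \<in> {0..T}" for t x
    unfolding w_def using li[OF that] by (intro conv_diff k)
  have Pgood: "P t x = \<i> * (conv (lapR \<rho>) (w t) x + of_real lam * conv \<rho> (F t) x)" if "good t" for t x
    unfolding P_def Pu_def Pv_def w_def F_def using that li[OF gT[OF that]]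
    by (simp add: conv_diff k k2 algebra_simps)
  obtain Cu where Cu: "Cu \<ge> 0" "\<And>t x. norm x \<le> R0 \<Longrightarrow> cmod (Pu t x) \<le> Cu" using cu(3) by metis
  obtain Cv where Cv: "Cv \<ge> 0" "\<And>t x. norm x \<le> R0 \<Longrightarrow> cmod (Pv t x) \<le> Cv" using cv(3) by metis
  define C where "C = Cu + Cv"
  have C0: "C \<ge> 0" using Cu Cv by (simp add: C_def)
  have PC: "cmod (P t x) \<le> C" if "norm x \<le> R0" for t x
    unfolding P_def C_def using Cu(2)[OF that, of t] Cv(2)[OF that, of t] norm_triangle_ineq4[of "Pu t x" "Pv t x"] by linarith
  have mP: "(\<lambda>t. P t x) \<in> borel_measurable lebesgue" for x
    unfolding P_def by (intro borel_measurable_diff cu cv)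
  have cP: "continuous_on UNIV (P t)" for t
    unfolding P_def by (intro continuous_on_diff cu cv)
  have P0: "P t x = 0" if "t > T" for t x
  proof -
    have "\<not> good t" using gT[of t] that by auto
    then show ?thesis by (simp add: P_def Pu_def Pv_def)
  qed
  have mW: "(\<lambda>t. W t x) \<in> borel_measurable lebesgue" for x
  proof -
    have "(\<lambda>t. (if t \<in> {0..T} then conv \<rho> (u t) x else 0) - (if t \<in> {0..T} then conv \<rho> (v t) x else 0)) \<in> borel_measurable lebesgue"
      by (intro borel_measurable_diff cu cv)
    also have "(\<lambda>t. (if t \<in> {0..T} then conv \<rho> (u t) x else 0) - (if t \<in> {0..T} then conv \<rho> (v t) x else 0)) = (\<lambda>t. W t x)"
      using Wuv by (auto simp: W_def)
    finally show ?thesis .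
  qed
  have cW: "continuous_on UNIV (W t)" for t
  proof (cases "t \<in> {0..T}")
    case True
    have "continuous_on UNIV (conv \<rho> (w t))" by (intro continuous_conv lw True k)
    then show ?thesis using True by (simp add: W_def[abs_def] continuous_on_eq)
  next
    case False
    then show ?thesis unfolding W_def by (simp only: if_False continuous_on_const)
  qed
  have WP: "W t x = (LINT \<tau>:{0..t}|lebesgue. P \<tau> x)" if t: "t \<in> {0..T}" and x: "norm x \<le> R0" for t x
  proof -
    have z: "conv \<rho> (u 0) x = conv \<rho> (v 0) x"
      using init[OF test_reflect(1)[OF k, of x]] by (simp add: pair_with_reflect)
    have "W t x = (conv \<rho> (u t) x - conv \<rho> (u 0) x) - (conv \<rho> (v t) x - conv \<rho> (v 0) x)"
      using t Wuv[OF t] z by (simp add: W_def)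
    also have "\<dots> = (LINT \<tau>:{0..t}|lebesgue. Pu \<tau> x) - (LINT \<tau>:{0..t}|lebesgue. Pv \<tau> x)"
      using cu(4)[OF t] cv(4)[OF t] by simp
    also have "\<dots> = (LINT \<tau>:{0..t}|lebesgue. P \<tau> x)"
      unfolding P_def
      by (rule set_integral_diff(2)[symmetric, OF set_integrable_bounded[OF cu(1) Cu(2)[OF x]] set_integrable_bounded[OF cv(1) Cv(2)[OF x]]])
    finally show ?thesis .
  qed
  have WC: "cmod (W t x) \<le> C * T" if x: "norm x \<le> R0" for t x
  proof (cases "t \<in> {0..T}")
    case True
    have "cmod (LINT \<tau>:{0..t}|lebesgue. P \<tau> x) \<le> C * (t - 0)"
      using True by (intro set_integral_increment(2)[OF mP PC[OF x]]) auto
    also have "\<dots> \<le> C * T" using True C0 by (intro mult_left_mono) auto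
    finally show ?thesis using WP[OF True x] by simp
  next
    case False
    then show ?thesis using C0 T by (simp add: W_def del: atLeastAtMost_iff)
  qed
  have mWW: "(\<lambda>(t, x). W t x) \<in> borel_measurable (lebesgue \<Otimes>\<^sub>M lborel)" by (rule caratheodory_measurable[OF mW cW])
  have mPP: "(\<lambda>(t, x). P t x) \<in> borel_measurable (lebesgue \<Otimes>\<^sub>M lborel)" by (rule caratheodory_measurable[OF mP cP])
  have mpp: "(\<lambda>(t, x). p x) \<in> borel_measurable (lebesgue \<Otimes>\<^sub>M lborel)" by measurable
  have EW: "E t = (LINT x|lborel. p x * (cmod (W t x))\<^sup>2)" if "t \<in> {0..T}" for t
    unfolding E_def p_def W_def w_def \<rho>_def using that by simp
  define E' where "E' = (\<lambda>t. LINT x|lborel. p x * (cmod (W t x))\<^sup>2)"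
  have E'_eq: "E' t = (if t \<in> {0..T} then E t else 0)" for t
    unfolding E'_def by (cases "t \<in> {0..T}") (simp_all add: EW W_def del: atLeastAtMost_iff)
  have mE': "E' \<in> borel_measurable lebesgue"
  proof -
    have "(\<lambda>(t, x). p x * (cmod (W t x))\<^sup>2) \<in> borel_measurable (lebesgue \<Otimes>\<^sub>M lborel)"
      using mWW mpp unfolding case_prod_unfold
      by (intro borel_measurable_times borel_measurable_power measurable_compose[OF _ borel_measurable_norm])
    then show ?thesis unfolding E'_def by (rule lborel.borel_measurable_lebesgue_integral)
  qed
  then show "(\<lambda>t. if t \<in> {0..T} then E t else 0) \<in> borel_measurable lebesgue"
    unfolding E'_eq[abs_def] .
  define V where "V = (LINT x|lborel. (C * T)\<^sup>2 * indicator (cball (0::'a) R0) x)"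
  have iV: "integrable lborel (\<lambda>x. (C * T)\<^sup>2 * indicator (cball (0::'a) R0) x)"
    by (intro integrable_mult_right integrable_indicator_cball)
  have pW_int: "integrable lborel (\<lambda>x. p x * (cmod (W t x))\<^sup>2)" for t
    by (rule integrable_continuous_compact_support[where R=R0])
       (auto intro!: continuous_intros cp cW simp: p0)
  have E'0: "E' t \<ge> 0" for t
    unfolding E'_def using p01 by (intro Bochner_Integration.integral_nonneg) simp
  have E'V: "E' t \<le> V" for t
    unfolding E'_def V_def
  proof (rule integral_mono[OF pW_int iV])
    fix x :: 'a
    show "p x * (cmod (W t x))\<^sup>2 \<le> (C * T)\<^sup>2 * indicator (cball 0 R0) x"
    proof (cases "norm x \<le> R0")
      case True
      have "p x * (cmod (W t x))\<^sup>2 \<le> 1 * (C * T)\<^sup>2"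
        using p01[of x] WC[OF True, of t] by (intro mult_mono power_mono) auto
      then show ?thesis using True by simp
    qed (simp add: p0)
  qed
  have "E t \<le> V" if "t \<in> {0..T}" for t using E'V[of t] that unfolding E'_eq by simp
  then show "\<exists>B. \<forall>t\<in>{0..T}. E t \<le> B" by blast
  assume t: "t \<in> {0..T}"
  then have t0: "0 \<le> t" "t \<le> T" by auto
  \<comment> \<open>The time derivative of the localised density p |W|^2, restricted to [0, t];
    boundedness and compact support make it integrable on the product space.\<close>
  define H where "H = (\<lambda>\<tau> x. indicator {0..t} \<tau> * (p x * (2 * Re (cnj (W \<tau> x) * P \<tau> x))))"
  define c where "c = 2 * (C * T * C)"
  have c0: "c \<ge> 0" using C0 T by (simp add: c_def)
  have Hint: "integrable (lebesgue \<Otimes>\<^sub>M lborel) (case_prod H)"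
  proof (rule Bochner_Integration.integrable_bound)
    have "emeasure (lebesgue \<Otimes>\<^sub>M lborel) ({0..t} \<times> cball (0::'a) R0) = emeasure lebesgue {0..t} * emeasure lborel (cball (0::'a) R0)"
      by (rule lborel.emeasure_pair_measure_Times) auto
    also have "\<dots> < \<infinity>"
      using emeasure_lborel_cball_finite[of "0::'a" R0] by (simp add: ennreal_mult_less_top emeasure_lborel_Icc_eq)
    finally show "integrable (lebesgue \<Otimes>\<^sub>M lborel) (\<lambda>z. c * indicator ({0..t} \<times> cball (0::'a) R0) z)"
      by (intro integrable_mult_right) (auto simp: integrable_indicator_iff)
    have "(\<lambda>z. indicator {0..t} (fst z) * (p (snd z) * (2 * Re (cnj (W (fst z) (snd z)) * P (fst z) (snd z))))) \<in> borel_measurable (lebesgue \<Otimes>\<^sub>M lborel)"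
      using mWW mPP mpp unfolding case_prod_unfold
      by (intro borel_measurable_times borel_measurable_const borel_measurable_Re borel_measurable_cnj
          measurable_compose[OF measurable_fst borel_measurable_indicator]) auto
    then show "case_prod H \<in> borel_measurable (lebesgue \<Otimes>\<^sub>M lborel)"
      by (simp add: H_def[abs_def] case_prod_unfold del: times_complex.sel)
    show "AE z in lebesgue \<Otimes>\<^sub>M lborel. norm (case_prod H z) \<le> norm (c * indicator ({0..t} \<times> cball (0::'a) R0) z)"
    proof (intro AE_I2)
      fix z :: "real \<times> 'a"
      obtain \<tau> x where z: "z = (\<tau>, x)" by force
      show "norm (case_prod H z) \<le> norm (c * indicator ({0..t} \<times> cball (0::'a) R0) z)"
      proof (cases "\<tau> \<in> {0..t} \<and> norm x \<le> R0")
        case True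
        have "\<bar>Re (cnj (W \<tau> x) * P \<tau> x)\<bar> \<le> cmod (W \<tau> x) * cmod (P \<tau> x)"
          using abs_Re_le_cmod[of "cnj (W \<tau> x) * P \<tau> x"] unfolding norm_mult complex_mod_cnj .
        also have "\<dots> \<le> (C * T) * C" using True C0 T by (intro mult_mono WC PC) auto
        finally have "p x * \<bar>2 * Re (cnj (W \<tau> x) * P \<tau> x)\<bar> \<le> 1 * c"
          unfolding c_def using p01[of x] by (intro mult_mono) (auto simp: abs_mult simp del: times_complex.sel)
        then show ?thesis
          using True p01[of x] c0 unfolding z H_def
          by (simp add: abs_mult del: times_complex.sel)
      next
        case False
        then show ?thesis using p0[of x] unfolding z H_def by (auto simp: indicator_def simp del: times_complex.sel)
      qed
    qed
  qed
  have "E t = (LINT x|lborel. p x * (cmod (W t x))\<^sup>2)" by (rule EW[OF t])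
  also have "\<dots> = (LINT x|lborel. (LINT \<tau>|lebesgue. H \<tau> x))"
  proof (rule Bochner_Integration.integral_cong[OF refl])
    fix x :: 'a
    show "p x * (cmod (W t x))\<^sup>2 = (LINT \<tau>|lebesgue. H \<tau> x)"
    proof (cases "norm x \<le> R0")
      case True
      have "(cmod (W t x))\<^sup>2 = (LINT \<tau>:{0..t}|lebesgue. 2 * Re (cnj (LINT \<sigma>:{0..\<tau>}|lebesgue. P \<sigma> x) * P \<tau> x))"
        unfolding WP[OF t True] by (rule cmod_sq_primitive[OF mP PC[OF True] _ P0 t0(1)]) (use T in auto)
      also have "\<dots> = (LINT \<tau>|lebesgue. indicator {0..t} \<tau> * (2 * Re (cnj (W \<tau> x) * P \<tau> x)))"
        unfolding set_lebesgue_integral_def[of _ "{0..t}"]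
      proof (rule Bochner_Integration.integral_cong[OF refl])
        fix \<tau>
        show "indicator {0..t} \<tau> *\<^sub>R (2 * Re (cnj (LINT \<sigma>:{0..\<tau>}|lebesgue. P \<sigma> x) * P \<tau> x)) =
            indicator {0..t} \<tau> * (2 * Re (cnj (W \<tau> x) * P \<tau> x))"
        proof (cases "\<tau> \<in> {0..t}")
          case \<tau>: True
          then have "\<tau> \<in> {0..T}" using t0 by auto
          then show ?thesis using WP[OF _ True] by simp
        next
          case False
          then show ?thesis by (simp del: atLeastAtMost_iff)
        qed
      qed
      finally have "p x * (cmod (W t x))\<^sup>2 = (LINT \<tau>|lebesgue. p x * (indicator {0..t} \<tau> * (2 * Re (cnj (W \<tau> x) * P \<tau> x))))"
        by (simp del: times_complex.sel)
      also have "\<dots> = (LINT \<tau>|lebesgue. H \<tau> x)" unfolding H_def by (simp add: mult_ac del: times_complex.sel)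
      finally show ?thesis .
    qed (simp add: p0 H_def)
  qed
  also have "\<dots> = (LINT \<tau>|lebesgue. (LINT x|lborel. H \<tau> x))"
    by (rule LL.Fubini_integral[OF Hint])
  also have "\<dots> \<le> (LINT \<tau>:{0..t}|lebesgue. (2 * \<kappa>1 + 2 * \<bar>lam\<bar> * \<kappa>2) + 8 * \<bar>lam\<bar> * E \<tau>)"
    unfolding set_lebesgue_integral_def
  proof (rule integral_mono_AE)
    show "integrable lebesgue (\<lambda>\<tau>. LINT x|lborel. H \<tau> x)" by (rule LL.integrable_fst[OF Hint])
    have "set_integrable lebesgue {0..t} (\<lambda>\<tau>. (2 * \<kappa>1 + 2 * \<bar>lam\<bar> * \<kappa>2) + 8 * \<bar>lam\<bar> * E' \<tau>)"
    proof (rule set_integrable_bounded)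
      show "(\<lambda>\<tau>. (2 * \<kappa>1 + 2 * \<bar>lam\<bar> * \<kappa>2) + 8 * \<bar>lam\<bar> * E' \<tau>) \<in> borel_measurable lebesgue"
        by (intro borel_measurable_add borel_measurable_times borel_measurable_const mE')
      show "norm ((2 * \<kappa>1 + 2 * \<bar>lam\<bar> * \<kappa>2) + 8 * \<bar>lam\<bar> * E' \<tau>) \<le> \<bar>2 * \<kappa>1 + 2 * \<bar>lam\<bar> * \<kappa>2\<bar> + 8 * \<bar>lam\<bar> * V" for \<tau>
      proof -
        have "8 * \<bar>lam\<bar> * E' \<tau> \<le> 8 * \<bar>lam\<bar> * V" "0 \<le> 8 * \<bar>lam\<bar> * E' \<tau>" using E'V[of \<tau>] E'0[of \<tau>] by (auto intro: mult_left_mono)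
        then show ?thesis unfolding real_norm_def by linarith
      qed
    qed
    then show "integrable lebesgue (\<lambda>\<tau>. indicator {0..t} \<tau> *\<^sub>R ((2 * \<kappa>1 + 2 * \<bar>lam\<bar> * \<kappa>2) + 8 * \<bar>lam\<bar> * E \<tau>))"
    proof -
      have "(\<lambda>\<tau>. indicator {0..t} \<tau> *\<^sub>R ((2 * \<kappa>1 + 2 * \<bar>lam\<bar> * \<kappa>2) + 8 * \<bar>lam\<bar> * E' \<tau>)) =
          (\<lambda>\<tau>. indicator {0..t} \<tau> *\<^sub>R ((2 * \<kappa>1 + 2 * \<bar>lam\<bar> * \<kappa>2) + 8 * \<bar>lam\<bar> * E \<tau>))"
        using t0 by (auto simp: indicator_def E'_eq)
      then show ?thesis
        using \<open>set_integrable lebesgue {0..t} (\<lambda>\<tau>. (2 * \<kappa>1 + 2 * \<bar>lam\<bar> * \<kappa>2) + 8 * \<bar>lam\<bar> * E' \<tau>)\<close>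
        unfolding set_integrable_def by simp
    qed
    show "AE \<tau> in lebesgue. (LINT x|lborel. H \<tau> x) \<le> indicator {0..t} \<tau> *\<^sub>R ((2 * \<kappa>1 + 2 * \<bar>lam\<bar> * \<kappa>2) + 8 * \<bar>lam\<bar> * E \<tau>)"
      using aeg
    proof eventually_elim
      fix \<tau> assume g: "\<tau> \<in> {0..T} \<longrightarrow> good \<tau>"
      show "(LINT x|lborel. H \<tau> x) \<le> indicator {0..t} \<tau> *\<^sub>R ((2 * \<kappa>1 + 2 * \<bar>lam\<bar> * \<kappa>2) + 8 * \<bar>lam\<bar> * E \<tau>)"
      proof (cases "\<tau> \<in> {0..t}")
        case False
        then show ?thesis by (simp add: H_def del: atLeastAtMost_iff)
      next
        case True
        then have \<tau>T: "\<tau> \<in> {0..T}" using t0 by auto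
        then have gt: "good \<tau>" using g by simp
        define Z1 where "Z1 = conv (lapR \<rho>) (w \<tau>)"
        define Z2 where "Z2 = conv \<rho> (F \<tau>)"
        have cZ: "continuous_on UNIV Z1" "continuous_on UNIV Z2"
          unfolding Z1_def Z2_def by (intro continuous_conv lw \<tau>T k k2)+
        have i1: "integrable lborel (\<lambda>x. p x * Im (cnj (W \<tau> x) * Z1 x))"
          by (rule integrable_continuous_compact_support[where R=R0])
             (auto intro!: continuous_intros cp cW cZ simp: p0 simp del: times_complex.sel)
        have i2: "integrable lborel (\<lambda>x. p x * Im (cnj (W \<tau> x) * Z2 x))"
          by (rule integrable_continuous_compact_support[where R=R0])
             (auto intro!: continuous_intros cp cW cZ simp: p0 simp del: times_complex.sel)
        \<comment> \<open>The factor \<i> in the equation turns the real part into minus the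
          imaginary part; this produces the two integrals that the assumptions \<open>flux\<close>
          and \<open>nonlin\<close> bound.\<close>
        have H_eq: "H \<tau> x = - 2 * (p x * Im (cnj (W \<tau> x) * Z1 x)) + (- 2 * lam) * (p x * Im (cnj (W \<tau> x) * Z2 x))" for x
        proof -
          have "Re (cnj z * (\<i> * (a + of_real lam * b))) = - Im (cnj z * a) - lam * Im (cnj z * b)" for z a b
            by (simp add: algebra_simps)
          then have "Re (cnj (W \<tau> x) * P \<tau> x) = - Im (cnj (W \<tau> x) * Z1 x) - lam * Im (cnj (W \<tau> x) * Z2 x)"
            unfolding Pgood[OF gt] Z1_def Z2_def .
          then have "H \<tau> x = p x * (2 * (- Im (cnj (W \<tau> x) * Z1 x) - lam * Im (cnj (W \<tau> x) * Z2 x)))"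
            using True unfolding H_def by (simp del: times_complex.sel)
          then show ?thesis by (simp add: right_diff_distrib del: times_complex.sel)
        qed
        have "(LINT x|lborel. H \<tau> x) = - 2 * (LINT x|lborel. p x * Im (cnj (W \<tau> x) * Z1 x))
            + (- 2 * lam) * (LINT x|lborel. p x * Im (cnj (W \<tau> x) * Z2 x))"
          unfolding H_eq using i1 i2
          by (subst Bochner_Integration.integral_add) (auto simp del: times_complex.sel)
        moreover have "\<bar>LINT x|lborel. p x * Im (cnj (W \<tau> x) * Z1 x)\<bar> \<le> \<kappa>1"
        proof -
          have fb: "frac_bound s (2 * M + 2 * M) (w \<tau>)"
            unfolding w_def using gt M by (intro frac_bound_diff) (auto simp: good_def)
          have "\<bar>LINT x|lborel. plateau R x * Im (cnj (conv (mollifier \<epsilon>) (w \<tau>) x) * conv (lapR (mollifier \<epsilon>)) (w \<tau>) x)\<bar> \<le> \<kappa>1"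
            using frac_boundD(1,4)[OF fb] by (intro flux) auto
          then show ?thesis using \<tau>T by (simp add: p_def W_def Z1_def \<rho>_def del: times_complex.sel)
        qed
        moreover have "\<bar>LINT x|lborel. p x * Im (cnj (W \<tau> x) * Z2 x)\<bar> \<le> 4 * E \<tau> + \<kappa>2"
        proof -
          have "\<bar>LINT x|lborel. plateau R x * Im (cnj (conv (mollifier \<epsilon>) (w \<tau>) x) * conv (mollifier \<epsilon>) (F \<tau>) x)\<bar> \<le> 4 * E \<tau> + \<kappa>2"
            unfolding w_def F_def E_def using gt by (intro nonlin) (auto simp: good_def)
          then show ?thesis using \<tau>T by (simp add: p_def W_def Z2_def \<rho>_def del: times_complex.sel)
        qed
        ultimately have "(LINT x|lborel. H \<tau> x) \<le> 2 * \<kappa>1 + 2 * \<bar>lam\<bar> * (4 * E \<tau> + \<kappa>2)"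
        proof -
          define a b where "a = (LINT x|lborel. p x * Im (cnj (W \<tau> x) * Z1 x))" and "b = (LINT x|lborel. p x * Im (cnj (W \<tau> x) * Z2 x))"
          assume eq: "(LINT x|lborel. H \<tau> x) = - 2 * (LINT x|lborel. p x * Im (cnj (W \<tau> x) * Z1 x))
            + (- 2 * lam) * (LINT x|lborel. p x * Im (cnj (W \<tau> x) * Z2 x))"
            and "\<bar>LINT x|lborel. p x * Im (cnj (W \<tau> x) * Z1 x)\<bar> \<le> \<kappa>1"
            and "\<bar>LINT x|lborel. p x * Im (cnj (W \<tau> x) * Z2 x)\<bar> \<le> 4 * E \<tau> + \<kappa>2"
          then have a: "\<bar>a\<bar> \<le> \<kappa>1" and b: "\<bar>b\<bar> \<le> 4 * E \<tau> + \<kappa>2" by (simp_all only: a_def b_def)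
          have "- (lam * b) \<le> \<bar>lam\<bar> * \<bar>b\<bar>" by (metis abs_ge_minus_self abs_mult)
          also have "\<dots> \<le> \<bar>lam\<bar> * (4 * E \<tau> + \<kappa>2)" using b by (intro mult_left_mono) auto
          finally have "- 2 * a + (- 2 * lam) * b \<le> 2 * \<kappa>1 + 2 * (\<bar>lam\<bar> * (4 * E \<tau> + \<kappa>2))"
            using a by (simp add: mult.assoc)
          then show ?thesis unfolding eq a_def[symmetric] b_def[symmetric] by (simp only: mult.assoc)
        qed
        then show ?thesis using True by (simp add: algebra_simps)
      qed
    qed
  qed
  finally show "E t \<le> (LINT \<tau>:{0..t}|lebesgue. (2 * \<kappa>1 + 2 * \<bar>lam\<bar> * \<kappa>2) + 8 * \<bar>lam\<bar> * E \<tau>)" .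
qed

section \<open>Uniqueness\<close>

text \<open>The parameters are \<open>\<epsilon> = 1 / (n + 1)\<close>, \<open>R = (n + 1)\<^sup>2\<close> and \<open>q = \<epsilon>\<^sup>s\<close>.\<close>

lemma error_term_tendsto_0:
  fixes A B C d s :: real
  assumes "s > 0" "d \<ge> 1"
  shows "(\<lambda>n::nat. 2 * (A / ((real n + 1)\<^sup>2 * (1 / (real n + 1)))) + 2 * l * (5 * (B * (2 * d * (1 / (real n + 1))) powr (2 * s)) / (1 / (real n + 1)) powr s
      + (1 / (real n + 1)) powr s * (4 * (C * (1 + (ln (d * ((real n + 1)\<^sup>2 + 1 / (real n + 1))))\<^sup>2))))) \<longlonglongrightarrow> 0"
proof -
  have 1: "(\<lambda>n::nat. A / ((real n + 1)\<^sup>2 * (1 / (real n + 1)))) \<longlonglongrightarrow> 0" by real_asymp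
  have 2: "(\<lambda>n::nat. (2 * d * (1 / (real n + 1))) powr (2 * s) / (1 / (real n + 1)) powr s) \<longlonglongrightarrow> 0" using assms by real_asymp
  have 3: "(\<lambda>n::nat. (1 / (real n + 1)) powr s * (1 + (ln (d * ((real n + 1)\<^sup>2 + 1 / (real n + 1))))\<^sup>2)) \<longlonglongrightarrow> 0" using assms by real_asymp
  have "(\<lambda>n::nat. 2 * (A / ((real n + 1)\<^sup>2 * (1 / (real n + 1)))) + 2 * l * (5 * B * ((2 * d * (1 / (real n + 1))) powr (2 * s) / (1 / (real n + 1)) powr s)
      + 4 * C * ((1 / (real n + 1)) powr s * (1 + (ln (d * ((real n + 1)\<^sup>2 + 1 / (real n + 1))))\<^sup>2)))) \<longlonglongrightarrow> 2 * 0 + 2 * l * (5 * B * 0 + 4 * C * 0)"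
    by (intro tendsto_add tendsto_mult tendsto_const 1 2 3)
  then show ?thesis by (simp add: algebra_simps)
qed

text \<open>The three contributions to the error are of orders \<epsilon> for the flux, \<epsilon>^s
  for the mollification error divided by q, and \<epsilon>^s (log R)^2 for the nonlinearity
  multiplied by q. Gronwall's inequality multiplies them by a factor that does not depend on n,
  since the rate 8 |lam| in the energy inequality is free of \<epsilon> and R.\<close>

lemma energy_estimate:
  fixes u v :: "real \<Rightarrow> 'a::euclidean_space \<Rightarrow> complex" and M T s lam :: real
  assumes T: "T > 0" and s: "0 < s" and M: "0 < M" and lam: "lam \<noteq> 0"
    and u: "tested_solution lam T s M u" and v: "tested_solution lam T s M v"
    and init: "\<And>\<psi>. test \<psi> \<Longrightarrow> pair_with (u 0) \<psi> = pair_with (v 0) \<psi>" and t: "t \<in> {0..T}"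
  obtains e :: "nat \<Rightarrow> real" where "e \<longlonglongrightarrow> 0"
    "\<And>n. (LINT x|lborel. plateau ((real n + 1)\<^sup>2) x * (cmod (conv (mollifier (1 / (real n + 1))) (\<lambda>x. u t x - v t x) x))\<^sup>2) \<le> e n"
proof -
  define d where "d = real DIM('a)"
  have d: "d \<ge> 1" unfolding d_def using DIM_positive[where 'a='a] by linarith
  obtain A where AA: "A \<ge> 0 \<and> (\<forall>\<epsilon> R (f :: 'a \<Rightarrow> complex) m. 0 < \<epsilon> \<longrightarrow> \<epsilon> \<le> 1 \<longrightarrow> 0 < R \<longrightarrow> f \<in> borel_measurable borel \<longrightarrow>
    l2sq f \<le> ennreal m \<longrightarrow> 0 \<le> m \<longrightarrow>
    \<bar>LINT x|lborel. plateau R x * Im (cnj (conv (mollifier \<epsilon>) f x) * conv (lapR (mollifier \<epsilon>)) f x)\<bar> \<le> A * m / (R * \<epsilon>))"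
    using flux_bound[where 'a='a] by (rule exE)
  note A = conjunct1[OF AA] conjunct2[OF AA, rule_format]
  obtain C where C: "C \<ge> 0" "\<And>(f :: 'a \<Rightarrow> complex) R. frac_bound s M f \<Longrightarrow> R \<ge> 1 \<Longrightarrow>
      l2sq (cutoff R (\<lambda>x. log_nonlinearity (f x))) \<le> ennreal (C * (1 + (ln R)\<^sup>2))"
    using l2_ball_log_nonlinearity[OF s M, where 'a='a] by metis
  define B where "B = 2 * M + 2 * M"
  have B: "B \<ge> 0" using M by (simp add: B_def)
  define \<epsilon> R where "\<epsilon> = (\<lambda>n::nat. 1 / (real n + 1))" and "R = (\<lambda>n::nat. (real n + 1)\<^sup>2)"
  have \<epsilon>: "0 < \<epsilon> n" "\<epsilon> n \<le> 1" for n by (auto simp: \<epsilon>_def)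
  have R: "1 \<le> R n" "0 < R n" for n by (auto simp: R_def one_le_power)
  define q where "q = (\<lambda>n. \<epsilon> n powr s)"
  have q: "0 < q n" "q n \<le> 1" for n
    using \<epsilon>[of n] s powr_mono2[of s "\<epsilon> n" 1] by (auto simp: q_def)
  define m where "m = (\<lambda>n. B * (2 * d * \<epsilon> n) powr (2 * s))"
  have m: "m n \<ge> 0" for n using B by (simp add: m_def)
  define c where "c = (\<lambda>n. C * (1 + (ln (d * (R n + \<epsilon> n)))\<^sup>2))"
  have c: "c n \<ge> 0" for n using C by (simp add: c_def)
  \<comment> \<open>In the flux the product R \<epsilon> is n + 1. In the next definition the factor
    4 in front of \<open>c\<close> comes from passing from u and v to the difference of their
    nonlinearities.\<close>
  define \<kappa>1 where "\<kappa>1 = (\<lambda>n. A * B / (R n * \<epsilon> n))"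
  define \<kappa>2 where "\<kappa>2 = (\<lambda>n. 5 * m n / q n + q n * (4 * c n))"
  define \<kappa> where "\<kappa> = (\<lambda>n. 2 * \<kappa>1 n + 2 * \<bar>lam\<bar> * \<kappa>2 n)"
  have \<kappa>0: "\<kappa> n \<ge> 0" for n
    unfolding \<kappa>_def \<kappa>1_def \<kappa>2_def using A B m[of n] c[of n] \<epsilon>[of n] R[of n] q[of n]
    by (intro add_nonneg_nonneg mult_nonneg_nonneg divide_nonneg_nonneg) auto
  have "\<kappa> \<longlonglongrightarrow> 0"
    using error_term_tendsto_0[OF s d, of "A * B" "\<bar>lam\<bar>" B C]
    unfolding \<kappa>_def \<kappa>1_def \<kappa>2_def m_def q_def c_def \<epsilon>_def R_def .
  \<comment> \<open>The Gronwall factor is taken at the final time T, which dominates its value at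
    t.\<close>
  define e where "e = (\<lambda>n. 2 * \<kappa> n * T * exp (2 * (8 * \<bar>lam\<bar>) * T))"
  show ?thesis
  proof (rule that[of e])
    have "e \<longlonglongrightarrow> 2 * 0 * T * exp (2 * (8 * \<bar>lam\<bar>) * T)"
      unfolding e_def by (intro tendsto_mult tendsto_const \<open>\<kappa> \<longlonglongrightarrow> 0\<close>)
    then show "e \<longlonglongrightarrow> 0" by simp
    fix n
    have flux: "\<bar>LINT x|lborel. plateau (R n) x * Im (cnj (conv (mollifier (\<epsilon> n)) f x) * conv (lapR (mollifier (\<epsilon> n))) f x)\<bar> \<le> \<kappa>1 n"
      if "f \<in> borel_measurable borel" "l2sq f \<le> ennreal (4 * M)" for f :: "'a \<Rightarrow> complex"
    proof -
      have "l2sq f \<le> ennreal B" using that(2) by (simp add: B_def)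
      then show ?thesis unfolding \<kappa>1_def by (rule A(2)[OF \<epsilon> R(2) that(1) _ B])
    qed
    have nonlin: "\<bar>LINT x|lborel. plateau (R n) x * Im (cnj (conv (mollifier (\<epsilon> n)) (\<lambda>x. a x - b x) x) *
         conv (mollifier (\<epsilon> n)) (\<lambda>x. log_nonlinearity (a x) - log_nonlinearity (b x)) x)\<bar> \<le>
      4 * (LINT x|lborel. plateau (R n) x * (cmod (conv (mollifier (\<epsilon> n)) (\<lambda>x. a x - b x) x))\<^sup>2) + \<kappa>2 n"
      if a: "frac_bound s M a" and b: "frac_bound s M b" for a b :: "'a \<Rightarrow> complex"
      unfolding \<kappa>2_def
    proof (rule nonlinear_bound[OF frac_boundD(1)[OF a] frac_boundD(1)[OF b] \<epsilon>(1) R(2) q])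
      have M': "0 \<le> M" using M by simp
      have fb: "frac_bound s B (\<lambda>x. a x - b x)" unfolding B_def by (rule frac_bound_diff[OF a b M' M'])
      show "square_integrable (\<lambda>x. a x - b x)" by (rule frac_boundD[OF fb])
      show "l2sq (\<lambda>x. (a (x - y) - b (x - y)) - conv (mollifier (\<epsilon> n)) (\<lambda>x. a x - b x) x) \<le> ennreal (m n)"
        if "norm y \<le> DIM('a) * \<epsilon> n" for y
        using mollify_diff_le[OF fb s B \<epsilon>(1) that] by (simp add: m_def d_def)
      show "m n \<ge> 0" by (rule m)
      have r: "1 \<le> d * (R n + \<epsilon> n)"
        using mult_mono[OF d, of 1 "R n + \<epsilon> n"] d R(1)[of n] \<epsilon>(1)[of n] by simp
      show "l2sq (cutoff (DIM('a) * (R n + \<epsilon> n)) (\<lambda>x. log_nonlinearity (a x) - log_nonlinearity (b x))) \<le> ennreal (4 * c n)"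
        using C(2)[OF a r] C(2)[OF b r] c[of n] unfolding d_def[symmetric] c_def
        by (rule l2sq_cutoff_diff_log_le[OF frac_boundD(1)[OF a] frac_boundD(1)[OF b]])
      show "4 * c n \<ge> 0" using c[of n] by simp
      show "loc_integrable (\<lambda>x. log_nonlinearity (a x) - log_nonlinearity (b x))"
        by (intro loc_integrable_diff loc_integrable_log_nonlinearity frac_boundD(2)[OF a] frac_boundD(2)[OF b])
    qed
    define E where "E = (\<lambda>t. LINT x|lborel. plateau (R n) x * (cmod (conv (mollifier (\<epsilon> n)) (\<lambda>x. u t x - v t x) x))\<^sup>2)"
    have E_meas: "(\<lambda>t. if t \<in> {0..T} then E t else 0) \<in> borel_measurable lebesgue"
      unfolding E_def by (rule energy_measurable[OF T s M \<epsilon>(1) R(2) u v]) (fact init flux nonlin)+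
    have E_bdd: "\<exists>B. \<forall>t\<in>{0..T}. E t \<le> B"
      unfolding E_def by (rule energy_bounded[OF T s M \<epsilon>(1) R(2) u v]) (fact init flux nonlin)+
    then obtain B' where B': "E t \<le> B'" if "t \<in> {0..T}" for t by blast
    have E_le: "E t \<le> (LINT \<tau>:{0..t}|lebesgue. \<kappa> n + 8 * \<bar>lam\<bar> * E \<tau>)" if "t \<in> {0..T}" for t
      unfolding E_def \<kappa>_def by (rule energy_le_integral[OF T s M \<epsilon>(1) R(2) u v]) (fact init flux nonlin that)+
    have E0: "0 \<le> E t" for t
      unfolding E_def by (intro Bochner_Integration.integral_nonneg) (simp add: plateau_nonneg)
    have l: "8 * \<bar>lam\<bar> > 0" using lam by simp
    have "E t \<le> 2 * \<kappa> n * T * exp (2 * (8 * \<bar>lam\<bar>) * t)"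
      by (rule gronwall_integral[OF T l \<kappa>0 E0 B' E_meas E_le t])
    also have "\<dots> \<le> e n"
      unfolding e_def using t T \<kappa>0[of n] by (intro mult_left_mono) (auto simp: mult_left_mono)
    finally show "(LINT x|lborel. plateau ((real n + 1)\<^sup>2) x * (cmod (conv (mollifier (1 / (real n + 1))) (\<lambda>x. u t x - v t x) x))\<^sup>2) \<le> e n"
      unfolding E_def R_def \<epsilon>_def .
  qed
qed

text \<open>The cutoff times w is split into the cutoff times W, small by the energy estimate, and
  the cutoff times w - W, small by the mollification error. As n grows the cutoff tends to a
  positive constant, so Fatou yields that a positive multiple of w has norm 0.\<close>

lemma tested_solution_unique:
  fixes u v :: "real \<Rightarrow> 'a::euclidean_space \<Rightarrow> complex" and M T s lam :: real
  assumes T: "T > 0" and s: "0 < s" and M: "0 < M" and lam: "lam \<noteq> 0"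
    and u: "tested_solution lam T s M u" and v: "tested_solution lam T s M v"
    and init: "\<And>\<psi>. test \<psi> \<Longrightarrow> pair_with (u 0) \<psi> = pair_with (v 0) \<psi>" and t: "t \<in> {0..T}"
  shows "AE x in lborel. u t x = v t x"
proof -
  obtain e where e: "e \<longlonglongrightarrow> 0"
    "\<And>n. (LINT x|lborel. plateau ((real n + 1)\<^sup>2) x * (cmod (conv (mollifier (1 / (real n + 1))) (\<lambda>x. u t x - v t x) x))\<^sup>2) \<le> e n"
    using energy_estimate[OF T s M lam u v init t] by blast
  define w where "w = (\<lambda>x. u t x - v t x)"
  define \<epsilon> R where "\<epsilon> = (\<lambda>n::nat. 1 / (real n + 1))" and "R = (\<lambda>n::nat. (real n + 1)\<^sup>2)"
  have \<epsilon>: "0 < \<epsilon> n" for n by (auto simp: \<epsilon>_def)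
  have R: "0 < R n" for n by (auto simp: R_def)
  \<comment> \<open>At the given time t the bound \<open>M\<close> may fail, as it is guaranteed at
    almost every time; the bounds particular to t suffice for the mollification error.\<close>
  obtain N1 N2 where N: "N1 \<ge> 0" "frac_bound s N1 (u t)" "N2 \<ge> 0" "frac_bound s N2 (v t)"
    using u v t unfolding tested_solution_def by meson
  define N where "N = 2 * N1 + 2 * N2"
  have N0: "N \<ge> 0" using N by (simp add: N_def)
  have fb: "frac_bound s N w" unfolding w_def N_def by (rule frac_bound_diff[OF N(2,4,1,3)])
  note wm[measurable] = frac_boundD(1)[OF fb]
  define W where "W = (\<lambda>n. conv (mollifier (\<epsilon> n)) w)"
  have Wm[measurable]: "W n \<in> borel_measurable borel" for n
    unfolding W_def by (intro conv_measurable kernel_borel kernel_mollifier \<epsilon> wm)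
  \<comment> \<open>The square root of the plateau, so that the squared modulus of p W carries the
    weight of the energy.\<close>
  define p where "p = (\<lambda>n x. complex_of_real (sqrt (plateau (R n) (x::'a))))"
  have pm[measurable]: "p n \<in> borel_measurable borel" for n
    unfolding p_def using kernel_borel[OF kernel_plateau[OF R[of n]]] by measurable
  have p1: "cmod (p n x) \<le> 1" for n x by (simp add: p_def plateau_nonneg plateau_le_1)
  define r where "r = (\<lambda>n. N * (2 * DIM('a) * \<epsilon> n) powr (2 * s))"
  have "l2sq (\<lambda>x. complex_of_real (sqrt (bump (0::'a))) * w x) \<le> 0"
  proof (rule l2sq_Fatou)
    show "(\<lambda>x. p n x * w x) \<in> borel_measurable borel" for n by measurable
    show "(\<lambda>n. p n x * w x) \<longlonglongrightarrow> complex_of_real (sqrt (bump (0::'a))) * w x" for x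
    proof -
      have "isCont (bump :: 'a \<Rightarrow> real) 0"
        using kernel_imp_continuous[OF kernel_bump[where 'a='a]] by (simp add: continuous_on_eq_continuous_at)
      moreover have "(\<lambda>n. (1 / R n) *\<^sub>R x) \<longlonglongrightarrow> 0 *\<^sub>R x"
        unfolding R_def by (intro tendsto_scaleR tendsto_const) real_asymp
      ultimately have "(\<lambda>n. bump ((1 / R n) *\<^sub>R x)) \<longlonglongrightarrow> bump (0::'a)"
        using isCont_tendsto_compose[of 0 bump "\<lambda>n. (1 / R n) *\<^sub>R x"] by simp
      then show ?thesis
        unfolding p_def plateau_def by (intro tendsto_mult tendsto_const tendsto_of_real tendsto_real_sqrt)
    qed
    show "l2sq (\<lambda>x. p n x * w x) \<le> 0 + 1 * ennreal (2 * e n + 2 * r n)" for n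
    proof -
      have "l2sq (W n) \<le> l2sq w" unfolding W_def by (rule l2sq_conv_mollifier_le[OF wm \<epsilon>])
      then have "l2sq (W n) < \<infinity>" using frac_boundD(2)[OF fb] unfolding square_integrable_iff by (meson order_le_less_trans)
      moreover have pW: "l2sq (\<lambda>x. p n x * W n x) \<le> l2sq (W n)"
        by (rule l2sq_mono) (simp add: norm_mult p1 mult_left_le_one_le)
      ultimately have "square_integrable (\<lambda>x. p n x * W n x)"
        unfolding square_integrable_iff by (auto intro: order_le_less_trans)
      then have "l2sq (\<lambda>x. p n x * W n x) = ennreal (LINT x|lborel. (cmod (p n x * W n x))\<^sup>2)"
        by (rule l2sq_eq_integral)
      also have "(\<lambda>x. (cmod (p n x * W n x))\<^sup>2) = (\<lambda>x. plateau (R n) x * (cmod (W n x))\<^sup>2)"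
        by (intro ext) (simp add: p_def norm_mult power_mult_distrib plateau_nonneg)
      also have "ennreal (LINT x|lborel. plateau (R n) x * (cmod (W n x))\<^sup>2) \<le> ennreal (e n)"
        using e(2)[of n] unfolding W_def w_def R_def \<epsilon>_def by (rule ennreal_leI)
      finally have 1: "l2sq (\<lambda>x. p n x * W n x) \<le> ennreal (e n)" .
      have "l2sq (\<lambda>x. p n x * (w x - W n x)) \<le> l2sq (\<lambda>x. w x - W n x)"
        by (rule l2sq_mono) (simp add: norm_mult p1 mult_left_le_one_le)
      also have "\<dots> \<le> ennreal (r n)"
        using mollify_diff_le[OF fb s N0 \<epsilon>[of n], of 0] \<epsilon>[of n] unfolding W_def r_def by simp
      finally have 2: "l2sq (\<lambda>x. p n x * (w x - W n x)) \<le> ennreal (r n)" .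
      have "l2sq (\<lambda>x. p n x * W n x + p n x * (w x - W n x)) \<le> 2 * l2sq (\<lambda>x. p n x * W n x) + 2 * l2sq (\<lambda>x. p n x * (w x - W n x))"
        by (rule l2sq_add_le) measurable
      also have "\<dots> \<le> 2 * ennreal (e n) + 2 * ennreal (r n)" by (intro add_mono mult_left_mono 1 2) auto
      also have "\<dots> = ennreal (2 * e n + 2 * r n)"
      proof -
        have "0 \<le> (LINT x|lborel. plateau (R n) x * (cmod (W n x))\<^sup>2)"
          by (intro Bochner_Integration.integral_nonneg) (simp add: plateau_nonneg)
        then have "0 \<le> e n" using e(2)[of n] unfolding W_def w_def R_def \<epsilon>_def by linarith
        moreover have "0 \<le> r n" using N0 by (simp add: r_def)
        ultimately show ?thesis by (simp add: ennreal_plus ennreal_mult)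
      qed
      finally show ?thesis by (simp add: right_diff_distrib)
    qed
    have "(\<lambda>n. r n) \<longlonglongrightarrow> N * 0"
      unfolding r_def
    proof (intro tendsto_mult tendsto_const)
      have "DIM('a) > 0" by simp
      then show "(\<lambda>n. (2 * DIM('a) * \<epsilon> n) powr (2 * s)) \<longlonglongrightarrow> 0" unfolding \<epsilon>_def using s by real_asymp
    qed
    then have "(\<lambda>n. 2 * e n + 2 * r n) \<longlonglongrightarrow> 2 * 0 + 2 * (N * 0)" by (intro tendsto_add tendsto_mult tendsto_const e)
    then show "(\<lambda>n. ennreal (2 * e n + 2 * r n)) \<longlonglongrightarrow> 0"
      using tendsto_ennrealI[of "\<lambda>n. 2 * e n + 2 * r n" 0 sequentially] by simp
  qed simp
  then have "l2sq (\<lambda>x. complex_of_real (sqrt (bump (0::'a))) * w x) = 0" by simp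
  then have ae: "AE x in lborel. complex_of_real (sqrt (bump (0::'a))) * w x = 0"
    by (subst (asm) l2sq_eq_0_iff) measurable
  have "bump (0::'a) > 0" unfolding bump_def by (intro prod_pos) (simp add: bump1_pos)
  then show ?thesis using ae by (simp add: w_def)
qed

text \<open>Two forms of the conclusion are joined, because an element of L^\<infinity>([0, T], H^s)
  is a class modulo null sets of times. The given functions can be compared at almost every time
  only; at every time the comparison is one of weakly continuous representatives, and it is made for
  all of them.\<close>

theorem theorem1p3:
  fixes lam T s :: real
    and u\<^sub>0 :: "'a::euclidean_space \<Rightarrow> complex"
    and u v :: "real \<Rightarrow> 'a \<Rightarrow> complex"
  assumes "lam \<noteq> 0" and "T > 0" and "0 < s" and "s < 1"
    and "u\<^sub>0 \<in> sobolev_space s"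
    and "weak_solution lam T s u\<^sub>0 u"
    and "weak_solution lam T s u\<^sub>0 v"
  shows "(AE t in lebesgue. t \<in> {0..T} \<longrightarrow> (AE x in lborel. u t x = v t x)) \<and>
         (\<forall>u' v'. weakly_continuous_rep T s u u' \<longrightarrow> weakly_continuous_rep T s v v' \<longrightarrow>
            (\<forall>t\<in>{0..T}. AE x in lborel. u' t x = v' t x))"
proof -
  have u0: "u\<^sub>0 \<in> borel_measurable borel"
    using sobolev_space_square_integrable[OF assms(5)] by (simp add: square_integrable_def)
  obtain wu where wu: "weakly_continuous_rep T s u wu" "AE x in lborel. wu 0 x = u\<^sub>0 x"
    using assms(6) by (auto simp: weak_solution_def)
  obtain wv where wv: "weakly_continuous_rep T s v wv" "AE x in lborel. wv 0 x = u\<^sub>0 x"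
    using assms(7) by (auto simp: weak_solution_def)
  \<comment> \<open>The representatives here are arbitrary, not those for which the initial
    condition is given; \<open>rep_initial\<close> carries the condition over. The larger of the two
    constants serves as a common bound, since the energy argument works with one \<open>M\<close>
    for both solutions.\<close>
  have uniq: "AE x in lborel. u' t x = v' t x"
    if u': "weakly_continuous_rep T s u u'" and v': "weakly_continuous_rep T s v v'" and t: "t \<in> {0..T}" for u' v' t
  proof -
    obtain M1 where M1: "M1 > 0" "tested_solution lam T s M1 u'"
      using tested_solution_rep[OF assms(2-4) _ _ u'] assms(6) unfolding weak_solution_def by metis
    obtain M2 where M2: "M2 > 0" "tested_solution lam T s M2 v'"
      using tested_solution_rep[OF assms(2-4) _ _ v'] assms(7) unfolding weak_solution_def by metis
    show ?thesis
    proof (rule tested_solution_unique[OF assms(2,3) _ assms(1) _ _ _ t])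
      show "0 < max M1 M2" using M1 by simp
      show "tested_solution lam T s (max M1 M2) u'" "tested_solution lam T s (max M1 M2) v'"
        using tested_solution_mono[OF M1(2)] tested_solution_mono[OF M2(2)] by simp_all
      show "pair_with (u' 0) \<psi> = pair_with (v' 0) \<psi>" if "test \<psi>" for \<psi>
        using rep_initial[OF assms(2-4) u' wu(1) u0 wu(2) that] rep_initial[OF assms(2-4) v' wv(1) u0 wv(2) that] by simp
    qed
  qed
  have "AE t in lebesgue. t \<in> {0..T} \<longrightarrow> (AE x in lborel. wu t x = u t x)"
       "AE t in lebesgue. t \<in> {0..T} \<longrightarrow> (AE x in lborel. wv t x = v t x)"
    using wu wv by (auto simp: weakly_continuous_rep_def)
  then have "AE t in lebesgue. t \<in> {0..T} \<longrightarrow> (AE x in lborel. u t x = v t x)"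
  proof eventually_elim
    fix t assume *: "t \<in> {0..T} \<longrightarrow> (AE x in lborel. wu t x = u t x)" "t \<in> {0..T} \<longrightarrow> (AE x in lborel. wv t x = v t x)"
    show "t \<in> {0..T} \<longrightarrow> (AE x in lborel. u t x = v t x)"
    proof
      assume t: "t \<in> {0..T}"
      show "AE x in lborel. u t x = v t x"
        using *(1)[rule_format, OF t] *(2)[rule_format, OF t] uniq[OF wu(1) wv(1) t]
        by eventually_elim simp
    qed
  qed
  then show ?thesis using uniq by blast
qed

end
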